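(* Suppose that the metric space $(\mathcal{M},\mathrm{dist}_\mathcal{M})$ embeds into $\ell_1^d$ with average distortion $D$, where $d \in \mathrm{poly}(\dim(\mathcal{M}))$. Further, suppose that for any point set $Q$ of $m\le n$ points in $\mathcal{M}$, an embedding into $\ell_1^d$ with average distortion $D$ with respect to $Q$ can be computed in time $T$, and then stored using $\mathrm{poly}(\dim(\mathcal{M}))$ bits and evaluated in $\mathrm{poly}(\dim(\mathcal{M}))$ time. Then, for any $\varepsilon \in (0,1]$ and $\Delta \ge r > 0$, there exists a data structure for the $(c, r)$-NNS problem over $n$-point sets in $\mathcal{M}$ of diameter at most $\Delta$ with (i) approximation factor $c\lesssim \frac{D(1+\log D)}{\varepsilon}$; (ii) pre-processing time $O(\mathrm{poly}(n\log_{1/b}(n)\dim(\mathcal{M}))\cdot T)$; (iii) space $O(n^{1+\varepsilon} \log_{1/b}(n)\,\mathrm{poly}(\dim(\mathcal{M})))$; (iv) query time $O(n^\varepsilon \log_{1/b}(n)\,\mathrm{poly}(\dim(\mathcal{M})))$; where $b\in(0,1)$ satisfies $1 - b \gtrsim \frac{r}{\Delta}$.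
   Context: Every metric space $(\mathcal{M},\mathrm{dist}_\mathcal{M})$ considered is endowed with a dimension $\dim(\mathcal{M})$: each point is represented by $\mathrm{poly}(\dim(\mathcal{M}))$ bits and distances can be computed in $\mathrm{poly}(\dim(\mathcal{M}))$ time. $\ell_1^d$ is $\mathbb{R}^d$ with the $\ell_1$ norm. For $f:\mathcal{M}\to\mathcal{N}$, $\|f\|_{\mathrm{Lip}}=\sup_{x\ne y}\mathrm{dist}_\mathcal{N}(f(x),f(y))/\mathrm{dist}_\mathcal{M}(x,y)$. For an $n$-point set $P\subseteq\mathcal{M}$, $f$ has $q$-average distortion $D$ with respect to $P$ if $\sum_{x\in P}\sum_{y\in P}\mathrm{dist}_\mathcal{N}(f(x),f(y))^q\ge \frac{\|f\|_{\mathrm{Lip}}^q}{D^q}\sum_{x\in P}\sum_{y\in P}\mathrm{dist}_\mathcal{M}(x,y)^q$; "average distortion" means $1$-average distortion. $\mathcal{M}$ embeds into $\mathcal{N}$ with average distortion $D$ if for every $n$ and every $n$-point set $P\subseteq\mathcal{M}$ there is an embedding $\mathcal{M}\to\mathcal{N}$ with average distortion $D$ with respect to $P$. $A\lesssim B$ means $A\le C_0B$ for an absolute constant $C_0$; $\mathrm{poly}(\cdot)$ denotes a polynomial. The $(c,r)$-NNS problem: given an $n$-point set $P\subseteq\mathcal{M}$, build a data structure such that for any query $q\in\mathcal{M}$ with $\mathrm{dist}_\mathcal{M}(x^*,q)\le r$ for some $x^*\in P$, it outputs $x\in P$ with $\mathrm{dist}_\mathcal{M}(x,q)\le cr$ with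 probability at least $2/3$. *)

theory Defs
  imports
    "HOL-Analysis.Abstract_Metric_Spaces"
    "HOL-Probability.Probability"
    "HOL-Computational_Algebra.Polynomial"
    "HOL-Library.Log_Nat"
begin

section \<open>Average distortion\<close>

definition dilations ::
    "'a set \<Rightarrow> ('a \<Rightarrow> 'a \<Rightarrow> real) \<Rightarrow> ('b \<Rightarrow> 'b \<Rightarrow> real) \<Rightarrow> ('a \<Rightarrow> 'b) \<Rightarrow> real set" where
  "dilations M dM dN f = {dN (f x) (f y) / dM x y | x y. x \<in> M \<and> y \<in> M \<and> x \<noteq> y}"

text \<open>The inserted 0 only matters for spaces with at most one point, where the supremum
  ranges over the empty set. The supremum is meaningful when the dilations are bounded above.\<close>

definition lip_norm ::
    "'a set \<Rightarrow> ('a \<Rightarrow> 'a \<Rightarrow> real) \<Rightarrow> ('b \<Rightarrow> 'b \<Rightarrow> real) \<Rightarrow> ('a \<Rightarrow> 'b) \<Rightarrow> real" where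
  "lip_norm M dM dN f = Sup (insert 0 (dilations M dM dN f))"

text \<open>A constant map satisfies the defining inequality for every \<open>D\<close>, as \<open>0 \<ge> 0\<close>; it is not an
  embedding with finite distortion. Hence the Lipschitz norm has to be positive as soon as \<open>P\<close>
  has two points. The bound \<open>0 < D\<close> excludes the junk values of division and \<open>powr\<close>.\<close>

definition has_avg_distortion ::
    "real \<Rightarrow> real \<Rightarrow> 'a set \<Rightarrow> ('a \<Rightarrow> 'a \<Rightarrow> real) \<Rightarrow> 'b set \<Rightarrow> ('b \<Rightarrow> 'b \<Rightarrow> real)
      \<Rightarrow> 'a set \<Rightarrow> ('a \<Rightarrow> 'b) \<Rightarrow> bool" where
  "has_avg_distortion q D M dM N dN P f \<longleftrightarrow>
     0 < D \<and> f \<in> M \<rightarrow> N \<and> bdd_above (dilations M dM dN f) \<and>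
     (card P \<ge> 2 \<longrightarrow> lip_norm M dM dN f > 0) \<and>
     (\<Sum>x\<in>P. \<Sum>y\<in>P. dN (f x) (f y) powr q)
       \<ge> lip_norm M dM dN f powr q / D powr q * (\<Sum>x\<in>P. \<Sum>y\<in>P. dM x y powr q)"

definition embeds_with_avg_distortion ::
    "real \<Rightarrow> 'a set \<Rightarrow> ('a \<Rightarrow> 'a \<Rightarrow> real) \<Rightarrow> 'b set \<Rightarrow> ('b \<Rightarrow> 'b \<Rightarrow> real) \<Rightarrow> bool" where
  "embeds_with_avg_distortion D M dM N dN \<longleftrightarrow>
     (\<forall>P. finite P \<and> P \<subseteq> M \<longrightarrow> (\<exists>f. has_avg_distortion 1 D M dM N dN P f))"

text \<open>The space \<open>\<ell>\<^sub>1\<^sup>d\<close>, with vectors as lists so that \<open>d\<close> can vary.\<close>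

definition ell1 :: "nat \<Rightarrow> real list set" where
  "ell1 d = {v. length v = d}"

definition ell1_dist :: "real list \<Rightarrow> real list \<Rightarrow> real" where
  "ell1_dist u v = (\<Sum>i<min (length u) (length v). \<bar>u ! i - v ! i\<bar>)"

lemma Metric_space_ell1_dist: "Metric_space (ell1 d) ell1_dist"
proof
  fix u v w :: "real list"
  show "0 \<le> ell1_dist u v"
    by (simp add: ell1_dist_def sum_nonneg)
  show "ell1_dist u v = ell1_dist v u"
    by (simp add: ell1_dist_def abs_minus_commute min.commute)
  show "ell1_dist u v = 0 \<longleftrightarrow> u = v" if "u \<in> ell1 d" "v \<in> ell1 d"
    using that by (auto simp: ell1_dist_def ell1_def sum_nonneg_eq_0_iff intro: nth_equalityI)
  show "ell1_dist u w \<le> ell1_dist u v + ell1_dist v w"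
    if "u \<in> ell1 d" "v \<in> ell1 d" "w \<in> ell1 d"
    using that unfolding ell1_dist_def ell1_def
    by (simp add: sum.distrib[symmetric]) (rule sum_mono, linarith)
qed

section \<open>Randomised random access machines\<close>

text \<open>A machine has three unbounded memories: for natural numbers, for real numbers and for bit
  strings. Operations on natural numbers are charged the bit length of all values involved
  (logarithmic cost criterion, addresses included), moving a string is charged its length, and
  operations on real numbers have unit cost (real RAM; there is no rounding to integers, and the
  only real constants are the natural numbers). Points of the metric space and stored embeddings
  are bit strings. The metric and the embeddings are available to a machine as subroutines, and
  each call is charged the running time of the subroutine.\<close>

type_synonym bits = "bool list"

record subroutines =
  dist_fun :: "bits \<Rightarrow> bits \<Rightarrow> real"
  dist_time :: nat
  embed_fun :: "bits list \<Rightarrow> bits"    \<comment> \<open>point set, as a list, to the code of an embedding\<close>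
  embed_time :: nat
  apply_fun :: "bits \<Rightarrow> bits \<Rightarrow> real list"    \<comment> \<open>code of an embedding and point to image vector\<close>
  apply_time :: nat

record state =
  nats :: "nat \<Rightarrow> nat"
  reals :: "nat \<Rightarrow> real"
  strs :: "nat \<Rightarrow> bits"

datatype nexp =
    NLit nat
  | NMem nexp
  | NAdd nexp nexp
  | NSub nexp nexp
  | NMul nexp nexp
  | NDiv nexp nexp

datatype rexp =
    RNat nexp
  | RMem nexp
  | RAdd rexp rexp
  | RSub rexp rexp
  | RMul rexp rexp
  | RDiv rexp rexp

datatype bexp =
    NLess nexp nexp
  | RLess rexp rexp
  | BNot bexp
  | BAnd bexp bexp

fun nval :: "nexp \<Rightarrow> state \<Rightarrow> nat" where
  "nval (NLit k) s = k"
| "nval (NMem a) s = nats s (nval a s)"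
| "nval (NAdd a b) s = nval a s + nval b s"
| "nval (NSub a b) s = nval a s - nval b s"
| "nval (NMul a b) s = nval a s * nval b s"
| "nval (NDiv a b) s = nval a s div nval b s"

fun rval :: "rexp \<Rightarrow> state \<Rightarrow> real" where
  "rval (RNat a) s = real (nval a s)"
| "rval (RMem a) s = reals s (nval a s)"
| "rval (RAdd a b) s = rval a s + rval b s"
| "rval (RSub a b) s = rval a s - rval b s"
| "rval (RMul a b) s = rval a s * rval b s"
| "rval (RDiv a b) s = rval a s / rval b s"

fun bval :: "bexp \<Rightarrow> state \<Rightarrow> bool" where
  "bval (NLess a b) s = (nval a s < nval b s)"
| "bval (RLess a b) s = (rval a s < rval b s)"
| "bval (BNot a) s = (\<not> bval a s)"
| "bval (BAnd a b) s = (bval a s \<and> bval b s)"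

text \<open>One plus the length of the binary expansion, which is empty for 0.\<close>

definition nat_size :: "nat \<Rightarrow> nat" where
  "nat_size k = Suc (floorlog 2 k)"

fun ncost :: "nexp \<Rightarrow> state \<Rightarrow> nat" where
  "ncost (NLit k) s = nat_size k"
| "ncost (NMem a) s = ncost a s + nat_size (nval (NMem a) s)"
| "ncost (NAdd a b) s = ncost a s + ncost b s + nat_size (nval (NAdd a b) s)"
| "ncost (NSub a b) s = ncost a s + ncost b s + nat_size (nval (NSub a b) s)"
| "ncost (NMul a b) s = ncost a s + ncost b s + nat_size (nval (NMul a b) s)"
| "ncost (NDiv a b) s = ncost a s + ncost b s + nat_size (nval (NDiv a b) s)"

fun rcost :: "rexp \<Rightarrow> state \<Rightarrow> nat" where
  "rcost (RNat a) s = Suc (ncost a s)"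
| "rcost (RMem a) s = Suc (ncost a s)"
| "rcost (RAdd a b) s = Suc (rcost a s + rcost b s)"
| "rcost (RSub a b) s = Suc (rcost a s + rcost b s)"
| "rcost (RMul a b) s = Suc (rcost a s + rcost b s)"
| "rcost (RDiv a b) s = Suc (rcost a s + rcost b s)"

fun bcost :: "bexp \<Rightarrow> state \<Rightarrow> nat" where
  "bcost (NLess a b) s = Suc (ncost a s + ncost b s)"
| "bcost (RLess a b) s = Suc (rcost a s + rcost b s)"
| "bcost (BNot a) s = Suc (bcost a s)"
| "bcost (BAnd a b) s = Suc (bcost a s + bcost b s)"

text \<open>In every assignment the first expression is the address of the target.\<close>

datatype com =
    Skip
  | NSet nexp nexp
  | RSet nexp rexp
  | SCopy nexp nexp
  | Flip nexp
  | CallDist nexp nexp nexp    \<comment> \<open>distance of the points at two string addresses\<close>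
  | CallEmbed nexp nexp nexp    \<comment> \<open>embedding for the points in an array: address and length\<close>
  | CallApply nexp nexp nexp    \<comment> \<open>image under a stored embedding: addresses of code and point\<close>
  | Seq com com
  | Cond bexp com com
  | While bexp com

definition write_array :: "nat \<Rightarrow> real list \<Rightarrow> (nat \<Rightarrow> real) \<Rightarrow> nat \<Rightarrow> real" where
  "write_array a v m = (\<lambda>i. if a \<le> i \<and> i < a + length v then v ! (i - a) else m i)"

text \<open>\<open>exec E c (s, \<omega>) t (s', \<omega>')\<close>: started in state \<open>s\<close> with the stream \<open>\<omega>\<close> of coin flips, the
  program \<open>c\<close> terminates with cost \<open>t\<close> in state \<open>s'\<close>, and \<open>\<omega>'\<close> is the unread part of \<open>\<omega>\<close>.\<close>

inductive exec ::
    "subroutines \<Rightarrow> com \<Rightarrow> state \<times> bool stream \<Rightarrow> nat \<Rightarrow> state \<times> bool stream \<Rightarrow> bool"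
  for E :: subroutines where
  Skip: "exec E Skip (s, \<omega>) 1 (s, \<omega>)"
| NSet: "exec E (NSet a e) (s, \<omega>) (1 + ncost a s + ncost e s)
     (s\<lparr>nats := (nats s)(nval a s := nval e s)\<rparr>, \<omega>)"
| RSet: "exec E (RSet a e) (s, \<omega>) (1 + ncost a s + rcost e s)
     (s\<lparr>reals := (reals s)(nval a s := rval e s)\<rparr>, \<omega>)"
| SCopy: "exec E (SCopy a b) (s, \<omega>)
     (1 + ncost a s + ncost b s + length (strs s (nval b s)))
     (s\<lparr>strs := (strs s)(nval a s := strs s (nval b s))\<rparr>, \<omega>)"
| Flip: "exec E (Flip a) (s, \<omega>) (1 + ncost a s)
     (s\<lparr>nats := (nats s)(nval a s := of_bool (shd \<omega>))\<rparr>, stl \<omega>)"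
| CallDist: "exec E (CallDist a x y) (s, \<omega>)
     (1 + ncost a s + ncost x s + ncost y s + dist_time E)
     (s\<lparr>reals := (reals s)(nval a s :=
          dist_fun E (strs s (nval x s)) (strs s (nval y s)))\<rparr>, \<omega>)"
| CallEmbed: "exec E (CallEmbed a x k) (s, \<omega>)
     (1 + ncost a s + ncost x s + ncost k s + embed_time E)
     (s\<lparr>strs := (strs s)(nval a s :=
          embed_fun E (map (strs s) [nval x s ..< nval x s + nval k s]))\<rparr>, \<omega>)"
| CallApply: "v = apply_fun E (strs s (nval c s)) (strs s (nval x s)) \<Longrightarrow>
     exec E (CallApply a c x) (s, \<omega>)
     (1 + ncost a s + ncost c s + ncost x s + apply_time E + length v)
     (s\<lparr>reals := write_array (nval a s) v (reals s)\<rparr>, \<omega>)"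
| Seq: "exec E c1 (s, \<omega>) t1 (s1, \<omega>1) \<Longrightarrow> exec E c2 (s1, \<omega>1) t2 (s2, \<omega>2) \<Longrightarrow>
     exec E (Seq c1 c2) (s, \<omega>) (t1 + t2) (s2, \<omega>2)"
| CondTrue: "bval b s \<Longrightarrow> exec E c1 (s, \<omega>) t (s', \<omega>') \<Longrightarrow>
     exec E (Cond b c1 c2) (s, \<omega>) (bcost b s + t) (s', \<omega>')"
| CondFalse: "\<not> bval b s \<Longrightarrow> exec E c2 (s, \<omega>) t (s', \<omega>') \<Longrightarrow>
     exec E (Cond b c1 c2) (s, \<omega>) (bcost b s + t) (s', \<omega>')"
| WhileFalse: "\<not> bval b s \<Longrightarrow> exec E (While b c) (s, \<omega>) (bcost b s) (s, \<omega>)"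
| WhileTrue: "bval b s \<Longrightarrow> exec E c (s, \<omega>) t1 (s1, \<omega>1) \<Longrightarrow>
     exec E (While b c) (s1, \<omega>1) t2 (s2, \<omega>2) \<Longrightarrow>
     exec E (While b c) (s, \<omega>) (bcost b s + t1 + t2) (s2, \<omega>2)"

definition coins :: "bool stream measure" where
  "coins = stream_space (measure_pmf (pmf_of_set UNIV))"

text \<open>All cells below the extent of a memory are charged, so that nothing can be stored for free
  in the choice of addresses. A cell for a real number counts as one unit.\<close>

definition extent :: "'a \<Rightarrow> (nat \<Rightarrow> 'a) \<Rightarrow> nat" where
  "extent blank m = (LEAST k. \<forall>i\<ge>k. m i = blank)"

definition space_usage :: "state \<Rightarrow> nat" where
  "space_usage s =
     (\<Sum>i<extent 0 (nats s). nat_size (nats s i))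
     + extent 0 (reals s)
     + (\<Sum>i<extent [] (strs s). Suc (length (strs s i)))"

section \<open>Near neighbour search\<close>

text \<open>Points of the space are identified with the bit strings that represent them.\<close>

definition represented_metric_space ::
    "nat poly \<Rightarrow> nat \<Rightarrow> bits set \<Rightarrow> (bits \<Rightarrow> bits \<Rightarrow> real) \<Rightarrow> subroutines \<Rightarrow> bool" where
  "represented_metric_space p dm M dM E \<longleftrightarrow>
     Metric_space M dM \<and>
     (\<forall>x\<in>M. length x \<le> poly p dm) \<and>
     (\<forall>x\<in>M. \<forall>y\<in>M. dist_fun E x y = dM x y) \<and>
     dist_time E \<le> poly p dm"

definition computes_ell1_embeddings ::
    "nat poly \<Rightarrow> nat \<Rightarrow> bits set \<Rightarrow> (bits \<Rightarrow> bits \<Rightarrow> real) \<Rightarrow> nat \<Rightarrow> real \<Rightarrow> nat \<Rightarrow> nat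
      \<Rightarrow> subroutines \<Rightarrow> bool" where
  "computes_ell1_embeddings p dm M dM d D n T E \<longleftrightarrow>
     (\<forall>xs. distinct xs \<and> set xs \<subseteq> M \<and> length xs \<le> n \<longrightarrow>
        length (embed_fun E xs) \<le> poly p dm \<and>
        has_avg_distortion 1 D M dM (ell1 d) ell1_dist (set xs) (apply_fun E (embed_fun E xs))) \<and>
     embed_time E \<le> T \<and>
     apply_time E \<le> poly p dm"

text \<open>Pre-processing starts with the parameters in the first cells of the number memories, with
  the points of \<open>P\<close> in string cells \<open>1, \<dots>, n\<close>, and all other cells blank.\<close>

definition initial_state ::
    "nat \<Rightarrow> real \<Rightarrow> real \<Rightarrow> real \<Rightarrow> real \<Rightarrow> bits list \<Rightarrow> state" where
  "initial_state d D \<epsilon> \<Delta> r xs =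
     \<lparr>nats = (\<lambda>_. 0)(0 := length xs, 1 := d),
      reals = (\<lambda>_. 0)(0 := D, 1 := \<epsilon>, 2 := \<Delta>, 3 := r),
      strs = (\<lambda>i. if 1 \<le> i \<and> i \<le> length xs then xs ! (i - 1) else [])\<rparr>"

text \<open>The data structure is the memory content left by pre-processing. A query is placed in
  string cell 0, where the answer is also expected.\<close>

definition with_query :: "bits \<Rightarrow> state \<Rightarrow> state" where
  "with_query x s = s\<lparr>strs := (strs s)(0 := x)\<rparr>"

definition answer :: "state \<Rightarrow> bits" where
  "answer s = strs s 0"

text \<open>The bounds on time and space are worst-case over all coin flips. The success probability
  is, for each fixed query, over the coins of both pre-processing and query.\<close>

definition solves_NNS ::
    "subroutines \<Rightarrow> com \<Rightarrow> com \<Rightarrow> (bits list \<Rightarrow> state) \<Rightarrow> bits set \<Rightarrow> (bits \<Rightarrow> bits \<Rightarrow> real)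
      \<Rightarrow> nat \<Rightarrow> real \<Rightarrow> real \<Rightarrow> real \<Rightarrow> real \<Rightarrow> real \<Rightarrow> real \<Rightarrow> bool" where
  "solves_NNS E pre qry init M dM n \<Delta> c r preTime spc qryTime \<longleftrightarrow>
     (\<forall>xs. distinct xs \<and> set xs \<subseteq> M \<and> length xs = n \<and> (\<forall>x\<in>set xs. \<forall>y\<in>set xs. dM x y \<le> \<Delta>) \<longrightarrow>
        (\<forall>\<omega>. \<exists>t s \<omega>'. exec E pre (init xs, \<omega>) t (s, \<omega>') \<and>
           real t \<le> preTime \<and> real (space_usage s) \<le> spc \<and>
           (\<forall>x\<in>M. \<exists>t' s' \<omega>''. exec E qry (with_query x s, \<omega>') t' (s', \<omega>'') \<and>
              real t' \<le> qryTime)) \<and>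
        (\<forall>x\<in>M. (\<exists>y\<in>set xs. dM y x \<le> r) \<longrightarrow>
           measure coins {\<omega>. \<exists>t s \<omega>' t' s' \<omega>''.
             exec E pre (init xs, \<omega>) t (s, \<omega>') \<and>
             exec E qry (with_query x s, \<omega>') t' (s', \<omega>'') \<and>
             answer s' \<in> set xs \<and> dM (answer s') x \<le> c * r} \<ge> 2 / 3))"

end

theory Submission
  imports Defs
begin

text \<open>The data structure is a forest of about \<open>n powr \<epsilon>\<close> random search trees whose nodes are subsets
  \<open>Q\<close> of the point set. Let \<open>R = 16 D r / \<epsilon>\<close>. If some ball of radius \<open>R\<close> around a point of \<open>Q\<close>
  contains half of \<open>Q\<close>, a query within \<open>R + r\<close> of the center is answered with the center, and
  every other query continues with the points outside the ball. Otherwise the average distance in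
  \<open>Q\<close> is at least \<open>R / 2\<close>. Let \<open>f\<close> be an embedding of average distortion \<open>D\<close> for \<open>Q\<close>. By the triangle
  inequality, for \<^emph>\<open>every\<close> point \<open>x\<close> the average distance of \<open>f x\<close> to the image of \<open>Q\<close> is at least
  half the average over all pairs, hence at least \<open>4 r / \<epsilon>\<close> times the Lipschitz norm of \<open>f\<close>. The node
  is split by a random threshold on a random coordinate of \<open>f\<close>, the pair being uniform with respect
  to length. Since the probability that two points are separated is proportional to the distance of
  their images, the expected fraction \<open>\<delta>\<close> of \<open>Q\<close> that is split off from the near neighbour is at
  least \<open>4 / \<epsilon>\<close> times the probability of separating it from the query. As
  \<open>(1 - \<delta>) powr - \<epsilon> \<ge> 1 + \<epsilon> \<delta>\<close>, the bound \<open>card Q powr - \<epsilon>\<close> for the success probability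
  below a node is maintained. The fraction \<open>\<delta>\<close> is also of expected order \<open>r / (d \<Delta>)\<close>, so a search can be
  stopped after \<open>O(d (\<Delta> / r) ln n)\<close> levels. The approximation
  factor is \<open>O(D / \<epsilon>)\<close>.

  All trees are built at the same time, breadth first and in place. Each round of the construction
  flips the same number of coins, so the rounds can be analysed as a supermartingale whose value is
  (an upper bound for) the conditional probability that all trees fail.\<close>

section \<open>Reasoning about machine programs\<close>

text \<open>The obstacle is that average distortion controls no individual pair, while the near
  neighbour is one fixed point; passing from pairs to the star of that point removes it. The
  potential is a power of the cardinality because sizes multiply along a path: a relative loss of
  points is then traded for a loss of probability at the same exchange rate
  \<open>\<epsilon>\<close> on every level. Coins are discrete, so thresholds come from a grid of
  \<open>2 ^ B\<close> positions. Rounding costs at most one position per coordinate, and the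
  constants in the radius and in \<open>B\<close> leave room for this. The numbers of rounds and of
  coins per round are fixed in advance; this makes the time bounds worst-case and reduces
  probabilities to counting bit lists. The trees grow together, yet no independence argument is
  needed: a round changes at most one factor of the product of the failure values, and all other
  factors are constants in that round.\<close>

definition bnd :: "nat \<Rightarrow> state \<Rightarrow> bool" where
  "bnd \<beta> s \<longleftrightarrow> (\<forall>i. nats s i < 2 ^ \<beta>)"

fun nsz :: "nexp \<Rightarrow> nat" where
  "nsz (NLit k) = 1"
| "nsz (NMem a) = Suc (nsz a)"
| "nsz (NAdd a b) = Suc (nsz a + nsz b)"
| "nsz (NSub a b) = Suc (nsz a + nsz b)"
| "nsz (NMul a b) = Suc (nsz a + nsz b)"
| "nsz (NDiv a b) = Suc (nsz a + nsz b)"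

fun nok :: "nexp \<Rightarrow> bool" where
  "nok (NLit k) \<longleftrightarrow> k < 128"
| "nok (NMem a) \<longleftrightarrow> nok a"
| "nok (NAdd a b) \<longleftrightarrow> nok a \<and> nok b"
| "nok (NSub a b) \<longleftrightarrow> nok a \<and> nok b"
| "nok (NMul a b) \<longleftrightarrow> nok a \<and> nok b"
| "nok (NDiv a b) \<longleftrightarrow> nok a \<and> nok b"

fun rsz :: "rexp \<Rightarrow> nat" where
  "rsz (RNat a) = Suc (nsz a)"
| "rsz (RMem a) = Suc (nsz a)"
| "rsz (RAdd a b) = Suc (rsz a + rsz b)"
| "rsz (RSub a b) = Suc (rsz a + rsz b)"
| "rsz (RMul a b) = Suc (rsz a + rsz b)"
| "rsz (RDiv a b) = Suc (rsz a + rsz b)"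

fun rok :: "rexp \<Rightarrow> bool" where
  "rok (RNat a) \<longleftrightarrow> nok a"
| "rok (RMem a) \<longleftrightarrow> nok a"
| "rok (RAdd a b) \<longleftrightarrow> rok a \<and> rok b"
| "rok (RSub a b) \<longleftrightarrow> rok a \<and> rok b"
| "rok (RMul a b) \<longleftrightarrow> rok a \<and> rok b"
| "rok (RDiv a b) \<longleftrightarrow> rok a \<and> rok b"

fun bsz :: "bexp \<Rightarrow> nat" where
  "bsz (NLess a b) = Suc (nsz a + nsz b)"
| "bsz (RLess a b) = Suc (rsz a + rsz b)"
| "bsz (BNot a) = Suc (bsz a)"
| "bsz (BAnd a b) = Suc (bsz a + bsz b)"

fun bok :: "bexp \<Rightarrow> bool" where
  "bok (NLess a b) \<longleftrightarrow> nok a \<and> nok b"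
| "bok (RLess a b) \<longleftrightarrow> rok a \<and> rok b"
| "bok (BNot a) \<longleftrightarrow> bok a"
| "bok (BAnd a b) \<longleftrightarrow> bok a \<and> bok b"

text \<open>Every node of the expression contributes at most \<open>\<beta>\<close> bits. Products
  add bit lengths, and a sum of two values is bounded by the product of their strict bounds.
  Literals stay below \<open>2 ^ 7\<close>, whence the condition
  \<open>7 \<le> \<beta>\<close>.\<close>

lemma nval_less:
  assumes "bnd \<beta> s" "7 \<le> \<beta>" "nok e"
  shows "nval e s < 2 ^ (\<beta> * nsz e)"
  using assms(3)
proof (induction e)
  case (NLit k)
  have "k < 2 ^ 7" using NLit by simp
  also have "(2::nat) ^ 7 \<le> 2 ^ (\<beta> * nsz (NLit k))" using assms(2) by (intro power_increasing) (auto simp: algebra_simps)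
  finally show ?case by simp
next
  case (NMem a)
  have "nval (NMem a) s < 2 ^ \<beta>" using assms(1) by (simp add: bnd_def)
  also have "(2::nat) ^ \<beta> \<le> 2 ^ (\<beta> * nsz (NMem a))" by (intro power_increasing) (auto simp: algebra_simps)
  finally show ?case .
next
  case (NAdd a b)
  then have "nval a s < 2 ^ (\<beta> * nsz a)" "nval b s < 2 ^ (\<beta> * nsz b)"
    by simp_all
  moreover have "x + y < 2 ^ (i + j + \<beta>)" if "x < 2 ^ i" "y < 2 ^ j" for x y i j :: nat
  proof -
    obtain a b where ab: "2 ^ i = Suc a" "2 ^ j = Suc b"
      using gr0_implies_Suc[of "2 ^ i"] gr0_implies_Suc[of "2 ^ j"] by auto
    have "x + y < 2 ^ i * 2 ^ j" using that unfolding ab by simp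
    also have "\<dots> \<le> 2 ^ (i + j + \<beta>)" by (simp add: power_add)
    finally show ?thesis .
  qed
  ultimately have "nval a s + nval b s < 2 ^ (\<beta> * nsz a + \<beta> * nsz b + \<beta>)" by blast
  then show ?case by (simp add: algebra_simps)
next
  case (NSub a b)
  then have "nval a s < 2 ^ (\<beta> * nsz a)" by simp
  also have "(2::nat) ^ (\<beta> * nsz a) \<le> 2 ^ (\<beta> * nsz (NSub a b))" by (intro power_increasing mult_le_mono) auto
  finally show ?case by simp
next
  case (NMul a b)
  then have "nval a s * nval b s < 2 ^ (\<beta> * nsz a) * 2 ^ (\<beta> * nsz b)"
    by (intro mult_strict_mono') auto
  also have "\<dots> = 2 ^ (\<beta> * nsz a + \<beta> * nsz b)" by (simp add: power_add)
  also have "\<dots> \<le> 2 ^ (\<beta> * nsz (NMul a b))" by (intro power_increasing) (auto simp: algebra_simps)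
  finally show ?case by simp
next
  case (NDiv a b)
  have "nval a s div nval b s \<le> nval a s" by simp
  also have "\<dots> < 2 ^ (\<beta> * nsz a)" using NDiv by simp
  also have "(2::nat) ^ (\<beta> * nsz a) \<le> 2 ^ (\<beta> * nsz (NDiv a b))" by (intro power_increasing) (auto simp: algebra_simps)
  finally show ?case by simp
qed

lemma nat_size_le: "v < 2 ^ b \<Longrightarrow> nat_size v \<le> Suc b"
  using floorlog_leI[of v 2 b] by (simp add: nat_size_def)

lemma ncost_le_aux:
  fixes \<beta> x y A B z :: nat
  assumes "A \<le> x * Suc (\<beta> * x)" "B \<le> y * Suc (\<beta> * y)" "z \<le> Suc (\<beta> * Suc (x + y))"
  shows "A + B + z \<le> Suc (x + y) * Suc (\<beta> * Suc (x + y))"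
proof -
  have "x * Suc (\<beta> * x) \<le> x * Suc (\<beta> * Suc (x + y))" "y * Suc (\<beta> * y) \<le> y * Suc (\<beta> * Suc (x + y))"
    by (intro mult_le_mono Suc_le_mono[THEN iffD2]; simp)+
  with assms have "A + B + z \<le> x * Suc (\<beta> * Suc (x + y)) + y * Suc (\<beta> * Suc (x + y)) + Suc (\<beta> * Suc (x + y))"
    by linarith
  also have "\<dots> = Suc (x + y) * Suc (\<beta> * Suc (x + y))" by (simp only: mult_Suc add_mult_distrib ac_simps)
  finally show ?thesis .
qed

text \<open>An expression has \<open>nsz e\<close> subexpressions, and each of them is charged at
  most the bit length allowed by \<open>nval_less\<close>. The bound is therefore quadratic in the
  size; as sizes are at most 40 in the programs, it becomes a constant multiple of
  \<open>\<beta>\<close>.\<close>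

lemma ncost_le:
  assumes "bnd \<beta> s" "7 \<le> \<beta>" "nok e"
  shows "ncost e s \<le> nsz e * Suc (\<beta> * nsz e)"
  using assms(3)
proof (induction e)
  case (NLit k)
  then show ?case using nat_size_le[OF nval_less[OF assms(1,2) NLit]] by simp
next
  case (NMem a)
  have "nat_size (nval (NMem a) s) \<le> Suc (\<beta> * nsz (NMem a))"
    using nat_size_le[OF nval_less[OF assms(1,2) NMem(2)]] .
  moreover have "ncost a s \<le> nsz a * Suc (\<beta> * nsz (NMem a))"
    using NMem by (auto intro: order_trans)
  ultimately show ?case unfolding ncost.simps nsz.simps mult_Suc[of "nsz a"] by linarith
next
  case (NAdd a b)
  then show ?case
    using ncost_le_aux[of "ncost a s" "nsz a" \<beta> "ncost b s" "nsz b" "nat_size (nval (NAdd a b) s)"]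
      nat_size_le[OF nval_less[OF assms(1,2) NAdd(3)]] by simp
next
  case (NSub a b)
  then show ?case
    using ncost_le_aux[of "ncost a s" "nsz a" \<beta> "ncost b s" "nsz b" "nat_size (nval (NSub a b) s)"]
      nat_size_le[OF nval_less[OF assms(1,2) NSub(3)]] by simp
next
  case (NMul a b)
  then show ?case
    using ncost_le_aux[of "ncost a s" "nsz a" \<beta> "ncost b s" "nsz b" "nat_size (nval (NMul a b) s)"]
      nat_size_le[OF nval_less[OF assms(1,2) NMul(3)]] by simp
next
  case (NDiv a b)
  then show ?case
    using ncost_le_aux[of "ncost a s" "nsz a" \<beta> "ncost b s" "nsz b" "nat_size (nval (NDiv a b) s)"]
      nat_size_le[OF nval_less[OF assms(1,2) NDiv(3)]] by simp
qed

lemma quad_super_add: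
  fixes \<beta> x y :: nat
  shows "Suc (x * Suc (\<beta> * x) + y * Suc (\<beta> * y)) \<le> Suc (x + y) * Suc (\<beta> * Suc (x + y))"
  by (simp add: algebra_simps)

lemma quad_super_Suc:
  fixes \<beta> x :: nat
  shows "Suc (x * Suc (\<beta> * x)) \<le> Suc x * Suc (\<beta> * Suc x)"
  by (simp add: algebra_simps)

lemma rcost_le:
  assumes "bnd \<beta> s" "7 \<le> \<beta>" "rok e"
  shows "rcost e s \<le> rsz e * Suc (\<beta> * rsz e)"
  using assms(3)
proof (induction e)
  case (RNat a)
  then show ?case using ncost_le[OF assms(1,2), of a] quad_super_Suc[of "nsz a" \<beta>] by simp
next
  case (RMem a)
  then show ?case using ncost_le[OF assms(1,2), of a] quad_super_Suc[of "nsz a" \<beta>] by simp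
next
  case (RAdd a b)
  then show ?case using quad_super_add[of "rsz a" \<beta> "rsz b"] by simp
next
  case (RSub a b)
  then show ?case using quad_super_add[of "rsz a" \<beta> "rsz b"] by simp
next
  case (RMul a b)
  then show ?case using quad_super_add[of "rsz a" \<beta> "rsz b"] by simp
next
  case (RDiv a b)
  then show ?case using quad_super_add[of "rsz a" \<beta> "rsz b"] by simp
qed

lemma bcost_le:
  assumes "bnd \<beta> s" "7 \<le> \<beta>" "bok e"
  shows "bcost e s \<le> bsz e * Suc (\<beta> * bsz e)"
  using assms(3)
proof (induction e)
  case (NLess a b)
  then show ?case
    using ncost_le[OF assms(1,2), of a] ncost_le[OF assms(1,2), of b] quad_super_add[of "nsz a" \<beta> "nsz b"] by simp
next
  case (RLess a b)
  then show ?case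
    using rcost_le[OF assms(1,2), of a] rcost_le[OF assms(1,2), of b] quad_super_add[of "rsz a" \<beta> "rsz b"] by simp
next
  case (BNot a)
  then show ?case using quad_super_Suc[of "bsz a" \<beta>] by simp
next
  case (BAnd a b)
  then show ?case using quad_super_add[of "bsz a" \<beta> "bsz b"] by simp
qed

text \<open>Every expression of the programs below has size at most 40.\<close>

fun small :: "com \<Rightarrow> bool" where
  "small Skip \<longleftrightarrow> True"
| "small (NSet a e) \<longleftrightarrow> nok a \<and> nok e \<and> nsz a + nsz e \<le> 40"
| "small (RSet a e) \<longleftrightarrow> nok a \<and> rok e \<and> nsz a + rsz e \<le> 40"
| "small (SCopy a b) \<longleftrightarrow> nok a \<and> nok b \<and> nsz a + nsz b \<le> 40"
| "small (Flip a) \<longleftrightarrow> nok a \<and> nsz a \<le> 40"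
| "small (CallDist a x y) \<longleftrightarrow> nok a \<and> nok x \<and> nok y \<and> nsz a + nsz x + nsz y \<le> 40"
| "small (CallEmbed a x y) \<longleftrightarrow> nok a \<and> nok x \<and> nok y \<and> nsz a + nsz x + nsz y \<le> 40"
| "small (CallApply a x y) \<longleftrightarrow> nok a \<and> nok x \<and> nok y \<and> nsz a + nsz x + nsz y \<le> 40"
| "small (Seq c1 c2) \<longleftrightarrow> small c1 \<and> small c2"
| "small (Cond b c1 c2) \<longleftrightarrow> bok b \<and> bsz b \<le> 40 \<and> small c1 \<and> small c2"
| "small (While b c) \<longleftrightarrow> bok b \<and> bsz b \<le> 40 \<and> small c"

text \<open>Symbolic execution of loop-free, coin-free code: final state, number of elementary steps,
  and the side conditions under which every step costs at most \<open>\<kappa>\<close>.\<close>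

fun exe :: "subroutines \<Rightarrow> com \<Rightarrow> state \<Rightarrow> state" where
  "exe E (NSet a e) s = s\<lparr>nats := (nats s)(nval a s := nval e s)\<rparr>"
| "exe E (RSet a e) s = s\<lparr>reals := (reals s)(nval a s := rval e s)\<rparr>"
| "exe E (SCopy a b) s = s\<lparr>strs := (strs s)(nval a s := strs s (nval b s))\<rparr>"
| "exe E (CallDist a x y) s = s\<lparr>reals := (reals s)(nval a s :=
     dist_fun E (strs s (nval x s)) (strs s (nval y s)))\<rparr>"
| "exe E (CallEmbed a x k) s = s\<lparr>strs := (strs s)(nval a s :=
     embed_fun E (map (strs s) [nval x s ..< nval x s + nval k s]))\<rparr>"
| "exe E (CallApply a c x) s = s\<lparr>reals := write_array (nval a s)
     (apply_fun E (strs s (nval c s)) (strs s (nval x s))) (reals s)\<rparr>"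
| "exe E (Seq c1 c2) s = exe E c2 (exe E c1 s)"
| "exe E (Cond b c1 c2) s = (if bval b s then exe E c1 s else exe E c2 s)"
| "exe E _ s = s"

fun steps :: "com \<Rightarrow> nat" where
  "steps (Seq c1 c2) = steps c1 + steps c2"
| "steps (Cond b c1 c2) = Suc (max (steps c1) (steps c2))"
| "steps _ = 1"

text \<open>The cost of an embedding call is demanded here and not in the locale \<open>ram\<close>,
  so that programs without such calls can be analysed with a step cost that does not involve
  \<open>embed_time\<close>. Flips and loops are excluded; they are left to the rules for
  \<open>runs\<close>.\<close>

fun safe :: "subroutines \<Rightarrow> nat \<Rightarrow> nat \<Rightarrow> nat \<Rightarrow> com \<Rightarrow> state \<Rightarrow> bool" where
  "safe E \<beta> \<kappa> \<mu> Skip s \<longleftrightarrow> True"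
| "safe E \<beta> \<kappa> \<mu> (NSet a e) s \<longleftrightarrow> nval e s < 2 ^ \<beta>"
| "safe E \<beta> \<kappa> \<mu> (RSet a e) s \<longleftrightarrow> True"
| "safe E \<beta> \<kappa> \<mu> (SCopy a b) s \<longleftrightarrow> length (strs s (nval b s)) \<le> \<mu>"
| "safe E \<beta> \<kappa> \<mu> (Flip a) s \<longleftrightarrow> False"
| "safe E \<beta> \<kappa> \<mu> (CallDist a x y) s \<longleftrightarrow> True"
| "safe E \<beta> \<kappa> \<mu> (CallEmbed a x k) s \<longleftrightarrow> 2000 * \<beta> + embed_time E \<le> \<kappa>"
| "safe E \<beta> \<kappa> \<mu> (CallApply a c x) s \<longleftrightarrow>
     length (apply_fun E (strs s (nval c s)) (strs s (nval x s))) \<le> \<mu>"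
| "safe E \<beta> \<kappa> \<mu> (Seq c1 c2) s \<longleftrightarrow> safe E \<beta> \<kappa> \<mu> c1 s \<and> safe E \<beta> \<kappa> \<mu> c2 (exe E c1 s)"
| "safe E \<beta> \<kappa> \<mu> (Cond b c1 c2) s \<longleftrightarrow> (if bval b s then safe E \<beta> \<kappa> \<mu> c1 s else safe E \<beta> \<kappa> \<mu> c2 s)"
| "safe E \<beta> \<kappa> \<mu> (While b c) s \<longleftrightarrow> False"

text \<open>\<open>\<mu>\<close> bounds the lengths of strings and image vectors, \<open>\<kappa>\<close> the cost of an elementary step, and
  the natural numbers in memory have at most \<open>\<beta>\<close> bits.\<close>

locale ram =
  fixes E :: subroutines and \<beta> \<kappa> \<mu> :: nat
  assumes beta_ge: "7 \<le> \<beta>"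
    and kappa_ge: "2000 * \<beta> + dist_time E + apply_time E + \<mu> \<le> \<kappa>"
begin

text \<open>The coins read form a finite prefix \<open>l1\<close>, and the same execution is
  asserted for every continuation \<open>w\<close>: a run is a function of finitely many bits. The
  budget \<open>k\<close> counts elementary steps of cost at most \<kappa>. The bit bound is a
  premise inside the definition, so that the sequencing rules pass it on.\<close>

definition runs ::
    "com \<Rightarrow> state \<Rightarrow> bool list \<Rightarrow> nat \<Rightarrow> (state \<Rightarrow> bool list \<Rightarrow> bool) \<Rightarrow> bool" where
  "runs c s l k Q \<longleftrightarrow> (bnd \<beta> s \<longrightarrow>
     (\<exists>t s' l1 l2. l = l1 @ l2 \<and> (\<forall>w. exec E c (s, l1 @- w) t (s', w)) \<and> t \<le> k * \<kappa>
        \<and> bnd \<beta> s' \<and> Q s' l2))"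

lemma size_cost:
  assumes "m \<le> 40"
  shows "Suc (m * Suc (\<beta> * m)) \<le> 2000 * \<beta>"
proof -
  have "m * Suc (\<beta> * m) \<le> 40 * Suc (\<beta> * 40)" using assms by (intro mult_le_mono) auto
  then show ?thesis using beta_ge by simp
qed

lemma cost1: "bnd \<beta> s \<Longrightarrow> nok a \<Longrightarrow> nsz a \<le> 40 \<Longrightarrow> 1 + ncost a s \<le> 2000 * \<beta>"
  using ncost_le[OF _ beta_ge, of s a] size_cost[of "nsz a"] by simp

lemma cost2: "bnd \<beta> s \<Longrightarrow> nok a \<Longrightarrow> nok b \<Longrightarrow> nsz a + nsz b \<le> 40 \<Longrightarrow>
    1 + ncost a s + ncost b s \<le> 2000 * \<beta>"
  using ncost_le[OF _ beta_ge, of s a] ncost_le[OF _ beta_ge, of s b] size_cost[of "nsz a + nsz b"]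
  by (simp add: algebra_simps)

lemma cost3: "bnd \<beta> s \<Longrightarrow> nok a \<Longrightarrow> nok b \<Longrightarrow> nok c \<Longrightarrow> nsz a + nsz b + nsz c \<le> 40 \<Longrightarrow>
    1 + ncost a s + ncost b s + ncost c s \<le> 2000 * \<beta>"
  using ncost_le[OF _ beta_ge, of s a] ncost_le[OF _ beta_ge, of s b] ncost_le[OF _ beta_ge, of s c]
    size_cost[of "nsz a + nsz b + nsz c"]
  by (simp add: algebra_simps)

lemma cost_r: "bnd \<beta> s \<Longrightarrow> nok a \<Longrightarrow> rok b \<Longrightarrow> nsz a + rsz b \<le> 40 \<Longrightarrow>
    1 + ncost a s + rcost b s \<le> 2000 * \<beta>"
  using ncost_le[OF _ beta_ge, of s a] rcost_le[OF _ beta_ge, of s b] size_cost[of "nsz a + rsz b"]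
  by (simp add: algebra_simps)

lemma cost_b: "bnd \<beta> s \<Longrightarrow> bok b \<Longrightarrow> bsz b \<le> 40 \<Longrightarrow> bcost b s \<le> \<kappa>"
  using bcost_le[OF _ beta_ge, of s b] size_cost[of "bsz b"] kappa_ge by simp

lemma exe_sound:
  assumes "small c" "safe E \<beta> \<kappa> \<mu> c s" "bnd \<beta> s"
  shows "\<exists>t. (\<forall>w. exec E c (s, w) t (exe E c s, w)) \<and> t \<le> steps c * \<kappa> \<and> bnd \<beta> (exe E c s)"
  using assms
proof (induction c arbitrary: s)
  case Skip
  then show ?case using beta_ge kappa_ge exec.Skip[of E s] by (intro exI[of _ 1]) auto
next
  case (NSet a e)
  then show ?case using cost2[of s a e] kappa_ge
    by (intro exI[of _ "1 + ncost a s + ncost e s"] conjI allI)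
      (unfold exe.simps, rule exec.NSet, auto simp: bnd_def)
next
  case (RSet a e)
  then show ?case using cost_r[of s a e] kappa_ge
    by (intro exI[of _ "1 + ncost a s + rcost e s"] conjI allI)
      (unfold exe.simps, rule exec.RSet, auto simp: bnd_def)
next
  case (SCopy a b)
  then show ?case using cost2[of s a b] kappa_ge
    by (intro exI[of _ "1 + ncost a s + ncost b s + length (strs s (nval b s))"] conjI allI)
      (unfold exe.simps, rule exec.SCopy, auto simp: bnd_def)
next
  case (Flip a)
  then show ?case by simp
next
  case (CallDist a x y)
  then show ?case using cost3[of s a x y] kappa_ge
    by (intro exI[of _ "1 + ncost a s + ncost x s + ncost y s + dist_time E"] conjI allI)
      (unfold exe.simps, rule exec.CallDist, auto simp: bnd_def)
next
  case (CallEmbed a x k)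
  then show ?case using cost3[of s a x k]
    by (intro exI[of _ "1 + ncost a s + ncost x s + ncost k s + embed_time E"] conjI allI)
      (unfold exe.simps, rule exec.CallEmbed, auto simp: bnd_def)
next
  case (CallApply a c x)
  then show ?case using cost3[of s a c x] kappa_ge
    by (intro exI[of _ "1 + ncost a s + ncost c s + ncost x s + apply_time E +
          length (apply_fun E (strs s (nval c s)) (strs s (nval x s)))"] conjI allI)
      (unfold exe.simps, rule exec.CallApply, rule refl, auto simp: bnd_def)
next
  case (Seq c1 c2)
  obtain t1 where t1: "\<And>w. exec E c1 (s, w) t1 (exe E c1 s, w)" "t1 \<le> steps c1 * \<kappa>" "bnd \<beta> (exe E c1 s)"
    using Seq.IH(1)[of s] Seq.prems by auto
  obtain t2 where t2: "\<And>w. exec E c2 (exe E c1 s, w) t2 (exe E c2 (exe E c1 s), w)"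
    "t2 \<le> steps c2 * \<kappa>" "bnd \<beta> (exe E c2 (exe E c1 s))"
    using Seq.IH(2)[of "exe E c1 s"] Seq.prems t1(3) by auto
  show ?case using t1 t2
    by (intro exI[of _ "t1 + t2"]) (auto intro: exec.Seq simp: distrib_right)
next
  case (Cond b c1 c2)
  have *: "bcost b s \<le> \<kappa>" using Cond cost_b by simp
  show ?case
  proof (cases "bval b s")
    case True
    then obtain t1 where t1: "\<And>w. exec E c1 (s, w) t1 (exe E c1 s, w)" "t1 \<le> steps c1 * \<kappa>" "bnd \<beta> (exe E c1 s)"
      using Cond.IH(1)[of s] Cond.prems by auto
    have "t1 \<le> max (steps c1) (steps c2) * \<kappa>"
      using t1(2) by (meson le_trans max.cobounded1 mult_le_mono1)
    then show ?thesis using t1 * True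
      by (intro exI[of _ "bcost b s + t1"]) (auto intro: exec.CondTrue )
  next
    case False
    then obtain t1 where t1: "\<And>w. exec E c2 (s, w) t1 (exe E c2 s, w)" "t1 \<le> steps c2 * \<kappa>" "bnd \<beta> (exe E c2 s)"
      using Cond.IH(2)[of s] Cond.prems by auto
    have "t1 \<le> max (steps c1) (steps c2) * \<kappa>"
      using t1(2) by (meson le_trans max.cobounded2 mult_le_mono1)
    then show ?thesis using t1 * False
      by (intro exI[of _ "bcost b s + t1"]) (auto intro: exec.CondFalse )
  qed
next
  case (While b c)
  then show ?case by simp
qed

lemma runs_exe:
  assumes "small c" "safe E \<beta> \<kappa> \<mu> c s" "steps c \<le> k" "Q (exe E c s) l"
  shows "runs c s l k Q"
  unfolding runs_def
proof
  assume "bnd \<beta> s"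
  from exe_sound[OF assms(1,2) this] obtain t where
    t: "\<And>w. exec E c (s, w) t (exe E c s, w)" "t \<le> steps c * \<kappa>" "bnd \<beta> (exe E c s)" by blast
  have "t \<le> k * \<kappa>" using t(2) assms(3) by (meson le_trans mult_le_mono1)
  with t assms(4) show "\<exists>t s' l1 l2. l = l1 @ l2 \<and> (\<forall>w. exec E c (s, l1 @- w) t (s', w)) \<and> t \<le> k * \<kappa>
        \<and> bnd \<beta> s' \<and> Q s' l2"
    by (intro exI[of _ t] exI[of _ "exe E c s"] exI[of _ "[]"] exI[of _ l]) auto
qed

lemma runs_mono:
  assumes "runs c s l k Q" "k \<le> k'" "\<And>s' l'. bnd \<beta> s' \<Longrightarrow> Q s' l' \<Longrightarrow> Q' s' l'"
  shows "runs c s l k' Q'"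
  unfolding runs_def
proof
  assume "bnd \<beta> s"
  then obtain t s' l1 l2 where *: "l = l1 @ l2" "\<forall>w. exec E c (s, l1 @- w) t (s', w)" "t \<le> k * \<kappa>"
     "bnd \<beta> s'" "Q s' l2" using assms(1) unfolding runs_def by blast
  have "t \<le> k' * \<kappa>" using *(3) assms(2) by (meson le_trans mult_le_mono1)
  with * assms(3) show "\<exists>t s' l1 l2. l = l1 @ l2 \<and> (\<forall>w. exec E c (s, l1 @- w) t (s', w)) \<and> t \<le> k' * \<kappa>
        \<and> bnd \<beta> s' \<and> Q' s' l2" by blast
qed

lemma runs_Flip:
  assumes "nok a" "nsz a \<le> 40" "Q (s\<lparr>nats := (nats s)(nval a s := of_bool x)\<rparr>) l"
  shows "runs (Flip a) s (x # l) 1 Q"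
  unfolding runs_def
proof
  assume b: "bnd \<beta> s"
  have 1: "1 + ncost a s \<le> 1 * \<kappa>" using cost1[OF b assms(1,2)] kappa_ge by simp
  have 2: "\<forall>w. exec E (Flip a) (s, [x] @- w) (1 + ncost a s) (s\<lparr>nats := (nats s)(nval a s := of_bool x)\<rparr>, w)"
    using exec.Flip[of E a s "[x] @- w" for w] by simp
  have 3: "bnd \<beta> (s\<lparr>nats := (nats s)(nval a s := of_bool x)\<rparr>)"
    using b beta_ge one_less_power[of "2::nat" \<beta>] by (auto simp: bnd_def)
  show "\<exists>t s' l1 l2. x # l = l1 @ l2 \<and> (\<forall>w. exec E (Flip a) (s, l1 @- w) t (s', w)) \<and> t \<le> 1 * \<kappa>
        \<and> bnd \<beta> s' \<and> Q s' l2"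
    by (intro exI[of _ "1 + ncost a s"] exI[of _ "s\<lparr>nats := (nats s)(nval a s := of_bool x)\<rparr>"]
        exI[of _ "[x]"] exI[of _ l]) (use 1 2 3 assms(3) in auto)
qed

lemma runs_Seq:
  assumes "runs c1 s l k1 Q1" "\<And>s1 l1. bnd \<beta> s1 \<Longrightarrow> Q1 s1 l1 \<Longrightarrow> runs c2 s1 l1 k2 Q" "k1 + k2 \<le> k"
  shows "runs (Seq c1 c2) s l k Q"
  unfolding runs_def
proof
  assume "bnd \<beta> s"
  then obtain t1 s1 a b where 1: "l = a @ b" "\<forall>w. exec E c1 (s, a @- w) t1 (s1, w)" "t1 \<le> k1 * \<kappa>"
     "bnd \<beta> s1" "Q1 s1 b" using assms(1) unfolding runs_def by blast
  then obtain t2 s2 a2 b2 where 2: "b = a2 @ b2" "\<forall>w. exec E c2 (s1, a2 @- w) t2 (s2, w)" "t2 \<le> k2 * \<kappa>"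
     "bnd \<beta> s2" "Q s2 b2" using assms(2)[OF 1(4,5)] unfolding runs_def by blast
  have "t1 + t2 \<le> (k1 + k2) * \<kappa>" using 1 2 by (simp add: distrib_right)
  also have "\<dots> \<le> k * \<kappa>" using assms(3) by simp
  finally have "t1 + t2 \<le> k * \<kappa>" .
  moreover have "\<forall>w. exec E (Seq c1 c2) (s, (a @ a2) @- w) (t1 + t2) (s2, w)"
    using 1(2) 2(2) by (auto intro: exec.Seq)
  ultimately show "\<exists>t s' l1 l2. l = l1 @ l2 \<and> (\<forall>w. exec E (Seq c1 c2) (s, l1 @- w) t (s', w)) \<and> t \<le> k * \<kappa>
        \<and> bnd \<beta> s' \<and> Q s' l2" using 1 2
    by (intro exI[of _ "t1 + t2"] exI[of _ s2] exI[of _ "a @ a2"] exI[of _ b2]) auto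
qed

lemma runs_Cond:
  assumes "bok b" "bsz b \<le> 40" "bval b s \<Longrightarrow> runs c1 s l k1 Q" "\<not> bval b s \<Longrightarrow> runs c2 s l k1 Q" "k1 + 1 \<le> k"
  shows "runs (Cond b c1 c2) s l k Q"
  unfolding runs_def
proof
  assume b: "bnd \<beta> s"
  have bc: "bcost b s \<le> \<kappa>" using cost_b b assms by blast
  have "runs (if bval b s then c1 else c2) s l k1 Q" using assms by simp
  then obtain t1 s1 l1 l2 where 1: "l = l1 @ l2" "\<forall>w. exec E (if bval b s then c1 else c2) (s, l1 @- w) t1 (s1, w)"
     "t1 \<le> k1 * \<kappa>" "bnd \<beta> s1" "Q s1 l2" using b unfolding runs_def by blast
  have "bcost b s + t1 \<le> (k1 + 1) * \<kappa>" using 1 bc by simp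
  also have "\<dots> \<le> k * \<kappa>" using assms(5) by (intro mult_le_mono1)
  finally have "bcost b s + t1 \<le> k * \<kappa>" .
  moreover have "\<forall>w. exec E (Cond b c1 c2) (s, l1 @- w) (bcost b s + t1) (s1, w)"
    using 1(2) by (auto intro: exec.CondTrue exec.CondFalse split: if_splits)
  ultimately show "\<exists>t s' l1 l2. l = l1 @ l2 \<and> (\<forall>w. exec E (Cond b c1 c2) (s, l1 @- w) t (s', w)) \<and> t \<le> k * \<kappa>
        \<and> bnd \<beta> s' \<and> Q s' l2" using 1 by blast
qed

text \<open>The index of \<open>I\<close> bounds the iterations that remain. It may drop by more
  than one, which lets a loop be left early; every iteration pays \<open>k1\<close> steps and one
  evaluation of the guard, and the final guard accounts for the last summand 1.\<close>

lemma runs_While: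
  assumes "bok b" "bsz b \<le> 40" "I m s l"
    "\<And>i s l. bnd \<beta> s \<Longrightarrow> I i s l \<Longrightarrow> bval b s \<Longrightarrow> 0 < i \<and> runs c s l k1 (\<lambda>s' l'. \<exists>i'<i. I i' s' l')"
    "\<And>i s l. bnd \<beta> s \<Longrightarrow> I i s l \<Longrightarrow> \<not> bval b s \<Longrightarrow> Q s l"
    "m * (k1 + 1) + 1 \<le> k"
  shows "runs (While b c) s l k Q"
proof -
  have "bnd \<beta> s \<Longrightarrow> I m s l \<Longrightarrow> \<exists>t s' l1 l2. l = l1 @ l2 \<and> (\<forall>w. exec E (While b c) (s, l1 @- w) t (s', w))
      \<and> t \<le> (m * (k1 + 1) + 1) * \<kappa> \<and> bnd \<beta> s' \<and> Q s' l2" for s l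
  proof (induction m arbitrary: s l rule: less_induct)
    case (less m)
    have bc: "bcost b s \<le> \<kappa>" using cost_b less assms(1,2) by blast
    show ?case
    proof (cases "bval b s")
      case True
      then have m: "0 < m" "runs c s l k1 (\<lambda>s' l'. \<exists>i'<m. I i' s' l')" using assms(4) less by auto
      then obtain t1 s1 a1 a2 m' where 1: "l = a1 @ a2" "\<forall>w. exec E c (s, a1 @- w) t1 (s1, w)"
        "t1 \<le> k1 * \<kappa>" "bnd \<beta> s1" "m' < m" "I m' s1 a2"
        using less.prems(1) unfolding runs_def by blast
      from less.IH[OF 1(5,4,6)] obtain t2 s2 b1 b2 where 2: "a2 = b1 @ b2"
        "\<forall>w. exec E (While b c) (s1, b1 @- w) t2 (s2, w)" "t2 \<le> (m' * (k1 + 1) + 1) * \<kappa>" "bnd \<beta> s2" "Q s2 b2"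
        by blast
      have "m' * (k1 + 1) + 1 + k1 + 1 \<le> m * (k1 + 1) + 1"
        using 1(5) mult_le_mono1[of "Suc m'" m "k1 + 1"] by simp
      then have "(m' * (k1 + 1) + 1 + k1 + 1) * \<kappa> \<le> (m * (k1 + 1) + 1) * \<kappa>" by (rule mult_le_mono1)
      then have "bcost b s + t1 + t2 \<le> (m * (k1 + 1) + 1) * \<kappa>"
        using bc 1(3) 2(3) by (simp add: distrib_right)
      moreover have "\<forall>w. exec E (While b c) (s, (a1 @ b1) @- w) (bcost b s + t1 + t2) (s2, w)"
        using 1 2 True by (auto intro: exec.WhileTrue)
      ultimately show ?thesis using 1 2
        by (intro exI[of _ "bcost b s + t1 + t2"] exI[of _ s2] exI[of _ "a1 @ b1"] exI[of _ b2]) auto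
    next
      case False
      then have "\<forall>w. exec E (While b c) (s, [] @- w) (bcost b s) (s, w)" by (auto intro: exec.WhileFalse)
      moreover have "bcost b s \<le> (m * (k1 + 1) + 1) * \<kappa>" using bc by simp
      ultimately show ?thesis using False less assms(5)
        by (intro exI[of _ "bcost b s"] exI[of _ s] exI[of _ "[]"] exI[of _ l]) auto
    qed
  qed
  then have "runs (While b c) s l (m * (k1 + 1) + 1) Q" using assms(3) unfolding runs_def by blast
  then show ?thesis using assms(6) by (rule runs_mono)
qed

lemma runs_for:
  assumes "bok b" "bsz b \<le> 40" "I 0 s l"
    "\<And>i s l. bnd \<beta> s \<Longrightarrow> I i s l \<Longrightarrow> i < m \<Longrightarrow> bval b s \<and> runs c s l k1 (I (Suc i))"
    "\<And>s l. bnd \<beta> s \<Longrightarrow> I m s l \<Longrightarrow> \<not> bval b s"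
    "m * (k1 + 1) + 1 \<le> k"
  shows "runs (While b c) s l k (I m)"
proof (rule runs_While[where I = "\<lambda>i s l. i \<le> m \<and> I (m - i) s l" and m = m and ?k1.0 = k1])
  show "m \<le> m \<and> I (m - m) s l" using assms(3) by simp
  fix i s l assume b: "bnd \<beta> s" and i: "i \<le> m \<and> I (m - i) s l"
  show "0 < i \<and> runs c s l k1 (\<lambda>s' l'. \<exists>i'<i. i' \<le> m \<and> I (m - i') s' l')" if "bval b s"
  proof -
    have "i \<noteq> 0" using assms(5)[OF b, of l] i that by (cases i) auto
    then have "runs c s l k1 (I (Suc (m - i)))"
      using assms(4)[OF b conjunct2[OF i]] i by auto
    then have "runs c s l k1 (\<lambda>s' l'. \<exists>i'<i. i' \<le> m \<and> I (m - i') s' l')"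
      by (rule runs_mono) (use i \<open>i \<noteq> 0\<close> in \<open>auto intro!: exI[of _ "i - 1"] simp: Suc_diff_le\<close>)
    then show ?thesis using \<open>i \<noteq> 0\<close> by simp
  qed
  show "I m s l" if "\<not> bval b s"
    using assms(4)[OF b conjunct2[OF i]] i that by (cases i) auto
qed (use assms in auto)

end

text \<open>A terminating execution has read only finitely many coins, and the unread ones do not
  influence it. This is what makes the success event measurable.\<close>

lemma exec_prefix:
  assumes "exec E c x t y"
  shows "\<exists>l. snd x = l @- snd y \<and> (\<forall>w. exec E c (fst x, l @- w) t (fst y, w))"
  using assms
proof (induction rule: exec.induct)
  case (Flip a s \<omega>)
  show ?case
    using exec.Flip[of E a s "[shd \<omega>] @- w" for w] by (intro exI[of _ "[shd \<omega>]"]) auto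
next
  case (Seq c1 s \<omega> t1 s1 \<omega>1 c2 t2 s2 \<omega>2)
  then obtain l1 l2 where "\<omega> = l1 @- \<omega>1" "\<forall>w. exec E c1 (s, l1 @- w) t1 (s1, w)"
    "\<omega>1 = l2 @- \<omega>2" "\<forall>w. exec E c2 (s1, l2 @- w) t2 (s2, w)" by auto
  then show ?case by (intro exI[of _ "l1 @ l2"]) (auto intro: exec.Seq)
next
  case (WhileTrue b s c \<omega> t1 s1 \<omega>1 t2 s2 \<omega>2)
  then obtain l1 l2 where "\<omega> = l1 @- \<omega>1" "\<forall>w. exec E c (s, l1 @- w) t1 (s1, w)"
    "\<omega>1 = l2 @- \<omega>2" "\<forall>w. exec E (While b c) (s1, l2 @- w) t2 (s2, w)" by auto
  then show ?case using WhileTrue(1) by (intro exI[of _ "l1 @ l2"]) (auto intro: exec.WhileTrue)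
next
  case (CallApply v c s x a \<omega>)
  then show ?case using exec.CallApply[OF CallApply] by (intro exI[of _ "[]"]) auto
next
  case (CondTrue b s c1 \<omega> t s' \<omega>' c2)
  then show ?case by (auto intro: exec.CondTrue)
next
  case (CondFalse b s c2 \<omega> t s' \<omega>' c1)
  then show ?case by (auto intro: exec.CondFalse)
qed (rule exI[of _ "[]"]; simp only: shift.simps fst_conv snd_conv simp_thms; rule allI; rule exec.intros; assumption?)+

section \<open>Random threshold cuts\<close>

text \<open>Counting integers in a half-open interval replaces its length up to an error of 1.
  Applied once per coordinate, it produces the total rounding error \<open>d\<close>.\<close>

lemma card_nats_between:
  fixes \<alpha> \<beta> :: real
  assumes "\<alpha> \<le> \<beta>"
  shows "finite {k::nat. \<alpha> \<le> real k \<and> real k < \<beta>}"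
    and "real (card {k::nat. \<alpha> \<le> real k \<and> real k < \<beta>}) \<le> \<beta> - \<alpha> + 1"
    and "0 \<le> \<alpha> \<Longrightarrow> \<beta> - \<alpha> - 1 \<le> real (card {k::nat. \<alpha> \<le> real k \<and> real k < \<beta>})"
proof -
  have eq: "{k::nat. \<alpha> \<le> real k \<and> real k < \<beta>} = {nat \<lceil>\<alpha>\<rceil>..<nat \<lceil>\<beta>\<rceil>}"
    by (auto simp: nat_le_iff ceiling_le_iff less_ceiling_iff zless_nat_eq_int_zless nat_less_iff)
  show "finite {k::nat. \<alpha> \<le> real k \<and> real k < \<beta>}" unfolding eq by simp
  show "real (card {k::nat. \<alpha> \<le> real k \<and> real k < \<beta>}) \<le> \<beta> - \<alpha> + 1"
    unfolding eq using assms by (simp add: of_nat_diff nat_le_eq_zle) linarith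
  show "\<beta> - \<alpha> - 1 \<le> real (card {k::nat. \<alpha> \<le> real k \<and> real k < \<beta>})" if "0 \<le> \<alpha>"
    unfolding eq using assms that by (simp add: nat_diff_distrib) linarith
qed

text \<open>The ranges of the coordinates are laid end to end; the position \<open>s\<close> on their concatenation
  determines a coordinate and a threshold for it.\<close>

definition cut_at :: "nat \<Rightarrow> (nat \<Rightarrow> real) \<Rightarrow> (nat \<Rightarrow> real) \<Rightarrow> real \<Rightarrow> nat \<Rightarrow> real \<Rightarrow> bool" where
  "cut_at d mn w s i t \<longleftrightarrow> i < d \<and> mn i \<le> t \<and> t < mn i + w i \<and> s = (\<Sum>i'<i. w i') + (t - mn i)"

lemma sum_lessThan_mono_real:
  fixes w :: "nat \<Rightarrow> real"
  assumes "\<And>i. i < d \<Longrightarrow> 0 \<le> w i" "a \<le> b" "b \<le> d"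
  shows "(\<Sum>i<a. w i) \<le> (\<Sum>i<b. w i)"
  using assms by (intro sum_mono2) auto

text \<open>Partial sums of the widths are monotone, so the half-open ranges are disjoint on their
  concatenation and a position determines its coordinate. Coordinates of width 0 have an empty range
  and are never selected.\<close>

lemma cut_at_coordinate:
  assumes c: "cut_at d mn w s i t" and w: "\<And>i. i < d \<Longrightarrow> 0 \<le> w i"
    and j: "j < d" "(\<Sum>i<j. w i) \<le> s" "s < (\<Sum>i<Suc j. w i)"
  shows "i = j"
proof (rule ccontr)
  assume "i \<noteq> j"
  then consider "Suc i \<le> j" | "Suc j \<le> i" by linarith
  then show False
  proof cases
    case 1
    then show ?thesis
      using sum_lessThan_mono_real[of d w "Suc i" j] w c j by (auto simp: cut_at_def)
  next
    case 2
    then show ?thesis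
      using sum_lessThan_mono_real[of d w "Suc j" i] w c j by (auto simp: cut_at_def)
  qed
qed

definition separated ::
    "nat \<Rightarrow> (nat \<Rightarrow> nat) \<Rightarrow> (nat \<Rightarrow> real) \<Rightarrow> (nat \<Rightarrow> real) \<Rightarrow> (nat \<Rightarrow> real) \<Rightarrow> nat set" where
  "separated G I t x y = {k. k < G \<and> (x (I k) \<le> t k) \<noteq> (y (I k) \<le> t k)}"

context
  fixes d G :: nat and mn w :: "nat \<Rightarrow> real" and W :: real and I :: "nat \<Rightarrow> nat" and t :: "nat \<Rightarrow> real"
  assumes w_nonneg: "\<And>i. i < d \<Longrightarrow> 0 \<le> w i" and W_eq: "W = (\<Sum>i<d. w i)" and W_pos: "0 < W"
    and G_pos: "0 < G"
    and cut: "\<And>k. k < G \<Longrightarrow> cut_at d mn w (real k / real G * W) (I k) (t k)"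
begin

lemma card_separated: "card (separated G I t x y) = (\<Sum>i<d. card {k \<in> separated G I t x y. I k = i})"
proof -
  have "separated G I t x y = (\<Union>i<d. {k \<in> separated G I t x y. I k = i})"
    using cut by (auto simp: separated_def cut_at_def)
  also have "card \<dots> = (\<Sum>i<d. card {k \<in> separated G I t x y. I k = i})"
    by (subst card_UN_disjoint) (auto simp: separated_def)
  finally show ?thesis .
qed

text \<open>The thresholds of coordinate \<open>i\<close> that separate \<open>x\<close> from
  \<open>y\<close> are those between the two values. These bounds are their positions on the
  concatenated ranges, rescaled to grid indices by \<open>G / W\<close>.\<close>

abbreviation (input) grid_lo where
  "grid_lo x y i \<equiv> ((\<Sum>i'<i. w i') + min (x i) (y i) - mn i) * real G / W"

abbreviation (input) grid_hi where
  "grid_hi x y i \<equiv> ((\<Sum>i'<i. w i') + max (x i) (y i) - mn i) * real G / W"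

lemma grid_width: "grid_hi x y i - grid_lo x y i = real G / W * \<bar>x i - y i\<bar>"
proof -
  have "grid_hi x y i - grid_lo x y i = (max (x i) (y i) - min (x i) (y i)) * real G / W"
    by (simp only: diff_divide_distrib[symmetric] left_diff_distrib[symmetric]) simp
  also have "max (x i) (y i) - min (x i) (y i) = \<bar>x i - y i\<bar>" by simp
  finally show ?thesis by simp
qed

lemma grid_le: "grid_lo x y i \<le> grid_hi x y i"
proof -
  have "0 \<le> real G / W * \<bar>x i - y i\<bar>" using W_pos by simp
  then show ?thesis using grid_width[where x = x and y = y and i = i] by linarith
qed

text \<open>The two points need not lie within the ranges, since a query may lie outside: leaving
  the range can only lose separating positions, and the upper bound survives.\<close>

lemma card_separated_le:
  "real (card (separated G I t x y)) \<le> real G / W * (\<Sum>i<d. \<bar>x i - y i\<bar>) + real d"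
proof -
  have "real (card {k \<in> separated G I t x y. I k = i}) \<le> real G / W * \<bar>x i - y i\<bar> + 1" if "i < d" for i
  proof -
    let ?S = "{k::nat. grid_lo x y i \<le> real k \<and> real k < grid_hi x y i}"
    have "{k \<in> separated G I t x y. I k = i} \<subseteq> ?S"
    proof
      fix k assume k: "k \<in> {k \<in> separated G I t x y. I k = i}"
      then have s: "real k / real G * W = (\<Sum>i'<i. w i') + (t k - mn i)"
        using cut[of k] by (auto simp: separated_def cut_at_def)
      have tk: "min (x i) (y i) \<le> t k" "t k < max (x i) (y i)" using k by (auto simp: separated_def)
      have "real k = ((\<Sum>i'<i. w i') + (t k - mn i)) * real G / W"
        using s W_pos G_pos by (simp add: field_simps)
      then show "k \<in> ?S" using tk W_pos G_pos
        by (auto intro!: divide_right_mono divide_strict_right_mono mult_right_mono mult_strict_right_mono)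
    qed
    then have "card {k \<in> separated G I t x y. I k = i} \<le> card ?S"
      using card_nats_between(1)[OF grid_le[where x = x and y = y and i = i]] by (intro card_mono) auto
    then show ?thesis
      using card_nats_between(2)[OF grid_le[where x = x and y = y and i = i]] grid_width[where x = x and y = y and i = i] by linarith
  qed
  then have "(\<Sum>i<d. real (card {k \<in> separated G I t x y. I k = i})) \<le> (\<Sum>i<d. real G / W * \<bar>x i - y i\<bar> + 1)"
    by (intro sum_mono) auto
  then show ?thesis
    unfolding card_separated of_nat_sum by (simp add: sum.distrib sum_distrib_left)
qed

text \<open>Both points lie within the ranges here, so every integer between the rescaled positions
  is an admissible grid index, and \<open>cut_at_coordinate\<close> shows that it selects coordinate
  \<open>i\<close> with a separating threshold.\<close>

lemma card_separated_ge:
  assumes x: "\<And>i. i < d \<Longrightarrow> mn i \<le> x i \<and> x i \<le> mn i + w i"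
    and y: "\<And>i. i < d \<Longrightarrow> mn i \<le> y i \<and> y i \<le> mn i + w i"
  shows "real G / W * (\<Sum>i<d. \<bar>x i - y i\<bar>) - real d \<le> real (card (separated G I t x y))"
proof -
  have "real G / W * \<bar>x i - y i\<bar> - 1 \<le> real (card {k \<in> separated G I t x y. I k = i})" if i: "i < d" for i
  proof -
    let ?S = "{k::nat. grid_lo x y i \<le> real k \<and> real k < grid_hi x y i}"
    have P0: "0 \<le> (\<Sum>i'<i. w i')" using w_nonneg i by (intro sum_nonneg) auto
    have "?S \<subseteq> {k \<in> separated G I t x y. I k = i}"
    proof
      fix k assume k: "k \<in> ?S"
      let ?s = "real k / real G * W"
      have s: "(\<Sum>i'<i. w i') + min (x i) (y i) - mn i \<le> ?s" "?s < (\<Sum>i'<i. w i') + max (x i) (y i) - mn i"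
        using k W_pos G_pos by (simp_all add: field_simps)
      have hi: "?s < (\<Sum>i'<Suc i. w i')" using s(2) x[OF i] y[OF i] by auto
      also have "\<dots> \<le> W" unfolding W_eq using sum_lessThan_mono_real[of d w "Suc i" d] w_nonneg i by simp
      finally have kG: "k < G" using W_pos G_pos by (simp add: field_simps)
      have lo: "(\<Sum>i'<i. w i') \<le> ?s" using s(1) x[OF i] y[OF i] by auto
      have I: "I k = i" using cut_at_coordinate[OF cut[OF kG] w_nonneg i lo hi] by simp
      then have "t k = ?s - (\<Sum>i'<i. w i') + mn i" using cut[OF kG] by (simp add: cut_at_def)
      then have "min (x i) (y i) \<le> t k" "t k < max (x i) (y i)" using s by auto
      then show "k \<in> {k \<in> separated G I t x y. I k = i}" using kG I by (auto simp: separated_def)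
    qed
    then have c: "card ?S \<le> card {k \<in> separated G I t x y. I k = i}"
      by (intro card_mono) (auto simp: separated_def)
    have "0 \<le> grid_lo x y i" using P0 x[OF i] y[OF i] W_pos by (intro divide_nonneg_pos mult_nonneg_nonneg) auto
    then show ?thesis
      using card_nats_between(3)[OF grid_le[where x = x and y = y and i = i]] grid_width[where x = x and y = y and i = i] c by linarith
  qed
  then have "(\<Sum>i<d. real G / W * \<bar>x i - y i\<bar> - 1) \<le> (\<Sum>i<d. real (card {k \<in> separated G I t x y. I k = i}))"
    by (intro sum_mono) auto
  then show ?thesis
    unfolding card_separated of_nat_sum by (simp add: sum_subtractf sum_distrib_left)
qed

end

section \<open>The success potential\<close>

text \<open>A lower bound for the probability that a search with \<open>k\<close> remaining levels in a random tree
  over \<open>Q\<close> finds the near neighbour \<open>z\<close>. The second term pays for stopping after \<open>k\<close> levels.\<close>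

definition pot :: "real \<Rightarrow> real \<Rightarrow> 'a \<Rightarrow> nat \<Rightarrow> 'a set \<Rightarrow> real" where
  "pot \<epsilon> \<tau> z k Q =
     (if z \<in> Q then max 0 (real (card Q) powr - \<epsilon> - (1 - \<tau>) ^ k * real (card Q)) else 0)"

lemma pot_nonneg: "0 \<le> pot \<epsilon> \<tau> z k Q"
  by (simp add: pot_def)

lemma card_powr_le_1: "finite Q \<Longrightarrow> z \<in> Q \<Longrightarrow> 0 < \<epsilon> \<Longrightarrow> real (card Q) powr - \<epsilon> \<le> 1"
  by (cases "card Q") (auto simp: powr_minus_divide ge_one_powr_ge_zero divide_le_eq_1)

lemma pot_le_1:
  assumes "finite Q" "0 < \<epsilon>" "\<tau> \<le> 1"
  shows "pot \<epsilon> \<tau> z k Q \<le> 1"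
proof (cases "z \<in> Q")
  case True
  have "0 \<le> (1 - \<tau>) ^ k * real (card Q)" using assms by simp
  then show ?thesis using card_powr_le_1[OF assms(1) True assms(2)] True by (auto simp: pot_def)
qed (simp add: pot_def)

lemma pot_0:
  assumes "finite Q" "0 < \<epsilon>"
  shows "pot \<epsilon> \<tau> z 0 Q = 0"
proof (cases "z \<in> Q")
  case True
  then have "1 \<le> real (card Q)" using assms by (auto simp: Suc_le_eq card_gt_0_iff)
  then show ?thesis using card_powr_le_1[OF assms(1) True assms(2)] by (simp add: pot_def)
qed (simp add: pot_def)

lemma bernoulli_neg_powr:
  fixes \<delta> \<epsilon> :: real
  assumes "0 \<le> \<delta>" "\<delta> < 1" "0 < \<epsilon>"
  shows "1 + \<epsilon> * \<delta> \<le> (1 - \<delta>) powr - \<epsilon>"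
proof -
  have "ln (1 - \<delta>) \<le> - \<delta>" using ln_le_minus_one[of "1 - \<delta>"] assms by simp
  then have "\<epsilon> * \<delta> \<le> - \<epsilon> * ln (1 - \<delta>)"
    using mult_left_mono[of "ln (1 - \<delta>)" "- \<delta>" \<epsilon>] assms by simp
  then have "1 + \<epsilon> * \<delta> \<le> 1 + (- \<epsilon> * ln (1 - \<delta>))" by simp
  also have "\<dots> \<le> exp (- \<epsilon> * ln (1 - \<delta>))" by (rule exp_ge_add_one_self)
  finally show ?thesis using assms by (simp add: powr_def)
qed

text \<open>A ball step loses a level but halves the set. The power term can only grow, and
  \<open>\<tau> \<le> 1 / 2\<close> makes the halving pay for the missing factor
  \<open>1 - \<tau>\<close> in the second term.\<close>

lemma pot_half:
  assumes Q': "finite Q" "Q' \<subseteq> Q" "2 * card Q' \<le> card Q" "z \<in> Q'" and "0 < \<epsilon>" "0 \<le> \<tau>" "\<tau> \<le> 1 / 2"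
  shows "pot \<epsilon> \<tau> z (Suc k) Q \<le> pot \<epsilon> \<tau> z k Q'"
proof -
  have pos: "0 < card Q'" using Q' finite_subset[of Q' Q] by (auto simp: card_gt_0_iff)
  have "real (card Q) powr - \<epsilon> \<le> real (card Q') powr - \<epsilon>"
    using assms pos by (intro powr_mono2') auto
  moreover have "(1 - \<tau>) ^ k * real (card Q') \<le> (1 - \<tau>) ^ Suc k * real (card Q)"
  proof -
    have "2 * real (card Q') \<le> real (card Q)" using Q'(3) by linarith
    then have "real (card Q') \<le> 1 / 2 * real (card Q)" by simp
    also have "\<dots> \<le> (1 - \<tau>) * real (card Q)" using assms by (intro mult_right_mono) auto
    finally have "(1 - \<tau>) ^ k * real (card Q') \<le> (1 - \<tau>) ^ k * ((1 - \<tau>) * real (card Q))"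
      using assms by (intro mult_left_mono) auto
    then show ?thesis by (simp add: mult_ac)
  qed
  ultimately show ?thesis using Q' by (auto simp: pot_def)
qed

text \<open>The gain \<open>1 + \<epsilon> \<delta>\<close> from discarding a fraction \<open>\<delta>\<close> of the points outweighs the loss
  from separating the query from its near neighbour.\<close>

lemma pot_cut:
  fixes side :: "'i \<Rightarrow> 'a \<Rightarrow> bool" and q :: 'a
  assumes fin: "finite Q" "finite L" and \<epsilon>: "0 < \<epsilon>" "\<epsilon> \<le> 1" and \<tau>: "0 \<le> \<tau>" "\<tau> \<le> 1"
    and gain: "2 * real (card Q) * real (card {l \<in> L. sideq l \<noteq> side l z})
      \<le> \<epsilon> * (\<Sum>y\<in>Q. real (card {l \<in> L. side l z \<noteq> side l y}))"
    and shrink: "\<tau> * real (card L) * real (card Q) \<le> (\<Sum>y\<in>Q. real (card {l \<in> L. side l z \<noteq> side l y}))"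
  shows "real (card L) * pot \<epsilon> \<tau> z (Suc k) Q \<le> (\<Sum>l\<in>L. pot \<epsilon> \<tau> z k {y \<in> Q. side l y = sideq l})"
proof (cases "z \<in> Q \<and> 0 < real (card Q) powr - \<epsilon> - (1 - \<tau>) ^ Suc k * real (card Q)")
  case False
  then have "pot \<epsilon> \<tau> z (Suc k) Q = 0" by (auto simp: pot_def)
  then show ?thesis by (simp add: sum_nonneg pot_nonneg)
next
  case True
  then have z: "z \<in> Q" by simp
  define c where "c = real (card Q)"
  have c: "1 \<le> c" using z fin by (auto simp: c_def Suc_le_eq card_gt_0_iff)
  define A where "A = c powr - \<epsilon>"
  have A: "0 \<le> A" by (simp add: A_def)
  define B where "B = (1 - \<tau>) ^ k"
  have B: "0 \<le> B" using \<tau> by (simp add: B_def)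
  define D where "D l = real (card {y \<in> Q. side l z \<noteq> side l y})" for l
  define S where "S l = (of_bool (sideq l \<noteq> side l z) :: real)" for l
  have D_le: "D l \<le> c - 1" and D_ge: "0 \<le> D l" and cardeq: "real (card {y \<in> Q. side l y = side l z}) = c - D l" for l
  proof -
    have "card Q = card {y \<in> Q. side l y = side l z} + card {y \<in> Q. side l z \<noteq> side l y}"
      using fin by (subst card_Un_disjoint[symmetric]) (auto intro: arg_cong[where f = card])
    then show ceq: "real (card {y \<in> Q. side l y = side l z}) = c - D l" by (simp add: c_def D_def)
    have "0 < card {y \<in> Q. side l y = side l z}" using z fin by (auto simp: card_gt_0_iff)
    then show "D l \<le> c - 1" using ceq by linarith
    show "0 \<le> D l" by (simp add: D_def)
  qed
  \<comment> \<open>A bound linear in \<open>D l\<close> and \<open>S l\<close> that can be summed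
    over \<open>L\<close>. If \<open>z\<close> stays with the query, it is the Bernoulli inequality
    for the remaining \<open>c - D l\<close> points. If not, the coefficient 2 makes it nonpositive,
    because \<open>\<epsilon> * (D l / c) \<le> 1\<close>.\<close>
  have point: "A * (1 + \<epsilon> * (D l / c) - 2 * S l) - B * (c - D l) \<le> pot \<epsilon> \<tau> z k {y \<in> Q. side l y = sideq l}" for l
  proof (cases "sideq l = side l z")
    case True
    have "(1 + \<epsilon> * (D l / c)) \<le> (1 - D l / c) powr - \<epsilon>"
      using D_le[of l] D_ge[of l] c \<epsilon> by (intro bernoulli_neg_powr) (auto simp: field_simps)
    then have "A * (1 + \<epsilon> * (D l / c)) \<le> A * (1 - D l / c) powr - \<epsilon>"
      using A by (intro mult_left_mono) auto
    also have "\<dots> = (c * (1 - D l / c)) powr - \<epsilon>"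
      unfolding A_def using D_le[of l] c by (subst powr_mult) (auto simp: field_simps)
    also have "c * (1 - D l / c) = c - D l" using c by (simp add: field_simps)
    finally show ?thesis using True z unfolding pot_def cardeq[of l, symmetric] B_def S_def by simp
  next
    case False
    have "A * (1 + \<epsilon> * (D l / c) - 2 * S l) \<le> A * 0"
    proof (intro mult_left_mono)
      have "\<epsilon> * (D l / c) \<le> 1 * 1"
        using D_le[of l] D_ge[of l] c \<epsilon> by (intro mult_mono) (auto simp: field_simps)
      then show "1 + \<epsilon> * (D l / c) - 2 * S l \<le> 0" using False by (simp add: S_def)
    qed (use A in auto)
    moreover have "0 \<le> B * (c - D l)" using D_le[of l] B by simp
    ultimately show ?thesis using pot_nonneg[of \<epsilon> \<tau> z k "{y \<in> Q. side l y = sideq l}"] by linarith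
  qed
  \<comment> \<open>Double counting of the pairs of a cut and a point that it separates from
    \<open>z\<close>.\<close>
  have swap: "(\<Sum>l\<in>L. D l) = (\<Sum>y\<in>Q. real (card {l \<in> L. side l z \<noteq> side l y}))"
  proof -
    have "(\<Sum>l\<in>L. D l) = (\<Sum>l\<in>L. \<Sum>y\<in>Q. of_bool (side l z \<noteq> side l y))"
      unfolding D_def using fin by (intro sum.cong refl) (simp add: Int_def conj_commute)
    also have "\<dots> = (\<Sum>y\<in>Q. \<Sum>l\<in>L. of_bool (side l z \<noteq> side l y))" by (rule sum.swap)
    also have "\<dots> = (\<Sum>y\<in>Q. real (card {l \<in> L. side l z \<noteq> side l y}))"
      using fin by (intro sum.cong refl) (simp add: Int_def conj_commute)
    finally show ?thesis .
  qed
  have Ssum: "(\<Sum>l\<in>L. S l) = real (card {l \<in> L. sideq l \<noteq> side l z})"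
    unfolding S_def using fin by (simp add: Int_def conj_commute)
  let ?n = "real (card L)" and ?D = "\<Sum>l\<in>L. D l"
  have "(\<Sum>l\<in>L. A * (1 + \<epsilon> * (D l / c) - 2 * S l) - B * (c - D l))
      = A * (\<Sum>l\<in>L. 1 + \<epsilon> * (D l / c) - 2 * S l) - B * (\<Sum>l\<in>L. c - D l)"
    by (simp only: sum_subtractf sum_distrib_left[symmetric])
  also have "(\<Sum>l\<in>L. 1 + \<epsilon> * (D l / c) - 2 * S l) = ?n + \<epsilon> * (?D / c) - 2 * (\<Sum>l\<in>L. S l)"
    by (simp add: sum_subtractf sum.distrib sum_distrib_left sum_divide_distrib)
  also have "(\<Sum>l\<in>L. c - D l) = ?n * c - ?D" by (simp add: sum_subtractf)
  finally have eq: "(\<Sum>l\<in>L. A * (1 + \<epsilon> * (D l / c) - 2 * S l) - B * (c - D l))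
      = A * (?n + \<epsilon> * (?D / c) - 2 * (\<Sum>l\<in>L. S l)) - B * (?n * c - ?D)" .
  have "2 * (\<Sum>l\<in>L. S l) \<le> \<epsilon> * (?D / c)"
    using gain c unfolding swap Ssum c_def[symmetric] by (simp add: field_simps)
  then have "A * ?n \<le> A * (?n + \<epsilon> * (?D / c) - 2 * (\<Sum>l\<in>L. S l))"
    using A by (intro mult_left_mono) auto
  moreover have "B * (?n * c - ?D) \<le> B * ((1 - \<tau>) * (?n * c))"
    using shrink B unfolding swap c_def[symmetric] by (intro mult_left_mono) (auto simp: algebra_simps)
  ultimately have "?n * (A - (1 - \<tau>) ^ Suc k * c) \<le> (\<Sum>l\<in>L. A * (1 + \<epsilon> * (D l / c) - 2 * S l) - B * (c - D l))"
    unfolding eq by (simp add: B_def algebra_simps)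
  also have "\<dots> \<le> (\<Sum>l\<in>L. pot \<epsilon> \<tau> z k {y \<in> Q. side l y = sideq l})"
    by (intro sum_mono point)
  finally show ?thesis using True by (simp add: pot_def A_def c_def)
qed

text \<open>Each pair is routed through \<open>x\<close>, and each point occurs
  \<open>card Q\<close> times at either end. The centre \<open>x\<close> need not belong to
  \<open>Q\<close>.\<close>

lemma sum_dist_le_twice_star:
  fixes \<rho> :: "'a \<Rightarrow> 'a \<Rightarrow> real"
  assumes "finite Q" "\<And>y z. y \<in> Q \<Longrightarrow> z \<in> Q \<Longrightarrow> \<rho> y z \<le> \<rho> x y + \<rho> x z"
  shows "(\<Sum>y\<in>Q. \<Sum>z\<in>Q. \<rho> y z) \<le> 2 * real (card Q) * (\<Sum>y\<in>Q. \<rho> x y)"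
proof -
  have "(\<Sum>y\<in>Q. \<Sum>z\<in>Q. \<rho> y z) \<le> (\<Sum>y\<in>Q. \<Sum>z\<in>Q. \<rho> x y + \<rho> x z)"
    using assms(2) by (intro sum_mono) auto
  also have "\<dots> = 2 * real (card Q) * (\<Sum>y\<in>Q. \<rho> x y)"
    by (simp add: sum.distrib sum_distrib_left mult.assoc)
  finally show ?thesis .
qed

section \<open>Coin flips\<close>

text \<open>Most significant bit first, so that appending a coin doubles the number and adds a bit,
  as the sampling loop does with its binary fraction.\<close>

fun unum :: "bool list \<Rightarrow> nat" where
  "unum [] = 0"
| "unum (b # l) = of_bool b * 2 ^ length l + unum l"

lemma unum_less: "unum l < 2 ^ length l"
  by (induction l) auto

lemma unum_inj: "length l = length l' \<Longrightarrow> unum l = unum l' \<Longrightarrow> l = l'"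
proof (induction l l' rule: list_induct2)
  case (Cons x xs y ys)
  have "unum xs < 2 ^ length xs" "unum ys < 2 ^ length xs"
    using unum_less[of xs] unum_less[of ys] Cons(1) by simp_all
  then show ?case using Cons by (cases x; cases y) auto
qed simp

lemma card_bool_lists: "card {l :: bool list. length l = n} = 2 ^ n" "finite {l :: bool list. length l = n}"
  using card_lists_length_eq[of "UNIV :: bool set" n] finite_lists_length_eq[of "UNIV :: bool set" n]
  by simp_all

lemma bij_betw_unum: "bij_betw unum {l. length l = n} {..<2 ^ n}"
proof -
  have inj: "inj_on unum {l. length l = n}" by (auto intro!: inj_onI unum_inj)
  moreover have "unum ` {l. length l = n} = {..<2 ^ n}"
    using inj unum_less by (intro card_subset_eq) (auto simp: card_image card_bool_lists)
  ultimately show ?thesis by (simp add: bij_betw_def)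
qed

lemma card_unum: "card {l. length l = n \<and> P (unum l)} = card {k. k < 2 ^ n \<and> P k}"
proof -
  have "unum ` {l. length l = n \<and> P (unum l)} = {k. k < 2 ^ n \<and> P k}"
    using bij_betw_imp_surj_on[OF bij_betw_unum[of n]] by (auto simp: set_eq_iff image_iff) metis+
  moreover have "inj_on unum {l. length l = n \<and> P (unum l)}" by (auto intro!: inj_onI unum_inj)
  ultimately show ?thesis using card_image by metis
qed

lemma unum_snoc: "unum (l @ [b]) = 2 * unum l + of_bool b"
  by (induction l) auto

lemma sum_bool_lists_append:
  fixes f :: "bool list \<Rightarrow> real"
  shows "(\<Sum>l | length l = m + n. f l) = (\<Sum>l1 | length l1 = m. \<Sum>l2 | length l2 = n. f (l1 @ l2))"
proof -
  have "(\<Sum>l1 | length l1 = m. \<Sum>l2 | length l2 = n. f (l1 @ l2))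
      = (\<Sum>(l1, l2) \<in> {l1. length l1 = m} \<times> {l2. length l2 = n}. f (l1 @ l2))"
    by (rule sum.cartesian_product)
  also have "\<dots> = (\<Sum>l | length l = m + n. f l)"
    by (rule sum.reindex_bij_witness[where i = "\<lambda>l. (take m l, drop m l)" and j = "\<lambda>(a, b). a @ b"]) auto
  finally show ?thesis by simp
qed

fun iter :: "('s \<Rightarrow> bool list \<Rightarrow> 's) \<Rightarrow> nat \<Rightarrow> nat \<Rightarrow> 's \<Rightarrow> bool list \<Rightarrow> 's" where
  "iter step B 0 a l = a"
| "iter step B (Suc m) a l = iter step B m (step a (take B l)) (drop B l)"

text \<open>Expectations are sums over all bit lists of the coins of a round, and splitting a list
  plays the role of conditioning on the first round. \<open>V j a\<close> bounds the proportion of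
  the remaining coin lists that lead from \<open>a\<close> to a state with \<open>Z\<close>.\<close>

lemma supermartingale_bound:
  fixes V :: "nat \<Rightarrow> 's \<Rightarrow> real"
  assumes inv: "\<And>j a l. j < J \<Longrightarrow> Inv j a \<Longrightarrow> length l = B \<Longrightarrow> Inv (Suc j) (step a l)"
    and super: "\<And>j a. j < J \<Longrightarrow> Inv j a \<Longrightarrow> (\<Sum>l | length l = B. V (Suc j) (step a l)) \<le> 2 ^ B * V j a"
    and final: "\<And>a. Inv J a \<Longrightarrow> of_bool (Z a) \<le> V J a"
  shows "Inv j a \<Longrightarrow> j + m = J \<Longrightarrow>
    (\<Sum>l | length l = m * B. of_bool (Z (iter step B m a l))) \<le> 2 ^ (m * B) * V j a"
proof (induction m arbitrary: j a)
  case 0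
  then show ?case using final[of a] by simp
next
  case (Suc m)
  have "(\<Sum>l | length l = Suc m * B. of_bool (Z (iter step B (Suc m) a l)) :: real)
      = (\<Sum>l1 | length l1 = B. \<Sum>l2 | length l2 = m * B. of_bool (Z (iter step B m (step a l1) l2)))"
    unfolding mult_Suc sum_bool_lists_append by (intro sum.cong refl) auto
  also have "\<dots> \<le> (\<Sum>l1 | length l1 = B. 2 ^ (m * B) * V (Suc j) (step a l1))"
    using Suc.prems inv by (intro sum_mono Suc.IH) auto
  also have "\<dots> = 2 ^ (m * B) * (\<Sum>l1 | length l1 = B. V (Suc j) (step a l1))"
    by (simp add: sum_distrib_left)
  also have "\<dots> \<le> 2 ^ (m * B) * (2 ^ B * V j a)"
    using super[of j a] Suc.prems by (intro mult_left_mono) auto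
  finally show ?case by (simp add: power_add mult_ac)
qed

section \<open>The coin measure on cylinder events\<close>

lemma space_coins: "space coins = UNIV"
  by (simp add: coins_def space_stream_space)

interpretation coins: prob_space coins
  unfolding coins_def by (rule prob_space.prob_space_stream_space[OF prob_space_measure_pmf])

lemma cylinder_in_coins: "{\<omega>. stake n \<omega> \<in> A} \<in> sets coins"
proof -
  have "sets coins = sets (stream_space (count_space UNIV))"
    unfolding coins_def by (intro sets_stream_space_cong) simp
  moreover have "stake n -` A \<inter> space (stream_space (count_space UNIV)) \<in> sets (stream_space (count_space UNIV))"
    by (rule measurable_sets[OF measurable_stake]) simp
  ultimately show ?thesis by (simp add: space_stream_space vimage_def)
qed

text \<open>There are only countably many finite bit lists, so an event decided by some finite
  prefix is a countable union of cylinders, even without a common bound on the length of the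
  prefixes.\<close>

lemma prefix_in_coins: "{\<omega>. \<exists>l w. \<omega> = l @- w \<and> l \<in> A} \<in> sets coins"
proof -
  have "{\<omega>. \<exists>l w. \<omega> = l @- w \<and> l \<in> A} = (\<Union>l\<in>A. {\<omega>. stake (length l) \<omega> \<in> {l}})"
    by (auto simp: stake_shift) (metis stake_sdrop)
  also have "\<dots> \<in> sets coins"
    by (intro sets.countable_UN'') (use cylinder_in_coins[of "length l" "{l}" for l] in auto)
  finally show ?thesis .
qed

lemma measure_coins_single: "length l = n \<Longrightarrow> measure coins {\<omega>. stake n \<omega> = l} = 1 / 2 ^ n"
proof (induction n arbitrary: l)
  case 0
  then show ?case using coins.prob_space space_coins by simp
next
  case (Suc n)
  then obtain b l' where l: "l = b # l'" "length l' = n" by (cases l) auto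
  have sets: "{\<omega>. stake (Suc n) \<omega> = l} \<in> sets coins" using cylinder_in_coins[of "Suc n" "{l}"] by simp
  have "emeasure coins {\<omega>. stake (Suc n) \<omega> = l} =
     (\<integral>\<^sup>+x. emeasure coins {\<omega> \<in> space coins. x ## \<omega> \<in> {\<omega>. stake (Suc n) \<omega> = l}} \<partial>measure_pmf (pmf_of_set UNIV))"
    using sets unfolding coins_def by (rule prob_space.emeasure_stream_space[OF prob_space_measure_pmf])
  also have "\<dots> = (\<integral>\<^sup>+x. ennreal (of_bool (x = b) * (1 / 2 ^ n)) \<partial>measure_pmf (pmf_of_set UNIV))"
    using Suc.IH[OF l(2)] by (intro nn_integral_cong) (auto simp: l space_coins coins.emeasure_eq_measure)
  also have "\<dots> = ennreal (1 / 2 ^ Suc n)"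
    by (subst nn_integral_pmf_of_set) (auto simp: UNIV_bool divide_ennreal mult.commute simp flip: ennreal_numeral)
  finally show ?case by (simp add: coins.emeasure_eq_measure)
qed

lemma measure_coins_stake:
  assumes "A \<subseteq> {l. length l = n}"
  shows "measure coins {\<omega>. stake n \<omega> \<in> A} = real (card A) / 2 ^ n"
proof -
  have fin: "finite A" using assms card_bool_lists(2) finite_subset by blast
  have "{\<omega>. stake n \<omega> \<in> A} = (\<Union>l\<in>A. {\<omega>. stake n \<omega> = l})" by auto
  also have "measure coins \<dots> = (\<Sum>l\<in>A. measure coins {\<omega>. stake n \<omega> = l})"
    using cylinder_in_coins[of n "{l}" for l] fin
    by (intro coins.finite_measure_finite_Union) (auto simp: disjoint_family_on_def)
  also have "\<dots> = (\<Sum>l\<in>A. 1 / 2 ^ n)"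
    using assms by (intro sum.cong refl measure_coins_single) auto
  finally show ?thesis by simp
qed

section \<open>Random search forests\<close>

locale point_set =
  fixes E :: subroutines and M :: "bits set" and dM :: "bits \<Rightarrow> bits \<Rightarrow> real"
    and d :: nat and D \<epsilon> \<Delta> r :: real and P :: "bits set"
  assumes metric: "Metric_space M dM"
    and P_M: "P \<subseteq> M" and P_fin: "finite P"
    and diam: "\<And>x y. x \<in> P \<Longrightarrow> y \<in> P \<Longrightarrow> dM x y \<le> \<Delta>"
    and distortion: "\<And>zs. distinct zs \<Longrightarrow> set zs \<subseteq> P \<Longrightarrow>
      has_avg_distortion 1 D M dM (ell1 d) ell1_dist (set zs) (apply_fun E (embed_fun E zs))"
    and d_pos: "0 < d" and eps: "0 < \<epsilon>" "\<epsilon> \<le> 1" and r_pos: "0 < r" and r_le: "r \<le> \<Delta>"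
begin

text \<open>In a set without dense ball the average distance is at least
  \<open>R / 2 = 8 * D * r / \<epsilon>\<close>. The embedding costs a factor \<open>D\<close> and
  the passage to a star a factor 2, which leaves \<open>4 * r / \<epsilon>\<close>. The potential
  requires \<open>2 * r / \<epsilon>\<close>; the remaining factor 2 absorbs the rounding to the
  grid.\<close>

definition R :: real where "R = 16 * D * r / \<epsilon>"

text \<open>A lower bound for the expected fraction of points that a cut splits off: the total width
  is at most \<open>d\<close> times the Lipschitz norm times \<Delta>. The 2 in the denominator
  secures \<open>\<tau> \<le> 1 / 2\<close>, as needed by \<open>pot_half\<close>.\<close>

definition \<tau> :: real where "\<tau> = r / (2 * real d * \<Delta>)"

definition coord :: "bits \<Rightarrow> bits \<Rightarrow> nat \<Rightarrow> real" where
  "coord e x i = apply_fun E e x ! i"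

definition lowest :: "bits \<Rightarrow> bits set \<Rightarrow> nat \<Rightarrow> real" where
  "lowest e Q i = Min ((\<lambda>x. coord e x i) ` Q)"

definition width :: "bits \<Rightarrow> bits set \<Rightarrow> nat \<Rightarrow> real" where
  "width e Q i = Max ((\<lambda>x. coord e x i) ` Q) - Min ((\<lambda>x. coord e x i) ` Q)"

definition tot_width :: "bits \<Rightarrow> bits set \<Rightarrow> real" where
  "tot_width e Q = (\<Sum>i<d. width e Q i)"

definition dense :: "bits set \<Rightarrow> bits \<Rightarrow> bool" where
  "dense Q c \<longleftrightarrow> c \<in> Q \<and> card Q \<le> 2 * card {y \<in> Q. dM c y \<le> R}"

lemma Delta_pos: "0 < \<Delta>"
  using r_pos r_le by linarith

lemma D_pos: "0 < D"
  using distortion[of "[]"] by (simp add: has_avg_distortion_def)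

lemma R_pos: "0 < R"
  using D_pos r_pos eps by (simp add: R_def)

lemma tau_bounds: "0 < \<tau>" "\<tau> \<le> 1 / 2"
proof -
  show "0 < \<tau>" using r_pos d_pos Delta_pos by (simp add: \<tau>_def)
  have "r * 1 \<le> \<Delta> * real d" using r_le r_pos d_pos by (intro mult_mono) auto
  then show "\<tau> \<le> 1 / 2" using d_pos Delta_pos by (simp add: \<tau>_def field_simps)
qed

lemma coord_bounds:
  assumes "finite Q" "x \<in> Q"
  shows "lowest e Q i \<le> coord e x i" "coord e x i \<le> lowest e Q i + width e Q i"
  using assms by (auto simp: lowest_def width_def)

lemma width_nonneg: "finite Q \<Longrightarrow> Q \<noteq> {} \<Longrightarrow> 0 \<le> width e Q i"
  using coord_bounds[of Q _ e i] by fastforce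

context
  fixes zs :: "bits list" and Q :: "bits set" and e :: bits
  assumes zs: "distinct zs" "set zs \<subseteq> P" and Q: "Q = set zs" and e: "e = embed_fun E zs"
begin

abbreviation (input) "Lip \<equiv> lip_norm M dM ell1_dist (apply_fun E e)"

lemma Q_facts: "finite Q" "Q \<subseteq> P" "Q \<subseteq> M"
  using zs Q P_M by auto

lemma code_length: "x \<in> M \<Longrightarrow> length (apply_fun E e x) = d"
  using distortion[OF zs] by (auto simp: has_avg_distortion_def ell1_def e Pi_iff)

lemma ell1_coord:
  assumes "x \<in> M" "y \<in> M"
  shows "ell1_dist (apply_fun E e x) (apply_fun E e y) = (\<Sum>i<d. \<bar>coord e x i - coord e y i\<bar>)"
  using assms by (simp add: ell1_dist_def code_length coord_def)

text \<open>The supremum in \<open>lip_norm\<close> is an upper bound of the dilations only because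
  \<open>has_avg_distortion\<close> requires them to be bounded above.\<close>

lemma Lip_bound:
  assumes "x \<in> M" "y \<in> M"
  shows "(\<Sum>i<d. \<bar>coord e x i - coord e y i\<bar>) \<le> Lip * dM x y"
proof (cases "x = y")
  case True
  then show ?thesis using Metric_space.mdist_zero[OF metric, of y] assms by simp
next
  case False
  interpret Metric_space M dM by (rule metric)
  have pos: "0 < dM x y" using False assms by simp
  have "bdd_above (insert 0 (dilations M dM ell1_dist (apply_fun E e)))"
    using distortion[OF zs] by (simp add: has_avg_distortion_def e)
  moreover have "ell1_dist (apply_fun E e x) (apply_fun E e y) / dM x y
      \<in> insert 0 (dilations M dM ell1_dist (apply_fun E e))"
    using assms False by (auto simp: dilations_def)
  ultimately have "ell1_dist (apply_fun E e x) (apply_fun E e y) / dM x y \<le> Lip"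
    unfolding lip_norm_def by (intro cSup_upper)
  then show ?thesis using pos by (simp add: ell1_coord[OF assms] pos_divide_le_eq)
qed

context
  assumes sparse: "\<And>c. \<not> dense Q c" and Q_ne: "Q \<noteq> {}"
begin

text \<open>The only point of a singleton would be a dense centre. Two points are what
  \<open>has_avg_distortion\<close> asks for before it provides a positive Lipschitz norm.\<close>

lemma card_Q_ge_2: "2 \<le> card Q"
proof -
  interpret Metric_space M dM by (rule metric)
  obtain c where c: "c \<in> Q" using Q_ne by blast
  then have "c \<in> {y \<in> Q. dM c y \<le> R}" using R_pos Q_facts by auto
  then have "0 < card {y \<in> Q. dM c y \<le> R}" using Q_facts by (auto simp: card_gt_0_iff)
  then show ?thesis using sparse[of c] c by (simp add: dense_def)
qed

lemma Lip_pos: "0 < Lip"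
  using distortion[OF zs] card_Q_ge_2 by (simp add: has_avg_distortion_def e Q)

text \<open>Sparsity forces many large distances, the distortion carries their sum over to the
  image, and \<open>sum_dist_le_twice_star\<close> concentrates it at \<open>x\<close>. The factor 4
  is 16 halved twice.\<close>

lemma star_sum:
  assumes "x \<in> M"
  shows "4 * real (card Q) * (Lip * r) / \<epsilon> \<le> (\<Sum>y\<in>Q. \<Sum>i<d. \<bar>coord e x i - coord e y i\<bar>)"
proof -
  interpret Metric_space M dM by (rule metric)
  let ?c = "real (card Q)" and ?\<rho> = "\<lambda>x y. \<Sum>i<d. \<bar>coord e x i - coord e y i\<bar>"
  have c: "0 < ?c" using card_Q_ge_2 by simp
  \<comment> \<open>The ball around \<open>x\<close> contains less than half of \<open>Q\<close>,
    and every point outside contributes more than \<open>R\<close>.\<close>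
  have "?c / 2 * R \<le> (\<Sum>y\<in>Q. dM x y)" if x: "x \<in> Q" for x
  proof -
    have "card Q = card {y \<in> Q. dM x y \<le> R} + card {y \<in> Q. \<not> dM x y \<le> R}"
      using Q_facts by (subst card_Un_disjoint[symmetric]) (auto intro: arg_cong[where f = card])
    then have "?c / 2 \<le> real (card {y \<in> Q. \<not> dM x y \<le> R})"
      using sparse[of x] x by (simp add: dense_def)
    then have "?c / 2 * R \<le> real (card {y \<in> Q. \<not> dM x y \<le> R}) * R" using R_pos by (intro mult_right_mono) auto
    also have "\<dots> = (\<Sum>y | y \<in> Q \<and> \<not> dM x y \<le> R. R)" by simp
    also have "\<dots> \<le> (\<Sum>y | y \<in> Q \<and> \<not> dM x y \<le> R. dM x y)" by (intro sum_mono) auto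
    also have "\<dots> \<le> (\<Sum>y\<in>Q. dM x y)" using Q_facts by (intro sum_mono2) auto
    finally show ?thesis .
  qed
  then have "(\<Sum>x\<in>Q. ?c / 2 * R) \<le> (\<Sum>x\<in>Q. \<Sum>y\<in>Q. dM x y)" by (rule sum_mono)
  then have "Lip / D * (?c * (?c / 2 * R)) \<le> Lip / D * (\<Sum>x\<in>Q. \<Sum>y\<in>Q. dM x y)"
    using Lip_pos D_pos by (intro mult_left_mono) auto
  also have "\<dots> = Lip powr 1 / D powr 1 * (\<Sum>x\<in>Q. \<Sum>y\<in>Q. dM x y powr 1)"
    using Lip_pos D_pos by simp
  also have "\<dots> \<le> (\<Sum>x\<in>Q. \<Sum>y\<in>Q. ell1_dist (apply_fun E e x) (apply_fun E e y) powr 1)"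
    using distortion[OF zs] unfolding has_avg_distortion_def e Q by blast
  also have "\<dots> = (\<Sum>x\<in>Q. \<Sum>y\<in>Q. ?\<rho> x y)"
    using Q_facts by (intro sum.cong refl) (auto simp: ell1_coord subset_iff sum_nonneg)
  also have "\<dots> \<le> 2 * ?c * (\<Sum>y\<in>Q. ?\<rho> x y)"
    using Q_facts by (intro sum_dist_le_twice_star) (auto simp: sum.distrib[symmetric] intro!: sum_mono)
  finally have "?c * (Lip / D * (?c / 2 * R)) \<le> ?c * (2 * (\<Sum>y\<in>Q. ?\<rho> x y))"
    by (simp only: mult_ac)
  then have "Lip / D * (?c / 2 * R) \<le> 2 * (\<Sum>y\<in>Q. ?\<rho> x y)"
    using c by (simp only: mult_le_cancel_left_pos)
  moreover have "Lip / D * (?c / 2 * R) = 8 * ?c * (Lip * r) / \<epsilon>"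
  proof -
    have "Lip / D * (?c / 2 * (16 * D * r / \<epsilon>)) = (D / D) * (8 * ?c * (Lip * r) / \<epsilon>)" by simp
    then show ?thesis using D_pos by (simp add: R_def)
  qed
  ultimately show ?thesis by simp
qed

lemma coord_diff_le_width: "x \<in> Q \<Longrightarrow> y \<in> Q \<Longrightarrow> \<bar>coord e x i - coord e y i\<bar> \<le> width e Q i"
  using coord_bounds[of Q x e i] coord_bounds[of Q y e i] Q_facts by auto

lemma tot_width_pos: "0 < tot_width e Q"
proof -
  obtain x where x: "x \<in> Q" using Q_ne by blast
  have "0 < 4 * real (card Q) * (Lip * r) / \<epsilon>"
    using card_Q_ge_2 Lip_pos r_pos eps by simp
  also have "\<dots> \<le> (\<Sum>y\<in>Q. \<Sum>i<d. \<bar>coord e x i - coord e y i\<bar>)"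
    using x Q_facts by (intro star_sum) auto
  also have "\<dots> \<le> (\<Sum>y\<in>Q. tot_width e Q)"
    unfolding tot_width_def using x by (intro sum_mono coord_diff_le_width) auto
  finally show ?thesis using card_Q_ge_2 by (simp add: zero_less_mult_iff)
qed

lemma tot_width_le: "tot_width e Q \<le> real d * (Lip * \<Delta>)"
proof -
  have "width e Q i \<le> Lip * \<Delta>" if i: "i < d" for i
  proof -
    have fin: "finite ((\<lambda>x. coord e x i) ` Q)" "(\<lambda>x. coord e x i) ` Q \<noteq> {}" using Q_facts Q_ne by auto
    obtain x where x: "x \<in> Q" "Max ((\<lambda>x. coord e x i) ` Q) = coord e x i" using Max_in[OF fin] by (rule imageE)
    obtain y where y: "y \<in> Q" "Min ((\<lambda>x. coord e x i) ` Q) = coord e y i" using Min_in[OF fin] by (rule imageE)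
    have xy: "x \<in> Q" "y \<in> Q" "width e Q i = coord e x i - coord e y i"
      using x y by (simp_all add: width_def)
    have "width e Q i \<le> \<bar>coord e x i - coord e y i\<bar>" using xy by simp
    also have "\<dots> \<le> (\<Sum>i<d. \<bar>coord e x i - coord e y i\<bar>)" using i by (intro member_le_sum) auto
    also have "\<dots> \<le> Lip * dM x y" using xy Q_facts by (intro Lip_bound) auto
    also have "\<dots> \<le> Lip * \<Delta>" using Lip_pos diam xy Q_facts by (intro mult_left_mono) auto
    finally show ?thesis .
  qed
  then have "(\<Sum>i<d. width e Q i) \<le> (\<Sum>i<d. Lip * \<Delta>)" by (intro sum_mono) auto
  then show ?thesis by (simp add: tot_width_def)
qed

text \<open>Instance of \<open>pot_cut\<close> with the coin lists as cuts. The condition on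
  \<open>B\<close> makes the grid so fine that rounding errors are at most half of \<open>X\<close>,
  the number of grid positions that correspond to a distance \<open>Lip * r\<close>.\<close>

lemma cut_potential:
  fixes i :: "bool list \<Rightarrow> nat" and t :: "bool list \<Rightarrow> real"
  assumes B: "2 * real d * real d * \<Delta> \<le> r * 2 ^ B"
    and cut: "\<And>l. length l = B \<Longrightarrow>
      cut_at d (lowest e Q) (width e Q) (real (unum l) / 2 ^ B * tot_width e Q) (i l) (t l)"
    and q: "q \<in> M" and z: "z \<in> M" "dM z q \<le> r"
  shows "2 ^ B * pot \<epsilon> \<tau> z (Suc k) Q \<le>
    (\<Sum>l | length l = B. pot \<epsilon> \<tau> z k {y \<in> Q. (coord e y (i l) \<le> t l) = (coord e q (i l) \<le> t l)})"
proof -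
  define G :: nat where "G = 2 ^ B"
  define W where "W = tot_width e Q"
  have W: "0 < W" using tot_width_pos by (simp add: W_def)
  \<comment> \<open>The coin list whose binary value is \<open>k\<close>. It translates the counts
    over lists into the counts over grid indices of \<open>separated\<close>.\<close>
  define J where "J k = inv_into {l. length l = B} unum k" for k
  have J: "length (J k) = B" "unum (J k) = k" if "k < G" for k
    using that bij_betw_unum[of B] inv_into_into[of k unum "{l. length l = B}"]
      f_inv_into_f[of k unum "{l. length l = B}"] by (auto simp: J_def G_def bij_betw_def)
  have Junum: "J (unum l) = l" if "length l = B" for l
    using that bij_betw_unum[of B] by (simp add: J_def bij_betw_def inv_into_f_f)
  have cut': "cut_at d (lowest e Q) (width e Q) (real k / real G * W) (i (J k)) (t (J k))" if "k < G" for k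
    using cut[OF J(1)[OF that]] J(2)[OF that] by (simp add: G_def W_def)
  have wn: "\<And>i. i < d \<Longrightarrow> 0 \<le> width e Q i" using width_nonneg Q_facts Q_ne by blast
  have Weq: "W = (\<Sum>i<d. width e Q i)" by (simp add: W_def tot_width_def)
  have G: "0 < G" by (simp add: G_def)
  define sep where "sep x y = card {l. length l = B \<and> (coord e x (i l) \<le> t l) \<noteq> (coord e y (i l) \<le> t l)}" for x y
  have sep_eq: "sep x y = card (separated G (\<lambda>k. i (J k)) (\<lambda>k. t (J k)) (coord e x) (coord e y))" for x y
  proof -
    have "sep x y = card {l. length l = B \<and> (coord e x (i (J (unum l))) \<le> t (J (unum l))) \<noteq>
        (coord e y (i (J (unum l))) \<le> t (J (unum l)))}"
      unfolding sep_def by (intro arg_cong[where f = card] Collect_cong) (auto simp: Junum)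
    also have "\<dots> = card {k. k < 2 ^ B \<and> (coord e x (i (J k)) \<le> t (J k)) \<noteq> (coord e y (i (J k)) \<le> t (J k))}"
      by (rule card_unum)
    finally show ?thesis
      by (simp add: separated_def G_def)
  qed
  have sep_le: "real (sep x y) \<le> real G / W * (\<Sum>i<d. \<bar>coord e x i - coord e y i\<bar>) + real d" for x y
    unfolding sep_eq by (rule card_separated_le[OF wn Weq W G cut'])
  have sep_ge: "real G / W * (\<Sum>i<d. \<bar>coord e x i - coord e y i\<bar>) - real d \<le> real (sep x y)" if "x \<in> Q" "y \<in> Q" for x y
    unfolding sep_eq using that coord_bounds Q_facts by (intro card_separated_ge[OF wn Weq W G cut']) auto
  show ?thesis
  proof (cases "z \<in> Q")
    case False
    then show ?thesis by (simp add: pot_def sum_nonneg)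
  next
    case zQ: True
    let ?c = "real (card Q)"
    have c: "0 < ?c" using card_Q_ge_2 by simp
    define X where "X = real G / W * (Lip * r)"
    have X1: "real G * (r / (real d * \<Delta>)) \<le> X"
    proof -
      have "r / (real d * \<Delta>) = (Lip * r) / (Lip * (real d * \<Delta>))" using Lip_pos by (subst mult_divide_mult_cancel_left) auto
      also have "\<dots> = Lip * r / (real d * (Lip * \<Delta>))" by (simp add: mult_ac)
      also have "\<dots> \<le> Lip * r / W"
        using tot_width_le W Lip_pos r_pos unfolding W_def by (intro divide_left_mono) auto
      finally have "real G * (r / (real d * \<Delta>)) \<le> real G * (Lip * r / W)" by (intro mult_left_mono) auto
      then show ?thesis by (simp add: X_def)
    qed
    have "2 * real d \<le> real G * (r / (real d * \<Delta>))"
    proof -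
      have "0 < real d * \<Delta>" using d_pos Delta_pos by simp
      then have "2 * real d \<le> r * real G / (real d * \<Delta>)"
        using B by (subst pos_le_divide_eq) (auto simp: G_def mult_ac)
      then show ?thesis by (simp add: mult.commute)
    qed
    \<comment> \<open>This is the point of the resolution \<open>B\<close>. The gain inequality
      amounts to \<open>2 * (X + d) \<le> 4 * X - d\<close>, that is,
      \<open>3 * d \<le> 2 * X\<close>.\<close>
    then have X2: "2 * real d \<le> X" using X1 by simp
    have S1: "real (sep q z) \<le> X + real d"
    proof -
      have "(\<Sum>i<d. \<bar>coord e q i - coord e z i\<bar>) \<le> Lip * dM q z" using Lip_bound[OF q z(1)] .
      also have "\<dots> \<le> Lip * r" using Lip_pos z(2) Metric_space.commute[OF metric, of q z] by (intro mult_left_mono) auto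
      finally have "real G / W * (\<Sum>i<d. \<bar>coord e q i - coord e z i\<bar>) \<le> X"
        unfolding X_def using W by (intro mult_left_mono) auto
      then show ?thesis using sep_le[of q z] by linarith
    qed
    have S2: "4 * ?c * X / \<epsilon> - ?c * real d \<le> (\<Sum>y\<in>Q. real (sep z y))"
    proof -
      have "4 * ?c * X / \<epsilon> = real G / W * (4 * ?c * (Lip * r) / \<epsilon>)" by (simp add: X_def)
      also have "\<dots> \<le> real G / W * (\<Sum>y\<in>Q. \<Sum>i<d. \<bar>coord e z i - coord e y i\<bar>)"
        using star_sum[OF z(1)] W by (intro mult_left_mono) auto
      finally have "4 * ?c * X / \<epsilon> - ?c * real d \<le> (\<Sum>y\<in>Q. real G / W * (\<Sum>i<d. \<bar>coord e z i - coord e y i\<bar>) - real d)"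
        by (simp add: sum_subtractf sum_distrib_left)
      also have "\<dots> \<le> (\<Sum>y\<in>Q. real (sep z y))" using zQ by (intro sum_mono sep_ge)
      finally show ?thesis .
    qed
    have e1: "4 * ?c * X - \<epsilon> * (?c * real d) \<le> \<epsilon> * (\<Sum>y\<in>Q. real (sep z y))"
    proof -
      have "4 * ?c * X - \<epsilon> * (?c * real d) = \<epsilon> * (4 * ?c * X / \<epsilon> - ?c * real d)"
        using eps by (simp add: right_diff_distrib)
      also have "\<dots> \<le> \<epsilon> * (\<Sum>y\<in>Q. real (sep z y))" using S2 eps by (intro mult_left_mono) auto
      finally show ?thesis .
    qed
    have "\<epsilon> * (?c * real d) \<le> 1 * (?c * real d)" using eps by (intro mult_right_mono) auto
    moreover have "3 * real d * ?c \<le> 2 * X * ?c" using X2 c by (intro mult_right_mono) auto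
    moreover have "2 * ?c * real (sep q z) \<le> 2 * ?c * (X + real d)" using S1 by (intro mult_left_mono) auto
    ultimately have gain: "2 * ?c * real (sep q z) \<le> \<epsilon> * (\<Sum>y\<in>Q. real (sep z y))"
      using e1 by (simp add: algebra_simps)
    have shrink: "\<tau> * real G * ?c \<le> (\<Sum>y\<in>Q. real (sep z y))"
    proof -
      have "2 * (\<tau> * real G) = real G * (r / (real d * \<Delta>))" by (simp add: \<tau>_def)
      moreover have "0 \<le> \<tau> * real G" using tau_bounds by simp
      ultimately have "\<tau> * real G \<le> X" using X1 by linarith
      then have "\<tau> * real G * ?c \<le> X * ?c" by (intro mult_right_mono) auto
      also have "\<dots> \<le> 4 * ?c * X - ?c * real d"
        using mult_right_mono[OF X2, of ?c] X2 c by (simp add: algebra_simps)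
      also have "4 * ?c * X \<le> 4 * ?c * X / \<epsilon>"
      proof -
        have "0 \<le> 4 * ?c * X" using c X2 by simp
        then show ?thesis using eps by (simp only: pos_le_divide_eq) (rule mult_left_le; simp)
      qed
      finally show ?thesis using S2 by linarith
    qed
    have "real (card {l :: bool list. length l = B}) * pot \<epsilon> \<tau> z (Suc k) Q \<le>
       (\<Sum>l | length l = B. pot \<epsilon> \<tau> z k {y \<in> Q. (coord e y (i l) \<le> t l) = (coord e q (i l) \<le> t l)})"
      using gain shrink Q_facts card_bool_lists tau_bounds eps
      by (intro pot_cut) (auto simp: sep_def G_def)
    then show ?thesis by (simp add: card_bool_lists)
  qed
qed

end

end

text \<open>No map stretches a distance by more than its Lipschitz norm, so the average in the image
  cannot exceed that norm times the original average. The bound gives \<open>0 \<le> ln D\<close>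
  and absorbs the summand \<open>r\<close> in the approximation factor.\<close>

lemma D_ge_1:
  assumes "2 \<le> card P"
  shows "1 \<le> D"
proof -
  interpret Metric_space M dM by (rule metric)
  obtain zs where zs: "distinct zs" "set zs = P" using finite_distinct_list[OF P_fin] by blast
  define e where "e = embed_fun E zs"
  have zs': "set zs \<subseteq> P" using zs by simp
  define Lip where "Lip = lip_norm M dM ell1_dist (apply_fun E e)"
  define S where "S = (\<Sum>x\<in>P. \<Sum>y\<in>P. dM x y)"
  have h: "has_avg_distortion 1 D M dM (ell1 d) ell1_dist P (apply_fun E e)"
    using distortion[OF zs(1) zs'] zs(2) by (simp add: e_def)
  have Lip: "0 < Lip" using h assms by (simp add: has_avg_distortion_def Lip_def)
  have nn: "0 \<le> ell1_dist u v" for u v by (simp add: ell1_dist_def sum_nonneg)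
  have "Lip / D * S = Lip powr 1 / D powr 1 * (\<Sum>x\<in>P. \<Sum>y\<in>P. dM x y powr 1)"
    using Lip D_pos by (simp add: S_def)
  also have "\<dots> \<le> (\<Sum>x\<in>P. \<Sum>y\<in>P. ell1_dist (apply_fun E e x) (apply_fun E e y) powr 1)"
    using h unfolding has_avg_distortion_def Lip_def by blast
  also have "\<dots> = (\<Sum>x\<in>P. \<Sum>y\<in>P. ell1_dist (apply_fun E e x) (apply_fun E e y))" using nn by simp
  also have "\<dots> \<le> (\<Sum>x\<in>P. \<Sum>y\<in>P. Lip * dM x y)"
  proof (intro sum_mono)
    fix x y assume "x \<in> P" "y \<in> P"
    then have xy: "x \<in> M" "y \<in> M" using P_M by auto
    show "ell1_dist (apply_fun E e x) (apply_fun E e y) \<le> Lip * dM x y"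
      using Lip_bound[OF zs(1) zs' refl e_def xy] ell1_coord[OF zs(1) zs' refl e_def xy] by (simp add: Lip_def)
  qed
  also have "\<dots> = Lip * S" by (simp add: S_def sum_distrib_left)
  finally have le: "Lip / D * S \<le> Lip * S" .
  have "0 < S"
  proof -
    obtain x y where xy: "x \<in> P" "y \<in> P" "x \<noteq> y"
      using assms by (metis One_nat_def card_le_Suc0_iff_eq P_fin not_less_eq_eq numeral_2_eq_2)
    then have "0 < dM x y" using P_M mdist_pos_less[of x y] by blast
    also have "\<dots> \<le> (\<Sum>y\<in>P. dM x y)" using xy P_fin by (intro member_le_sum) auto
    also have "\<dots> \<le> S" unfolding S_def using xy P_fin by (intro member_le_sum[of x P "\<lambda>x. \<Sum>y\<in>P. dM x y"]) (auto intro: sum_nonneg)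
    finally show ?thesis .
  qed
  then have "Lip / D \<le> Lip" using le by (simp only: mult_le_cancel_right_pos)
  then have "Lip * 1 \<le> Lip * D" using D_pos by (simp add: pos_divide_le_eq)
  then show ?thesis using Lip by (simp only: mult_le_cancel_left_pos)
qed

end

text \<open>\<open>Ball c i\<close> answers \<open>c\<close> or continues at node \<open>i\<close>; \<open>Cut e a t i\<close> compares coordinate \<open>a\<close>
  of the embedding \<open>e\<close> with \<open>t\<close> and continues at \<open>i\<close> (above) or \<open>Suc i\<close> (below); \<open>Pend Q\<close> is
  not processed yet.\<close>

datatype node = Ball bits nat | Cut bits nat real nat | Pend "bits set"

fun children :: "node \<Rightarrow> nat set" where
  "children (Ball c i) = {i}"
| "children (Cut e a t i) = {i, Suc i}"
| "children (Pend Q) = {}"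

definition (in point_set) grows ::
    "nat \<Rightarrow> nat \<Rightarrow> nat \<Rightarrow> bits list \<Rightarrow> bool list \<Rightarrow> (nat \<Rightarrow> node) \<Rightarrow> bool" where
  "grows B cnt j zs l A' \<longleftrightarrow>
    (if \<exists>c. dense (set zs) c
     then \<exists>c i. dense (set zs) c \<and> A' j = Ball c i \<and>
       ({y \<in> set zs. \<not> dM c y \<le> R} = {} \<or> A' i = Pend {y \<in> set zs. \<not> dM c y \<le> R})
     else \<exists>a t. let e = embed_fun E zs in
       cut_at d (lowest e (set zs)) (width e (set zs)) (real (unum l) / 2 ^ B * tot_width e (set zs)) a t \<and>
       A' j = Cut e a t cnt \<and> A' cnt = Pend {y \<in> set zs. \<not> coord e y a \<le> t} \<and>
       A' (Suc cnt) = Pend {y \<in> set zs. coord e y a \<le> t})"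

section \<open>The value of a query in a partly built forest\<close>

locale near_query = point_set +
  fixes q z :: bits
  assumes q_M: "q \<in> M" and z_P: "z \<in> P" and z_q: "dM z q \<le> r"
begin

text \<open>The search for \<open>q\<close> is followed through the processed nodes; at a pending
  node the potential stands in for the randomness still to come. A pending node does not use up a
  level by itself. The value 0 without levels agrees with \<open>pot_0\<close>, which gives
  \<open>val_Pend\<close> for all \<open>k\<close>.\<close>

primrec val :: "nat \<Rightarrow> (nat \<Rightarrow> node) \<Rightarrow> nat \<Rightarrow> real" where
  "val 0 A i = 0"
| "val (Suc k) A i = (case A i of
     Ball c j \<Rightarrow> if dM c q \<le> R + r then 1 else val k A j
   | Cut e a t j \<Rightarrow> val k A (if coord e q a \<le> t then Suc j else j)
   | Pend Q \<Rightarrow> pot \<epsilon> \<tau> z (Suc k) Q)"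

lemma val_Pend: "A i = Pend Q \<Longrightarrow> finite Q \<Longrightarrow> val k A i = pot \<epsilon> \<tau> z k Q"
  using eps by (cases k) (simp_all add: pot_0)

lemma val_bounds:
  assumes "\<And>i Q. A i = Pend Q \<Longrightarrow> finite Q"
  shows "0 \<le> val k A i \<and> val k A i \<le> 1"
proof (induction k arbitrary: i)
  case (Suc k)
  have "\<tau> \<le> 1" using tau_bounds by simp
  then show ?case using Suc assms[of i] pot_nonneg pot_le_1[OF _ eps(1)] by (auto split: node.split)
qed simp

text \<open>A search started in a set of nodes closed under children never leaves it. With a tree as
  this set, changes in other trees leave its value alone.\<close>

lemma val_cong:
  assumes "\<And>i. i \<in> S \<Longrightarrow> A' i = A i" "\<And>i. i \<in> S \<Longrightarrow> children (A i) \<subseteq> S"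
  shows "i \<in> S \<Longrightarrow> val k A' i = val k A i"
proof (induction k arbitrary: i)
  case (Suc k)
  then show ?case using assms(1)[of i] assms(2)[of i] by (cases "A i") auto
qed simp

text \<open>A query within \<open>R + r\<close> of the centre is answered, which has value 1.
  Otherwise the triangle inequality puts \<open>z\<close> at distance more than \<open>R\<close>
  from the centre, so \<open>z\<close> survives in the far set, which has at most half of the
  points.\<close>

lemma val_ball:
  assumes "dense Q c" "Q \<subseteq> P" "A' j = Ball c i"
    and "{y \<in> Q. \<not> dM c y \<le> R} = {} \<or> A' i = Pend {y \<in> Q. \<not> dM c y \<le> R}"
    and A': "\<And>i Q. A' i = Pend Q \<Longrightarrow> finite Q"
  shows "pot \<epsilon> \<tau> z k Q \<le> val k A' j"
proof (cases k)
  case 0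
  have "finite Q" using assms(2) P_fin finite_subset by blast
  then show ?thesis using 0 eps by (simp add: pot_0)
next
  case (Suc k')
  interpret Metric_space M dM by (rule metric)
  have fin: "finite Q" using assms(2) P_fin finite_subset by blast
  show ?thesis
  proof (cases "dM c q \<le> R + r")
    case True
    then show ?thesis using Suc assms(3) pot_le_1[OF fin eps(1), of \<tau>] tau_bounds by simp
  next
    case far: False
    show ?thesis
    proof (cases "z \<in> Q")
      case False
      then show ?thesis using val_bounds[OF A'] by (simp add: pot_def)
    next
      case True
      have "c \<in> M" "z \<in> M" using assms(1,2) P_M z_P by (auto simp: dense_def)
      then have "dM c q \<le> dM c z + dM z q" using q_M by (intro triangle) auto
      then have z: "z \<in> {y \<in> Q. \<not> dM c y \<le> R}" using far z_q True by auto
      then have Ai: "A' i = Pend {y \<in> Q. \<not> dM c y \<le> R}" using assms(4) by blast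
      have "card Q = card {y \<in> Q. dM c y \<le> R} + card {y \<in> Q. \<not> dM c y \<le> R}"
        using fin by (subst card_Un_disjoint[symmetric]) (auto intro: arg_cong[where f = card])
      then have half: "2 * card {y \<in> Q. \<not> dM c y \<le> R} \<le> card Q" using assms(1) by (simp add: dense_def)
      have "pot \<epsilon> \<tau> z k Q \<le> pot \<epsilon> \<tau> z k' {y \<in> Q. \<not> dM c y \<le> R}"
        unfolding Suc using fin z half eps tau_bounds by (intro pot_half) auto
      also have "\<dots> = val k' A' i" using val_Pend[where A = A' and i = i, OF Ai] fin by simp
      also have "\<dots> = val k A' j" using far assms(3) Suc by simp
      finally show ?thesis .
    qed
  qed
qed

lemma val_grows:
  assumes B: "2 * real d * real d * \<Delta> \<le> r * 2 ^ B"
    and zs: "distinct zs" "set zs \<subseteq> P" "zs \<noteq> []"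
    and gr: "\<And>l. length l = B \<Longrightarrow> grows B cnt j zs l (A' l)"
    and A': "\<And>l i Q. length l = B \<Longrightarrow> A' l i = Pend Q \<Longrightarrow> finite Q"
  shows "2 ^ B * pot \<epsilon> \<tau> z k (set zs) \<le> (\<Sum>l | length l = B. val k (A' l) j)"
proof (cases "\<exists>c. dense (set zs) c")
  case True
  have "pot \<epsilon> \<tau> z k (set zs) \<le> val k (A' l) j" if l: "length l = B" for l
  proof -
    from gr[OF l] True obtain c i where "dense (set zs) c" "A' l j = Ball c i"
       "{y \<in> set zs. \<not> dM c y \<le> R} = {} \<or> A' l i = Pend {y \<in> set zs. \<not> dM c y \<le> R}"
      unfolding grows_def by auto
    from val_ball[OF this(1) zs(2) this(2,3) A'[OF l]] show ?thesis .
  qed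
  then have "(\<Sum>l :: bool list | length l = B. pot \<epsilon> \<tau> z k (set zs)) \<le> (\<Sum>l | length l = B. val k (A' l) j)"
    by (intro sum_mono) auto
  then show ?thesis by (simp add: card_bool_lists)
next
  case False
  define e where "e = embed_fun E zs"
  define \<Phi> where "\<Phi> l a t \<longleftrightarrow> cut_at d (lowest e (set zs)) (width e (set zs)) (real (unum l) / 2 ^ B * tot_width e (set zs)) a t \<and>
       A' l j = Cut e a t cnt \<and> A' l cnt = Pend {y \<in> set zs. \<not> coord e y a \<le> t} \<and>
       A' l (Suc cnt) = Pend {y \<in> set zs. coord e y a \<le> t}" for l a t
  have "\<exists>a t. \<Phi> l a t" if "length l = B" for l
    using gr[OF that] False unfolding grows_def Let_def e_def \<Phi>_def by simp
  then obtain a t where "\<And>l. length l = B \<Longrightarrow> \<Phi> l (a l) (t l)" by metis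
  then have at: "\<And>l. length l = B \<Longrightarrow> cut_at d (lowest e (set zs)) (width e (set zs)) (real (unum l) / 2 ^ B * tot_width e (set zs)) (a l) (t l)"
     "\<And>l. length l = B \<Longrightarrow> A' l j = Cut e (a l) (t l) cnt"
     "\<And>l. length l = B \<Longrightarrow> A' l cnt = Pend {y \<in> set zs. \<not> coord e y (a l) \<le> t l}"
     "\<And>l. length l = B \<Longrightarrow> A' l (Suc cnt) = Pend {y \<in> set zs. coord e y (a l) \<le> t l}"
    unfolding \<Phi>_def by blast+
  show ?thesis
  proof (cases k)
    case 0
    then show ?thesis using eps by (simp add: pot_0)
  next
    case (Suc k')
    have "2 ^ B * pot \<epsilon> \<tau> z (Suc k') (set zs) \<le>
        (\<Sum>l | length l = B. pot \<epsilon> \<tau> z k' {y \<in> set zs. (coord e y (a l) \<le> t l) = (coord e q (a l) \<le> t l)})"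
      using zs False z_P P_M q_M z_q at(1)
      by (intro cut_potential[OF zs(1,2) refl e_def _ _ B]) auto
    also have "\<dots> = (\<Sum>l | length l = B. val k (A' l) j)"
    proof (intro sum.cong refl)
      fix l :: "bool list" assume "l \<in> {l. length l = B}"
      then have l: "length l = B" by simp
      show "pot \<epsilon> \<tau> z k' {y \<in> set zs. (coord e y (a l) \<le> t l) = (coord e q (a l) \<le> t l)} = val k (A' l) j"
        using val_Pend[where A = "A' l" and i = cnt, OF at(3)[OF l]]
          val_Pend[where A = "A' l" and i = "Suc cnt", OF at(4)[OF l]] at(2)[OF l] by (simp add: Suc)
    qed
    finally show ?thesis by (simp add: Suc)
  qed
qed

text \<open>\<open>own\<close> names the tree of a node. Processing node \<open>j\<close> changes
  only the factor of its tree, whose value does not decrease on average, so the product of the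
  failure values does not increase on average. No independence between the trees is used.\<close>

lemma forest_step:
  assumes B: "2 * real d * real d * \<Delta> \<le> r * 2 ^ B"
    and zs: "distinct zs" "set zs \<subseteq> P" "zs \<noteq> []"
    and j: "j < cnt" "A j = Pend (set zs)"
    and gr: "\<And>l. length l = B \<Longrightarrow> grows B cnt j zs l (A' l)"
    and A': "\<And>l i Q. length l = B \<Longrightarrow> A' l i = Pend Q \<Longrightarrow> finite Q"
    and A: "\<And>i Q. A i = Pend Q \<Longrightarrow> finite Q"
    and same: "\<And>l i. length l = B \<Longrightarrow> i < cnt \<Longrightarrow> i \<noteq> j \<Longrightarrow> A' l i = A i"
    and closed: "\<And>i i'. i < cnt \<Longrightarrow> i' \<in> children (A i) \<Longrightarrow> i' < cnt \<and> own i' = own i"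
    and roots: "N \<le> cnt" "\<And>i. i < N \<Longrightarrow> own i = (i :: nat)"
  shows "(\<Sum>l | length l = B. \<Prod>i<N. 1 - val K (A' l) i) \<le> 2 ^ B * (\<Prod>i<N. 1 - val K A i)"
proof -
  \<comment> \<open>Induction on the levels: at \<open>j\<close> it is the gain of one processing
    step, and at every other node the search moves to a child that does not depend on the coins of
    this round.\<close>
  have main: "2 ^ B * val k A i \<le> (\<Sum>l | length l = B. val k (A' l) i)" if "i < cnt" for k i
    using that
  proof (induction k arbitrary: i)
    case (Suc k)
    show ?case
    proof (cases "i = j")
      case True
      then show ?thesis using val_grows[where k = "Suc k", OF B zs gr A'] j by simp
    next
      case False
      have IH: "2 ^ B * val k A i' \<le> (\<Sum>l | length l = B. val k (A' l) i')" if "i' \<in> children (A i)" for i'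
        using Suc closed[OF Suc.prems that] by blast
      have eq: "\<And>l. length l = B \<Longrightarrow> A' l i = A i" using same Suc.prems False by blast
      show ?thesis
      proof (cases "A i")
        case (Ball c i')
        then show ?thesis using IH[of i'] by (simp add: eq card_bool_lists)
      next
        case (Cut e a t i')
        then show ?thesis using IH[of i'] IH[of "Suc i'"] by (simp add: eq)
      next
        case (Pend Q)
        then show ?thesis by (simp add: eq card_bool_lists)
      qed
    qed
  qed simp
  define o' where "o' = own j"
  have other: "val K (A' l) i = val K A i" if l: "length l = B" and i: "i < cnt" "own i \<noteq> o'" for l i
    using i l closed same by (intro val_cong[where S = "{i. i < cnt \<and> own i \<noteq> o'}"]) (auto simp: o'_def)
  have nn: "0 \<le> 1 - val K A i" for i using val_bounds[where A = A and k = K and i = i] A by simp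
  show ?thesis
  proof (cases "o' < N")
    case False
    then have "(\<Sum>l | length l = B. \<Prod>i<N. 1 - val K (A' l) i) = (\<Sum>l :: bool list | length l = B. \<Prod>i<N. 1 - val K A i)"
      using roots by (intro sum.cong prod.cong refl) (subst other; auto)
    then show ?thesis by (simp add: card_bool_lists)
  next
    case True
    have split: "(\<Prod>i<N. f i) = f o' * (\<Prod>i\<in>{..<N} - {o'}. f i)" for f :: "nat \<Rightarrow> real"
      using True by (intro prod.remove) auto
    let ?C = "\<Prod>i\<in>{..<N} - {o'}. 1 - val K A i"
    have "(\<Sum>l | length l = B. \<Prod>i<N. 1 - val K (A' l) i) = (\<Sum>l | length l = B. (1 - val K (A' l) o') * ?C)"
      unfolding split using roots
      by (intro sum.cong arg_cong2[where f = "(*)"] prod.cong refl) (subst other; auto)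
    also have "\<dots> = (2 ^ B - (\<Sum>l | length l = B. val K (A' l) o')) * ?C"
      by (simp add: sum_distrib_right[symmetric] sum_subtractf card_bool_lists)
    also have "\<dots> \<le> (2 ^ B - 2 ^ B * val K A o') * ?C"
      using main[of o' K] True roots nn by (intro mult_right_mono prod_nonneg) auto
    also have "\<dots> = 2 ^ B * (\<Prod>i<N. 1 - val K A i)" unfolding split by (simp add: algebra_simps)
    finally show ?thesis .
  qed
qed

end

section \<open>The programs\<close>

abbreviation seq_com (infixr ";;" 60) where "c1 ;; c2 \<equiv> Seq c1 c2"
abbreviation "V k \<equiv> NMem (NLit k)"
abbreviation "X k \<equiv> RMem (NLit k)"
abbreviation "inc k \<equiv> NSet (NLit k) (NAdd (V k) (NLit 1))"

text \<open>Natural number cells: 0 \<open>n\<close>, 1 \<open>d\<close>, 2 number of trees, 3 number of nodes, 4 current node,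
  5 and 6 ends of its segment, 7 to 15 temporaries. Node \<open>i\<close> occupies the cells \<open>32 + 4 i + a\<close>,
  where \<open>a = 0, 1\<close> are the ends of its segment in the string memory, \<open>a = 2\<close> is 0 for a ball and
  one more than the coordinate for a cut, and \<open>a = 3\<close> is the first child. Real cells: 0 \<open>D\<close>,
  1 \<open>\<epsilon>\<close>, 2 \<open>\<Delta>\<close>, 3 \<open>r\<close>, 4 radius, 5 number of levels, 6 to 14 temporaries, from 16 on three arrays of
  length \<open>d\<close> (an image vector, lowest values, widths), then the thresholds of the nodes. String
  cells: 0 query, from 1 on the points of all trees, then the centers and embeddings of the nodes.\<close>

definition fld :: "nat \<Rightarrow> nexp \<Rightarrow> nexp" where
  "fld a e = NAdd (NLit (32 + a)) (NMul (NLit 4) e)"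

definition sad :: "nexp \<Rightarrow> nexp" where
  "sad e = NAdd (NAdd (NLit 1) (NMul (V 2) (V 0))) e"

definition tad :: "nexp \<Rightarrow> nexp" where
  "tad e = NAdd (NAdd (NLit 16) (NMul (NLit 3) (V 1))) e"

definition lowad :: "nexp \<Rightarrow> nexp" where
  "lowad e = NAdd (NAdd (NLit 16) (V 1)) e"

definition widad :: "nexp \<Rightarrow> nexp" where
  "widad e = NAdd (NAdd (NLit 16) (NMul (NLit 2) (V 1))) e"

definition fa :: "nat \<Rightarrow> nat \<Rightarrow> nat" where
  "fa a i = 32 + 4 * i + a"

lemma fa_eq: "a < 4 \<Longrightarrow> b < 4 \<Longrightarrow> fa a i = fa b k \<longleftrightarrow> a = b \<and> i = k"
  unfolding fa_def by presburger

lemma fa_ge: "32 \<le> fa a i"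
  by (simp add: fa_def)

lemma fa_neq: "k < 32 \<Longrightarrow> fa a i \<noteq> k" "k < 32 \<Longrightarrow> k \<noteq> fa a i"
  using fa_ge[of a i] by auto

lemma nval_reals [simp]: "nval e (s\<lparr>reals := f\<rparr>) = nval e s"
  by (induction e) auto

lemma nval_fld [simp]: "nval (fld a e) s = fa a (nval e s)"
  by (simp add: fld_def fa_def)

lemma nval_sad [simp]: "nval (sad e) s = Suc (nats s 2 * nats s 0 + nval e s)"
  by (simp add: sad_def)

lemma nval_tad [simp]: "nval (tad e) s = 16 + 3 * nats s 1 + nval e s"
  by (simp add: tad_def)

lemma nval_lowad [simp]: "nval (lowad e) s = 16 + nats s 1 + nval e s"
  by (simp add: lowad_def)

lemma nval_widad [simp]: "nval (widad e) s = 16 + 2 * nats s 1 + nval e s"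
  by (simp add: widad_def)

lemma nsz_ad [simp]: "nsz (fld a e) = nsz e + 4" "nsz (sad e) = nsz e + 8" "nsz (tad e) = nsz e + 7"
  "nsz (lowad e) = nsz e + 5" "nsz (widad e) = nsz e + 7"
  by (simp_all add: fld_def sad_def tad_def lowad_def widad_def)

lemma nok_ad [simp]: "nok (fld a e) \<longleftrightarrow> a < 96 \<and> nok e" "nok (sad e) \<longleftrightarrow> nok e" "nok (tad e) \<longleftrightarrow> nok e"
  "nok (lowad e) \<longleftrightarrow> nok e" "nok (widad e) \<longleftrightarrow> nok e"
  by (auto simp: fld_def sad_def tad_def lowad_def widad_def)

text \<open>Balls and cuts both compare a real number with a threshold, so one routine serves
  partition and search. The image vector starts at cell 16 and field 2 holds the coordinate plus
  one, hence the base 15.\<close>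

definition val_prog :: "nexp \<Rightarrow> nexp \<Rightarrow> com" where
  "val_prog node pt =
    Cond (NLess (NLit 0) (NMem (fld 2 node)))
      (CallApply (NLit 16) (sad node) pt ;;
       RSet (NLit 8) (RMem (NAdd (NLit 15) (NMem (fld 2 node)))))
      (CallDist (NLit 8) (sad node) pt)"

definition count_prog :: com where
  "count_prog =
    While (NLess (V 8) (V 6))
      (CallDist (NLit 8) (V 7) (V 8) ;;
       Cond (RLess (X 4) (X 8)) Skip (inc 9) ;;
       inc 8)"

text \<open>Cell 10 holds the string address of a dense centre. The value 0 can signal that there is
  none, because the points of a segment start at address 1.\<close>

definition dense_prog :: com where
  "dense_prog =
    NSet (NLit 10) (NLit 0) ;;
    NSet (NLit 7) (V 5) ;;
    While (NLess (V 7) (V 6))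
      ((NSet (NLit 9) (NLit 0) ;; NSet (NLit 8) (V 5)) ;;
       count_prog ;;
       Cond (NLess (NAdd (V 9) (V 9)) (NSub (V 6) (V 5))) Skip (NSet (NLit 10) (V 7)) ;;
       inc 7)"

definition ball_prog :: com where
  "ball_prog =
    SCopy (sad (V 4)) (V 10) ;;
    NSet (fld 2 (V 4)) (NLit 0) ;;
    RSet (tad (V 4)) (X 4)"

definition range_prog :: com where
  "range_prog =
    While (NLess (V 8) (V 6))
      (val_prog (V 4) (V 8) ;;
       Cond (RLess (X 8) (X 10)) (RSet (NLit 10) (X 8)) Skip ;;
       Cond (RLess (X 11) (X 8)) (RSet (NLit 11) (X 8)) Skip ;;
       inc 8)"

definition ranges_prog :: com where
  "ranges_prog =
    While (NLess (V 12) (V 1))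
      (NSet (fld 2 (V 4)) (NAdd (V 12) (NLit 1)) ;;
       val_prog (V 4) (V 5) ;;
       (RSet (NLit 10) (X 8) ;; RSet (NLit 11) (X 8) ;; NSet (NLit 8) (V 5)) ;;
       range_prog ;;
       RSet (lowad (V 12)) (X 10) ;;
       RSet (widad (V 12)) (RSub (X 11) (X 10)) ;;
       RSet (NLit 9) (RAdd (X 9) (RSub (X 11) (X 10))) ;;
       inc 12)"

text \<open>Widths are subtracted from a position on the concatenated ranges until the rest falls
  into the range of the current coordinate; the rest is then the offset of the threshold from the
  lowest value.\<close>

definition select_prog :: com where
  "select_prog =
    While (BNot (RLess (X 12) (RMem (widad (V 12)))))
      (RSet (NLit 12) (RSub (X 12) (RMem (widad (V 12)))) ;; inc 12)"

definition cut_prog :: com where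
  "cut_prog =
    (CallEmbed (sad (V 4)) (V 5) (NSub (V 6) (V 5)) ;;
     RSet (NLit 9) (RNat (NLit 0)) ;;
     NSet (NLit 12) (NLit 0)) ;;
    ranges_prog ;;
    (RSet (NLit 12) (RMul (X 6) (X 9)) ;;
     NSet (NLit 12) (NLit 0)) ;;
    select_prog ;;
    RSet (tad (V 4)) (RAdd (RMem (lowad (V 12))) (X 12)) ;;
    NSet (fld 2 (V 4)) (NAdd (V 12) (NLit 1))"

text \<open>In-place partition with the low side in front, ending before the address in cell 11.
  String cell 0 is the buffer for swaps, so no further string space is needed.\<close>

definition partition_prog :: com where
  "partition_prog =
    (NSet (NLit 11) (V 5) ;; NSet (NLit 8) (V 5)) ;;
    While (NLess (V 8) (V 6))
      (val_prog (V 4) (V 8) ;;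
       Cond (RLess (RMem (tad (V 4))) (X 8)) Skip
         (SCopy (NLit 0) (V 8) ;; SCopy (V 8) (V 11) ;; SCopy (V 11) (NLit 0) ;; inc 11) ;;
       inc 8)"

text \<open>A ball whose far set is empty becomes its own child.\<close>

definition children_prog :: com where
  "children_prog =
    Cond (NLess (V 11) (V 6))
      (NSet (fld 0 (V 3)) (V 11) ;; NSet (fld 1 (V 3)) (V 6) ;; NSet (fld 3 (V 4)) (V 3) ;; inc 3)
      (NSet (fld 3 (V 4)) (V 4)) ;;
    Cond (NLess (NLit 0) (NMem (fld 2 (V 4))))
      (NSet (fld 0 (V 3)) (V 5) ;; NSet (fld 1 (V 3)) (V 11) ;; inc 3)
      Skip"

definition process_prog :: com where
  "process_prog =
    (NSet (NLit 5) (NMem (fld 0 (V 4))) ;; NSet (NLit 6) (NMem (fld 1 (V 4)))) ;;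
    (dense_prog ;; Cond (NLess (NLit 0) (V 10)) ball_prog cut_prog) ;;
    partition_prog ;;
    children_prog"

text \<open>Real cell 7 runs through the powers of 1/2 and cell 6 collects a binary fraction. The
  guard involves only the parameters and the number of flips so far, so every call reads the same
  number of coins.\<close>

definition sample_prog :: com where
  "sample_prog =
    (RSet (NLit 6) (RNat (NLit 0)) ;; RSet (NLit 7) (RNat (NLit 1))) ;;
    While (RLess (X 3) (RMul (X 7) (RMul (RMul (RNat (NLit 2)) (RMul (RNat (V 1)) (RNat (V 1)))) (X 2))))
      (Flip (NLit 13) ;;
       RSet (NLit 7) (RDiv (X 7) (RNat (NLit 2))) ;;
       RSet (NLit 6) (RAdd (X 6) (RMul (X 7) (RNat (V 13)))))"

text \<open>The sample is drawn even when no node is left, so that every round consumes equally many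
  coins.\<close>

definition body_prog :: com where
  "body_prog = sample_prog ;; Cond (NLess (V 4) (V 3)) process_prog Skip ;; inc 4"

definition main_prog :: com where
  "main_prog = While (NLess (V 4) (NMul (NLit 2) (NMul (V 2) (V 0)))) body_prog"

text \<open>Without real powers: the number of trees is eight times the greatest power of two up to
  \<open>2 powr (\<epsilon> l)\<close>, where \<open>l\<close> is the binary logarithm of \<open>n\<close>, rounded up, left in real cell 13.\<close>

definition trees_prog :: com where
  "trees_prog =
    (NSet (NLit 14) (NLit 1) ;; NSet (NLit 2) (NLit 8) ;;
     RSet (NLit 12) (RNat (NLit 0)) ;; RSet (NLit 13) (RNat (NLit 0))) ;;
    While (NLess (V 14) (V 0))
      (NSet (NLit 14) (NAdd (V 14) (V 14)) ;;
       RSet (NLit 13) (RAdd (X 13) (RNat (NLit 1))) ;;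
       RSet (NLit 12) (RAdd (X 12) (X 1)) ;;
       Cond (RLess (X 12) (RNat (NLit 1))) Skip
         (RSet (NLit 12) (RSub (X 12) (RNat (NLit 1))) ;; NSet (NLit 2) (NAdd (V 2) (V 2))))"

text \<open>With \<open>l\<close> in real cell 13, the number of levels is
  \<open>3 * l / \<tau>\<close>. After so many levels the penalty factor
  \<open>(1 - \<tau>) ^ k\<close> is at most the inverse third power of the number of
  points.\<close>

definition radius_prog :: com where
  "radius_prog =
    RSet (NLit 4) (RDiv (RMul (RMul (RNat (NLit 16)) (X 0)) (X 3)) (X 1)) ;;
    RSet (NLit 5) (RDiv (RMul (RMul (RMul (RNat (NLit 6)) (X 13)) (RNat (V 1))) (X 2)) (X 3))"

text \<open>Copying with offset \<open>n\<close> reproduces the initial block periodically.\<close>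

definition copy_prog :: com where
  "copy_prog =
    NSet (NLit 7) (NLit 1) ;;
    While (NLess (NAdd (V 7) (V 0)) (NAdd (NMul (V 2) (V 0)) (NLit 1)))
      (SCopy (NAdd (V 7) (V 0)) (V 7) ;; inc 7)"

definition roots_prog :: com where
  "roots_prog =
    While (NLess (V 3) (V 2))
      (NSet (fld 0 (V 3)) (NAdd (NMul (V 3) (V 0)) (NLit 1)) ;;
       NSet (fld 1 (V 3)) (NAdd (NMul (NAdd (V 3) (NLit 1)) (V 0)) (NLit 1)) ;;
       inc 3)"

text \<open>The final copy overwrites the swap buffer. Cell 0 is exempt from the length bound of
  \<open>mem_ok\<close>, and in this way it ends with a string of bounded length.\<close>

definition pre_prog :: com where
  "pre_prog = (trees_prog ;; radius_prog ;; copy_prog ;; roots_prog) ;; main_prog ;; SCopy (NLit 0) (NLit 1)"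

text \<open>There is no jump out of a loop: a hit moves the level counter to its limit and the tree
  counter to the number of trees, which stops this loop and the enclosing one.\<close>

definition walk_prog :: com where
  "walk_prog =
    While (RLess (X 14) (X 5))
      (val_prog (V 12) (NLit 0) ;;
       Cond (NLess (NLit 0) (NMem (fld 2 (V 12))))
         (Cond (RLess (RMem (tad (V 12))) (X 8))
           (NSet (NLit 12) (NMem (fld 3 (V 12))))
           (NSet (NLit 12) (NAdd (NMem (fld 3 (V 12))) (NLit 1))))
         (Cond (RLess (RAdd (X 4) (X 3)) (X 8))
           (NSet (NLit 12) (NMem (fld 3 (V 12))))
           (SCopy (NLit 0) (sad (V 12)) ;; NSet (NLit 15) (V 2) ;; RSet (NLit 14) (X 5))) ;;
       RSet (NLit 14) (RAdd (X 14) (RNat (NLit 1))))"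

definition query_prog :: com where
  "query_prog =
    NSet (NLit 15) (NLit 0) ;;
    While (NLess (V 15) (V 2))
      ((NSet (NLit 12) (V 15) ;; RSet (NLit 14) (RNat (NLit 0))) ;;
       walk_prog ;;
       inc 15)"

section \<open>Coin-free programs\<close>

context ram
begin

definition det :: "com \<Rightarrow> state \<Rightarrow> nat \<Rightarrow> (state \<Rightarrow> bool) \<Rightarrow> bool" where
  "det c s k Q \<longleftrightarrow> (\<forall>l. runs c s l k (\<lambda>s' l'. l' = l \<and> Q s'))"

lemma det_exe:
  "small c \<Longrightarrow> safe E \<beta> \<kappa> \<mu> c s \<Longrightarrow> steps c \<le> k \<Longrightarrow> Q (exe E c s) \<Longrightarrow> det c s k Q"
  unfolding det_def by (auto intro: runs_exe)

lemma det_mono: "det c s k Q \<Longrightarrow> k \<le> k' \<Longrightarrow> (\<And>s'. bnd \<beta> s' \<Longrightarrow> Q s' \<Longrightarrow> Q' s') \<Longrightarrow> det c s k' Q'"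
  unfolding det_def by (blast intro: runs_mono)

lemma det_Seq:
  assumes "det c1 s k1 Q1" "\<And>s1. bnd \<beta> s1 \<Longrightarrow> Q1 s1 \<Longrightarrow> det c2 s1 k2 Q" "k1 + k2 \<le> k"
  shows "det (c1 ;; c2) s k Q"
  unfolding det_def
proof
  fix l
  show "runs (c1 ;; c2) s l k (\<lambda>s' l'. l' = l \<and> Q s')"
  proof (rule runs_Seq)
    show "runs c1 s l k1 (\<lambda>s' l'. l' = l \<and> Q1 s')" using assms(1) by (simp add: det_def)
  qed (use assms(2,3) in \<open>auto simp: det_def\<close>)
qed

lemma det_Cond:
  assumes "bok b" "bsz b \<le> 40" "bval b s \<Longrightarrow> det c1 s k1 Q" "\<not> bval b s \<Longrightarrow> det c2 s k1 Q" "k1 + 1 \<le> k"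
  shows "det (Cond b c1 c2) s k Q"
  using assms unfolding det_def by (blast intro: runs_Cond)

lemma det_While:
  assumes "bok b" "bsz b \<le> 40" "I m s"
    "\<And>i s. bnd \<beta> s \<Longrightarrow> I i s \<Longrightarrow> bval b s \<Longrightarrow> 0 < i \<and> det c s k1 (\<lambda>s'. \<exists>i'<i. I i' s')"
    "\<And>i s. bnd \<beta> s \<Longrightarrow> I i s \<Longrightarrow> \<not> bval b s \<Longrightarrow> Q s"
    "m * (k1 + 1) + 1 \<le> k"
  shows "det (While b c) s k Q"
  unfolding det_def
proof
  fix l
  show "runs (While b c) s l k (\<lambda>s' l'. l' = l \<and> Q s')"
  proof (rule runs_While[where I = "\<lambda>i s l'. l' = l \<and> I i s" and m = m and ?k1.0 = k1])
    fix i s l' assume a: "bnd \<beta> s" "l' = l \<and> I i s" "bval b s"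
    show "0 < i \<and> runs c s l' k1 (\<lambda>s' l'. \<exists>i'<i. l' = l \<and> I i' s')"
    proof -
      have "0 < i" and *: "runs c s l' k1 (\<lambda>s' l''. l'' = l' \<and> (\<exists>i'<i. I i' s'))"
        using assms(4)[OF a(1) conjunct2[OF a(2)] a(3)] by (auto simp: det_def)
      then show ?thesis using a(2) runs_mono[OF * order_refl] by auto
    qed
  qed (use assms in auto)
qed

lemma det_for:
  assumes "bok b" "bsz b \<le> 40" "I 0 s"
    "\<And>i s. bnd \<beta> s \<Longrightarrow> I i s \<Longrightarrow> i < m \<Longrightarrow> bval b s \<and> det c s k1 (I (Suc i))"
    "\<And>s. bnd \<beta> s \<Longrightarrow> I m s \<Longrightarrow> \<not> bval b s"
    "m * (k1 + 1) + 1 \<le> k"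
  shows "det (While b c) s k (I m)"
  unfolding det_def
proof
  fix l
  have "runs (While b c) s l k ((\<lambda>i s l'. l' = l \<and> I i s) m)"
  proof (rule runs_for[where I = "\<lambda>i s l'. l' = l \<and> I i s" and ?k1.0 = k1])
    fix i s l' assume a: "bnd \<beta> s" "l' = l \<and> I i s" "i < m"
    show "bval b s \<and> runs c s l' k1 (\<lambda>s l'. l' = l \<and> I (Suc i) s)"
      using assms(4)[OF a(1) conjunct2[OF a(2)] a(3)] a(2) unfolding det_def by auto
  qed (use assms in auto)
  then show "runs (While b c) s l k (\<lambda>s' l'. l' = l \<and> I m s')" by simp
qed

end

text \<open>The frame condition of the program proofs: \<open>A\<close>, \<open>B\<close>,
  \<open>C\<close> contain the cells of the three memories that may have changed.\<close>

definition upd :: "nat set \<Rightarrow> nat set \<Rightarrow> nat set \<Rightarrow> state \<Rightarrow> state \<Rightarrow> bool" where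
  "upd A B C s s' \<longleftrightarrow> (\<forall>a. a \<notin> A \<longrightarrow> nats s' a = nats s a) \<and>
     (\<forall>a. a \<notin> B \<longrightarrow> reals s' a = reals s a) \<and> (\<forall>a. a \<notin> C \<longrightarrow> strs s' a = strs s a)"

lemma upd_refl: "upd A B C s s"
  by (simp add: upd_def)

lemma upd_trans: "upd A B C s s' \<Longrightarrow> upd A' B' C' s' s'' \<Longrightarrow> A \<subseteq> A'' \<Longrightarrow> A' \<subseteq> A'' \<Longrightarrow> B \<subseteq> B'' \<Longrightarrow>
    B' \<subseteq> B'' \<Longrightarrow> C \<subseteq> C'' \<Longrightarrow> C' \<subseteq> C'' \<Longrightarrow> upd A'' B'' C'' s s''"
  unfolding upd_def by (metis subsetD)

lemma updD:
  assumes "upd A B C s s'"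
  shows "a \<notin> A \<Longrightarrow> nats s' a = nats s a" "a \<notin> B \<Longrightarrow> reals s' a = reals s a" "a \<notin> C \<Longrightarrow> strs s' a = strs s a"
  using assms by (auto simp: upd_def)

section \<open>Correctness of the tree construction\<close>

text \<open>By \<open>size\<close>, every natural number that the programs store fits in
  \<open>\<beta>\<close> bits. Node indices go up to \<open>2 * (n * N)\<close> and string addresses
  of points up to \<open>n * N\<close>; cell addresses occur only inside expressions and need no
  such bound.\<close>

locale nns = point_set E M dM d D \<epsilon> \<Delta> r P + ram E \<beta> \<kappa> \<mu>
  for E :: subroutines and M :: "bits set" and dM :: "bits \<Rightarrow> bits \<Rightarrow> real"
    and d :: nat and D \<epsilon> \<Delta> r :: real and P :: "bits set" and \<beta> \<kappa> \<mu> :: nat +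
  fixes n N :: nat and Lev :: real
  assumes dist_eq: "\<And>x y. x \<in> M \<Longrightarrow> y \<in> M \<Longrightarrow> dist_fun E x y = dM x y"
    and M_len: "\<And>x. x \<in> M \<Longrightarrow> length x \<le> \<mu>"
    and code_len: "\<And>zs. distinct zs \<Longrightarrow> set zs \<subseteq> P \<Longrightarrow> length (embed_fun E zs) \<le> \<mu>"
    and d_le: "d \<le> \<mu>"
    and n_ge: "2 \<le> n" and N_pos: "0 < N"
    and size: "4 * (n * N) + d + 2 < 2 ^ \<beta>"
begin

definition params :: "state \<Rightarrow> bool" where
  "params s \<longleftrightarrow> nats s 0 = n \<and> nats s 1 = d \<and> nats s 2 = N \<and>
     reals s 2 = \<Delta> \<and> reals s 3 = r \<and> reals s 4 = R \<and> reals s 5 = Lev"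

abbreviation "str s i \<equiv> strs s (Suc (N * n + i))"
abbreviation "thr s i \<equiv> reals s (16 + 3 * d + i)"

definition node_val :: "state \<Rightarrow> nat \<Rightarrow> bits \<Rightarrow> real" where
  "node_val s i x = (if nats s (fa 2 i) = 0 then dM (str s i) x else coord (str s i) x (nats s (fa 2 i) - 1))"

definition node_ok :: "state \<Rightarrow> nat \<Rightarrow> bool" where
  "node_ok s i \<longleftrightarrow> nats s (fa 2 i) \<le> d \<and> (nats s (fa 2 i) = 0 \<longrightarrow> str s i \<in> M) \<and>
     (0 < nats s (fa 2 i) \<longrightarrow> (\<forall>x\<in>M. length (apply_fun E (str s i) x) = d))"

abbreviation "vec_cells \<equiv> {16..<16 + d}"

lemma det_val:
  assumes p: "params s" and i: "nval node s = i" and x: "strs s (nval pt s) \<in> M" and ok: "node_ok s i"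
    and sz: "nok node" "nok pt" "nsz node \<le> 5" "nsz pt \<le> 5"
  shows "det (val_prog node pt) s 3 (\<lambda>s'. nats s' = nats s \<and> strs s' = strs s \<and>
    upd {} ({8} \<union> vec_cells) {} s s' \<and> reals s' 8 = node_val s i (strs s (nval pt s)))"
proof (rule det_exe)
  show "small (val_prog node pt)" using sz by (simp add: val_prog_def)
  show "steps (val_prog node pt) \<le> 3" by (simp add: val_prog_def)
  show "safe E \<beta> \<kappa> \<mu> (val_prog node pt) s"
    using p i x ok d_le by (auto simp: val_prog_def params_def node_ok_def)
  show "nats (exe E (val_prog node pt) s) = nats s \<and> strs (exe E (val_prog node pt) s) = strs s \<and>
    upd {} ({8} \<union> vec_cells) {} s (exe E (val_prog node pt) s) \<and>
    reals (exe E (val_prog node pt) s) 8 = node_val s i (strs s (nval pt s))"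
  proof (cases "nats s (fa 2 i) = 0")
    case True
    then show ?thesis
      using p i x ok by (auto simp: val_prog_def params_def node_ok_def node_val_def upd_def dist_eq)
  next
    case False
    then have "length (apply_fun E (str s i) (strs s (nval pt s))) = d" using ok x by (simp add: node_ok_def)
    moreover have "nats s (fa 2 i) \<le> d" using ok by (simp add: node_ok_def)
    ultimately show ?thesis using False p i
      by (auto simp: val_prog_def params_def node_val_def upd_def write_array_def coord_def)
  qed
qed

definition near_cells :: "state \<Rightarrow> nat \<Rightarrow> nat \<Rightarrow> nat \<Rightarrow> nat set" where
  "near_cells s x lo k = {y \<in> {lo..<lo + k}. dM (strs s x) (strs s y) \<le> R}"

lemma near_cells_Suc: "near_cells s x lo (Suc k) =
   (if dM (strs s x) (strs s (lo + k)) \<le> R then insert (lo + k) (near_cells s x lo k) else near_cells s x lo k)"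
  by (auto simp: near_cells_def less_Suc_eq)

lemma near_cells_card: "finite (near_cells s x lo k)" "lo + k \<notin> near_cells s x lo k" "card (near_cells s x lo k) \<le> k"
proof -
  show "finite (near_cells s x lo k)" "lo + k \<notin> near_cells s x lo k" by (auto simp: near_cells_def)
  have "card (near_cells s x lo k) \<le> card {lo..<lo + k}"
    unfolding near_cells_def by (intro card_mono) auto
  then show "card (near_cells s x lo k) \<le> k" by simp
qed

lemma det_count:
  assumes p: "params s0" and lo: "nats s0 5 = lo" "nats s0 6 = lo + m" "nats s0 7 = x"
    and st: "nats s0 9 = 0" "nats s0 8 = lo"
    and M: "strs s0 x \<in> M" "\<And>y. lo \<le> y \<Longrightarrow> y < lo + m \<Longrightarrow> strs s0 y \<in> M"
    and sz: "lo + m < 2 ^ \<beta>"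
  shows "det count_prog s0 (m * 5 + 1) (\<lambda>s. upd {8, 9} {8} {} s0 s \<and> nats s 9 = card (near_cells s0 x lo m))"
proof -
  define I where "I k s \<longleftrightarrow> upd {8, 9} {8} {} s0 s \<and> nats s 8 = lo + k \<and> nats s 9 = card (near_cells s0 x lo k)" for k s
  have "det count_prog s0 (m * 5 + 1) (I m)"
    unfolding count_prog_def
  proof (rule det_for[where ?k1.0 = 4])
    show "I 0 s0" using st by (simp add: I_def upd_refl near_cells_def)
    fix k s assume I: "I k s" and k: "k < m"
    have u: "upd {8, 9} {8} {} s0 s" "nats s 8 = lo + k" "nats s 9 = card (near_cells s0 x lo k)"
      using I by (auto simp: I_def)
    have v: "nats s 6 = lo + m" "nats s 7 = x" "reals s 4 = R" "strs s = strs s0"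
      using u(1) p lo by (auto simp: upd_def params_def)
    have d: "dist_fun E (strs s0 x) (strs s0 (lo + k)) = dM (strs s0 x) (strs s0 (lo + k))"
      using M k by (intro dist_eq) auto
    let ?c = "CallDist (NLit 8) (V 7) (V 8) ;; Cond (RLess (X 4) (X 8)) Skip (inc 9) ;; inc 8"
    have "det ?c s 4 (I (Suc k))"
    proof (rule det_exe)
      have c: "Suc (card (near_cells s0 x lo k)) < 2 ^ \<beta>"
        using near_cells_card(3)[where s = s0 and x = x and lo = lo and k = k] k sz by linarith
      show "safe E \<beta> \<kappa> \<mu> ?c s" using k sz c by (simp add: v u)
      show "I (Suc k) (exe E ?c s)"
        using u(1) near_cells_card(1,2)[where s = s0 and x = x and lo = lo and k = k]
        by (auto simp: v u I_def d near_cells_Suc upd_def)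
    qed (simp_all)
    then show "bval (NLess (V 8) (V 6)) s \<and> det ?c s 4 (I (Suc k))"
      using k by (simp add: v u)
  next
    fix s assume "I m s"
    then show "\<not> bval (NLess (V 8) (V 6)) s" using lo by (auto simp: I_def upd_def)
  qed (simp_all)
  then show ?thesis by (rule det_mono) (auto simp: I_def)
qed


section \<open>Dense balls, cuts and partition for the points of one segment\<close>

abbreviation seg :: "nat \<Rightarrow> nat \<Rightarrow> nat set" where
  "seg lo m \<equiv> {lo..<lo + m}"

definition segment :: "state \<Rightarrow> nat \<Rightarrow> nat \<Rightarrow> bool" where
  "segment s lo m \<longleftrightarrow> params s \<and> nats s 5 = lo \<and> nats s 6 = lo + m \<and> 0 < m \<and> 1 \<le> lo \<and>
     lo + m \<le> Suc (N * n) \<and> strs s ` seg lo m \<subseteq> P \<and> inj_on (strs s) (seg lo m)"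

lemma segment_upd:
  assumes "segment s lo m" "upd A B C s s'" "A \<inter> {0, 1, 2, 5, 6} = {}" "B \<inter> {2, 3, 4, 5} = {}" "C \<inter> seg lo m = {}"
  shows "segment s' lo m"
proof -
  have st: "strs s' x = strs s x" if "x \<in> seg lo m" for x using assms(2,5) that by (auto simp: upd_def)
  then have "strs s' ` seg lo m = strs s ` seg lo m" "inj_on (strs s') (seg lo m) = inj_on (strs s) (seg lo m)"
    by (auto simp: inj_on_def)
  moreover have "nats s' a = nats s a" if "a \<in> {0, 1, 2, 5, 6}" for a using assms(2,3) that by (auto simp: upd_def)
  moreover have "reals s' a = reals s a" if "a \<in> {2, 3, 4, 5}" for a using assms(2,4) that by (auto simp: upd_def)
  ultimately show ?thesis using assms(1) by (simp add: segment_def params_def)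
qed

lemma segment_M: "segment s lo m \<Longrightarrow> y \<in> seg lo m \<Longrightarrow> strs s y \<in> M"
  unfolding segment_def using P_M by blast

lemma segment_size: "segment s lo m \<Longrightarrow> lo + m + d + 1 < 2 ^ \<beta>"
  using size by (auto simp: segment_def mult.commute)

lemma det_dense:
  assumes sg: "segment s0 lo m"
  shows "det dense_prog s0 (m * (m * 5 + 8) + 3) (\<lambda>s. upd {7, 8, 9, 10} {8} {} s0 s \<and>
    (nats s 10 = 0 \<and> (\<forall>x\<in>seg lo m. \<not> m \<le> 2 * card (near_cells s0 x lo m)) \<or>
     nats s 10 \<in> seg lo m \<and> m \<le> 2 * card (near_cells s0 (nats s 10) lo m)))"
proof -
  define I where "I k s \<longleftrightarrow> upd {7, 8, 9, 10} {8} {} s0 s \<and> nats s 7 = lo + k \<and>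
    (nats s 10 = 0 \<and> (\<forall>x\<in>seg lo k. \<not> m \<le> 2 * card (near_cells s0 x lo m)) \<or>
     nats s 10 \<in> seg lo m \<and> m \<le> 2 * card (near_cells s0 (nats s 10) lo m))" for k s
  have p: "params s0" "nats s0 5 = lo" "nats s0 6 = lo + m" "1 \<le> lo" using sg by (auto simp: segment_def)
  have sz: "lo + m < 2 ^ \<beta>" using segment_size[OF sg] by simp
  let ?init = "NSet (NLit 9) (NLit 0) ;; NSet (NLit 8) (V 5)"
  let ?end = "Cond (NLess (NAdd (V 9) (V 9)) (NSub (V 6) (V 5))) Skip (NSet (NLit 10) (V 7)) ;; inc 7"
  let ?body = "?init ;; count_prog ;; ?end"
  have loop: "det (While (NLess (V 7) (V 6)) ?body) s (m * (m * 5 + 8) + 1) (I m)" if "I 0 s" for s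
  proof (rule det_for[where ?k1.0 = "m * 5 + 7"])
    show "I 0 s" by (rule that)
    fix k s assume I: "I k s" and k: "k < m"
    have u: "upd {7, 8, 9, 10} {8} {} s0 s" "nats s 7 = lo + k" using I by (auto simp: I_def)
    have v: "nats s 5 = lo" "nats s 6 = lo + m" "strs s = strs s0"
      using u(1) p by (auto simp: upd_def)
    have "det ?body s (m * 5 + 7) (I (Suc k))"
    proof (rule det_Seq)
      define s1 where "s1 = exe E ?init s"
      show "det ?init s 2 (\<lambda>s'. s' = s1)"
        by (rule det_exe) (use sz in \<open>auto simp: s1_def v\<close>)
      fix s' assume "s' = s1"
      have u1: "upd {8, 9} {} {} s s1" "nats s1 9 = 0" "nats s1 8 = lo" by (auto simp: s1_def upd_def v)
      have sg1: "segment s1 lo m"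
        using upd_trans[OF u(1) u1(1), of "{7,8,9,10}" "{8}" "{}"] by (intro segment_upd[OF sg]) auto
      have "det (count_prog ;; ?end) s1 (m * 5 + 5) (I (Suc k))"
      proof (rule det_Seq)
        show "det count_prog s1 (m * 5 + 1) (\<lambda>s2. upd {8, 9} {8} {} s1 s2 \<and> nats s2 9 = card (near_cells s1 (lo + k) lo m))"
          using sg1 u1 v u(2) k sz segment_M[OF sg1]
          by (intro det_count) (auto simp: segment_def upd_def)
        fix s2 assume s2: "upd {8, 9} {8} {} s1 s2 \<and> nats s2 9 = card (near_cells s1 (lo + k) lo m)"
        have u2: "upd {7, 8, 9, 10} {8} {} s0 s2"
          using u(1) u1(1) s2 by (auto simp: upd_def)
        have "near_cells s1 (lo + k) lo m = near_cells s0 (lo + k) lo m"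
          using u1(1) v by (simp add: near_cells_def upd_def)
        then have v2: "nats s2 9 = card (near_cells s0 (lo + k) lo m)" "nats s2 7 = lo + k" "nats s2 10 = nats s 10"
            "nats s2 5 = lo" "nats s2 6 = lo + m"
          using s2 u1 u(2) v by (auto simp: upd_def)
        show "det ?end s2 3 (I (Suc k))"
        proof (rule det_exe)
          show "safe E \<beta> \<kappa> \<mu> ?end s2" using k sz by (simp add: v2)
          have sk: "seg lo (Suc k) = insert (lo + k) (seg lo k)" by auto
          show "I (Suc k) (exe E ?end s2)"
            using u2 I k unfolding I_def sk by (auto simp: v2 upd_def)
        qed simp_all
      qed simp
      then show "det (count_prog ;; ?end) s' (m * 5 + 5) (I (Suc k))" using \<open>s' = s1\<close> by simp
    qed simp
    then show "bval (NLess (V 7) (V 6)) s \<and> det ?body s (m * 5 + 7) (I (Suc k))"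
      using k by (simp add: v u)
  next
    fix s assume "I m s"
    then show "\<not> bval (NLess (V 7) (V 6)) s" using p by (auto simp: I_def upd_def)
  qed (simp_all)
  have "det dense_prog s0 (m * (m * 5 + 8) + 3) (I m)"
    unfolding dense_prog_def
  proof (rule det_Seq)
    show "det (NSet (NLit 10) (NLit 0)) s0 1 (\<lambda>s. s = s0\<lparr>nats := (nats s0)(10 := 0)\<rparr>)"
      by (rule det_exe) auto
    fix s1 assume s1: "s1 = s0\<lparr>nats := (nats s0)(10 := 0)\<rparr>"
    show "det (NSet (NLit 7) (V 5) ;; While (NLess (V 7) (V 6)) ?body) s1 (m * (m * 5 + 8) + 2) (I m)"
    proof (rule det_Seq)
      show "det (NSet (NLit 7) (V 5)) s1 1 (\<lambda>s. s = s1\<lparr>nats := (nats s1)(7 := lo)\<rparr>)"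
        by (rule det_exe) (use sz p in \<open>auto simp: s1\<close>)
      fix s2 assume s2: "s2 = s1\<lparr>nats := (nats s1)(7 := lo)\<rparr>"
      show "det (While (NLess (V 7) (V 6)) ?body) s2 (m * (m * 5 + 8) + 1) (I m)"
        by (rule loop) (auto simp: I_def s1 s2 upd_def)
    qed simp
  qed simp
  then show ?thesis by (rule det_mono) (auto simp: I_def)
qed

lemma det_range:
  assumes sg: "segment s0 lo m" and j: "nats s0 4 = j" "nats s0 (fa 2 j) = Suc i" "i < d"
    and e: "str s0 j = e" "\<And>x. x \<in> M \<Longrightarrow> length (apply_fun E e x) = d"
    and st: "nats s0 8 = lo" "reals s0 10 = coord e (strs s0 lo) i" "reals s0 11 = coord e (strs s0 lo) i"
  shows "det range_prog s0 (m * 9 + 1) (\<lambda>s. upd {8} ({8, 10, 11} \<union> vec_cells) {} s0 s \<and>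
    reals s 10 = Min ((\<lambda>x. coord e x i) ` strs s0 ` seg lo m) \<and>
    reals s 11 = Max ((\<lambda>x. coord e x i) ` strs s0 ` seg lo m))"
proof -
  define f where "f y = coord e (strs s0 y) i" for y
  define I where "I k s \<longleftrightarrow> upd {8} ({8, 10, 11} \<union> vec_cells) {} s0 s \<and> nats s 8 = lo + k \<and>
    reals s 10 = Min (insert (f lo) (f ` seg lo k)) \<and> reals s 11 = Max (insert (f lo) (f ` seg lo k))" for k s
  have p: "nats s0 5 = lo" "nats s0 6 = lo + m" "0 < m" using sg by (auto simp: segment_def)
  have sz: "lo + m < 2 ^ \<beta>" using segment_size[OF sg] by simp
  let ?end = "Cond (RLess (X 8) (X 10)) (RSet (NLit 10) (X 8)) Skip ;;
       Cond (RLess (X 11) (X 8)) (RSet (NLit 11) (X 8)) Skip ;; inc 8"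
  let ?body = "val_prog (V 4) (V 8) ;; ?end"
  have "det range_prog s0 (m * 9 + 1) (I m)"
    unfolding range_prog_def
  proof (rule det_for[where ?k1.0 = 8])
    show "I 0 s0" using st by (simp add: I_def upd_refl f_def)
    fix k s assume I: "I k s" and k: "k < m"
    have u: "upd {8} ({8, 10, 11} \<union> vec_cells) {} s0 s" "nats s 8 = lo + k" using I by (auto simp: I_def)
    have v: "nats s 4 = j" "nats s 6 = lo + m" "strs s = strs s0" "nats s (fa 2 j) = Suc i"
      using u(1) p j fa_ge[of 2 j] by (auto simp: upd_def)
    have sgs: "segment s lo m" using u(1) by (intro segment_upd[OF sg u(1)]) auto
    have "det ?body s 8 (I (Suc k))"
    proof (rule det_Seq)
      show "det (val_prog (V 4) (V 8)) s 3 (\<lambda>s'. nats s' = nats s \<and> strs s' = strs s \<and>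
         upd {} ({8} \<union> vec_cells) {} s s' \<and> reals s' 8 = node_val s j (strs s (nval (V 8) s)))"
        using sgs k e j v u(2) segment_M[OF sgs, of "lo + k"]
        by (intro det_val) (auto simp: node_ok_def segment_def)
      fix s1 assume s1: "nats s1 = nats s \<and> strs s1 = strs s \<and>
         upd {} ({8} \<union> vec_cells) {} s s1 \<and> reals s1 8 = node_val s j (strs s (nval (V 8) s))"
      have r1: "reals s1 8 = f (lo + k)" "reals s1 10 = reals s 10" "reals s1 11 = reals s 11"
        using s1 by (auto simp: node_val_def v u f_def e upd_def)
      have u1: "upd {8} ({8, 10, 11} \<union> vec_cells) {} s0 s1"
        using s1 by (intro upd_trans[OF u(1), of "{}" "{8} \<union> vec_cells" "{}" s1]) auto
      show "det ?end s1 5 (I (Suc k))"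
      proof (rule det_exe)
        show "safe E \<beta> \<kappa> \<mu> ?end s1" using k sz s1 by (simp add: u)
        have sk: "seg lo (Suc k) = insert (lo + k) (seg lo k)" by auto
        have mm: "Min (insert (f lo) (f ` seg lo (Suc k))) = min (f (lo + k)) (reals s 10)"
           "Max (insert (f lo) (f ` seg lo (Suc k))) = max (f (lo + k)) (reals s 11)"
          using I unfolding I_def sk image_insert insert_commute[of "f lo" "f (lo + k)"] by simp_all
        have e1: "nats (exe E ?end s1) = (nats s)(8 := lo + Suc k)" "strs (exe E ?end s1) = strs s1"
          "reals (exe E ?end s1) 10 = min (f (lo + k)) (reals s 10)"
          "reals (exe E ?end s1) 11 = max (f (lo + k)) (reals s 11)"
          "\<And>a. a \<noteq> 10 \<Longrightarrow> a \<noteq> 11 \<Longrightarrow> reals (exe E ?end s1) a = reals s1 a"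
          using s1 u(2) by (auto simp: r1 min_def max_def)
        have "upd {8} ({8, 10, 11} \<union> vec_cells) {} s0 (exe E ?end s1)"
          using u1 e1 u(1) unfolding upd_def by auto
        then show "I (Suc k) (exe E ?end s1)" unfolding I_def mm using e1 by simp
      qed simp_all
    qed simp
    then show "bval (NLess (V 8) (V 6)) s \<and> det ?body s 8 (I (Suc k))"
      using k by (simp add: v u)
  next
    fix s assume "I m s"
    then show "\<not> bval (NLess (V 8) (V 6)) s" using p by (auto simp: I_def upd_def)
  qed (simp_all add: val_prog_def)
  moreover have "insert (f lo) (f ` seg lo m) = (\<lambda>x. coord e x i) ` strs s0 ` seg lo m"
    using p(3) by (force simp: f_def)
  ultimately show ?thesis by (elim det_mono) (auto simp: I_def)
qed

lemma det_ranges: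
  assumes sg: "segment s0 lo m" and j: "nats s0 4 = j"
    and e: "str s0 j = e" "\<And>x. x \<in> M \<Longrightarrow> length (apply_fun E e x) = d"
    and st: "nats s0 12 = 0" "reals s0 9 = 0"
    and Q: "Q = strs s0 ` seg lo m"
  shows "det ranges_prog s0 (d * (m * 9 + 13) + 1) (\<lambda>s.
    upd {8, 12, fa 2 j} ({8, 9, 10, 11} \<union> {16..<16 + 3 * d}) {} s0 s \<and>
    (\<forall>i<d. reals s (16 + d + i) = lowest e Q i \<and> reals s (16 + 2 * d + i) = width e Q i) \<and>
    reals s 9 = tot_width e Q)"
proof -
  let ?A = "{8, 12, fa 2 j}" and ?B = "{8, 9, 10, 11} \<union> {16..<16 + 3 * d}"
  define I where "I k s \<longleftrightarrow> upd ?A ?B {} s0 s \<and> nats s 12 = k \<and> k \<le> d \<and>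
    (\<forall>i<k. reals s (16 + d + i) = lowest e Q i \<and> reals s (16 + 2 * d + i) = width e Q i) \<and>
    reals s 9 = (\<Sum>i<k. width e Q i)" for k s
  have p: "nats s0 5 = lo" "nats s0 6 = lo + m" "0 < m" "nats s0 1 = d" using sg by (auto simp: segment_def params_def)
  have sz: "lo + m < 2 ^ \<beta>" "d + 1 < 2 ^ \<beta>" using segment_size[OF sg] by simp_all
  let ?init = "NSet (fld 2 (V 4)) (NAdd (V 12) (NLit 1))"
  let ?copy = "RSet (NLit 10) (X 8) ;; RSet (NLit 11) (X 8) ;; NSet (NLit 8) (V 5)"
  let ?end = "RSet (lowad (V 12)) (X 10) ;; RSet (widad (V 12)) (RSub (X 11) (X 10)) ;;
       RSet (NLit 9) (RAdd (X 9) (RSub (X 11) (X 10))) ;; inc 12"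
  let ?body = "?init ;; val_prog (V 4) (V 5) ;; ?copy ;; range_prog ;; ?end"
  have "det ranges_prog s0 (d * (m * 9 + 13) + 1) (I d)"
    unfolding ranges_prog_def
  proof (rule det_for[where ?k1.0 = "m * 9 + 12"])
    show "I 0 s0" using st by (simp add: I_def upd_refl)
    fix k s assume I: "I k s" and k: "k < d"
    have u: "upd ?A ?B {} s0 s" "nats s 12 = k" using I by (auto simp: I_def)
    have v: "nats s 4 = j" "nats s 5 = lo" "nats s (Suc 0) = d" "strs s = strs s0"
      using u(1) p j fa_ge[of 2 j] by (auto simp: upd_def)
    have "det ?body s (m * 9 + 12) (I (Suc k))"
    proof (rule det_Seq)
      define s1 where "s1 = s\<lparr>nats := (nats s)(fa 2 j := Suc k)\<rparr>"
      show "det ?init s 1 (\<lambda>s'. s' = s1)"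
        by (rule det_exe) (use sz k in \<open>auto simp: s1_def v u\<close>)
      fix s' assume "s' = s1"
      have u1: "upd ?A ?B {} s0 s1" using u(1) by (auto simp: s1_def upd_def)
      have sg1: "segment s1 lo m" using u1 fa_ge[of 2 j] by (intro segment_upd[OF sg u1]) auto
      have v1: "nats s1 4 = j" "nats s1 5 = lo" "nats s1 1 = d" "strs s1 = strs s0" "nats s1 (fa 2 j) = Suc k" "nats s1 12 = k"
        using v u fa_ge[of 2 j] by (auto simp: s1_def)
      have "det (val_prog (V 4) (V 5) ;; ?copy ;; range_prog ;; ?end) s1 (m * 9 + 11) (I (Suc k))"
      proof (rule det_Seq)
        show "det (val_prog (V 4) (V 5)) s1 3 (\<lambda>s'. nats s' = nats s1 \<and> strs s' = strs s1 \<and>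
           upd {} ({8} \<union> vec_cells) {} s1 s' \<and> reals s' 8 = node_val s1 j (strs s1 (nval (V 5) s1)))"
          using sg1 k e v1 segment_M[OF sg1, of lo] p(3)
          by (intro det_val) (auto simp: node_ok_def segment_def)
        fix s2 assume s2: "nats s2 = nats s1 \<and> strs s2 = strs s1 \<and>
           upd {} ({8} \<union> vec_cells) {} s1 s2 \<and> reals s2 8 = node_val s1 j (strs s1 (nval (V 5) s1))"
        have r2: "reals s2 8 = coord e (strs s0 lo) k"
          using s2 by (simp add: node_val_def v1 e)
        show "det (?copy ;; range_prog ;; ?end) s2 (m * 9 + 8) (I (Suc k))"
        proof (rule det_Seq)
          define s3 where "s3 = exe E ?copy s2"
          show "det ?copy s2 3 (\<lambda>s'. s' = s3)"
            by (rule det_exe) (use sz s2 v1 in \<open>auto simp: s3_def\<close>)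
          fix s' assume "s' = s3"
          have n3: "nats s3 = (nats s1)(8 := lo)" "strs s3 = strs s0" "reals s3 10 = coord e (strs s0 lo) k"
            "reals s3 11 = coord e (strs s0 lo) k" "\<And>a. a \<noteq> 10 \<Longrightarrow> a \<noteq> 11 \<Longrightarrow> reals s3 a = reals s2 a"
            using s2 v1 r2 by (auto simp: s3_def)
          have r3: "reals s3 a = reals s a" if "a \<notin> {8, 10, 11} \<union> vec_cells" for a
            using n3(5)[of a] s2 that by (auto simp: upd_def s1_def)
          have u3: "upd ?A ?B {} s0 s3"
            using u(1) r3 unfolding upd_def n3(1,2) s1_def by auto
          have sg3: "segment s3 lo m" using u3 fa_ge[of 2 j] by (intro segment_upd[OF sg u3]) auto
          have "det (range_prog ;; ?end) s3 (m * 9 + 5) (I (Suc k))"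
          proof (rule det_Seq)
            show "det range_prog s3 (m * 9 + 1) (\<lambda>s. upd {8} ({8, 10, 11} \<union> vec_cells) {} s3 s \<and>
              reals s 10 = Min ((\<lambda>x. coord e x k) ` strs s3 ` seg lo m) \<and>
              reals s 11 = Max ((\<lambda>x. coord e x k) ` strs s3 ` seg lo m))"
              using n3 v1 k e fa_ge[of 2 j] by (intro det_range[OF sg3]) auto
            fix s4 assume s4: "upd {8} ({8, 10, 11} \<union> vec_cells) {} s3 s4 \<and>
              reals s4 10 = Min ((\<lambda>x. coord e x k) ` strs s3 ` seg lo m) \<and>
              reals s4 11 = Max ((\<lambda>x. coord e x k) ` strs s3 ` seg lo m)"
            have r4: "reals s4 10 = lowest e Q k" "reals s4 11 - lowest e Q k = width e Q k"
              using s4 n3(2) by (simp_all add: lowest_def width_def Q)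
            have u4: "upd ?A ?B {} s0 s4"
              using s4 by (intro upd_trans[OF u3, of "{8}" "{8, 10, 11} \<union> vec_cells" "{}" s4]) auto
            have v4: "nats s4 12 = k" "nats s4 (Suc 0) = d" using s4 n3 v1 by (auto simp: upd_def)
            have k4: "reals s4 a = reals s a" if "a \<notin> {8, 10, 11} \<union> vec_cells" for a
              using s4 r3[OF that] that by (auto simp: upd_def)
            show "det ?end s4 4 (I (Suc k))"
            proof (rule det_exe)
              show "safe E \<beta> \<kappa> \<mu> ?end s4" using k sz by (simp add: v4)
              define s5 where "s5 = exe E ?end s4"
              have e4: "nats s5 = (nats s4)(12 := Suc k)" "strs s5 = strs s4"
                "reals s5 = (reals s4)(16 + d + k := lowest e Q k, 16 + 2 * d + k := width e Q k,
                   9 := reals s4 9 + width e Q k)"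
                using k by (auto simp: v4 r4 s5_def)
              have u5: "upd ?A ?B {} s0 s5"
                using u4 k unfolding upd_def e4 by auto
              have a: "reals s5 (16 + d + i) = lowest e Q i \<and> reals s5 (16 + 2 * d + i) = width e Q i"
                if "i < Suc k" for i
              proof (cases "i = k")
                case True
                then show ?thesis using k by (simp add: e4)
              next
                case False
                then have "reals s (16 + d + i) = lowest e Q i \<and> reals s (16 + 2 * d + i) = width e Q i"
                  using I that by (simp add: I_def)
                then show ?thesis using False that k k4[of "16 + d + i"] k4[of "16 + 2 * d + i"] by (simp add: e4)
              qed
              have "reals s5 9 = (\<Sum>i<Suc k. width e Q i)"
                using I k4[of 9] by (simp add: e4 I_def)
              then show "I (Suc k) (exe E ?end s4)"
                using u5 a k unfolding I_def s5_def[symmetric] by (simp add: e4(1))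
            qed simp_all
          qed simp
          then show "det (range_prog ;; ?end) s' (m * 9 + 5) (I (Suc k))" using \<open>s' = s3\<close> by simp
        qed simp
      qed simp
      then show "det (val_prog (V 4) (V 5) ;; ?copy ;; range_prog ;; ?end) s' (m * 9 + 11) (I (Suc k))"
        using \<open>s' = s1\<close> by simp
    qed simp
    then show "bval (NLess (V 12) (V 1)) s \<and> det ?body s (m * 9 + 12) (I (Suc k))"
      using k by (simp add: v u)
  next
    fix s assume "I d s"
    then show "\<not> bval (NLess (V 12) (V 1)) s" using p fa_ge[of 2 j] by (auto simp: I_def upd_def)
  qed simp_all
  then show ?thesis by (rule det_mono) (auto simp: I_def tot_width_def)
qed

lemma det_select:
  assumes p: "params s0" and st: "nats s0 12 = 0" "0 \<le> reals s0 12" "reals s0 12 < (\<Sum>i<d. reals s0 (16 + 2 * d + i))"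
  shows "det select_prog s0 (d * 3 + 1) (\<lambda>s. upd {12} {12} {} s0 s \<and> nats s 12 < d \<and> 0 \<le> reals s 12 \<and>
    reals s 12 = reals s0 12 - (\<Sum>i<nats s 12. reals s0 (16 + 2 * d + i)) \<and>
    reals s 12 < reals s0 (16 + 2 * d + nats s 12))"
proof -
  define w where "w i = reals s0 (16 + 2 * d + i)" for i
  define I where "I k s \<longleftrightarrow> upd {12} {12} {} s0 s \<and> nats s 12 + k = d \<and> 0 < k \<and> 0 \<le> reals s 12 \<and>
    reals s 12 = reals s0 12 - (\<Sum>i<nats s 12. w i)" for k s
  let ?b = "BNot (RLess (X 12) (RMem (widad (V 12))))"
  let ?body = "RSet (NLit 12) (RSub (X 12) (RMem (widad (V 12)))) ;; inc 12"
  have sz: "d + 1 < 2 ^ \<beta>" using size by simp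
  have rd: "reals s (16 + 2 * nats s 1 + nats s 12) = w (nats s 12)" if "I k s" for k s
    using that p by (auto simp: I_def upd_def w_def params_def)
  have "det select_prog s0 (d * 3 + 1) (\<lambda>s. \<exists>k. I k s \<and> reals s 12 < w (nats s 12))"
    unfolding select_prog_def
  proof (rule det_While[where I = I and m = d and ?k1.0 = 2])
    show "I d s0" using st d_pos by (simp add: I_def upd_refl)
    fix k s assume I: "I k s"
    show "\<exists>k. I k s \<and> reals s 12 < w (nats s 12)" if "\<not> bval ?b s"
      using that I rd[OF I] by auto
    assume "bval ?b s"
    then have ge: "w (nats s 12) \<le> reals s 12" using rd[OF I] by simp
    \<comment> \<open>At the last coordinate another subtraction would mean that the position is at
      least the total width. The strict upper bound on the position therefore stops the loop in
      time.\<close>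
    have k: "1 < k"
    proof (rule ccontr)
      assume "\<not> 1 < k"
      then have "d = Suc (nats s 12)" using I by (auto simp: I_def)
      then have "(\<Sum>i<d. w i) \<le> reals s0 12" using ge I by (simp add: I_def)
      then show False using st(3) by (simp add: w_def)
    qed
    have "det ?body s 2 (I (k - 1))"
    proof (rule det_exe)
      show "safe E \<beta> \<kappa> \<mu> ?body s" using I sz by (simp add: I_def)
      show "I (k - 1) (exe E ?body s)" using I k ge rd[OF I] by (auto simp: I_def upd_def)
    qed simp_all
    then have "det ?body s 2 (\<lambda>s'. \<exists>i'<k. I i' s')" by (rule det_mono) (use k in \<open>auto intro!: exI[of _ "k - 1"]\<close>)
    then show "0 < k \<and> det ?body s 2 (\<lambda>s'. \<exists>i'<k. I i' s')" using k by simp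
  qed simp_all
  then show ?thesis by (rule det_mono) (auto simp: I_def w_def)
qed


lemma apply_length:
  "distinct zs \<Longrightarrow> set zs \<subseteq> P \<Longrightarrow> x \<in> M \<Longrightarrow> length (apply_fun E (embed_fun E zs) x) = d"
  using distortion[of zs] by (auto simp: has_avg_distortion_def ell1_def Pi_iff)

lemma segment_points:
  assumes "segment s lo m"
  shows "distinct (map (strs s) [lo..<lo + m])" "set (map (strs s) [lo..<lo + m]) = strs s ` seg lo m"
    "strs s ` seg lo m \<subseteq> P" "strs s ` seg lo m \<noteq> {}" "card (strs s ` seg lo m) = m"
  using assms by (auto simp: segment_def distinct_map card_image)

text \<open>The program counts cells and \<open>dense\<close> counts points; the counts agree
  because a segment contains no point twice.\<close>

lemma dense_iff_near_cells:
  assumes "segment s lo m" "x \<in> seg lo m"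
  shows "dense (strs s ` seg lo m) (strs s x) \<longleftrightarrow> m \<le> 2 * card (near_cells s x lo m)"
proof -
  have "{y \<in> strs s ` seg lo m. dM (strs s x) y \<le> R} = strs s ` near_cells s x lo m"
    by (auto simp: near_cells_def)
  moreover have "inj_on (strs s) (near_cells s x lo m)"
    using assms(1) by (auto simp: segment_def near_cells_def intro: inj_on_subset)
  ultimately have "card {y \<in> strs s ` seg lo m. dM (strs s x) y \<le> R} = card (near_cells s x lo m)"
    by (simp add: card_image)
  then show ?thesis using assms segment_points(5)[OF assms(1)] by (simp add: dense_def)
qed

text \<open>Sparsity makes the total width positive, so a fraction below 1 of it is strictly below
  the total and the selection ends at a coordinate. The embedding is the only step whose cost
  depends on \<open>embed_time\<close>.\<close>

lemma det_cut:
  assumes sg: "segment s0 lo m" and j: "nats s0 4 = j"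
    and zs: "zs = map (strs s0) [lo..<lo + m]" and Q: "Q = strs s0 ` seg lo m" and e: "e = embed_fun E zs"
    and sparse: "\<And>c. \<not> dense Q c" and u: "0 \<le> reals s0 6" "reals s0 6 < 1"
    and emb: "2000 * \<beta> + embed_time E \<le> \<kappa>"
  shows "det cut_prog s0 (d * (m * 9 + 16) + 9) (\<lambda>s.
    upd {8, 12, fa 2 j} ({8, 9, 10, 11, 12} \<union> {16..<16 + 3 * d} \<union> {16 + 3 * d + j}) {Suc (N * n + j)} s0 s \<and>
    str s j = e \<and>
    (\<exists>i t. cut_at d (lowest e Q) (width e Q) (reals s0 6 * tot_width e Q) i t \<and>
       nats s (fa 2 j) = Suc i \<and> thr s j = t))"
proof -
  let ?A = "{8, 12, fa 2 j}" and ?B = "{8, 9, 10, 11, 12} \<union> {16..<16 + 3 * d} \<union> {16 + 3 * d + j}"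
  let ?C = "{Suc (N * n + j)}"
  have p: "nats s0 5 = lo" "nats s0 6 = lo + m" "0 < m" "params s0" using sg by (auto simp: segment_def)
  have Cseg: "?C \<inter> seg lo m = {}" using sg by (auto simp: segment_def)
  have sz: "lo + m < 2 ^ \<beta>" "d + 1 < 2 ^ \<beta>" using segment_size[OF sg] by simp_all
  have zsP: "distinct zs" "set zs \<subseteq> P" "Q = set zs" "Q \<noteq> {}"
    using segment_points[OF sg] by (simp_all add: zs Q)
  have e_len: "\<And>x. x \<in> M \<Longrightarrow> length (apply_fun E e x) = d" using apply_length[OF zsP(1,2)] by (simp add: e)
  have W: "0 < tot_width e Q" using tot_width_pos[OF zsP(1-3) e sparse zsP(4)] .
  have wn: "0 \<le> width e Q i" for i using width_nonneg[of Q e i] zsP by simp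
  let ?init = "CallEmbed (sad (V 4)) (V 5) (NSub (V 6) (V 5)) ;; RSet (NLit 9) (RNat (NLit 0)) ;; NSet (NLit 12) (NLit 0)"
  let ?mid = "RSet (NLit 12) (RMul (X 6) (X 9)) ;; NSet (NLit 12) (NLit 0)"
  let ?end = "RSet (tad (V 4)) (RAdd (RMem (lowad (V 12))) (X 12)) ;; NSet (fld 2 (V 4)) (NAdd (V 12) (NLit 1))"
  show ?thesis
    unfolding cut_prog_def
  proof (rule det_Seq)
    show "det ?init s0 3 (\<lambda>s. upd {12} {9} ?C s0 s \<and> str s j = e \<and> nats s 12 = 0 \<and> reals s 9 = 0)"
      by (rule det_exe) (use p j emb in \<open>auto simp: upd_def params_def e zs\<close>)
    fix s1 assume s1: "upd {12} {9} ?C s0 s1 \<and> str s1 j = e \<and> nats s1 12 = 0 \<and> reals s1 9 = 0"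
    have sg1: "segment s1 lo m" using s1 Cseg by (intro segment_upd[OF sg]) auto
    have Q1: "Q = strs s1 ` seg lo m" using s1 Cseg unfolding Q by (intro image_cong) (auto simp: upd_def)
    show "det (ranges_prog ;; ?mid ;; select_prog ;; ?end) s1 (d * (m * 9 + 16) + 6) (\<lambda>s.
        upd ?A ?B ?C s0 s \<and> str s j = e \<and>
        (\<exists>i t. cut_at d (lowest e Q) (width e Q) (reals s0 6 * tot_width e Q) i t \<and>
           nats s (fa 2 j) = Suc i \<and> thr s j = t))"
    proof (rule det_Seq)
      show "det ranges_prog s1 (d * (m * 9 + 13) + 1) (\<lambda>s.
        upd {8, 12, fa 2 j} ({8, 9, 10, 11} \<union> {16..<16 + 3 * d}) {} s1 s \<and>
        (\<forall>i<d. reals s (16 + d + i) = lowest e Q i \<and> reals s (16 + 2 * d + i) = width e Q i) \<and>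
        reals s 9 = tot_width e Q)"
        using s1 j e_len Q1 by (intro det_ranges[OF sg1]) (auto simp: upd_def)
      fix s2 assume s2: "upd {8, 12, fa 2 j} ({8, 9, 10, 11} \<union> {16..<16 + 3 * d}) {} s1 s2 \<and>
        (\<forall>i<d. reals s2 (16 + d + i) = lowest e Q i \<and> reals s2 (16 + 2 * d + i) = width e Q i) \<and>
        reals s2 9 = tot_width e Q"
      have u2: "upd ?A ?B ?C s0 s2" using s1 s2 unfolding upd_def by auto
      have r6: "reals s2 6 = reals s0 6" using u2 by (auto simp: upd_def)
      show "det (?mid ;; select_prog ;; ?end) s2 (d * 3 + 5) (\<lambda>s.
        upd ?A ?B ?C s0 s \<and> str s j = e \<and>
        (\<exists>i t. cut_at d (lowest e Q) (width e Q) (reals s0 6 * tot_width e Q) i t \<and>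
           nats s (fa 2 j) = Suc i \<and> thr s j = t))"
      proof (rule det_Seq)
        show "det ?mid s2 2 (\<lambda>s. upd {12} {12} {} s2 s \<and> nats s 12 = 0 \<and> reals s 12 = reals s0 6 * tot_width e Q)"
          by (rule det_exe) (use s2 r6 in \<open>auto simp: upd_def\<close>)
        fix s3 assume s3: "upd {12} {12} {} s2 s3 \<and> nats s3 12 = 0 \<and> reals s3 12 = reals s0 6 * tot_width e Q"
        have u3: "upd ?A ?B ?C s0 s3" using u2 s3 unfolding upd_def by auto
        have sg3: "segment s3 lo m" using Cseg fa_ge[of 2 j] by (intro segment_upd[OF sg u3]) auto
        have w3: "reals s3 (16 + d + i) = lowest e Q i" "reals s3 (16 + 2 * d + i) = width e Q i" if "i < d" for i
          using s2 s3 that by (auto simp: upd_def)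
        have j3: "nats s3 4 = j" "str s3 j = e"
        proof -
          show "nats s3 4 = j" using updD(1)[OF u3, of 4] fa_neq(2)[of 4 2 j] j by simp
          show "str s3 j = e" using s1 s2 s3 by (auto simp: upd_def)
        qed
        show "det (select_prog ;; ?end) s3 (d * 3 + 3) (\<lambda>s.
          upd ?A ?B ?C s0 s \<and> str s j = e \<and>
          (\<exists>i t. cut_at d (lowest e Q) (width e Q) (reals s0 6 * tot_width e Q) i t \<and>
             nats s (fa 2 j) = Suc i \<and> thr s j = t))"
        proof (rule det_Seq)
          have "reals s0 6 * tot_width e Q < 1 * tot_width e Q" using u W by (intro mult_strict_right_mono) auto
          also have "1 * tot_width e Q = (\<Sum>i<d. reals s3 (16 + 2 * d + i))" using w3 by (simp add: tot_width_def)
          finally show "det select_prog s3 (d * 3 + 1) (\<lambda>s. upd {12} {12} {} s3 s \<and> nats s 12 < d \<and> 0 \<le> reals s 12 \<and>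
              reals s 12 = reals s3 12 - (\<Sum>i<nats s 12. reals s3 (16 + 2 * d + i)) \<and>
              reals s 12 < reals s3 (16 + 2 * d + nats s 12))"
            using s3 sg3 u W by (intro det_select) (auto simp: segment_def)
          fix s4 assume s4: "upd {12} {12} {} s3 s4 \<and> nats s4 12 < d \<and> 0 \<le> reals s4 12 \<and>
              reals s4 12 = reals s3 12 - (\<Sum>i<nats s4 12. reals s3 (16 + 2 * d + i)) \<and>
              reals s4 12 < reals s3 (16 + 2 * d + nats s4 12)"
          define i where "i = nats s4 12"
          have i: "i < d" using s4 by (simp add: i_def)
          define t where "t = lowest e Q i + reals s4 12"
          have "(\<Sum>i<i. reals s3 (16 + 2 * d + i)) = (\<Sum>i<i. width e Q i)"
            using i w3 by (intro sum.cong) auto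
          then have cut: "cut_at d (lowest e Q) (width e Q) (reals s0 6 * tot_width e Q) i t"
            using s3 s4 i w3[OF i] by (simp add: cut_at_def t_def i_def)
          have u4: "upd ?A ?B ?C s0 s4" using u3 s4 unfolding upd_def by auto
          have v4: "nats s4 4 = j" "nats s4 (Suc 0) = d" "reals s4 (16 + d + i) = lowest e Q i" "nats s4 12 = i"
            using s4 j3 sg3 w3[OF i] by (auto simp: upd_def i_def segment_def params_def)
          show "det ?end s4 2 (\<lambda>s. upd ?A ?B ?C s0 s \<and> str s j = e \<and>
            (\<exists>i t. cut_at d (lowest e Q) (width e Q) (reals s0 6 * tot_width e Q) i t \<and>
               nats s (fa 2 j) = Suc i \<and> thr s j = t))"
          proof (rule det_exe)
            show "safe E \<beta> \<kappa> \<mu> ?end s4" using i sz by (simp add: v4)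
            define s5 where "s5 = exe E ?end s4"
            have e5: "nats s5 = (nats s4)(fa 2 j := Suc i)" "reals s5 = (reals s4)(16 + 3 * d + j := t)" "strs s5 = strs s4"
              by (simp_all add: s5_def v4 t_def)
            have "upd ?A ?B ?C s0 s5" using u4 unfolding upd_def e5 by auto
            moreover have "str s5 j = e" using s4 j3 by (simp add: e5 upd_def)
            ultimately show "upd ?A ?B ?C s0 (exe E ?end s4) \<and> str (exe E ?end s4) j = e \<and>
              (\<exists>i t. cut_at d (lowest e Q) (width e Q) (reals s0 6 * tot_width e Q) i t \<and>
                 nats (exe E ?end s4) (fa 2 j) = Suc i \<and> thr (exe E ?end s4) j = t)"
              using cut unfolding s5_def[symmetric] by (auto simp: e5)
          qed simp_all
        qed simp
      qed simp
    qed (simp add: algebra_simps)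
  qed simp
qed

lemma det_partition:
  assumes sg: "segment s0 lo m" and j: "nats s0 4 = j" and ok: "node_ok s0 j"
  shows "det partition_prog s0 (m * 10 + 3) (\<lambda>s. upd {8, 11} ({8} \<union> vec_cells) ({0} \<union> seg lo m) s0 s \<and>
    strs s ` seg lo m = strs s0 ` seg lo m \<and> inj_on (strs s) (seg lo m) \<and> lo \<le> nats s 11 \<and> nats s 11 \<le> lo + m \<and>
    (\<forall>i\<in>{lo..<nats s 11}. node_val s0 j (strs s i) \<le> thr s0 j) \<and>
    (\<forall>i\<in>{nats s 11..<lo + m}. \<not> node_val s0 j (strs s i) \<le> thr s0 j))"
proof -
  define I where "I k s \<longleftrightarrow> upd {8, 11} ({8} \<union> vec_cells) ({0} \<union> seg lo m) s0 s \<and> nats s 8 = lo + k \<and>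
    strs s ` seg lo m = strs s0 ` seg lo m \<and> inj_on (strs s) (seg lo m) \<and> lo \<le> nats s 11 \<and> nats s 11 \<le> lo + k \<and>
    (\<forall>i\<in>{lo..<nats s 11}. node_val s0 j (strs s i) \<le> thr s0 j) \<and>
    (\<forall>i\<in>{nats s 11..<lo + k}. \<not> node_val s0 j (strs s i) \<le> thr s0 j)" for k s
  have p: "nats s0 5 = lo" "nats s0 6 = lo + m" "0 < m" "params s0" "1 \<le> lo" "lo + m \<le> Suc (N * n)" using sg by (auto simp: segment_def)
  have sz: "lo + m < 2 ^ \<beta>" using segment_size[OF sg] by simp
  have P_len: "\<And>x. x \<in> P \<Longrightarrow> length x \<le> \<mu>" using P_M M_len by auto
  let ?init = "NSet (NLit 11) (V 5) ;; NSet (NLit 8) (V 5)"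
  let ?swap = "SCopy (NLit 0) (V 8) ;; SCopy (V 8) (V 11) ;; SCopy (V 11) (NLit 0) ;; inc 11"
  let ?end = "Cond (RLess (RMem (tad (V 4))) (X 8)) Skip ?swap ;; inc 8"
  let ?body = "val_prog (V 4) (V 8) ;; ?end"
  have loop: "det (While (NLess (V 8) (V 6)) ?body) s (m * 10 + 1) (I m)" if "I 0 s" for s
  proof (rule det_for[where ?k1.0 = 9])
    show "I 0 s" by (rule that)
    fix k s assume I: "I k s" and k: "k < m"
    have u: "upd {8, 11} ({8} \<union> vec_cells) ({0} \<union> seg lo m) s0 s" "nats s 8 = lo + k" using I by (auto simp: I_def)
    have sj: "str s j = str s0 j" using u(1) p by (auto simp: upd_def)
    have v: "nats s 4 = j" "nats s 6 = lo + m" "nats s (fa 2 j) = nats s0 (fa 2 j)" "params s"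
      using u(1) p j fa_neq(1)[of 8 2 j] fa_neq(1)[of 11 2 j] by (auto simp: upd_def params_def)
    have oks: "node_ok s j" using ok sj v(3) by (simp add: node_ok_def)
    have nv: "node_val s j x = node_val s0 j x" for x using sj v(3) by (simp add: node_val_def)
    have segP: "strs s ` seg lo m \<subseteq> P" using I segment_points(3)[OF sg] by (simp add: I_def)
    have sk: "strs s (lo + k) \<in> P" using segP k by auto
    have "det ?body s 9 (I (Suc k))"
    proof (rule det_Seq)
      show "det (val_prog (V 4) (V 8)) s 3 (\<lambda>s'. nats s' = nats s \<and> strs s' = strs s \<and>
         upd {} ({8} \<union> vec_cells) {} s s' \<and> reals s' 8 = node_val s j (strs s (nval (V 8) s)))"
        using v u(2) oks sk P_M by (intro det_val) auto
      fix s1 assume s1: "nats s1 = nats s \<and> strs s1 = strs s \<and>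
         upd {} ({8} \<union> vec_cells) {} s s1 \<and> reals s1 8 = node_val s j (strs s (nval (V 8) s))"
      have r8: "reals s1 8 = node_val s0 j (strs s (lo + k))" using s1 by (simp add: nv u)
      have rt: "reals s1 (16 + 3 * nats s (Suc 0) + j) = thr s0 j" using s1 u(1) v(4) by (auto simp: upd_def params_def)
      let ?mid = "nats s 11"
      have mid: "lo \<le> ?mid" "?mid \<le> lo + k" using I by (auto simp: I_def)
      have sm: "?mid \<in> seg lo m" "lo + k \<in> seg lo m" using mid k by auto
      have len: "length (strs s (lo + k)) \<le> \<mu>" "length (strs s ?mid) \<le> \<mu>"
        using segP sm P_len by blast+
      show "det ?end s1 6 (I (Suc k))"
      proof (cases "thr s0 j < node_val s0 j (strs s (lo + k))")
        case True
        show ?thesis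
        proof (rule det_exe)
          show "safe E \<beta> \<kappa> \<mu> ?end s1" using k sz s1 True by (simp add: u v r8 rt)
          define s2 where "s2 = exe E ?end s1"
          have e2: "nats s2 = (nats s)(8 := lo + Suc k)" "reals s2 = reals s1" "strs s2 = strs s"
            using s1 True by (simp_all add: s2_def u v r8 rt)
          have u2: "upd {8, 11} ({8} \<union> vec_cells) ({0} \<union> seg lo m) s0 s2"
            using u(1) s1 unfolding upd_def e2 by auto
          show "I (Suc k) (exe E ?end s1)"
            using u2 I True unfolding s2_def[symmetric] I_def e2 by (auto simp: less_Suc_eq)
        qed simp_all
      next
        case False
        show ?thesis
        proof (rule det_exe)
          show "safe E \<beta> \<kappa> \<mu> ?end s1"
            using k sz s1 False len mid by (auto simp: u v r8 rt)
          define s2 where "s2 = exe E ?end s1"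
          have e2: "nats s2 = (nats s)(11 := Suc ?mid, 8 := lo + Suc k)" "reals s2 = reals s1"
            "strs s2 = (strs s)(0 := strs s (lo + k), lo + k := strs s ?mid, ?mid := strs s (lo + k))"
            using s1 False mid p(5) by (auto simp: s2_def u v r8 rt fun_upd_def fun_eq_iff)
          have u2: "upd {8, 11} ({8} \<union> vec_cells) ({0} \<union> seg lo m) s0 s2"
            using u(1) s1 sm unfolding upd_def e2 by auto
          \<comment> \<open>The three copies permute the cells of the segment by a transposition.
            Hence the set of points and their distinctness are preserved.\<close>
          define \<pi> where "\<pi> = Transposition.transpose (lo + k) ?mid"
          have eq: "strs s2 y = strs s (\<pi> y)" if "y \<in> seg lo m" for y
            using that p(5) by (auto simp: e2 \<pi>_def Transposition.transpose_def)
          have \<pi>: "\<pi> ` seg lo m = seg lo m" "inj_on \<pi> (seg lo m)"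
            using sm by (auto simp: \<pi>_def)
          have im: "strs s2 ` seg lo m = strs s ` seg lo m"
          proof -
            have "strs s2 ` seg lo m = strs s ` \<pi> ` seg lo m" using eq by (simp add: image_image)
            then show ?thesis by (simp only: \<pi>(1))
          qed
          have inj: "inj_on (strs s2) (seg lo m)"
          proof -
            have "inj_on (strs s \<circ> \<pi>) (seg lo m)" using \<pi> I by (intro comp_inj_on) (auto simp: I_def)
            then show ?thesis using eq by (subst inj_on_cong[of _ _ "strs s \<circ> \<pi>"]) auto
          qed
          have le: "node_val s0 j (strs s2 i) \<le> thr s0 j" if "i \<in> {lo..<Suc ?mid}" for i
            using that I False p(5) mid by (cases "i = ?mid") (auto simp: e2 I_def)
          have gt: "\<not> node_val s0 j (strs s2 i) \<le> thr s0 j" if "i \<in> {Suc ?mid..<lo + Suc k}" for i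
            using that I p(5) mid by (cases "i = lo + k") (auto simp: e2 I_def)
          show "I (Suc k) (exe E ?end s1)"
            using u2 im inj le gt I mid unfolding s2_def[symmetric] I_def
            by (auto simp: e2(1))
        qed simp_all
      qed
    qed simp
    then show "bval (NLess (V 8) (V 6)) s \<and> det ?body s 9 (I (Suc k))"
      using k by (simp add: v u)
  next
    fix s assume "I m s"
    then show "\<not> bval (NLess (V 8) (V 6)) s" using p by (auto simp: I_def upd_def)
  qed simp_all
  have "det partition_prog s0 (m * 10 + 3) (I m)"
    unfolding partition_prog_def
  proof (rule det_Seq)
    show "det ?init s0 2 (I 0)"
      by (rule det_exe) (use sz p sg in \<open>auto simp: I_def upd_def segment_def\<close>)
    show "det (While (NLess (V 8) (V 6)) ?body) s1 (m * 10 + 1) (I m)" if "I 0 s1" for s1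
      using loop[OF that] .
  qed simp
  then show ?thesis by (rule det_mono) (auto simp: I_def)
qed



section \<open>Processing a single node\<close>

lemma det_children:
  assumes p: "nats s 3 = cnt" "nats s 4 = j" "nats s 5 = lo" "nats s 6 = hi" "nats s 11 = mid" "j < cnt"
    and sz: "cnt + 2 < 2 ^ \<beta>" "hi < 2 ^ \<beta>" "lo \<le> hi" "mid \<le> hi"
  shows "det children_prog s 12 (\<lambda>s'. strs s' = strs s \<and> reals s' = reals s \<and>
    nats s' = (let f = (if mid < hi then (nats s)(fa 0 cnt := mid, fa 1 cnt := hi, fa 3 j := cnt, 3 := Suc cnt)
        else (nats s)(fa 3 j := j))
      in if 0 < nats s (fa 2 j) then f(fa 0 (f 3) := lo, fa 1 (f 3) := mid, 3 := Suc (f 3)) else f))"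
proof (rule det_exe)
  have jl: "j < 2 ^ \<beta>" using sz p(6) by linarith
  show "safe E \<beta> \<kappa> \<mu> children_prog s"
    using sz p(6) by (simp add: children_prog_def p fa_eq fa_neq jl)
  show "strs (exe E children_prog s) = strs s \<and> reals (exe E children_prog s) = reals s \<and>
    nats (exe E children_prog s) = (let f = (if mid < hi then (nats s)(fa 0 cnt := mid, fa 1 cnt := hi, fa 3 j := cnt, 3 := Suc cnt)
        else (nats s)(fa 3 j := j))
      in if 0 < nats s (fa 2 j) then f(fa 0 (f 3) := lo, fa 1 (f 3) := mid, 3 := Suc (f 3)) else f)"
    using p(6) by (simp add: children_prog_def p fa_eq fa_neq Let_def)
qed (simp_all add: children_prog_def)

definition ball_node :: "state \<Rightarrow> nat \<Rightarrow> bits set \<Rightarrow> bool" where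
  "ball_node s j Q \<longleftrightarrow> nats s (fa 2 j) = 0 \<and> dense Q (str s j) \<and> thr s j = R"

definition cut_node :: "state \<Rightarrow> nat \<Rightarrow> bits list \<Rightarrow> real \<Rightarrow> bool" where
  "cut_node s j zs u \<longleftrightarrow> (\<nexists>c. dense (set zs) c) \<and> str s j = embed_fun E zs \<and>
     (\<exists>a. nats s (fa 2 j) = Suc a \<and>
       cut_at d (lowest (str s j) (set zs)) (width (str s j) (set zs)) (u * tot_width (str s j) (set zs)) a (thr s j))"

definition split_node :: "state \<Rightarrow> nat \<Rightarrow> bits list \<Rightarrow> real \<Rightarrow> bool" where
  "split_node s j zs u \<longleftrightarrow> (if \<exists>c. dense (set zs) c then ball_node s j (set zs) else cut_node s j zs u)"

lemma split_node_upd: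
  assumes "split_node s j zs u" "upd A B C s s'" "fa 2 j \<notin> A" "16 + 3 * d + j \<notin> B" "Suc (N * n + j) \<notin> C"
  shows "split_node s' j zs u"
proof -
  have *: "nats s' (fa 2 j) = nats s (fa 2 j)" "thr s' j = thr s j" "str s' j = str s j"
    using assms by (auto simp: upd_def)
  show ?thesis using assms(1) unfolding split_node_def ball_node_def cut_node_def by (simp only: *)
qed

lemma split_node_ok:
  assumes "split_node s j zs u" "distinct zs" "set zs \<subseteq> P"
  shows "node_ok s j"
proof (cases "\<exists>c. dense (set zs) c")
  case True
  then show ?thesis using assms P_M by (auto simp: split_node_def ball_node_def node_ok_def dense_def)
next
  case False
  then show ?thesis using assms apply_length by (auto simp: split_node_def cut_node_def node_ok_def cut_at_def)
qed

text \<open>The centre of a ball has distance 0 from itself, and the threshold of a cut is at least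
  the lowest value. So the part below the threshold is never empty, and the far set of a ball is a
  proper subset.\<close>

lemma split_node_low:
  assumes s: "split_node s j zs u" and zs: "distinct zs" "set zs \<subseteq> P" "zs \<noteq> []"
  shows "\<exists>y\<in>set zs. node_val s j y \<le> thr s j"
proof (cases "\<exists>c. dense (set zs) c")
  case True
  then have b: "ball_node s j (set zs)" using s by (simp add: split_node_def)
  then have "str s j \<in> set zs" "dM (str s j) (str s j) = 0"
    using zs P_M Metric_space.mdist_zero[OF metric] by (auto simp: ball_node_def dense_def)
  then show ?thesis using b R_pos by (intro bexI[of _ "str s j"]) (auto simp: node_val_def ball_node_def)
next
  case False
  then have c: "cut_node s j zs u" using s by (simp add: split_node_def)
  then obtain a where a: "nats s (fa 2 j) = Suc a" "lowest (str s j) (set zs) a \<le> thr s j"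
    by (auto simp: cut_node_def cut_at_def)
  have "lowest (str s j) (set zs) a \<in> (\<lambda>x. coord (str s j) x a) ` set zs"
    unfolding lowest_def using zs by (intro Min_in) auto
  then obtain y where "y \<in> set zs" "lowest (str s j) (set zs) a = coord (str s j) y a" by blast
  then show ?thesis using a by (intro bexI[of _ y]) (auto simp: node_val_def)
qed

text \<open>The range of thresholds is half-open, so a point with the highest value lies strictly
  above. Together with \<open>split_node_low\<close> both parts of a cut are nonempty, which is what
  bounds the number of nodes.\<close>

lemma cut_node_high:
  assumes c: "cut_node s j zs u" and zs: "zs \<noteq> []"
  shows "\<exists>y\<in>set zs. \<not> node_val s j y \<le> thr s j"
proof -
  obtain a where a: "nats s (fa 2 j) = Suc a" "thr s j < lowest (str s j) (set zs) a + width (str s j) (set zs) a"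
    using c by (auto simp: cut_node_def cut_at_def)
  have "lowest (str s j) (set zs) a + width (str s j) (set zs) a \<in> (\<lambda>x. coord (str s j) x a) ` set zs"
    unfolding lowest_def width_def using zs Max_in[of "(\<lambda>x. coord (str s j) x a) ` set zs"] by simp
  then obtain y where "y \<in> set zs" "lowest (str s j) (set zs) a + width (str s j) (set zs) a = coord (str s j) y a" by blast
  then show ?thesis using a by (intro bexI[of _ y]) (auto simp: node_val_def)
qed

definition grown :: "state \<Rightarrow> nat \<Rightarrow> nat \<Rightarrow> nat \<Rightarrow> nat \<Rightarrow> bits list \<Rightarrow> real \<Rightarrow> nat \<Rightarrow> bool" where
  "grown s j cnt lo m zs u mid \<longleftrightarrow> split_node s j zs u \<and>
    strs s ` seg lo m = set zs \<and> inj_on (strs s) (seg lo m) \<and> lo < mid \<and> mid \<le> lo + m \<and>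
    strs s ` {lo..<mid} = {y \<in> set zs. node_val s j y \<le> thr s j} \<and>
    strs s ` {mid..<lo + m} = {y \<in> set zs. \<not> node_val s j y \<le> thr s j} \<and>
    (if nats s (fa 2 j) = 0
     then if mid < lo + m
       then nats s (fa 3 j) = cnt \<and> nats s 3 = Suc cnt \<and> nats s (fa 0 cnt) = mid \<and> nats s (fa 1 cnt) = lo + m
       else nats s (fa 3 j) = j \<and> nats s 3 = cnt
     else mid < lo + m \<and> nats s (fa 3 j) = cnt \<and> nats s 3 = Suc (Suc cnt) \<and>
       nats s (fa 0 cnt) = mid \<and> nats s (fa 1 cnt) = lo + m \<and>
       nats s (fa 0 (Suc cnt)) = lo \<and> nats s (fa 1 (Suc cnt)) = mid)"

definition processed :: "state \<Rightarrow> state \<Rightarrow> nat \<Rightarrow> nat \<Rightarrow> nat \<Rightarrow> nat \<Rightarrow> bits list \<Rightarrow> nat \<Rightarrow> bool" where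
  "processed s0 s j cnt lo m zs mid \<longleftrightarrow>
    upd ({3, 5, 6, 7, 8, 9, 10, 11, 12} \<union> {fa 2 j, fa 3 j, fa 0 cnt, fa 1 cnt, fa 0 (Suc cnt), fa 1 (Suc cnt)})
      ({8, 9, 10, 11, 12} \<union> {16..<16 + 3 * d} \<union> {16 + 3 * d + j}) ({0, Suc (N * n + j)} \<union> seg lo m) s0 s \<and>
    grown s j cnt lo m zs (reals s0 6) mid"

lemma det_split:
  assumes sg: "segment s0 lo m" and j: "nats s0 4 = j"
    and zs: "zs = map (strs s0) [lo..<lo + m]"
    and u: "0 \<le> reals s0 6" "reals s0 6 < 1" and emb: "2000 * \<beta> + embed_time E \<le> \<kappa>"
  shows "det (dense_prog ;; Cond (NLess (NLit 0) (V 10)) ball_prog cut_prog) s0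
      (m * (m * 5 + 8) + d * (m * 9 + 16) + 14) (\<lambda>s.
    upd {7, 8, 9, 10, 12, fa 2 j} ({8, 9, 10, 11, 12} \<union> {16..<16 + 3 * d} \<union> {16 + 3 * d + j}) {Suc (N * n + j)} s0 s \<and>
    split_node s j zs (reals s0 6))"
proof (rule det_Seq)
  let ?A = "{7, 8, 9, 10, 12, fa 2 j}" and ?B = "{8, 9, 10, 11, 12} \<union> {16..<16 + 3 * d} \<union> {16 + 3 * d + j}"
  let ?C = "{Suc (N * n + j)}"
  show "det dense_prog s0 (m * (m * 5 + 8) + 3) (\<lambda>s. upd {7, 8, 9, 10} {8} {} s0 s \<and>
    (nats s 10 = 0 \<and> (\<forall>x\<in>seg lo m. \<not> m \<le> 2 * card (near_cells s0 x lo m)) \<or>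
     nats s 10 \<in> seg lo m \<and> m \<le> 2 * card (near_cells s0 (nats s 10) lo m)))"
    by (rule det_dense[OF sg])
  fix s1 assume s1: "upd {7, 8, 9, 10} {8} {} s0 s1 \<and>
    (nats s1 10 = 0 \<and> (\<forall>x\<in>seg lo m. \<not> m \<le> 2 * card (near_cells s0 x lo m)) \<or>
     nats s1 10 \<in> seg lo m \<and> m \<le> 2 * card (near_cells s0 (nats s1 10) lo m))"
  have sg1: "segment s1 lo m" using s1 by (intro segment_upd[OF sg, of "{7, 8, 9, 10}" "{8}" "{}"]) auto
  have st: "strs s1 = strs s0" "nats s1 4 = j" "reals s1 6 = reals s0 6" using s1 j by (auto simp: upd_def)
  have Q: "set zs = strs s0 ` seg lo m" "distinct zs" "set zs \<subseteq> P" using segment_points[OF sg] by (auto simp: zs)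
  show "det (Cond (NLess (NLit 0) (V 10)) ball_prog cut_prog) s1 (d * (m * 9 + 16) + 11) (\<lambda>s.
    upd ?A ?B ?C s0 s \<and> split_node s j zs (reals s0 6))"
  proof (rule det_Cond[where ?k1.0 = "d * (m * 9 + 16) + 9"])
    assume "bval (NLess (NLit 0) (V 10)) s1"
    then have b: "nats s1 10 \<in> seg lo m" "m \<le> 2 * card (near_cells s0 (nats s1 10) lo m)" using s1 by auto
    then have D: "dense (set zs) (strs s0 (nats s1 10))" using dense_iff_near_cells[OF sg b(1)] Q by simp
    have p1: "params s1" using sg1 by (simp add: segment_def)
    show "det ball_prog s1 (d * (m * 9 + 16) + 9) (\<lambda>s. upd ?A ?B ?C s0 s \<and> split_node s j zs (reals s0 6))"
      unfolding ball_prog_def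
    proof (rule det_exe)
      let ?c = "SCopy (sad (V 4)) (V 10) ;; NSet (fld 2 (V 4)) (NLit 0) ;; RSet (tad (V 4)) (X 4)"
      have "strs s0 (nats s1 10) \<in> M" using b(1) segment_M[OF sg] by blast
      then show "safe E \<beta> \<kappa> \<mu> ?c s1" using M_len by (simp add: st)
      define s2 where "s2 = exe E ?c s1"
      have e2: "nats s2 = (nats s1)(fa 2 j := 0)" "strs s2 = (strs s0)(Suc (N * n + j) := strs s0 (nats s1 10))"
        "reals s2 = (reals s1)(16 + 3 * d + j := R)"
        using p1 fa_ge[of 2 j] by (simp_all add: s2_def st params_def fa_neq)
      have "upd ?A ?B ?C s0 s2" using s1 unfolding upd_def e2 by auto
      moreover have "split_node s2 j zs (reals s0 6)"
        using D by (auto simp: split_node_def ball_node_def e2)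
      ultimately show "upd ?A ?B ?C s0 (exe E ?c s1) \<and> split_node (exe E ?c s1) j zs (reals s0 6)"
        by (simp only: s2_def)
    qed simp_all
  next
    assume "\<not> bval (NLess (NLit 0) (V 10)) s1"
    then have "\<forall>x\<in>seg lo m. \<not> m \<le> 2 * card (near_cells s0 x lo m)" using s1 sg by (auto simp: segment_def)
    then have sparse: "\<not> dense (set zs) c" for c
      using dense_iff_near_cells[OF sg] Q by (auto simp: dense_def)
    have zs1: "zs = map (strs s1) [lo..<lo + m]" "set zs = strs s1 ` seg lo m" using Q st zs by auto
    show "det cut_prog s1 (d * (m * 9 + 16) + 9) (\<lambda>s. upd ?A ?B ?C s0 s \<and> split_node s j zs (reals s0 6))"
    proof (rule det_mono[OF det_cut[OF sg1 st(2) zs1 refl sparse _ _ emb]])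
      fix s' assume s': "upd {8, 12, fa 2 j} ?B ?C s1 s' \<and> str s' j = embed_fun E zs \<and>
        (\<exists>i t. cut_at d (lowest (embed_fun E zs) (set zs)) (width (embed_fun E zs) (set zs))
           (reals s1 6 * tot_width (embed_fun E zs) (set zs)) i t \<and> nats s' (fa 2 j) = Suc i \<and> thr s' j = t)"
      have "upd ?A ?B ?C s0 s'"
        using conjunct1[OF s'] s1 by (intro upd_trans[OF conjunct1[OF s1], of "{8, 12, fa 2 j}" ?B ?C s']) auto
      then show "upd ?A ?B ?C s0 s' \<and> split_node s' j zs (reals s0 6)"
        using s' sparse by (auto simp: split_node_def cut_node_def st)
    qed (use u st in auto)
  qed simp_all
qed simp

lemma det_process:
  assumes p: "params s0" "nats s0 3 = cnt" "nats s0 4 = j" "j < cnt" "nats s0 (fa 0 j) = lo" "nats s0 (fa 1 j) = lo + m"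
    and m: "0 < m" "1 \<le> lo" "lo + m \<le> Suc (N * n)"
    and pts: "strs s0 ` seg lo m \<subseteq> P" "inj_on (strs s0) (seg lo m)"
    and zs: "zs = map (strs s0) [lo..<lo + m]"
    and u: "0 \<le> reals s0 6" "reals s0 6 < 1" and emb: "2000 * \<beta> + embed_time E \<le> \<kappa>" and cnt: "cnt + 2 < 2 ^ \<beta>"
  shows "det process_prog s0 (m * (m * 5 + 8) + d * (m * 9 + 16) + m * 10 + 31)
     (\<lambda>s. \<exists>mid. processed s0 s j cnt lo m zs mid)"
proof -
  let ?B = "{8, 9, 10, 11, 12} \<union> {16..<16 + 3 * d} \<union> {16 + 3 * d + j}"
  have zs': "distinct zs" "set zs \<subseteq> P" "zs \<noteq> []" "set zs = strs s0 ` seg lo m"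
    using pts m by (auto simp: zs distinct_map)
  have sz: "lo + m < 2 ^ \<beta>" using size m by (simp add: mult.commute)
  let ?init = "NSet (NLit 5) (NMem (fld 0 (V 4))) ;; NSet (NLit 6) (NMem (fld 1 (V 4)))"
  let ?split = "dense_prog ;; Cond (NLess (NLit 0) (V 10)) ball_prog cut_prog"
  have "det (?init ;; ?split ;; partition_prog ;; children_prog) s0
     (m * (m * 5 + 8) + d * (m * 9 + 16) + m * 10 + 31) (\<lambda>s. \<exists>mid. processed s0 s j cnt lo m zs mid)"
  proof (rule det_Seq)
    show "det ?init s0 2 (\<lambda>s. upd {5, 6} {} {} s0 s \<and> nats s 5 = lo \<and> nats s 6 = lo + m)"
      by (rule det_exe) (use p sz fa_neq in \<open>auto simp: upd_def\<close>)
    fix s1 assume s1: "upd {5, 6} {} {} s0 s1 \<and> nats s1 5 = lo \<and> nats s1 6 = lo + m"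
    have v1: "nats s1 4 = j" "strs s1 = strs s0" "reals s1 6 = reals s0 6" "params s1" "nats s1 3 = cnt"
      using s1 p by (auto simp: upd_def params_def)
    have sg1: "segment s1 lo m" using s1 v1 m pts by (simp add: segment_def)
    show "det (?split ;; partition_prog ;; children_prog) s1
      (m * (m * 5 + 8) + d * (m * 9 + 16) + m * 10 + 29) (\<lambda>s. \<exists>mid. processed s0 s j cnt lo m zs mid)"
    proof (rule det_Seq)
      show "det ?split s1 (m * (m * 5 + 8) + d * (m * 9 + 16) + 14) (\<lambda>s.
        upd {7, 8, 9, 10, 12, fa 2 j} ?B {Suc (N * n + j)} s1 s \<and> split_node s j zs (reals s1 6))"
        using v1 u zs by (intro det_split[OF sg1 v1(1) _ _ _ emb]) auto
      fix s2 assume s2: "upd {7, 8, 9, 10, 12, fa 2 j} ?B {Suc (N * n + j)} s1 s2 \<and> split_node s2 j zs (reals s1 6)"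
      have v2: "nats s2 4 = j" "nats s2 3 = cnt"
        using s2 v1 fa_neq(2)[of 4 2 j] fa_neq(2)[of 3 2 j] by (auto simp: upd_def)
      have sg2: "segment s2 lo m"
        using m fa_ge[of 2 j] by (intro segment_upd[OF sg1 conjunct1[OF s2]]) auto
      have st2: "strs s2 ` seg lo m = set zs"
        unfolding zs'(4) using s2 v1 m by (intro image_cong) (auto simp: upd_def)
      have ok2: "node_ok s2 j" using s2 split_node_ok zs' by blast
      show "det (partition_prog ;; children_prog) s2 (m * 10 + 15) (\<lambda>s. \<exists>mid. processed s0 s j cnt lo m zs mid)"
      proof (rule det_Seq[OF det_partition[OF sg2 v2(1) ok2]])
        fix s3 assume s3: "upd {8, 11} ({8} \<union> vec_cells) ({0} \<union> seg lo m) s2 s3 \<and>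
          strs s3 ` seg lo m = strs s2 ` seg lo m \<and> inj_on (strs s3) (seg lo m) \<and> lo \<le> nats s3 11 \<and> nats s3 11 \<le> lo + m \<and>
          (\<forall>i\<in>{lo..<nats s3 11}. node_val s2 j (strs s3 i) \<le> thr s2 j) \<and>
          (\<forall>i\<in>{nats s3 11..<lo + m}. \<not> node_val s2 j (strs s3 i) \<le> thr s2 j)"
        define mid where "mid = nats s3 11"
        note u23 = conjunct1[OF s3]
        have f2: "fa 2 j \<notin> {8, 11}" using fa_neq(1)[of _ 2 j] by auto
        have oc: "16 + 3 * d + j \<notin> {8} \<union> vec_cells" "Suc (N * n + j) \<notin> {0} \<union> seg lo m" using m by auto
        have v3: "nats s3 3 = cnt" "nats s3 4 = j" "nats s3 5 = lo" "nats s3 6 = lo + m"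
          using updD(1)[OF u23] v2 sg2 by (auto simp: segment_def)
        have k3: "nats s3 (fa 2 j) = nats s2 (fa 2 j)" "thr s3 j = thr s2 j" "str s3 j = str s2 j"
          using updD(1)[OF u23 f2] updD(2)[OF u23 oc(1)] updD(3)[OF u23 oc(2)] by simp_all
        have nv3: "node_val s3 j x = node_val s2 j x" for x using k3 by (simp add: node_val_def)
        have sn3: "split_node s3 j zs (reals s0 6)"
          using split_node_upd[OF conjunct2[OF s2] u23 f2 oc] v1(3) by simp
        have img: "strs s3 ` seg lo m = set zs" using s3 st2 by simp
        have left: "strs s3 ` {lo..<mid} = {y \<in> set zs. node_val s3 j y \<le> thr s3 j}"
          and right: "strs s3 ` {mid..<lo + m} = {y \<in> set zs. \<not> node_val s3 j y \<le> thr s3 j}"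
        proof -
          have a: "i \<in> {lo..<mid} \<Longrightarrow> node_val s3 j (strs s3 i) \<le> thr s3 j"
            and b: "i \<in> {mid..<lo + m} \<Longrightarrow> \<not> node_val s3 j (strs s3 i) \<le> thr s3 j" for i
            using s3 unfolding nv3 k3(2) mid_def by blast+
          have "lo \<le> mid" "mid \<le> lo + m" using s3 unfolding mid_def by blast+
          then have sp: "seg lo m = {lo..<mid} \<union> {mid..<lo + m}" by auto
          show "strs s3 ` {lo..<mid} = {y \<in> set zs. node_val s3 j y \<le> thr s3 j}"
            using a b unfolding img[symmetric] sp by blast
          show "strs s3 ` {mid..<lo + m} = {y \<in> set zs. \<not> node_val s3 j y \<le> thr s3 j}"
            using a b unfolding img[symmetric] sp by blast
        qed
        have mid: "lo < mid" "mid \<le> lo + m"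
        proof -
          have "{y \<in> set zs. node_val s3 j y \<le> thr s3 j} \<noteq> {}" using split_node_low[OF sn3] zs' by blast
          then have "{lo..<mid} \<noteq> {}" unfolding left[symmetric] by blast
          then show "lo < mid" by simp
          show "mid \<le> lo + m" using s3 unfolding mid_def by blast
        qed
        have midc: "mid < lo + m" if "nats s3 (fa 2 j) \<noteq> 0"
        proof -
          have "cut_node s3 j zs (reals s0 6)" using sn3 that unfolding split_node_def ball_node_def by metis
          then have "{y \<in> set zs. \<not> node_val s3 j y \<le> thr s3 j} \<noteq> {}" using cut_node_high zs' by blast
          then have "{mid..<lo + m} \<noteq> {}" unfolding right[symmetric] by blast
          then show ?thesis by simp
        qed
        have u3: "upd ({3, 5, 6, 7, 8, 9, 10, 11, 12} \<union> {fa 2 j, fa 3 j, fa 0 cnt, fa 1 cnt, fa 0 (Suc cnt), fa 1 (Suc cnt)})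
          ?B ({0, Suc (N * n + j)} \<union> seg lo m) s0 s3"
        proof -
          have "upd ({5, 6} \<union> {7, 8, 9, 10, 12, fa 2 j}) ?B {Suc (N * n + j)} s0 s2"
            by (rule upd_trans[OF conjunct1[OF s1] conjunct1[OF s2]]) auto
          then show ?thesis by (rule upd_trans[OF _ conjunct1[OF s3]]) auto
        qed
        show "det children_prog s3 12 (\<lambda>s. \<exists>mid. processed s0 s j cnt lo m zs mid)"
        proof (rule det_mono[OF det_children[OF v3 mid_def[symmetric] p(4) cnt sz _ mid(2)]])
          fix s4 :: state assume s4: "strs s4 = strs s3 \<and> reals s4 = reals s3 \<and>
            nats s4 = (let f = (if mid < lo + m then (nats s3)(fa 0 cnt := mid, fa 1 cnt := lo + m, fa 3 j := cnt, 3 := Suc cnt)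
                else (nats s3)(fa 3 j := j))
              in if 0 < nats s3 (fa 2 j) then f(fa 0 (f 3) := lo, fa 1 (f 3) := mid, 3 := Suc (f 3)) else f)"
          have st4: "strs s4 = strs s3" "reals s4 = reals s3" using s4 by (simp_all only:)
          note n4 = conjunct2[OF conjunct2[OF s4]]
          have u4: "upd {3, fa 3 j, fa 0 cnt, fa 1 cnt, fa 0 (Suc cnt), fa 1 (Suc cnt)} {} {} s3 s4"
            using v3(1) p(4) midc unfolding upd_def st4 n4 Let_def
            by (cases "mid < lo + m"; cases "0 < nats s3 (fa 2 j)") (simp_all add: fa_eq fa_neq)
          have sn4: "split_node s4 j zs (reals s0 6)"
            using p(4) by (intro split_node_upd[OF sn3 u4]) (auto simp: fa_eq fa_neq)
          have k4: "nats s4 (fa 2 j) = nats s3 (fa 2 j)"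
            using updD(1)[OF u4, of "fa 2 j"] p(4) by (simp add: fa_eq fa_neq)
          have nv4: "node_val s4 j x = node_val s3 j x" for x by (simp only: node_val_def k4 st4)
          have u04: "upd ({3, 5, 6, 7, 8, 9, 10, 11, 12} \<union> {fa 2 j, fa 3 j, fa 0 cnt, fa 1 cnt, fa 0 (Suc cnt), fa 1 (Suc cnt)})
            ?B ({0, Suc (N * n + j)} \<union> seg lo m) s0 s4"
            by (rule upd_trans[OF u3 u4]) auto
          have ch: "if nats s4 (fa 2 j) = 0
            then if mid < lo + m
              then nats s4 (fa 3 j) = cnt \<and> nats s4 3 = Suc cnt \<and> nats s4 (fa 0 cnt) = mid \<and> nats s4 (fa 1 cnt) = lo + m
              else nats s4 (fa 3 j) = j \<and> nats s4 3 = cnt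
            else mid < lo + m \<and> nats s4 (fa 3 j) = cnt \<and> nats s4 3 = Suc (Suc cnt) \<and>
              nats s4 (fa 0 cnt) = mid \<and> nats s4 (fa 1 cnt) = lo + m \<and>
              nats s4 (fa 0 (Suc cnt)) = lo \<and> nats s4 (fa 1 (Suc cnt)) = mid"
          proof (cases "nats s3 (fa 2 j) = 0")
            case True
            then have n4: "nats s4 = (if mid < lo + m then (nats s3)(fa 0 cnt := mid, fa 1 cnt := lo + m, fa 3 j := cnt, 3 := Suc cnt)
                else (nats s3)(fa 3 j := j))" unfolding n4 by (simp add: Let_def)
            show ?thesis using True p(4) v3(1) unfolding k4 n4 by (simp add: fa_eq fa_neq)
          next
            case False
            then have n4: "nats s4 = (nats s3)(fa 0 cnt := mid, fa 1 cnt := lo + m, fa 3 j := cnt, 3 := Suc cnt,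
                fa 0 (Suc cnt) := lo, fa 1 (Suc cnt) := mid, 3 := Suc (Suc cnt))"
              using midc unfolding n4 by (simp add: Let_def)
            show ?thesis using False midc p(4) unfolding k4 n4 by (simp add: fa_eq fa_neq)
          qed
          have "processed s0 s4 j cnt lo m zs mid"
            unfolding processed_def grown_def nv4 st4 using u04 sn4 img mid left right s3 ch by blast
          then show "\<exists>mid. processed s0 s4 j cnt lo m zs mid" ..
        qed (use mid in auto)
      qed simp
    qed simp
  qed simp
  then show ?thesis unfolding process_prog_def .
qed


section \<open>Sampling a grid position\<close>

definition B :: nat where
  "B = (LEAST b. 2 * real d * real d * \<Delta> \<le> r * 2 ^ b)"

lemma B_resolution: "2 * real d * real d * \<Delta> \<le> r * 2 ^ B"
proof -
  obtain b where "2 * real d * real d * \<Delta> / r < 2 ^ b" using real_arch_pow[of 2] by auto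
  then have "2 * real d * real d * \<Delta> \<le> r * 2 ^ b" using r_pos by (simp add: pos_divide_less_eq mult.commute)
  then show ?thesis unfolding B_def by (rule LeastI)
qed

lemma B_minimal: "i < B \<Longrightarrow> r * 2 ^ i < 2 * real d * real d * \<Delta>"
  unfolding B_def using not_less_Least by force

text \<open>The order of magnitude is logarithmic, but \<open>Suc b \<le> 2 ^ b\<close> with the
  minimality of \<open>B\<close> gives a linear bound, and this suffices for a polynomial
  pre-processing time.\<close>

lemma B_le: "real B \<le> 2 * real d * real d * \<Delta> / r"
proof (cases B)
  case 0
  then show ?thesis using r_pos Delta_pos by simp
next
  case (Suc b)
  have "real B \<le> 2 ^ b" using less_exp[of b] unfolding Suc
    by (metis Suc_leI of_nat_le_iff of_nat_numeral of_nat_power)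
  also have "\<dots> \<le> 2 * real d * real d * \<Delta> / r"
    using B_minimal[of b] Suc r_pos by (simp add: pos_le_divide_eq mult.commute)
  finally show ?thesis .
qed

lemma runs_sample:
  assumes p: "params s0" and l: "length l = B"
  shows "runs sample_prog s0 l (B * 4 + 3) (\<lambda>s l'. l' = [] \<and> upd {13} {6, 7} {} s0 s \<and> reals s 6 = real (unum l) / 2 ^ B)"
proof -
  define I where "I i s l' \<longleftrightarrow> (\<exists>l1. l = l1 @ l' \<and> length l1 = i \<and> upd {13} {6, 7} {} s0 s \<and>
    reals s 7 = 1 / 2 ^ i \<and> reals s 6 = real (unum l1) / 2 ^ i)" for i s l'
  let ?init = "RSet (NLit 6) (RNat (NLit 0)) ;; RSet (NLit 7) (RNat (NLit 1))"
  let ?b = "RLess (X 3) (RMul (X 7) (RMul (RMul (RNat (NLit 2)) (RMul (RNat (V 1)) (RNat (V 1)))) (X 2)))"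
  let ?upd = "RSet (NLit 7) (RDiv (X 7) (RNat (NLit 2))) ;; RSet (NLit 6) (RAdd (X 6) (RMul (X 7) (RNat (V 13))))"
  let ?body = "Flip (NLit 13) ;; ?upd"
  have bv: "bval ?b s \<longleftrightarrow> r * 2 ^ i < 2 * real d * real d * \<Delta>" if "I i s l'" for i s l'
  proof -
    have "nats s (Suc 0) = d" "reals s 2 = \<Delta>" "reals s 3 = r" "reals s 7 = 1 / 2 ^ i"
      using that p by (auto simp: I_def upd_def params_def)
    then show ?thesis by (simp add: pos_less_divide_eq mult.assoc)
  qed
  have "runs sample_prog s0 l (B * 4 + 3) (I B)"
    unfolding sample_prog_def
  proof (rule runs_Seq)
    show "runs ?init s0 l 2 (I 0)"
      by (rule runs_exe) (auto simp: I_def upd_def)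
    fix s1 l1 assume "I 0 s1 l1"
    then show "runs (While ?b ?body) s1 l1 (B * 4 + 1) (I B)"
    proof (rule runs_for[where ?k1.0 = 3, rotated 2])
      fix i s l' assume I: "I i s l'" and i: "i < B"
      then obtain l1 where l1: "l = l1 @ l'" "length l1 = i" "upd {13} {6, 7} {} s0 s"
        "reals s 7 = 1 / 2 ^ i" "reals s 6 = real (unum l1) / 2 ^ i" by (auto simp: I_def)
      then obtain x l2 where l2: "l' = x # l2" using i l by (cases l') auto
      have "runs ?body s l' 3 (I (Suc i))"
        unfolding l2
      proof (rule runs_Seq)
        show "runs (Flip (NLit 13)) s (x # l2) 1 (\<lambda>s' l'. l' = l2 \<and> s' = s\<lparr>nats := (nats s)(13 := of_bool x)\<rparr>)"
          by (rule runs_Flip) auto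
        fix s2 l3 assume s2: "l3 = l2 \<and> s2 = s\<lparr>nats := (nats s)(13 := of_bool x)\<rparr>"
        show "runs ?upd s2 l3 2 (I (Suc i))"
        proof (rule runs_exe)
          have "real (unum l1) / 2 ^ i + 1 / 2 ^ i / 2 * of_bool x = real (unum (l1 @ [x])) / 2 ^ Suc i"
            by (simp add: unum_snoc field_simps)
          then show "I (Suc i) (exe E ?upd s2) l3"
            using l1 l2 s2 unfolding I_def by (intro exI[of _ "l1 @ [x]"]) (auto simp: upd_def)
        qed (simp_all add: s2)
      qed simp
      moreover have "bval ?b s" using bv[OF I] B_minimal[OF i] by blast
      ultimately show "bval ?b s \<and> runs ?body s l' 3 (I (Suc i))" by blast
    next
      fix s l' assume "I B s l'"
      then show "\<not> bval ?b s" using bv[of B s l'] B_resolution by simp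
    qed simp_all
  qed simp
  then show ?thesis
    by (rule runs_mono) (use l in \<open>auto simp: I_def\<close>)
qed

text \<open>The tree of a node: every tree has its own block of \<open>n\<close> string cells.\<close>

definition own :: "state \<Rightarrow> nat \<Rightarrow> nat" where
  "own s i = (nats s (fa 0 i) - 1) div n"

definition proc_ok :: "state \<Rightarrow> nat \<Rightarrow> bool" where
  "proc_ok s i \<longleftrightarrow> nats s (fa 2 i) \<le> d \<and>
    (if nats s (fa 2 i) = 0
     then str s i \<in> P \<and> nats s (fa 3 i) < nats s 3 \<and> own s (nats s (fa 3 i)) = own s i
     else (\<exists>zs. distinct zs \<and> set zs \<subseteq> P \<and> str s i = embed_fun E zs) \<and> Suc (nats s (fa 3 i)) < nats s 3 \<and>
       own s (nats s (fa 3 i)) = own s i \<and> own s (Suc (nats s (fa 3 i))) = own s i)"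

definition cell_ok :: "state \<Rightarrow> nat \<Rightarrow> bool" where
  "cell_ok s i \<longleftrightarrow> 1 \<le> nats s (fa 0 i) \<and> nats s (fa 0 i) < nats s (fa 1 i) \<and>
     nats s (fa 1 i) \<le> Suc (n * Suc (own s i)) \<and> own s i < N"

definition cells :: "state \<Rightarrow> nat \<Rightarrow> nat set" where
  "cells s i = {nats s (fa 0 i)..<nats s (fa 1 i)}"

text \<open>The limits are the extents charged as space. There are at most
  \<open>2 * (N * n)\<close> nodes with four number cells each, and the slots for two new nodes
  beyond them turn the base 32 into 40. String cell 0 is exempt, being swap buffer and query
  cell.\<close>

definition mem_ok :: "state \<Rightarrow> bool" where
  "mem_ok s \<longleftrightarrow> (\<forall>a\<ge>40 + 8 * (N * n). nats s a = 0) \<and> (\<forall>a\<ge>16 + 3 * d + 2 * (N * n). reals s a = 0) \<and>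
     (\<forall>a\<ge>Suc (3 * (N * n)). strs s a = []) \<and> (\<forall>a\<ge>1. length (strs s a) \<le> \<mu>)"

text \<open>Below a pending node with \<open>k\<close> points at most \<open>2 (k - 1)\<close> further nodes are created.\<close>

definition weight :: "state \<Rightarrow> nat \<Rightarrow> nat" where
  "weight s i = 2 * (nats s (fa 1 i) - nats s (fa 0 i) - 1)"

text \<open>Nodes below \<open>j\<close> are processed, the others pending. Disjointness is required
  for the segments of pending nodes only, since a processed node shares its cells with its
  descendants. The sum of the weights reserves room for all nodes still to be created.\<close>

definition forest_inv :: "nat \<Rightarrow> state \<Rightarrow> bool" where
  "forest_inv j s \<longleftrightarrow> params s \<and> nats s 4 = j \<and> mem_ok s \<and> N \<le> nats s 3 \<and>
     nats s 3 + (\<Sum>i\<in>{j..<nats s 3}. weight s i) \<le> 2 * (N * n) \<and>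
     (\<forall>i<nats s 3. cell_ok s i) \<and> (\<forall>i<N. own s i = i) \<and>
     (\<forall>i\<in>{j..<nats s 3}. \<forall>i'\<in>{j..<nats s 3}. i \<noteq> i' \<longrightarrow> cells s i \<inter> cells s i' = {}) \<and>
     (\<forall>i\<in>{j..<nats s 3}. inj_on (strs s) (cells s i) \<and> strs s ` cells s i \<subseteq> P) \<and>
     (\<forall>i<nats s 3. i < j \<longrightarrow> proc_ok s i)"

text \<open>The abstract forest represented by the memory. A pending node is taken as a set of
  points, so the order in which earlier partitions left its segment is forgotten.\<close>

definition abs :: "state \<Rightarrow> nat \<Rightarrow> nat \<Rightarrow> node" where
  "abs s j i =
     (if i < j
      then if nats s (fa 2 i) = 0 then Ball (str s i) (nats s (fa 3 i))
        else Cut (str s i) (nats s (fa 2 i) - 1) (thr s i) (nats s (fa 3 i))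
      else Pend (strs s ` cells s i))"

lemma cell_hi:
  assumes "cell_ok s i"
  shows "nats s (fa 1 i) \<le> Suc (N * n)"
proof -
  have "n * Suc (own s i) \<le> n * N" using assms by (intro mult_le_mono) (auto simp: cell_ok_def)
  then show ?thesis using assms by (simp add: cell_ok_def mult.commute)
qed

lemma cells_sub: "cell_ok s i \<Longrightarrow> cells s i \<subseteq> {1..N * n}"
  using cell_hi[of s i] by (auto simp: cell_ok_def cells_def)

section \<open>Preservation of the forest invariant\<close>

lemma idle_step:
  assumes inv: "forest_inv j s" and j: "nats s 3 \<le> j" and u: "upd {4, 13} {6, 7} {} s s'" "nats s' 4 = Suc j"
  shows "forest_inv (Suc j) s'" "\<And>i. i < nats s 3 \<Longrightarrow> abs s' (Suc j) i = abs s j i" "nats s' 3 = nats s 3"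
proof -
  have n: "nats s' a = nats s a" if "a \<noteq> 4" "a \<noteq> 13" for a using u(1) that by (simp add: upd_def)
  have f: "nats s' (fa a i) = nats s (fa a i)" for a i using fa_neq(1)[of 4 a i] fa_neq(1)[of 13 a i] by (simp add: n)
  have r: "reals s' a = reals s a" if "a \<noteq> 6" "a \<noteq> 7" for a using u(1) that by (simp add: upd_def)
  have st: "strs s' = strs s" using u(1) by (auto simp: upd_def)
  have o: "own s' i = own s i" for i by (simp add: own_def f)
  show 3: "nats s' 3 = nats s 3" by (simp add: n)
  have e: "{j..<nats s 3} = {}" "{Suc j..<nats s 3} = {}" using j by auto
  have p: "proc_ok s' i = proc_ok s i" for i by (simp add: proc_ok_def f st o n)
  have c: "cell_ok s' i = cell_ok s i" for i by (simp add: cell_ok_def f o)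
  have m: "mem_ok s' = mem_ok s" unfolding mem_ok_def st using n r d_pos n_ge N_pos by (auto simp: n r)
  show "forest_inv (Suc j) s'"
    using inv u(2) j unfolding forest_inv_def 3 e c m p o by (simp add: params_def n r)
  show "abs s' (Suc j) i = abs s j i" if "i < nats s 3" for i
    using that j by (simp add: abs_def f st r)
qed

lemma grown_step:
  assumes inv: "forest_inv j s" and j: "j < nats s 3" and cnt: "cnt = nats s 3"
    and lo: "lo = nats s (fa 0 j)" "lo + m = nats s (fa 1 j)"
    and zs: "zs = map (strs s) [lo..<lo + m]"
    and u: "upd ({3, 4, 5, 6, 7, 8, 9, 10, 11, 12, 13} \<union> {fa 2 j, fa 3 j, fa 0 cnt, fa 1 cnt, fa 0 (Suc cnt), fa 1 (Suc cnt)})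
      ({6, 7, 8, 9, 10, 11, 12} \<union> {16..<16 + 3 * d} \<union> {16 + 3 * d + j}) ({0, Suc (N * n + j)} \<union> seg lo m) s s'"
    and g: "grown s' j cnt lo m zs (real (unum l) / 2 ^ B) mid" and j': "nats s' 4 = Suc j"
  shows "forest_inv (Suc j) s'" "grows B cnt j zs l (abs s' (Suc j))"
    "\<And>i. i < cnt \<Longrightarrow> i \<noteq> j \<Longrightarrow> abs s' (Suc j) i = abs s j i" "abs s j j = Pend (set zs)"
    "\<And>i. i < cnt \<Longrightarrow> own s' i = own s i"
proof -
  let ?A = "{3, 4, 5, 6, 7, 8, 9, 10, 11, 12, 13} \<union> {fa 2 j, fa 3 j, fa 0 cnt, fa 1 cnt, fa 0 (Suc cnt), fa 1 (Suc cnt)}"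
  have I: "params s" "mem_ok s" "N \<le> cnt" "cnt + (\<Sum>i\<in>{j..<cnt}. weight s i) \<le> 2 * (N * n)"
    "\<And>i. i < cnt \<Longrightarrow> cell_ok s i" "\<And>i. i < N \<Longrightarrow> own s i = i"
    "\<And>i i'. i \<in> {j..<cnt} \<Longrightarrow> i' \<in> {j..<cnt} \<Longrightarrow> i \<noteq> i' \<Longrightarrow> cells s i \<inter> cells s i' = {}"
    "\<And>i. i \<in> {j..<cnt} \<Longrightarrow> inj_on (strs s) (cells s i) \<and> strs s ` cells s i \<subseteq> P"
    "\<And>i. i < cnt \<Longrightarrow> i < j \<Longrightarrow> proc_ok s i"
    using inv unfolding forest_inv_def cnt by blast+
  have jc: "j < cnt" using j cnt by simp
  have cj: "cell_ok s j" "cells s j = seg lo m" using I(5)[OF jc] unfolding cells_def lo(1)[symmetric] lo(2)[symmetric] by blast+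
  have Nn: "lo + m \<le> Suc (N * n)" "1 \<le> lo" "0 < m"
    using cell_hi[OF cj(1)] cj(1) unfolding cell_ok_def lo(1)[symmetric] lo(2)[symmetric] by simp_all
  have cnt_le: "cnt \<le> 2 * (N * n)" using I(4) by linarith
  have G: "split_node s' j zs (real (unum l) / 2 ^ B)" "strs s' ` seg lo m = set zs" "inj_on (strs s') (seg lo m)"
    "lo < mid" "mid \<le> lo + m" "strs s' ` {lo..<mid} = {y \<in> set zs. node_val s' j y \<le> thr s' j}"
    "strs s' ` {mid..<lo + m} = {y \<in> set zs. \<not> node_val s' j y \<le> thr s' j}"
    using g unfolding grown_def by blast+
  have ch: "if nats s' (fa 2 j) = 0
     then if mid < lo + m
       then nats s' (fa 3 j) = cnt \<and> nats s' 3 = Suc cnt \<and> nats s' (fa 0 cnt) = mid \<and> nats s' (fa 1 cnt) = lo + m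
       else nats s' (fa 3 j) = j \<and> nats s' 3 = cnt
     else mid < lo + m \<and> nats s' (fa 3 j) = cnt \<and> nats s' 3 = Suc (Suc cnt) \<and>
       nats s' (fa 0 cnt) = mid \<and> nats s' (fa 1 cnt) = lo + m \<and>
       nats s' (fa 0 (Suc cnt)) = lo \<and> nats s' (fa 1 (Suc cnt)) = mid"
    using g unfolding grown_def by blast
  have zs': "distinct zs" "set zs \<subseteq> P" "set zs = strs s ` seg lo m" "zs \<noteq> []"
    using I(8)[of j] jc Nn by (auto simp: zs distinct_map cj(2))
  have f01: "nats s' (fa 0 i) = nats s (fa 0 i)" "nats s' (fa 1 i) = nats s (fa 1 i)" if "i < cnt" for i
    using updD(1)[OF u, of "fa 0 i"] updD(1)[OF u, of "fa 1 i"] that by (simp_all add: fa_eq fa_neq)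
  have f23: "nats s' (fa 2 i) = nats s (fa 2 i)" "nats s' (fa 3 i) = nats s (fa 3 i)" if "i \<noteq> j" for i
    using updD(1)[OF u, of "fa 2 i"] updD(1)[OF u, of "fa 3 i"] that by (simp_all add: fa_eq fa_neq)
  have ow: "own s' i = own s i" if "i < cnt" for i using f01[OF that] by (simp add: own_def)
  then show "\<And>i. i < cnt \<Longrightarrow> own s' i = own s i" .
  have ce: "cells s' i = cells s i" "weight s' i = weight s i" if "i < cnt" for i
    using f01[OF that] by (simp_all add: cells_def weight_def)
  have th: "thr s' i = thr s i" if "i \<noteq> j" for i using updD(2)[OF u, of "16 + 3 * d + i"] that by simp
  have sr: "str s' i = str s i" if "i \<noteq> j" for i using updD(3)[OF u, of "Suc (N * n + i)"] that Nn by simp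
  have sc: "strs s' x = strs s x" if "i \<in> {Suc j..<cnt}" "x \<in> cells s i" for i x
  proof -
    have "x \<in> {1..N * n}" using cells_sub[OF I(5), of i] that by auto
    moreover have "x \<notin> seg lo m" using I(7)[of i j] that jc cj(2) by auto
    ultimately show ?thesis using updD(3)[OF u, of x] by simp
  qed
  have cnt': "cnt \<le> nats s' 3" "nats s' 3 \<le> Suc (Suc cnt)" using ch by (auto split: if_splits)
  \<comment> \<open>A segment inside that of \<open>j\<close> stays in the block of \<open>n\<close>
    string cells of the same tree, and the tree is recovered from its first address by
    division.\<close>
  have ownc: "own s' i = own s j \<and> cell_ok s' i \<and> cells s' i \<subseteq> seg lo m" if i: "lo \<le> nats s' (fa 0 i)" "nats s' (fa 0 i) < nats s' (fa 1 i)" "nats s' (fa 1 i) \<le> lo + m" for i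
  proof -
    define o' where "o' = own s j"
    have o1: "o' * n \<le> lo - 1" unfolding o'_def own_def lo by (simp add: div_times_less_eq_dividend)
    have hi: "lo + m \<le> Suc (n * Suc o')" "o' < N" using cj(1) unfolding cell_ok_def lo(1)[symmetric] lo(2)[symmetric] o'_def by simp_all
    have "own s' i = o'" unfolding own_def
    proof (rule div_nat_eqI)
      show "n * o' \<le> nats s' (fa 0 i) - 1" using o1 i(1) by (simp add: mult.commute)
      show "nats s' (fa 0 i) - 1 < n * Suc o'" using hi(1) i Nn(2) by linarith
    qed
    then show ?thesis using i hi Nn(2) by (auto simp: cell_ok_def cells_def o'_def)
  qed
  have new: "own s' i = own s j \<and> cell_ok s' i \<and> cells s' i \<subseteq> seg lo m" if i: "cnt \<le> i" "i < nats s' 3" for i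
  proof -
    consider "i = cnt" | "i = Suc cnt" "nats s' (fa 2 j) \<noteq> 0" using i cnt' ch by (cases "i = cnt") (auto split: if_splits)
    then have "nats s' (fa 0 i) = mid \<and> nats s' (fa 1 i) = lo + m \<and> mid < lo + m \<or> nats s' (fa 0 i) = lo \<and> nats s' (fa 1 i) = mid"
    proof cases
      case 1
      show ?thesis using ch i unfolding 1 by (auto split: if_splits)
    next
      case 2
      show ?thesis using ch 2(2) unfolding 2(1) by auto
    qed
    then show ?thesis using G(4,5) by (intro ownc) auto
  qed
  have cell: "cell_ok s' i" if "i < nats s' 3" for i
  proof (cases "i < cnt")
    case True
    then show ?thesis using I(5)[OF True] f01[OF True] ow[OF True] by (simp add: cell_ok_def)
  qed (use new that in auto)
  have nodej: "node_ok s' j" using split_node_ok[OF G(1)] zs' by blast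
  have chown: "proc_ok s' j"
  proof (cases "nats s' (fa 2 j) = 0")
    case True
    then have "str s' j \<in> P"
      using G(1) zs'(2) by (auto simp: split_node_def ball_node_def cut_node_def dense_def split: if_splits)
    moreover have "nats s' (fa 3 j) < nats s' 3 \<and> own s' (nats s' (fa 3 j)) = own s' j"
      using ch True new[of cnt] ow[OF jc] jc by (auto split: if_splits)
    ultimately show ?thesis using True by (simp add: proc_ok_def)
  next
    case False
    then have "cut_node s' j zs (real (unum l) / 2 ^ B)"
      using G(1) unfolding split_node_def ball_node_def by metis
    then have "str s' j = embed_fun E zs" by (simp add: cut_node_def)
    then have ex: "\<exists>zs. distinct zs \<and> set zs \<subseteq> P \<and> str s' j = embed_fun E zs" using zs'(1,2) by blast
    have h: "nats s' (fa 3 j) = cnt" "nats s' 3 = Suc (Suc cnt)" using ch False by auto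
    show ?thesis
      unfolding proc_ok_def h using False ex h new[of cnt] new[of "Suc cnt"] ow[OF jc] nodej by (simp add: node_ok_def)
  qed
  have proc: "proc_ok s' i" if "i < nats s' 3" "i < Suc j" for i
  proof (cases "i = j")
    case True
    then show ?thesis using chown by simp
  next
    case False
    then have i: "i < j" "i < cnt" using that jc by auto
    show ?thesis using I(9)[OF i(2,1)] i f23[OF False] sr[OF False] ow cnt'
      unfolding proc_ok_def cnt[symmetric] by (auto split: if_splits)
  qed
  have m1: "mem_ok s'"
    unfolding mem_ok_def
  proof (intro conjI allI impI)
    fix a assume a: "40 + 8 * (N * n) \<le> a"
    have "a \<notin> ?A" using a jc cnt_le by (auto simp: fa_def)
    then show "nats s' a = 0" using updD(1)[OF u, of a] I(2) a by (simp add: mem_ok_def)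
  next
    fix a assume a: "16 + 3 * d + 2 * (N * n) \<le> a"
    then show "reals s' a = 0" using updD(2)[OF u, of a] I(2) jc cnt_le by (simp add: mem_ok_def)
  next
    fix a assume a: "Suc (3 * (N * n)) \<le> a"
    then show "strs s' a = []" using updD(3)[OF u, of a] I(2) jc cnt_le Nn by (simp add: mem_ok_def)
  next
    fix a :: nat assume a: "1 \<le> a"
    consider "a \<in> seg lo m" | "a = Suc (N * n + j)" | "a \<notin> {0, Suc (N * n + j)} \<union> seg lo m" using a by auto
    then show "length (strs s' a) \<le> \<mu>"
    proof cases
      case 1
      then have "strs s' a \<in> set zs" unfolding G(2)[symmetric] by (rule imageI)
      then show ?thesis using zs'(2) P_M M_len by blast
    next
      case 2
      then show ?thesis using chown P_M M_len code_len by (auto simp: proc_ok_def split: if_splits)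
    next
      case 3
      then show ?thesis using updD(3)[OF u 3] I(2) a by (simp add: mem_ok_def)
    qed
  qed
  have par: "params s'"
  proof -
    have "nats s' a = nats s a" if "a \<in> {0, 1, 2}" for a using updD(1)[OF u, of a] that by (auto simp: fa_neq)
    moreover have "reals s' a = reals s a" if "a \<in> {2, 3, 4, 5}" for a using updD(2)[OF u, of a] that by auto
    ultimately show ?thesis using I(1) by (simp add: params_def)
  qed
  \<comment> \<open>Splitting \<open>m\<close> points into two nonempty parts creates two nodes, and
    \<open>2 + 2 * (m1 - 1) + 2 * (m2 - 1) = 2 * (m - 1)\<close>. A ball with nonempty far set
    creates one node on at most \<open>m - 1\<close> points.\<close>
  have wt: "nats s' 3 + (\<Sum>i\<in>{Suc j..<nats s' 3}. weight s' i) \<le> 2 * (N * n)"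
  proof -
    have "(\<Sum>i\<in>{j..<cnt}. weight s i) = weight s j + (\<Sum>i\<in>{Suc j..<cnt}. weight s i)"
      using jc by (rule sum.atLeast_Suc_lessThan)
    moreover have "weight s j = 2 * (m - 1)" unfolding weight_def lo(1)[symmetric] lo(2)[symmetric] by simp
    moreover have "(\<Sum>i\<in>{Suc j..<cnt}. weight s' i) = (\<Sum>i\<in>{Suc j..<cnt}. weight s i)"
      using ce by (intro sum.cong) auto
    moreover have "nats s' 3 + (\<Sum>i\<in>{Suc j..<nats s' 3}. weight s' i) \<le> cnt + 2 * (m - 1) + (\<Sum>i\<in>{Suc j..<cnt}. weight s' i)"
    proof (cases "nats s' (fa 2 j) = 0")
      case True
      then show ?thesis using ch G(4) jc Nn by (cases "mid < lo + m") (auto simp: weight_def)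
    next
      case False
      have "{Suc j..<Suc (Suc cnt)} = insert cnt (insert (Suc cnt) {Suc j..<cnt})" using jc by auto
      moreover have "2 + (2 * (lo + m - mid - 1) + 2 * (mid - lo - 1)) \<le> 2 * (m - 1)" if "mid < lo + m"
        using that G(4) by linarith
      ultimately show ?thesis using ch False by (simp add: weight_def)
    qed
    ultimately show ?thesis using I(4) by linarith
  qed
  have disj: "cells s' i \<inter> cells s' i' = {}" if i: "i \<in> {Suc j..<nats s' 3}" "i' \<in> {Suc j..<nats s' 3}" "i < i'" for i i'
  proof (cases "i' < cnt")
    case True
    then have "cells s i \<inter> cells s i' = {}" using i by (intro I(7)) auto
    then show ?thesis using True i ce by simp
  next
    case i': False
    then have sub: "cells s' i' \<subseteq> seg lo m" using new[of i'] i by auto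
    show ?thesis
    proof (cases "i < cnt")
      case True
      then have "cells s i \<inter> cells s j = {}" using i jc by (intro I(7)) auto
      then show ?thesis using sub ce[OF True] cj(2) by blast
    next
      case False
      then have "i = cnt" "i' = Suc cnt" "nats s' 3 = Suc (Suc cnt)" using i i' cnt' by auto
      then show ?thesis using ch by (auto simp: cells_def split: if_splits)
    qed
  qed
  have pend: "inj_on (strs s') (cells s' i) \<and> strs s' ` cells s' i \<subseteq> P" if i: "i \<in> {Suc j..<nats s' 3}" for i
  proof (cases "i < cnt")
    case True
    then have i': "i \<in> {Suc j..<cnt}" using i by simp
    have "strs s' ` cells s' i = strs s ` cells s i" using sc[OF i'] ce[OF True] by (intro image_cong) auto
    moreover have "inj_on (strs s') (cells s' i) = inj_on (strs s) (cells s i)"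
      unfolding ce(1)[OF True] using sc[OF i'] by (intro inj_on_cong) auto
    ultimately show ?thesis using I(8)[of i] i' by simp
  next
    case False
    then have "cells s' i \<subseteq> seg lo m" using new[of i] i by auto
    then show ?thesis using G(2,3) zs'(2) inj_on_subset by blast
  qed
  show "forest_inv (Suc j) s'"
    unfolding forest_inv_def
  proof (intro conjI)
    show "N \<le> nats s' 3" using I(3) cnt' by simp
    show "\<forall>i<N. own s' i = i" using I(3,6) ow by simp
    show "\<forall>i\<in>{Suc j..<nats s' 3}. \<forall>i'\<in>{Suc j..<nats s' 3}. i \<noteq> i' \<longrightarrow> cells s' i \<inter> cells s' i' = {}"
      using disj by (metis Int_commute linorder_neqE_nat)
  qed (use par j' m1 wt cell pend proc in blast)+
  show "abs s' (Suc j) i = abs s j i" if "i < cnt" "i \<noteq> j" for i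
  proof (cases "i < j")
    case True
    then show ?thesis using that f23 sr th by (simp add: abs_def)
  next
    case False
    then have "strs s' ` cells s' i = strs s ` cells s i"
      using that sc[of i] ce[OF that(1)] by (intro image_cong) auto
    then show ?thesis using False that by (simp add: abs_def)
  qed
  show "abs s j j = Pend (set zs)" by (simp add: abs_def cj(2) zs'(3))
  show "grows B cnt j zs l (abs s' (Suc j))"
  proof (cases "\<exists>c. dense (set zs) c")
    case True
    then have b: "nats s' (fa 2 j) = 0" "dense (set zs) (str s' j)" "thr s' j = R"
      using G(1) by (simp_all add: split_node_def ball_node_def)
    have far: "strs s' ` {mid..<lo + m} = {y \<in> set zs. \<not> dM (str s' j) y \<le> R}"
      unfolding G(7) using b by (simp add: node_val_def)
    have "{y \<in> set zs. \<not> dM (str s' j) y \<le> R} = {} \<or>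
        abs s' (Suc j) (nats s' (fa 3 j)) = Pend {y \<in> set zs. \<not> dM (str s' j) y \<le> R}"
      unfolding far[symmetric] using ch b jc by (cases "mid < lo + m") (auto simp: abs_def cells_def)
    moreover have "abs s' (Suc j) j = Ball (str s' j) (nats s' (fa 3 j))" using b by (simp add: abs_def)
    ultimately show ?thesis using True b(2) unfolding grows_def by auto
  next
    case False
    then have c: "cut_node s' j zs (real (unum l) / 2 ^ B)" using G(1) by (simp add: split_node_def)
    then obtain a where a: "nats s' (fa 2 j) = Suc a" "str s' j = embed_fun E zs"
      "cut_at d (lowest (str s' j) (set zs)) (width (str s' j) (set zs))
         (real (unum l) / 2 ^ B * tot_width (str s' j) (set zs)) a (thr s' j)"
      unfolding cut_node_def by blast
    have h: "nats s' (fa 3 j) = cnt" "nats s' (fa 0 cnt) = mid" "nats s' (fa 1 cnt) = lo + m"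
       "nats s' (fa 0 (Suc cnt)) = lo" "nats s' (fa 1 (Suc cnt)) = mid" using ch a(1) by auto
    have nv: "node_val s' j y = coord (str s' j) y a" for y using a by (simp add: node_val_def)
    have "abs s' (Suc j) j = Cut (str s' j) a (thr s' j) cnt" using a h by (simp add: abs_def)
    moreover have "abs s' (Suc j) cnt = Pend {y \<in> set zs. \<not> coord (str s' j) y a \<le> thr s' j}"
      using jc h G(7) by (simp add: abs_def cells_def nv)
    moreover have "abs s' (Suc j) (Suc cnt) = Pend {y \<in> set zs. coord (str s' j) y a \<le> thr s' j}"
      using jc h G(6) by (simp add: abs_def cells_def nv)
    ultimately show ?thesis using False a(2,3) unfolding grows_def Let_def by auto
  qed
qed


lemma grown_counter:
  "grown (s\<lparr>nats := (nats s)(4 := x)\<rparr>) j cnt lo m zs u mid \<longleftrightarrow> grown s j cnt lo m zs u mid"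
  by (simp add: grown_def split_node_def ball_node_def cut_node_def node_val_def fa_neq)

section \<open>Rounds as functions of their coins\<close>

definition node_points :: "state \<Rightarrow> nat \<Rightarrow> bits list" where
  "node_points s j = map (strs s) [nats s (fa 0 j)..<nats s (fa 1 j)]"

definition step_rel :: "nat \<Rightarrow> state \<Rightarrow> bool list \<Rightarrow> state \<Rightarrow> bool" where
  "step_rel j s l s' \<longleftrightarrow> forest_inv (Suc j) s' \<and>
    (\<forall>i<nats s 3. i \<noteq> j \<longrightarrow> abs s' (Suc j) i = abs s j i) \<and>
    (j < nats s 3 \<longrightarrow> grows B (nats s 3) j (node_points s j) l (abs s' (Suc j)))"

definition process_steps :: nat where
  "process_steps = n * (n * 5 + 8) + d * (n * 9 + 16) + n * 10 + 31"

definition body_steps :: nat where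
  "body_steps = B * 4 + 3 + (process_steps + 1) + 1"

lemma runs_body:
  assumes inv: "forest_inv j s0" and j: "j < 2 * (N * n)" and l: "length l = B"
    and emb: "2000 * \<beta> + embed_time E \<le> \<kappa>"
  shows "runs body_prog s0 l body_steps (\<lambda>s' l'. l' = [] \<and> step_rel j s0 l s')"
proof -
  have p: "params s0" "nats s0 4 = j" using inv by (simp_all add: forest_inv_def)
  have sz: "Suc j < 2 ^ \<beta>" using j size by (simp add: mult.commute)
  define cnt where "cnt = nats s0 3"
  have cnt_le: "cnt \<le> 2 * (N * n)" using inv unfolding forest_inv_def cnt_def by linarith
  let ?rest = "Cond (NLess (V 4) (V 3)) process_prog Skip ;; inc 4"
  show ?thesis
    unfolding body_prog_def body_steps_def
  proof (rule runs_Seq[OF runs_sample[OF p(1) l]])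
    fix s1 and l1 :: "bool list" assume s1': "l1 = [] \<and> upd {13} {6, 7} {} s0 s1 \<and> reals s1 6 = real (unum l) / 2 ^ B"
    then have s1: "upd {13} {6, 7} {} s0 s1" "reals s1 6 = real (unum l) / 2 ^ B" by auto
    have v1: "nats s1 4 = j" "nats s1 3 = cnt" "strs s1 = strs s0" "params s1"
      using s1(1) p by (auto simp: upd_def cnt_def params_def)
    have f1: "nats s1 (fa a i) = nats s0 (fa a i)" for a i using updD(1)[OF s1(1), of "fa a i"] by (simp add: fa_neq)
    have "det ?rest s1 (process_steps + 1 + 1) (step_rel j s0 l)"
    proof (cases "j < cnt")
      case False
      have "det ?rest s1 4 (step_rel j s0 l)"
      proof (rule det_Seq)
        show "det (Cond (NLess (V 4) (V 3)) process_prog Skip) s1 2 (\<lambda>s. s = s1)"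
          by (rule det_Cond[where ?k1.0 = 1]) (use False v1 in \<open>auto intro: det_exe\<close>)
        show "det (inc 4) s2 1 (step_rel j s0 l)" if "s2 = s1" for s2
        proof (rule det_exe)
          show "safe E \<beta> \<kappa> \<mu> (inc 4) s2" using that sz v1 by simp
          define s' where "s' = exe E (inc 4) s2"
          have u: "upd {4, 13} {6, 7} {} s0 s'" "nats s' 4 = Suc j"
            using s1 that v1 by (auto simp: s'_def upd_def)
          have c: "nats s0 3 \<le> j" using False by (simp add: cnt_def)
          show "step_rel j s0 l (exe E (inc 4) s2)"
            unfolding s'_def[symmetric] step_rel_def
            using idle_step[OF inv c u] False by (auto simp: cnt_def)
        qed simp_all
      qed simp
      then show ?thesis by (rule det_mono) (auto simp: process_steps_def)
    next
      case True
      define lo where "lo = nats s0 (fa 0 j)"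
      define m where "m = nats s0 (fa 1 j) - lo"
      define zs where "zs = node_points s0 j"
      have cell: "cell_ok s0 j" and pts: "inj_on (strs s0) (cells s0 j)" "strs s0 ` cells s0 j \<subseteq> P"
        using inv True unfolding forest_inv_def cnt_def by auto
      have lom: "lo + m = nats s0 (fa 1 j)" "0 < m" "1 \<le> lo" "lo + m \<le> Suc (N * n)"
        using cell cell_hi[OF cell] by (auto simp: cell_ok_def m_def lo_def)
      have "own s0 j * n \<le> lo - 1" unfolding own_def lo_def by (simp add: div_times_less_eq_dividend)
      moreover have "lo + m \<le> Suc (n * Suc (own s0 j))" using cell lom(1) by (simp add: cell_ok_def)
      ultimately have mn: "m \<le> n" using lom(3) by (simp add: mult.commute)
      have zs: "zs = map (strs s1) [lo..<lo + m]" unfolding zs_def node_points_def v1 lom(1) unfolding lo_def ..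
      have pts1: "strs s1 ` seg lo m \<subseteq> P" "inj_on (strs s1) (seg lo m)"
        using pts unfolding cells_def lom(1)[symmetric] lo_def[symmetric] v1 by auto
      have u01: "0 \<le> reals s1 6" "reals s1 6 < 1"
      proof -
        have "real (unum l) < 2 ^ B" using unum_less[of l] l by (metis of_nat_less_iff of_nat_numeral of_nat_power)
        then show "0 \<le> reals s1 6" "reals s1 6 < 1" unfolding s1(2) by simp_all
      qed
      have cb: "cnt + 2 < 2 ^ \<beta>" using cnt_le size by (simp add: mult.commute)
      have f1': "nats s1 (fa 0 j) = lo" "nats s1 (fa 1 j) = lo + m" using f1 lom(1) by (simp_all add: lo_def)
      have st: "m * (m * 5 + 8) + d * (m * 9 + 16) + m * 10 + 31 \<le> process_steps"
        unfolding process_steps_def using mn by (intro add_mono mult_le_mono) auto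
      show ?thesis
      proof (rule det_Seq)
        show "det (Cond (NLess (V 4) (V 3)) process_prog Skip) s1 (process_steps + 1)
           (\<lambda>s. \<exists>mid. processed s1 s j cnt lo m zs mid)"
        proof (rule det_Cond[where ?k1.0 = process_steps])
          show "det process_prog s1 process_steps (\<lambda>s. \<exists>mid. processed s1 s j cnt lo m zs mid)"
            by (rule det_mono[OF det_process[OF v1(4,2,1) True f1' lom(2,3,4) pts1 zs u01 emb cb] st])
        qed (use True v1 in auto)
        fix s2 assume "\<exists>mid. processed s1 s2 j cnt lo m zs mid"
        then obtain mid where pr: "processed s1 s2 j cnt lo m zs mid" ..
        let ?A = "{3, 5, 6, 7, 8, 9, 10, 11, 12} \<union> {fa 2 j, fa 3 j, fa 0 cnt, fa 1 cnt, fa 0 (Suc cnt), fa 1 (Suc cnt)}"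
        let ?B = "{8, 9, 10, 11, 12} \<union> {16..<16 + 3 * d} \<union> {16 + 3 * d + j}"
        let ?C = "{0, Suc (N * n + j)} \<union> seg lo m"
        have u2: "upd ?A ?B ?C s1 s2" and g2: "grown s2 j cnt lo m zs (real (unum l) / 2 ^ B) mid"
          using pr s1(2) by (simp_all add: processed_def)
        have n4: "nats s2 4 = j" using updD(1)[OF u2, of 4] v1 by (simp add: fa_neq)
        show "det (inc 4) s2 1 (step_rel j s0 l)"
        proof (rule det_exe)
          show "safe E \<beta> \<kappa> \<mu> (inc 4) s2" using sz n4 by simp
          define s' where "s' = exe E (inc 4) s2"
          have s': "s' = s2\<lparr>nats := (nats s2)(4 := Suc j)\<rparr>" using n4 by (simp add: s'_def)
          have u3: "upd {4} {} {} s2 s'" by (simp add: s' upd_def)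
          have "upd ({13} \<union> ?A) ({6, 7} \<union> ?B) ?C s0 s2" by (rule upd_trans[OF s1(1) u2]) auto
          then have u: "upd ({3, 4, 5, 6, 7, 8, 9, 10, 11, 12, 13} \<union> {fa 2 j, fa 3 j, fa 0 cnt, fa 1 cnt, fa 0 (Suc cnt), fa 1 (Suc cnt)})
            ({6, 7, 8, 9, 10, 11, 12} \<union> {16..<16 + 3 * d} \<union> {16 + 3 * d + j}) ?C s0 s'"
            by (rule upd_trans[OF _ u3]) auto
          have g: "grown s' j cnt lo m zs (real (unum l) / 2 ^ B) mid" unfolding s' grown_counter by (rule g2)
          have zs0: "zs = map (strs s0) [lo..<lo + m]" using zs v1 by simp
          have j4: "nats s' 4 = Suc j" by (simp add: s')
          have jc: "j < nats s0 3" using True by (simp add: cnt_def)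
          note gs = grown_step[OF inv jc cnt_def lo_def lom(1) zs0 u g j4]
          show "step_rel j s0 l (exe E (inc 4) s2)"
            unfolding s'_def[symmetric] step_rel_def zs_def[symmetric] cnt_def[symmetric]
            using gs(1,2,3) by blast
        qed simp_all
      qed simp
    qed
    then show "runs ?rest s1 l1 (process_steps + 1 + 1) (\<lambda>s' l'. l' = [] \<and> step_rel j s0 l s')"
      using s1' by (simp add: det_def)
  qed simp
qed

definition step_ok :: "state \<Rightarrow> bool list \<Rightarrow> state \<Rightarrow> bool" where
  "step_ok s l s' \<longleftrightarrow> (\<exists>t. (\<forall>w. exec E body_prog (s, l @- w) t (s', w)) \<and> t \<le> body_steps * \<kappa> \<and> bnd \<beta> s' \<and>
     step_rel (nats s 4) s l s')"

text \<open>The choice depends on the coins of one round only, so that later rounds are independent of it.\<close>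

definition step :: "state \<Rightarrow> bool list \<Rightarrow> state" where
  "step s l = (SOME s'. step_ok s l s')"

lemma step_ok:
  assumes "forest_inv j s" "bnd \<beta> s" "j < 2 * (N * n)" "length l = B" "2000 * \<beta> + embed_time E \<le> \<kappa>"
  shows "step_ok s l (step s l)"
proof -
  have j: "nats s 4 = j" using assms(1) by (simp add: forest_inv_def)
  from runs_body[OF assms(1,3,4,5)] assms(2) obtain t s' l1 l2 where "l = l1 @ l2" "\<forall>w. exec E body_prog (s, l1 @- w) t (s', w)"
    "t \<le> body_steps * \<kappa>" "bnd \<beta> s'" "l2 = [] \<and> step_rel j s l s'" unfolding runs_def by blast
  then have "step_ok s l s'" using j by (auto simp: step_ok_def)
  then show ?thesis unfolding step_def by (rule someI)
qed

text \<open>The loop is unrolled into \<open>iter\<close>, one block of \<open>B\<close> coins per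
  round, which is the form in which \<open>supermartingale_bound\<close> counts coin lists.\<close>

lemma main_exec:
  assumes emb: "2000 * \<beta> + embed_time E \<le> \<kappa>"
  shows "forest_inv j s \<Longrightarrow> bnd \<beta> s \<Longrightarrow> j + m = 2 * (N * n) \<Longrightarrow> length l = m * B \<Longrightarrow>
    \<exists>t. (\<forall>w. exec E main_prog (s, l @- w) t (iter step B m s l, w)) \<and> t \<le> (m * (body_steps + 1) + 1) * \<kappa> \<and>
      forest_inv (2 * (N * n)) (iter step B m s l) \<and> bnd \<beta> (iter step B m s l)"
proof (induction m arbitrary: j s l)
  let ?b = "NLess (V 4) (NMul (NLit 2) (NMul (V 2) (V 0)))"
  case 0
  then have j: "j = 2 * (N * n)" "l = []" by auto
  have v: "nats s 4 = 2 * (N * n)" "nats s 2 = N" "nats s 0 = n"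
    using 0(1) j by (simp_all add: forest_inv_def params_def)
  have "\<forall>w. exec E main_prog (s, w) (bcost ?b s) (s, w)"
    unfolding main_prog_def by (intro allI exec.WhileFalse) (simp add: v)
  moreover have "bcost ?b s \<le> \<kappa>" using 0(2) by (intro cost_b) auto
  ultimately show ?case using 0 j by auto
next
  case (Suc m)
  let ?b = "NLess (V 4) (NMul (NLit 2) (NMul (V 2) (V 0)))"
  have v: "nats s 4 = j" "nats s 2 = N" "nats s 0 = n" and j: "j < 2 * (N * n)"
    using Suc(2,4) by (simp_all add: forest_inv_def params_def)
  define l1 where "l1 = take B l"
  define l2 where "l2 = drop B l"
  have l: "l = l1 @ l2" "length l1 = B" "length l2 = m * B" using Suc(5) by (simp_all add: l1_def l2_def)
  define s1 where "s1 = step s l1"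
  from step_ok[OF Suc(2,3) j l(2) emb] obtain t1 where t1: "\<forall>w. exec E body_prog (s, l1 @- w) t1 (s1, w)"
    "t1 \<le> body_steps * \<kappa>" "bnd \<beta> s1" "step_rel j s l1 s1" unfolding step_ok_def s1_def v by blast
  have inv1: "forest_inv (Suc j) s1" using t1(4) by (simp add: step_rel_def)
  have it: "iter step B (Suc m) s l = iter step B m s1 l2" by (simp add: s1_def l1_def l2_def)
  have "Suc j + m = 2 * (N * n)" using Suc(4) by simp
  from Suc.IH[OF inv1 t1(3) this l(3)] obtain t2 where t2:
    "\<forall>w. exec E main_prog (s1, l2 @- w) t2 (iter step B m s1 l2, w)" "t2 \<le> (m * (body_steps + 1) + 1) * \<kappa>"
    "forest_inv (2 * (N * n)) (iter step B m s1 l2)" "bnd \<beta> (iter step B m s1 l2)" by blast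
  have "bcost ?b s \<le> \<kappa>" using Suc(3) by (intro cost_b) auto
  then have "bcost ?b s + t1 + t2 \<le> (Suc m * (body_steps + 1) + 1) * \<kappa>"
    using t1(2) t2(2) by (simp add: algebra_simps)
  moreover have "\<forall>w. exec E main_prog (s, l @- w) (bcost ?b s + t1 + t2) (iter step B m s1 l2, w)"
    using t1(1) t2(1) j unfolding main_prog_def l(1) shift_append
    by (intro allI exec.WhileTrue[where ?s1.0 = s1]) (auto simp: v)
  ultimately show ?case using t2(3,4) unfolding it by blast
qed

section \<open>Queries in a finished forest\<close>

primrec hits :: "bits \<Rightarrow> nat \<Rightarrow> (nat \<Rightarrow> node) \<Rightarrow> nat \<Rightarrow> bool" where
  "hits q 0 A i = False"
| "hits q (Suc k) A i = (case A i of
     Ball c j \<Rightarrow> dM c q \<le> R + r \<or> hits q k A j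
   | Cut e a t j \<Rightarrow> hits q k A (if coord e q a \<le> t then Suc j else j)
   | Pend Q \<Rightarrow> False)"

definition final :: "state \<Rightarrow> bool" where
  "final s \<longleftrightarrow> params s \<and> N \<le> nats s 3 \<and> nats s 3 \<le> 2 * (N * n) \<and> mem_ok s \<and> (\<forall>i<nats s 3. proc_ok s i)"

lemma final_forest:
  assumes "forest_inv (2 * (N * n)) s"
  shows "final s"
proof -
  have c: "nats s 3 \<le> 2 * (N * n)" using assms unfolding forest_inv_def by linarith
  then show ?thesis using assms unfolding forest_inv_def final_def by auto
qed

text \<open>The search counts 0, 1, 2, ... in a real cell while the count is below
  \<open>Lev\<close>, which takes exactly this many iterations.\<close>

definition levels :: nat where
  "levels = nat \<lceil>Lev\<rceil>"

lemma final_children: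
  assumes "final s" "i < nats s 3" "i' \<in> children (abs s (2 * (N * n)) i)"
  shows "i' < nats s 3 \<and> own s i' = own s i"
proof -
  have "proc_ok s i" "i < 2 * (N * n)" using assms(1,2) by (auto simp: final_def)
  then show ?thesis using assms(3) by (auto simp: abs_def proc_ok_def split: if_splits)
qed

definition found :: "bits \<Rightarrow> state \<Rightarrow> bool" where
  "found q s \<longleftrightarrow> strs s 0 \<in> P \<and> dM (strs s 0) q \<le> R + r"

lemma det_walk:
  assumes fin: "final sf" and A: "A = abs sf (2 * (N * n))" and q: "q \<in> M"
    and u0: "upd {12, 15} ({8, 14} \<union> vec_cells) {0} sf s0"
    and st: "nats s0 12 = i0" "i0 < nats sf 3" "reals s0 14 = 0" "strs s0 0 = q"
  shows "det walk_prog s0 (levels * 11 + 1) (\<lambda>s. upd {12, 15} ({8, 14} \<union> vec_cells) {0} sf s \<and>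
    (found q s \<and> nats s 15 = N \<or> strs s 0 = q \<and> nats s 15 = nats s0 15 \<and> \<not> hits q levels A i0))"
proof -
  define U where "U = upd {12, 15} ({8, 14} \<union> vec_cells) {0} sf"
  \<comment> \<open>Either the answer is in place and the variant is 0, or the outcome of the rest
    of the walk from the current node still equals the outcome from the root.\<close>
  define I where "I m s \<longleftrightarrow> U s \<and>
    (found q s \<and> nats s 15 = N \<and> Lev \<le> reals s 14 \<and> m = 0 \<or>
     (\<exists>c. reals s 14 = real c \<and> c + m = levels \<and> strs s 0 = q \<and> nats s 15 = nats s0 15 \<and>
       nats s 12 < nats sf 3 \<and> hits q m A (nats s 12) = hits q levels A i0))" for m :: nat and s
  let ?V = "val_prog (V 12) (NLit 0)"
  let ?hit = "SCopy (NLit 0) (sad (V 12)) ;; NSet (NLit 15) (V 2) ;; RSet (NLit 14) (X 5)"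
  let ?move = "Cond (NLess (NLit 0) (NMem (fld 2 (V 12))))
         (Cond (RLess (RMem (tad (V 12))) (X 8))
           (NSet (NLit 12) (NMem (fld 3 (V 12))))
           (NSet (NLit 12) (NAdd (NMem (fld 3 (V 12))) (NLit 1))))
         (Cond (RLess (RAdd (X 4) (X 3)) (X 8))
           (NSet (NLit 12) (NMem (fld 3 (V 12))))
           ?hit) ;;
       RSet (NLit 14) (RAdd (X 14) (RNat (NLit 1)))"
  have pf: "params sf" "nats sf 3 \<le> 2 * (N * n)" using fin by (auto simp: final_def)
  have sz: "2 * (N * n) + 2 < 2 ^ \<beta>" "N < 2 ^ \<beta>"
  proof -
    have "N * 1 \<le> N * n" using n_ge by (intro mult_le_mono) auto
    moreover have "4 * (N * n) + d + 2 < 2 ^ \<beta>" using size by (simp add: mult.commute)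
    ultimately show "2 * (N * n) + 2 < 2 ^ \<beta>" "N < 2 ^ \<beta>" by linarith+
  qed
  have "det walk_prog s0 (levels * 11 + 1) (\<lambda>s. U s \<and>
    (found q s \<and> nats s 15 = N \<or> strs s 0 = q \<and> nats s 15 = nats s0 15 \<and> \<not> hits q levels A i0))"
    unfolding walk_prog_def
  proof (rule det_While[where I = I and m = levels and ?k1.0 = 10])
    show "I levels s0" using u0 st by (auto simp: I_def U_def)
    fix m s assume I: "I m s"
    have u: "upd {12, 15} ({8, 14} \<union> vec_cells) {0} sf s" using I by (simp add: I_def U_def)
    have v: "params s" "reals s 5 = Lev" "nats s 2 = N" using updD[OF u] pf(1) by (simp_all add: params_def)
    show "U s \<and> (found q s \<and> nats s 15 = N \<or> strs s 0 = q \<and> nats s 15 = nats s0 15 \<and> \<not> hits q levels A i0)"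
      if nb: "\<not> bval (RLess (X 14) (X 5)) s"
    proof (cases "found q s \<and> nats s 15 = N")
      case False
      then obtain c where c: "reals s 14 = real c" "c + m = levels" "strs s 0 = q" "nats s 15 = nats s0 15"
        "hits q m A (nats s 12) = hits q levels A i0" using I by (auto simp: I_def)
      have "Lev \<le> real c" using nb c v by simp
      then have "levels \<le> c" unfolding levels_def by linarith
      then have "m = 0" using c by simp
      then show ?thesis using c I by (auto simp: I_def)
    qed (use I in \<open>auto simp: I_def\<close>)
    assume "bval (RLess (X 14) (X 5)) s"
    then have b: "reals s 14 < Lev" using v by simp
    then obtain c where c: "reals s 14 = real c" "c + m = levels" "strs s 0 = q" "nats s 15 = nats s0 15"
        "nats s 12 < nats sf 3" "hits q m A (nats s 12) = hits q levels A i0"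
      using I by (auto simp: I_def)
    have "c < levels" using b c(1) unfolding levels_def by linarith
    then obtain m' where m': "m = Suc m'" using c(2) by (cases m) auto
    define i where "i = nats s 12"
    have i: "i < nats sf 3" "i < 2 * (N * n)" using c(5) pf(2) by (simp_all add: i_def)
    have pi: "proc_ok sf i" using fin i by (simp add: final_def)
    have f: "nats s (fa a k) = nats sf (fa a k)" for a k using updD(1)[OF u, of "fa a k"] by (simp add: fa_neq)
    have sr: "str s k = str sf k" "thr s k = thr sf k" for k
      using updD(3)[OF u, of "Suc (N * n + k)"] updD(2)[OF u, of "16 + 3 * d + k"] by simp_all
    have ok: "node_ok s i"
      using pi P_M apply_length unfolding node_ok_def proc_ok_def f sr by (auto split: if_splits)
    have slen: "length (str s i) \<le> \<mu>" using fin by (simp add: sr final_def mem_ok_def)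
    have chl: "nats s (fa 3 i) < nats sf 3" "0 < nats s (fa 2 i) \<Longrightarrow> Suc (nats s (fa 3 i)) < nats sf 3"
      using pi unfolding proc_ok_def f by (auto split: if_splits)
    have "det (?V ;; ?move) s 10 (\<lambda>s'. \<exists>i'<m. I i' s')"
    proof (rule det_Seq)
      show "det ?V s 3 (\<lambda>s'. nats s' = nats s \<and> strs s' = strs s \<and>
         upd {} ({8} \<union> vec_cells) {} s s' \<and> reals s' 8 = node_val s i (strs s (nval (NLit 0) s)))"
        using v ok q c(3) by (intro det_val) (auto simp: i_def)
      fix s1 assume "nats s1 = nats s \<and> strs s1 = strs s \<and>
         upd {} ({8} \<union> vec_cells) {} s s1 \<and> reals s1 8 = node_val s i (strs s (nval (NLit 0) s))"
      then have s1: "nats s1 = nats s" "strs s1 = strs s" "upd {} ({8} \<union> vec_cells) {} s s1" "reals s1 8 = node_val s i q"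
        using c(3) by simp_all
      have r1: "reals s1 (16 + 3 * d + k) = thr sf k" "reals s1 4 = R" "reals s1 3 = r" "reals s1 5 = Lev" "reals s1 14 = real c" for k
        using updD(2)[OF s1(3)] v(1) c(1) sr by (simp_all add: params_def)
      have n1: "nats s 2 = N" "nats s 0 = n" "nats s (Suc 0) = d" "nats s 12 = i"
        using v(1) by (simp_all add: params_def i_def)
      have u1: "upd {12, 15} ({8, 14} \<union> vec_cells) {0} sf s1"
        by (rule upd_trans[OF u s1(3)]) auto
      show "det ?move s1 7 (\<lambda>s'. \<exists>i'<m. I i' s')"
      proof (rule det_exe)
        have ch: "nats s (fa 3 i) < 2 ^ \<beta>" "0 < nats s (fa 2 i) \<Longrightarrow> Suc (nats s (fa 3 i)) < 2 ^ \<beta>"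
          using chl pf(2) sz by linarith+
        show "safe E \<beta> \<kappa> \<mu> ?move s1"
          using ch slen sz by (simp add: s1(1,2) n1)
        define s' where "s' = exe E ?move s1"
        consider (cut) "0 < nats s (fa 2 i)" | (far) "nats s (fa 2 i) = 0" "R + r < node_val s i q"
          | (hit) "nats s (fa 2 i) = 0" "node_val s i q \<le> R + r" by linarith
        then have "\<exists>i'<m. I i' s'"
        proof cases
          case cut
          define k where "k = (if thr sf i < node_val s i q then nats s (fa 3 i) else Suc (nats s (fa 3 i)))"
          have e: "s' = s1\<lparr>nats := (nats s)(12 := k), reals := (reals s1)(14 := real c + 1)\<rparr>"
            using cut by (simp add: s'_def s1(1) n1 r1 s1(4) k_def)
          have h: "hits q m A i = hits q m' A k"
            using cut i(2) unfolding m' A k_def by (auto simp: abs_def f sr node_val_def not_less)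
          have "I m' s'"
            using u1 c h chl cut unfolding I_def U_def
            by (auto simp: e upd_def s1 k_def m' i_def intro!: exI[of _ "Suc c"])
          then show ?thesis by (auto simp: m')
        next
          case far
          define k where "k = nats s (fa 3 i)"
          have e: "s' = s1\<lparr>nats := (nats s)(12 := k), reals := (reals s1)(14 := real c + 1)\<rparr>"
            using far by (simp add: s'_def s1(1) n1 r1 s1(4) k_def)
          have h: "hits q m A i = hits q m' A k"
            using far i(2) unfolding m' A k_def by (auto simp: abs_def f sr node_val_def not_le)
          have "I m' s'"
            using u1 c h chl far unfolding I_def U_def
            by (auto simp: e upd_def s1 k_def m' i_def intro!: exI[of _ "Suc c"])
          then show ?thesis by (auto simp: m')
        next
          case hit
          have e: "s' = s1\<lparr>strs := (strs s)(0 := str s i), nats := (nats s)(15 := N), reals := (reals s1)(14 := Lev + 1)\<rparr>"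
            using hit by (simp add: s'_def s1(1,2) n1 r1 s1(4) not_less)
          have "str s i \<in> P" "dM (str s i) q \<le> R + r"
            using hit pi unfolding sr f by (simp_all add: proc_ok_def node_val_def f sr)
          then have "I 0 s'"
            using u1 unfolding I_def U_def by (auto simp: e found_def upd_def s1)
          then show ?thesis by (auto simp: m')
        qed
        then show "\<exists>i'<m. I i' (exe E ?move s1)" by (simp only: s'_def)
      qed simp_all
    qed simp
    then show "0 < m \<and> det (?V ;; ?move) s 10 (\<lambda>s'. \<exists>i'<m. I i' s')" using m' by simp
  qed simp_all
  then show ?thesis by (simp add: U_def)
qed

text \<open>The step bound holds for every query of the space, with or without a near neighbour; the
  quality of the answer depends on \<open>hits\<close> alone.\<close>

lemma det_query:
  assumes fin: "final sf" and A: "A = abs sf (2 * (N * n))" and q: "q \<in> M"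
    and s0: "s0 = with_query q sf"
  shows "det query_prog s0 (N * (levels * 11 + 5) + 2) (\<lambda>s. found q s \<or> (\<forall>i<N. \<not> hits q levels A i))"
proof -
  define U where "U = upd {12, 15} ({8, 14} \<union> vec_cells) {0} sf"
  define I where "I m s \<longleftrightarrow> U s \<and>
    (found q s \<and> m = 0 \<and> N \<le> nats s 15 \<or>
     nats s 15 + m = N \<and> strs s 0 = q \<and> (\<forall>i<nats s 15. \<not> hits q levels A i))" for m :: nat and s
  have pf: "params sf" "N \<le> nats sf 3" using fin by (auto simp: final_def)
  have sz: "N + 1 < 2 ^ \<beta>"
  proof -
    have "N * 1 \<le> N * n" using n_ge by (intro mult_le_mono) auto
    moreover have "4 * (N * n) + d + 2 < 2 ^ \<beta>" using size by (simp add: mult.commute)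
    ultimately show "N + 1 < 2 ^ \<beta>" using N_pos n_ge by linarith
  qed
  let ?init = "NSet (NLit 12) (V 15) ;; RSet (NLit 14) (RNat (NLit 0))"
  let ?body = "?init ;; walk_prog ;; inc 15"
  show ?thesis
    unfolding query_prog_def
  proof (rule det_Seq)
    show "det (NSet (NLit 15) (NLit 0)) s0 1 (I N)"
      by (rule det_exe) (auto simp: I_def U_def s0 with_query_def upd_def)
    fix s1 assume "I N s1"
    then show "det (While (NLess (V 15) (V 2)) ?body) s1 (N * (levels * 11 + 5) + 1)
        (\<lambda>s. found q s \<or> (\<forall>i<N. \<not> hits q levels A i))"
    proof (rule det_While[where I = I and ?k1.0 = "levels * 11 + 4", rotated 2])
      fix m s assume I: "I m s"
      have u: "U s" using I by (simp add: I_def)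
      have v: "nats s 2 = N" using updD(1)[OF u[unfolded U_def], of 2] pf by (simp add: params_def)
      show "found q s \<or> (\<forall>i<N. \<not> hits q levels A i)" if "\<not> bval (NLess (V 15) (V 2)) s"
        using that I v by (auto simp: I_def)
      assume "bval (NLess (V 15) (V 2)) s"
      then have b: "nats s 15 < N" using v by simp
      define i where "i = nats s 15"
      have c: "i + m = N" "strs s 0 = q" "\<And>i'. i' < i \<Longrightarrow> \<not> hits q levels A i'"
        using I b by (auto simp: I_def i_def)
      have m: "0 < m" using c(1) b by (simp add: i_def)
      have "det ?body s (levels * 11 + 4) (\<lambda>s'. \<exists>i'<m. I i' s')"
      proof (rule det_Seq)
        show "det ?init s 2 (\<lambda>s'. U s' \<and> nats s' 12 = i \<and> reals s' 14 = 0 \<and> strs s' 0 = q \<and> nats s' 15 = i)"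
          by (rule det_exe) (use u b sz c in \<open>auto simp: U_def upd_def i_def\<close>)
        fix s2 assume s2: "U s2 \<and> nats s2 12 = i \<and> reals s2 14 = 0 \<and> strs s2 0 = q \<and> nats s2 15 = i"
        show "det (walk_prog ;; inc 15) s2 (levels * 11 + 2) (\<lambda>s'. \<exists>i'<m. I i' s')"
        proof (rule det_Seq)
          show "det walk_prog s2 (levels * 11 + 1) (\<lambda>s. upd {12, 15} ({8, 14} \<union> vec_cells) {0} sf s \<and>
             (found q s \<and> nats s 15 = N \<or> strs s 0 = q \<and> nats s 15 = nats s2 15 \<and> \<not> hits q levels A i))"
            using s2 b pf by (intro det_walk[OF fin A q]) (auto simp: U_def i_def)
          fix s3 assume s3: "upd {12, 15} ({8, 14} \<union> vec_cells) {0} sf s3 \<and>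
             (found q s3 \<and> nats s3 15 = N \<or> strs s3 0 = q \<and> nats s3 15 = nats s2 15 \<and> \<not> hits q levels A i)"
          have i15: "nats s3 15 = N \<or> nats s3 15 = i" using s3 s2 by auto
          show "det (inc 15) s3 1 (\<lambda>s'. \<exists>i'<m. I i' s')"
          proof (rule det_exe)
            have "i < N" using b by (simp add: i_def)
            then show "safe E \<beta> \<kappa> \<mu> (inc 15) s3" using sz i15 by auto
            have U': "U (exe E (inc 15) s3)" using s3 by (simp add: U_def upd_def)
            show "\<exists>i'<m. I i' (exe E (inc 15) s3)"
            proof (cases "found q s3 \<and> nats s3 15 = N")
              case True
              then have "I 0 (exe E (inc 15) s3)" using U' by (simp add: I_def found_def)
              then show ?thesis using m by blast
            next
              case False
              then have "strs s3 0 = q" "nats s3 15 = i" "\<not> hits q levels A i" using s3 s2 by auto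
              then have "I (m - 1) (exe E (inc 15) s3)" using U' c m \<open>i < N\<close> by (auto simp: I_def less_Suc_eq)
              then show ?thesis using m by (intro exI[of _ "m - 1"]) simp
            qed
          qed simp_all
        qed simp
      qed simp
      then show "0 < m \<and> det ?body s (levels * 11 + 4) (\<lambda>s'. \<exists>i'<m. I i' s')"
        using m by blast
    qed simp_all
  qed simp
qed

end

section \<open>Initialisation\<close>

locale nns_input = nns E M dM d D \<epsilon> \<Delta> r P \<beta> \<kappa> \<mu> n N Lev
  for E :: subroutines and M :: "bits set" and dM :: "bits \<Rightarrow> bits \<Rightarrow> real"
    and d :: nat and D \<epsilon> \<Delta> r :: real and P :: "bits set" and \<beta> \<kappa> \<mu> n N :: nat and Lev :: real +
  fixes xs :: "bits list" and lg :: nat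
  assumes xs: "distinct xs" "set xs = P" "length xs = n"
    and ell: "n \<le> 2 ^ lg" "\<And>i. i < lg \<Longrightarrow> 2 ^ i < n"
    and N_eq: "N = 8 * 2 ^ nat \<lfloor>\<epsilon> * real lg\<rfloor>"
    and Lev_eq: "Lev = 6 * real lg * real d * \<Delta> / r"
    and emb: "2000 * \<beta> + embed_time E \<le> \<kappa>"
begin

abbreviation "s_init \<equiv> initial_state d D \<epsilon> \<Delta> r xs"

lemma size': "4 * (N * n) + d + 2 < 2 ^ \<beta>" "N \<le> N * n" "n \<le> N * n"
  using size n_ge N_pos by (simp_all add: mult.commute)

lemma det_trees:
  "det trees_prog s_init (lg * 8 + 5) (\<lambda>s. upd {2, 14} {12, 13} {} s_init s \<and> nats s 2 = N \<and> reals s 13 = real lg)"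
proof -
  define frac where "frac i = \<epsilon> * real i - of_int \<lfloor>\<epsilon> * real i\<rfloor>" for i
  define num where "num i = nat \<lfloor>\<epsilon> * real i\<rfloor>" for i
  define I where "I i s \<longleftrightarrow> upd {2, 14} {12, 13} {} s_init s \<and> nats s 14 = 2 ^ i \<and> nats s 2 = 8 * 2 ^ num i \<and>
    reals s 13 = real i \<and> reals s 12 = frac i" for i s
  let ?init = "NSet (NLit 14) (NLit 1) ;; NSet (NLit 2) (NLit 8) ;;
     RSet (NLit 12) (RNat (NLit 0)) ;; RSet (NLit 13) (RNat (NLit 0))"
  let ?body = "NSet (NLit 14) (NAdd (V 14) (V 14)) ;;
       RSet (NLit 13) (RAdd (X 13) (RNat (NLit 1))) ;;
       RSet (NLit 12) (RAdd (X 12) (X 1)) ;;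
       Cond (RLess (X 12) (RNat (NLit 1))) Skip
         (RSet (NLit 12) (RSub (X 12) (RNat (NLit 1))) ;; NSet (NLit 2) (NAdd (V 2) (V 2)))"
  have i0: "nats s_init 0 = n" "reals s_init 1 = \<epsilon>" "reals s_init (Suc 0) = \<epsilon>" using xs by (simp_all add: initial_state_def)
  have small: "8 * 2 ^ num i < (2::nat) ^ \<beta>" if "i \<le> lg" for i
  proof -
    have "num i \<le> num lg" unfolding num_def using that eps by (intro nat_mono floor_mono mult_left_mono) auto
    then have "8 * 2 ^ num i \<le> N" unfolding N_eq num_def by simp
    then show ?thesis using size' by linarith
  qed
  \<comment> \<open>As \<open>\<epsilon> \<le> 1\<close>, adding it crosses at most one integer, so
    one comparison and one subtraction track the floor.\<close>
  have step: "if frac i + \<epsilon> < 1 then frac (Suc i) = frac i + \<epsilon> \<and> num (Suc i) = num i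
     else frac (Suc i) = frac i + \<epsilon> - 1 \<and> num (Suc i) = Suc (num i)" for i
  proof -
    have fr: "0 \<le> frac i" "frac i < 1" unfolding frac_def by linarith+
    have e: "\<epsilon> * real (Suc i) = of_int \<lfloor>\<epsilon> * real i\<rfloor> + (frac i + \<epsilon>)" unfolding frac_def by (simp add: algebra_simps)
    have "0 \<le> \<lfloor>\<epsilon> * real i\<rfloor>" using eps by simp
    then show ?thesis
    proof (cases "frac i + \<epsilon> < 1")
      case True
      then have "\<lfloor>\<epsilon> * real (Suc i)\<rfloor> = \<lfloor>\<epsilon> * real i\<rfloor>" unfolding e using fr eps by (intro floor_unique) auto
      then show ?thesis using True e by (simp add: frac_def num_def)
    next
      case False
      then have "\<lfloor>\<epsilon> * real (Suc i)\<rfloor> = \<lfloor>\<epsilon> * real i\<rfloor> + 1" unfolding e using fr eps by (intro floor_unique) auto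
      then show ?thesis using False e \<open>0 \<le> \<lfloor>\<epsilon> * real i\<rfloor>\<close> by (simp add: frac_def num_def nat_add_distrib)
    qed
  qed
  have "det trees_prog s_init (lg * 8 + 5) (I lg)"
    unfolding trees_prog_def
  proof (rule det_Seq)
    show "det ?init s_init 4 (I 0)"
    proof (rule det_exe)
      show "safe E \<beta> \<kappa> \<mu> ?init s_init" using small[of 0] one_less_power[of "2::nat" \<beta>] beta_ge by (simp add: num_def)
    qed (auto simp: I_def upd_def frac_def num_def)
    fix s1 assume "I 0 s1"
    then show "det (While (NLess (V 14) (V 0)) ?body) s1 (lg * 8 + 1) (I lg)"
    proof (rule det_for[where ?k1.0 = 7, rotated 2])
      fix i s assume I: "I i s" and i: "i < lg"
      have v: "nats s 0 = n" "reals s (Suc 0) = \<epsilon>" "nats s 14 = 2 ^ i" "nats s 2 = 8 * 2 ^ num i" "reals s 13 = real i" "reals s 12 = frac i"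
        using I i0 by (auto simp: I_def upd_def)
      have "det ?body s 7 (I (Suc i))"
      proof (rule det_exe)
        have "2 * 2 ^ i < (2::nat) ^ \<beta>" using ell(2)[OF i] size' by linarith
        moreover have "8 * 2 ^ num (Suc i) < (2::nat) ^ \<beta>" using small[of "Suc i"] i by simp
        ultimately show "safe E \<beta> \<kappa> \<mu> ?body s" using step[of i] by (auto simp: v split: if_splits)
        show "I (Suc i) (exe E ?body s)" using step[of i] I by (auto simp: I_def v upd_def split: if_splits)
      qed simp_all
      then show "bval (NLess (V 14) (V 0)) s \<and> det ?body s 7 (I (Suc i))" using ell(2)[OF i] by (simp add: v)
    next
      fix s assume I: "I lg s"
      then have "nats s 0 = n" "nats s 14 = 2 ^ lg" using i0 by (auto simp: I_def upd_def)
      then show "\<not> bval (NLess (V 14) (V 0)) s" using ell(1) by simp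
    qed simp_all
  qed simp
  then show ?thesis by (rule det_mono) (auto simp: I_def num_def N_eq)
qed

lemma det_copy:
  assumes p: "params s0" and st: "strs s0 = strs s_init"
  shows "det copy_prog s0 (N * n * 3 + 2) (\<lambda>s. upd {7} {} {a. 1 \<le> a} s0 s \<and>
    (\<forall>a\<ge>1. strs s a = (if a \<le> N * n then xs ! ((a - 1) mod n) else [])))"
proof -
  define I where "I k s \<longleftrightarrow> upd {7} {} {a. 1 \<le> a} s0 s \<and> nats s 7 = Suc k \<and>
    (\<forall>a\<ge>1. strs s a = (if a \<le> n + k then xs ! ((a - 1) mod n) else []))" for k s
  let ?b = "NLess (NAdd (V 7) (V 0)) (NAdd (NMul (V 2) (V 0)) (NLit 1))"
  let ?body = "SCopy (NAdd (V 7) (V 0)) (V 7) ;; inc 7"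
  let ?m = "N * n - n"
  have len: "length (xs ! (a mod n)) \<le> \<mu>" for a
  proof -
    have "xs ! (a mod n) \<in> P" using xs n_ge by (metis less_le_trans mod_less_divisor nth_mem zero_less_numeral)
    then show ?thesis using P_M M_len by blast
  qed
  have "det copy_prog s0 (?m * 3 + 2) (I ?m)"
    unfolding copy_prog_def
  proof (rule det_Seq)
    show "det (NSet (NLit 7) (NLit 1)) s0 1 (I 0)"
    proof (rule det_exe)
      show "safe E \<beta> \<kappa> \<mu> (NSet (NLit 7) (NLit 1)) s0" using one_less_power[of "2::nat" \<beta>] beta_ge by simp
      show "I 0 (exe E (NSet (NLit 7) (NLit 1)) s0)"
        using xs by (auto simp: I_def upd_def st initial_state_def)
    qed simp_all
    fix s1 assume "I 0 s1"
    then show "det (While ?b ?body) s1 (?m * 3 + 1) (I ?m)"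
    proof (rule det_for[where ?k1.0 = 2, rotated 2])
      fix k s assume I: "I k s" and k: "k < ?m"
      have v: "nats s 0 = n" "nats s 2 = N" "nats s 7 = Suc k" "strs s (Suc k) = xs ! (k mod n)"
        using I p n_ge by (auto simp: I_def upd_def params_def)
      have "det ?body s 2 (I (Suc k))"
      proof (rule det_exe)
        have "Suc (Suc k) < 2 ^ \<beta>" using k size' by linarith
        then show "safe E \<beta> \<kappa> \<mu> ?body s" using len by (simp add: v)
        show "I (Suc k) (exe E ?body s)" using I n_ge by (auto simp: I_def v upd_def)
      qed simp_all
      then show "bval ?b s \<and> det ?body s 2 (I (Suc k))" using k by (simp add: v)
    next
      fix s assume "I ?m s"
      then have "nats s 0 = n" "nats s 2 = N" "nats s 7 = Suc ?m" using p by (auto simp: I_def upd_def params_def)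
      then show "\<not> bval ?b s" using size'(3) by simp
    qed simp_all
  qed simp
  then show ?thesis by (rule det_mono) (use size'(3) in \<open>auto simp: I_def\<close>)
qed

lemma det_roots:
  assumes p: "params s0" and st: "nats s0 3 = 0"
  shows "det roots_prog s0 (N * 4 + 1) (\<lambda>s. upd ({3} \<union> {32..<32 + 4 * N}) {} {} s0 s \<and> nats s 3 = N \<and>
    (\<forall>i<N. nats s (fa 0 i) = Suc (i * n) \<and> nats s (fa 1 i) = Suc (Suc i * n)))"
proof -
  define I where "I c s \<longleftrightarrow> upd ({3} \<union> {32..<32 + 4 * N}) {} {} s0 s \<and> nats s 3 = c \<and>
    (\<forall>i<c. nats s (fa 0 i) = Suc (i * n) \<and> nats s (fa 1 i) = Suc (Suc i * n))" for c s
  let ?body = "NSet (fld 0 (V 3)) (NAdd (NMul (V 3) (V 0)) (NLit 1)) ;;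
       NSet (fld 1 (V 3)) (NAdd (NMul (NAdd (V 3) (NLit 1)) (V 0)) (NLit 1)) ;; inc 3"
  have "det roots_prog s0 (N * 4 + 1) (I N)"
    unfolding roots_prog_def
  proof (rule det_for[where ?k1.0 = 3])
    show "I 0 s0" using st by (simp add: I_def upd_refl)
    fix c s assume I: "I c s" and c: "c < N"
    have v: "nats s 0 = n" "nats s 2 = N" "nats s 3 = c" using I p by (auto simp: I_def upd_def params_def)
    have "det ?body s 3 (I (Suc c))"
    proof (rule det_exe)
      have "Suc c * n \<le> N * n" using c by (intro mult_le_mono) auto
      moreover have "c * n \<le> Suc c * n" by simp
      moreover have "Suc c \<le> N" using c by simp
      ultimately have "Suc (Suc c * n) < 2 ^ \<beta>" "Suc (c * n) < 2 ^ \<beta>" "Suc c < 2 ^ \<beta>" using size' by linarith+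
      then show "safe E \<beta> \<kappa> \<mu> ?body s" by (simp add: v fa_neq)
      have a: "fa 0 c \<in> {32..<32 + 4 * N}" "fa 1 c \<in> {32..<32 + 4 * N}" using c by (simp_all add: fa_def)
      define s' where "s' = exe E ?body s"
      have s': "nats s' = (nats s)(fa 0 c := Suc (c * n), fa 1 c := Suc (Suc c * n), 3 := Suc c)"
        "reals s' = reals s" "strs s' = strs s" by (simp_all add: s'_def v fa_neq)
      have "upd ({3} \<union> {32..<32 + 4 * N}) {} {} s0 s'" using I a unfolding I_def upd_def s' by auto
      moreover have "\<forall>i<Suc c. nats s' (fa 0 i) = Suc (i * n) \<and> nats s' (fa 1 i) = Suc (Suc i * n)"
        using I unfolding I_def s' by (simp add: fa_eq fa_neq less_Suc_eq)
      ultimately show "I (Suc c) (exe E ?body s)" unfolding s'_def[symmetric] by (simp add: I_def s'(1))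
    qed simp_all
    then show "bval (NLess (V 3) (V 2)) s \<and> det ?body s 3 (I (Suc c))" using c by (simp add: v)
  next
    fix s assume "I N s"
    then show "\<not> bval (NLess (V 3) (V 2)) s" using p by (auto simp: I_def upd_def params_def)
  qed simp_all
  then show ?thesis by (rule det_mono) (auto simp: I_def)
qed

lemma forest_inv_roots:
  assumes p: "params s" and n4: "nats s 4 = 0" "nats s 3 = N"
    and roots: "\<And>i. i < N \<Longrightarrow> nats s (fa 0 i) = Suc (i * n)" "\<And>i. i < N \<Longrightarrow> nats s (fa 1 i) = Suc (Suc i * n)"
    and blank: "\<And>a. 40 + 8 * (N * n) \<le> a \<Longrightarrow> nats s a = 0" "\<And>a. 16 \<le> a \<Longrightarrow> reals s a = 0"
    and pts: "\<And>a. 1 \<le> a \<Longrightarrow> strs s a = (if a \<le> N * n then xs ! ((a - 1) mod n) else [])"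
  shows "forest_inv 0 s"
proof -
  have n: "0 < n" using n_ge by simp
  have o: "own s i = i" if "i < N" for i using roots[OF that] n by (simp add: own_def)
  have xsP: "xs ! (a mod n) \<in> P" for a using xs n by (metis mod_less_divisor nth_mem)
  have ce: "cells s i = {Suc (i * n)..<Suc (Suc i * n)}" if "i < N" for i
    using roots[OF that] unfolding cells_def by simp
  have w: "weight s i = 2 * (n - 1)" if "i < N" for i using roots[OF that] unfolding weight_def by simp
  have sub: "a \<le> N * n" if "i < N" "a \<in> cells s i" for i a
  proof -
    have "Suc i * n \<le> N * n" using that by (intro mult_le_mono) auto
    then show ?thesis using that(2) unfolding ce[OF that(1)] by auto
  qed
  have val: "strs s a = xs ! (a - Suc (i * n))" "a - Suc (i * n) < n" if "i < N" "a \<in> cells s i" for i a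
  proof -
    have a: "Suc (i * n) \<le> a" "a < Suc (i * n) + n" using that(2) unfolding ce[OF that(1)] by auto
    then have "a - 1 = (a - Suc (i * n)) + i * n" by simp
    then have "(a - 1) mod n = (a - Suc (i * n)) mod n" by simp
    then have m: "(a - 1) mod n = a - Suc (i * n)" using a by simp
    show "strs s a = xs ! (a - Suc (i * n))" using pts[of a] a(1) sub[OF that] m by simp
    show "a - Suc (i * n) < n" using a by simp
  qed
  have mem: "mem_ok s"
    unfolding mem_ok_def
  proof (intro conjI allI impI)
    show "strs s a = []" if "Suc (3 * (N * n)) \<le> a" for a using pts[of a] that by simp
    show "length (strs s a) \<le> \<mu>" if "1 \<le> a" for a using pts[OF that] xsP P_M M_len by auto
  qed (use blank in auto)
  show ?thesis
    unfolding forest_inv_def n4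
  proof (intro conjI)
    show "params s" by (rule p)
    show "mem_ok s" by (rule mem)
    show "N + (\<Sum>i\<in>{0..<N}. weight s i) \<le> 2 * (N * n)"
    proof -
      have "(\<Sum>i\<in>{0..<N}. weight s i) = N * (2 * (n - 1))" using w by simp
      moreover have "N + N * (2 * (n - 1)) \<le> 2 * (N * n)"
      proof -
        obtain k where "n = Suc k" using n by (cases n) auto
        then show ?thesis by simp
      qed
      ultimately show ?thesis by simp
    qed
    show "\<forall>i<N. cell_ok s i" using roots o n by (simp add: cell_ok_def mult.commute)
    show "\<forall>i<N. own s i = i" using o by simp
    show "\<forall>i\<in>{0..<N}. \<forall>i'\<in>{0..<N}. i \<noteq> i' \<longrightarrow> cells s i \<inter> cells s i' = {}"
    proof (intro ballI impI)
      fix i i' assume i: "i \<in> {0..<N}" "i' \<in> {0..<N}" "i \<noteq> i'"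
      have "cells s i \<inter> cells s i' = {}" if "i < i'" "i' < N" for i i'
      proof -
        have "Suc i * n \<le> i' * n" using that by (intro mult_le_mono) auto
        then show ?thesis using that unfolding ce[OF that(2)] ce[OF less_trans[OF that]] by auto
      qed
      then show "cells s i \<inter> cells s i' = {}" using i by (metis Int_commute atLeastLessThan_iff linorder_neqE_nat)
    qed
    show "\<forall>i\<in>{0..<N}. inj_on (strs s) (cells s i) \<and> strs s ` cells s i \<subseteq> P"
    proof (intro ballI conjI)
      fix i assume "i \<in> {0..<N}"
      then have i: "i < N" by simp
      show "inj_on (strs s) (cells s i)"
      proof (rule inj_onI)
        fix a b assume a: "a \<in> cells s i" and b: "b \<in> cells s i" and eq: "strs s a = strs s b"
        have "a - Suc (i * n) = b - Suc (i * n)"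
          using eq val[OF i a] val[OF i b] xs by (simp add: nth_eq_iff_index_eq)
        then show "a = b" using a b unfolding ce[OF i] by auto
      qed
      show "strs s ` cells s i \<subseteq> P"
      proof (rule image_subsetI)
        fix a assume a: "a \<in> cells s i"
        show "strs s a \<in> P" unfolding val(1)[OF i a] using val(2)[OF i a] nth_mem[of _ xs] by (simp add: xs)
      qed
    qed
  qed simp_all
qed

definition init_steps :: nat where
  "init_steps = lg * 8 + N * n * 3 + N * 4 + 10"

definition whole :: "state \<Rightarrow> bool" where
  "whole s \<longleftrightarrow> (\<forall>i<N. strs s ` cells s i = P)"

lemma whole_roots:
  assumes inv: "forest_inv 0 s" and n3: "nats s 3 = N"
    and roots: "\<And>i. i < N \<Longrightarrow> nats s (fa 0 i) = Suc (i * n)" "\<And>i. i < N \<Longrightarrow> nats s (fa 1 i) = Suc (Suc i * n)"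
  shows "whole s"
  unfolding whole_def
proof (intro allI impI)
  fix i assume i: "i < N"
  have "inj_on (strs s) (cells s i) \<and> strs s ` cells s i \<subseteq> P" using inv i n3 unfolding forest_inv_def by simp
  moreover have "card (cells s i) = n" using roots[OF i] unfolding cells_def by simp
  moreover have "card P = n" using xs distinct_card by fastforce
  ultimately show "strs s ` cells s i = P" using P_fin by (intro card_subset_eq) (auto simp: card_image)
qed

lemma det_init:
  "det (trees_prog ;; radius_prog ;; copy_prog ;; roots_prog) s_init init_steps (\<lambda>s. forest_inv 0 s \<and> whole s)"
proof (rule det_Seq[OF det_trees])
  fix s1 assume s1: "upd {2, 14} {12, 13} {} s_init s1 \<and> nats s1 2 = N \<and> reals s1 13 = real lg"
  note u1 = conjunct1[OF s1]
  have v1: "nats s1 0 = n" "nats s1 (Suc 0) = d" "reals s1 0 = D" "reals s1 (Suc 0) = \<epsilon>" "reals s1 2 = \<Delta>" "reals s1 3 = r"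
    using updD[OF u1] xs by (simp_all add: initial_state_def)
  show "det (radius_prog ;; copy_prog ;; roots_prog) s1 (N * n * 3 + N * 4 + 5) (\<lambda>s. forest_inv 0 s \<and> whole s)"
  proof (rule det_Seq)
    show "det radius_prog s1 2 (\<lambda>s. upd {} {4, 5} {} s1 s \<and> params s)"
    proof (rule det_exe)
      have "nats s1 2 = N" "reals s1 13 = real lg" using s1 by simp_all
      then show "upd {} {4, 5} {} s1 (exe E radius_prog s1) \<and> params (exe E radius_prog s1)"
        using v1 unfolding radius_prog_def upd_def params_def by (simp add: R_def Lev_eq)
    qed (simp_all add: radius_prog_def)
    fix s2 assume s2: "upd {} {4, 5} {} s1 s2 \<and> params s2"
    have u2: "upd {2, 14} {4, 5, 12, 13} {} s_init s2"
      using upd_trans[OF u1 conjunct1[OF s2]] by auto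
    have st2: "strs s2 = strs s_init" using u2 by (auto simp: upd_def)
    show "det (copy_prog ;; roots_prog) s2 (N * n * 3 + N * 4 + 3) (\<lambda>s. forest_inv 0 s \<and> whole s)"
    proof (rule det_Seq[OF det_copy[OF conjunct2[OF s2] st2]])
      fix s3 assume s3: "upd {7} {} {a. 1 \<le> a} s2 s3 \<and>
        (\<forall>a\<ge>1. strs s3 a = (if a \<le> N * n then xs ! ((a - 1) mod n) else []))"
      have p3: "params s3" using s2 s3 by (auto simp: params_def upd_def)
      have n3: "nats s3 3 = 0" using u2 s3 by (auto simp: upd_def initial_state_def)
      show "det roots_prog s3 (N * 4 + 1) (\<lambda>s. forest_inv 0 s \<and> whole s)"
      proof (rule det_mono[OF det_roots[OF p3 n3]])
        fix s4 assume s4: "upd ({3} \<union> {32..<32 + 4 * N}) {} {} s3 s4 \<and> nats s4 3 = N \<and>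
          (\<forall>i<N. nats s4 (fa 0 i) = Suc (i * n) \<and> nats s4 (fa 1 i) = Suc (Suc i * n))"
        have nz: "nats s4 a = nats s_init a" if "a \<notin> {2, 3, 7, 14} \<union> {32..<32 + 4 * N}" for a
          using that u2 s3 s4 by (auto simp: upd_def)
        have rz: "reals s4 a = reals s_init a" if "a \<notin> {4, 5, 12, 13}" for a
          using that u2 s3 s4 by (auto simp: upd_def)
        have st4: "strs s4 = strs s3" using s4 by (auto simp: upd_def)
        have "forest_inv 0 s4"
        proof (rule forest_inv_roots)
          show "params s4" using p3 s4 by (auto simp: params_def upd_def)
          show "nats s4 4 = 0" using nz[of 4] by (simp add: initial_state_def)
          show "nats s4 a = 0" if "40 + 8 * (N * n) \<le> a" for a
            using nz[of a] that size'(2) by (simp add: initial_state_def)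
          show "reals s4 a = 0" if "16 \<le> a" for a using rz[of a] that by (simp add: initial_state_def)
        qed (use s3 s4 st4 in auto)
        moreover from this have "whole s4" using s4 by (intro whole_roots) auto
        ultimately show "forest_inv 0 s4 \<and> whole s4" ..
      qed simp
    qed simp
  qed simp
qed (simp add: init_steps_def)

lemma bnd_init: "bnd \<beta> s_init"
proof -
  have "n < 2 ^ \<beta>" "d < 2 ^ \<beta>" using size' by linarith+
  then show ?thesis by (simp add: bnd_def initial_state_def xs)
qed

text \<open>Initialisation reads no coins, so one state with these properties is reached for every
  coin stream and can be fixed as the start of the random process.\<close>

definition s_root :: state where
  "s_root = (SOME s. forest_inv 0 s \<and> whole s \<and> bnd \<beta> s \<and> (\<exists>t. (\<forall>w. exec E (trees_prog ;; radius_prog ;; copy_prog ;; roots_prog) (s_init, w) t (s, w)) \<and> t \<le> init_steps * \<kappa>))"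

lemma s_root: "forest_inv 0 s_root" "whole s_root" "bnd \<beta> s_root"
  "\<exists>t. (\<forall>w. exec E (trees_prog ;; radius_prog ;; copy_prog ;; roots_prog) (s_init, w) t (s_root, w)) \<and> t \<le> init_steps * \<kappa>"
proof -
  have "runs (trees_prog ;; radius_prog ;; copy_prog ;; roots_prog) s_init [] init_steps (\<lambda>s' l'. l' = [] \<and> forest_inv 0 s' \<and> whole s')"
    using det_init by (simp add: det_def)
  then obtain t s l1 l2 where "[] = l1 @ l2" "\<forall>w. exec E (trees_prog ;; radius_prog ;; copy_prog ;; roots_prog) (s_init, l1 @- w) t (s, w)"
    "t \<le> init_steps * \<kappa>" "bnd \<beta> s" "forest_inv 0 s" "whole s" using bnd_init unfolding runs_def by blast
  then have "forest_inv 0 s \<and> whole s \<and> bnd \<beta> s \<and> (\<exists>t. (\<forall>w. exec E (trees_prog ;; radius_prog ;; copy_prog ;; roots_prog) (s_init, w) t (s, w)) \<and> t \<le> init_steps * \<kappa>)"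
    by auto
  then have "forest_inv 0 s_root \<and> whole s_root \<and> bnd \<beta> s_root \<and> (\<exists>t. (\<forall>w. exec E (trees_prog ;; radius_prog ;; copy_prog ;; roots_prog) (s_init, w) t (s_root, w)) \<and> t \<le> init_steps * \<kappa>)"
    unfolding s_root_def by (rule someI)
  then show "forest_inv 0 s_root" "whole s_root" "bnd \<beta> s_root"
    "\<exists>t. (\<forall>w. exec E (trees_prog ;; radius_prog ;; copy_prog ;; roots_prog) (s_init, w) t (s_root, w)) \<and> t \<le> init_steps * \<kappa>"
    by blast+
qed

abbreviation "rounds \<equiv> 2 * (N * n)"

definition forest :: "bool list \<Rightarrow> state" where
  "forest l = iter step B rounds s_root l"

definition stored :: "bool list \<Rightarrow> state" where
  "stored l = (forest l)\<lparr>strs := (strs (forest l))(0 := strs (forest l) 1)\<rparr>"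

definition pre_steps :: nat where
  "pre_steps = init_steps + rounds * (body_steps + 1) + 2"

lemma pre_exec:
  assumes l: "length l = rounds * B"
  shows "\<exists>t. (\<forall>w. exec E pre_prog (s_init, l @- w) t (stored l, w)) \<and> t \<le> pre_steps * \<kappa>"
    and "final (stored l)" "bnd \<beta> (stored l)" "length (strs (stored l) 0) \<le> \<mu>"
    and "\<And>i. i < rounds \<Longrightarrow> abs (stored l) rounds i = abs (forest l) rounds i"
    and "nats (stored l) = nats (forest l)" "forest_inv rounds (forest l)"
proof -
  obtain t0 where t0: "\<And>w. exec E (trees_prog ;; radius_prog ;; copy_prog ;; roots_prog) (s_init, w) t0 (s_root, w)"
    "t0 \<le> init_steps * \<kappa>" using s_root(4) by blast
  obtain t1 where t1: "\<And>w. exec E main_prog (s_root, l @- w) t1 (forest l, w)" "t1 \<le> (rounds * (body_steps + 1) + 1) * \<kappa>"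
    and f: "forest_inv rounds (forest l)" "bnd \<beta> (forest l)"
    using main_exec[OF emb s_root(1,3) _ l] unfolding forest_def by auto
  have mo: "mem_ok (forest l)" using f(1) by (simp add: forest_inv_def)
  have "length (strs (forest l) 1) \<le> \<mu>" using mo by (simp add: mem_ok_def)
  then have "safe E \<beta> \<kappa> \<mu> (SCopy (NLit 0) (NLit 1)) (forest l)" by simp
  from exe_sound[OF _ this f(2)] obtain t2 where t2: "\<And>w. exec E (SCopy (NLit 0) (NLit 1)) (forest l, w) t2 (stored l, w)"
    "t2 \<le> 1 * \<kappa>" "bnd \<beta> (stored l)" unfolding stored_def by auto
  have "exec E pre_prog (s_init, l @- w) (t0 + (t1 + t2)) (stored l, w)" for w
    unfolding pre_prog_def using t0(1) t1(1) t2(1) by (blast intro: exec.Seq)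
  moreover have "t0 + (t1 + t2) \<le> pre_steps * \<kappa>"
    using t0(2) t1(2) t2(2) by (simp add: pre_steps_def algebra_simps)
  ultimately show "\<exists>t. (\<forall>w. exec E pre_prog (s_init, l @- w) t (stored l, w)) \<and> t \<le> pre_steps * \<kappa>" by blast
  show "bnd \<beta> (stored l)" by (rule t2(3))
  show "length (strs (stored l) 0) \<le> \<mu>" using mo by (simp add: stored_def mem_ok_def)
  have o: "own (stored l) i = own (forest l) i" for i by (simp add: own_def stored_def)
  have mo': "mem_ok (stored l)" using mo by (simp add: mem_ok_def stored_def)
  have "proc_ok (stored l) i = proc_ok (forest l) i" for i
    unfolding proc_ok_def o by (simp add: stored_def)
  then show "final (stored l)"
    using final_forest[OF f(1)] mo' by (simp add: final_def params_def) (simp add: stored_def)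
  show "abs (stored l) rounds i = abs (forest l) rounds i" if "i < rounds" for i
    using that by (simp add: abs_def stored_def)
  show "nats (stored l) = nats (forest l)" by (simp add: stored_def)
  show "forest_inv rounds (forest l)" by (rule f(1))
qed

end

section \<open>Success probability\<close>

text \<open>By \<open>exec_prefix\<close> the two executions together read a finite prefix, and
  every stream with this prefix lies in the event. It is therefore a countable union of
  cylinders.\<close>

lemma event_measurable:
  "{\<omega>. \<exists>t s \<omega>' t' s' \<omega>''. exec E c (s0, \<omega>) t (s, \<omega>') \<and> exec E c' (f s, \<omega>') t' (s', \<omega>'') \<and> \<Phi> s'} \<in> sets coins"
    (is "?E \<in> _")
proof -
  have "?E = {\<omega>. \<exists>l w. \<omega> = l @- w \<and> l \<in> {l. \<forall>w. l @- w \<in> ?E}}"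
  proof (intro equalityI subsetI)
    fix \<omega> assume "\<omega> \<in> ?E"
    then obtain t s \<omega>' t' s' \<omega>'' where 1: "exec E c (s0, \<omega>) t (s, \<omega>')" and 2: "exec E c' (f s, \<omega>') t' (s', \<omega>'')"
      and \<Phi>: "\<Phi> s'" by blast
    obtain l1 where l1: "\<omega> = l1 @- \<omega>'" "\<And>w. exec E c (s0, l1 @- w) t (s, w)"
      using exec_prefix[OF 1] by auto
    obtain l2 where l2: "\<omega>' = l2 @- \<omega>''" "\<And>w. exec E c' (f s, l2 @- w) t' (s', w)"
      using exec_prefix[OF 2] by auto
    have "\<omega> = (l1 @ l2) @- \<omega>''" using l1(1) l2(1) by simp
    moreover have "(l1 @ l2) @- w \<in> ?E" for w
    proof -
      have "(l1 @ l2) @- w = l1 @- (l2 @- w)" by simp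
      then show ?thesis using l1(2)[of "l2 @- w"] l2(2)[of w] \<Phi> unfolding mem_Collect_eq by metis
    qed
    ultimately show "\<omega> \<in> {\<omega>. \<exists>l w. \<omega> = l @- w \<and> l \<in> {l. \<forall>w. l @- w \<in> ?E}}" by blast
  qed blast
  also have "\<dots> \<in> sets coins" by (rule prefix_in_coins)
  finally show ?thesis .
qed

lemma extent_le:
  assumes "\<And>a. b \<le> a \<Longrightarrow> m a = blank"
  shows "extent blank m \<le> b"
  unfolding extent_def by (rule Least_le) (use assms in blast)

context nns_input
begin

lemma space_stored:
  assumes l: "length l = rounds * B"
  shows "space_usage (stored l) \<le>
    (40 + 8 * (N * n)) * Suc (Suc \<beta>) + (16 + 3 * d + 2 * (N * n)) + Suc (3 * (N * n)) * Suc \<mu>"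
proof -
  let ?s = "stored l"
  have mo: "mem_ok ?s" using pre_exec(2)[OF l] by (simp add: final_def)
  have e: "extent 0 (nats ?s) \<le> 40 + 8 * (N * n)" "extent 0 (reals ?s) \<le> 16 + 3 * d + 2 * (N * n)"
    "extent [] (strs ?s) \<le> Suc (3 * (N * n))"
    using mo by (auto simp: mem_ok_def intro!: extent_le)
  have "(\<Sum>i<extent 0 (nats ?s). nat_size (nats ?s i)) \<le> (\<Sum>i<extent 0 (nats ?s). Suc (Suc \<beta>))"
  proof (rule sum_mono)
    fix i
    have "nat_size (nats ?s i) \<le> Suc \<beta>"
      using pre_exec(3)[OF l] nat_size_le[of "nats ?s i" \<beta>] by (simp add: bnd_def)
    then show "nat_size (nats ?s i) \<le> Suc (Suc \<beta>)" by simp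
  qed
  also have "\<dots> \<le> (40 + 8 * (N * n)) * Suc (Suc \<beta>)"
    using mult_le_mono1[OF e(1), of "Suc (Suc \<beta>)"] by simp
  finally have 1: "(\<Sum>i<extent 0 (nats ?s). nat_size (nats ?s i)) \<le> (40 + 8 * (N * n)) * Suc (Suc \<beta>)" .
  have "(\<Sum>i<extent [] (strs ?s). Suc (length (strs ?s i))) \<le> (\<Sum>i<extent [] (strs ?s). Suc \<mu>)"
  proof (rule sum_mono)
    fix i
    have "length (strs ?s i) \<le> \<mu>" using mo pre_exec(4)[OF l] by (cases "i = 0") (auto simp: mem_ok_def)
    then show "Suc (length (strs ?s i)) \<le> Suc \<mu>" by simp
  qed
  also have "\<dots> \<le> Suc (3 * (N * n)) * Suc \<mu>" using mult_le_mono1[OF e(3), of "Suc \<mu>"] by simp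
  finally have 2: "(\<Sum>i<extent [] (strs ?s). Suc (length (strs ?s i))) \<le> Suc (3 * (N * n)) * Suc \<mu>" .
  show ?thesis unfolding space_usage_def using 1 2 e(2) by linarith
qed

text \<open>\<open>2 ^ lg\<close> lies between \<open>n\<close> and \<open>2 * n\<close>. The floor
  in the exponent loses at most a factor 2, so the factor 8 in \<open>N\<close> leaves 4 from below;
  rounding up to a power of two gains at most \<open>2 powr \<epsilon> \<le> 2\<close>. The bound on
  \<open>lg\<close> uses \<open>1 / 2 \<le> ln 2\<close>.\<close>

lemma N_bounds: "4 * real n powr \<epsilon> \<le> real N" "real N \<le> 16 * real n powr \<epsilon>" "real lg \<le> 4 * ln (real n)"
  "lg \<le> n" "1 \<le> lg"
proof -
  define k where "k = nat \<lfloor>\<epsilon> * real lg\<rfloor>"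
  have k: "real k \<le> \<epsilon> * real lg" "\<epsilon> * real lg < real k + 1" using eps by (simp_all add: k_def)
  have lg0: "lg \<noteq> 0"
  proof
    assume "lg = 0"
    then show False using ell(1) n_ge by simp
  qed
  then show "1 \<le> lg" by simp
  have half: "2 ^ lg < 2 * n"
  proof -
    have "2 ^ (lg - 1) < n" using ell(2)[of "lg - 1"] lg0 by simp
    then show ?thesis using lg0 by (cases lg) auto
  qed
  have pw: "2 powr (\<epsilon> * real lg) = (2 ^ lg) powr \<epsilon>"
  proof -
    have "(2 ^ lg :: real) = 2 powr real lg" by (simp add: powr_realpow)
    then show ?thesis by (simp only: powr_powr mult.commute)
  qed
  have "real n powr \<epsilon> \<le> (2 ^ lg) powr \<epsilon>"
  proof -
    have "real n \<le> 2 ^ lg" using ell(1) by (metis of_nat_le_iff of_nat_numeral of_nat_power)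
    then show ?thesis using eps by (intro powr_mono2) auto
  qed
  also have "\<dots> \<le> 2 powr (real k + 1)" unfolding pw[symmetric] using k by simp
  also have "\<dots> = 2 * 2 ^ k" by (simp add: powr_add powr_realpow)
  finally show "4 * real n powr \<epsilon> \<le> real N" by (simp add: N_eq k_def)
  have "2 ^ k = 2 powr real k" by (simp add: powr_realpow)
  also have "\<dots> \<le> (2 ^ lg) powr \<epsilon>" unfolding pw[symmetric] using k by simp
  also have "\<dots> \<le> (2 * real n) powr \<epsilon>"
  proof -
    have "real (2 ^ lg) \<le> real (2 * n)" using half by (intro of_nat_mono) simp
    then show ?thesis using eps by (intro powr_mono2) auto
  qed
  also have "\<dots> = 2 powr \<epsilon> * real n powr \<epsilon>" by (simp add: powr_mult)
  also have "\<dots> \<le> 2 * real n powr \<epsilon>"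
    using powr_mono[of \<epsilon> 1 2] eps by (intro mult_right_mono) auto
  finally have "2 ^ k \<le> 2 * real n powr \<epsilon>" .
  then show "real N \<le> 16 * real n powr \<epsilon>" by (simp add: N_eq k_def)
  have ln2: "1 / 2 \<le> ln (2 :: real)"
    using ln_le_minus_one[of "1 / 2 :: real"] by (simp add: ln_div)
  have lnn: "ln 2 \<le> ln (real n)" using n_ge by simp
  have "real lg * ln 2 = ln (2 ^ lg)" by (simp add: ln_realpow)
  also have "\<dots> \<le> ln (2 * real n)"
  proof -
    have "real (2 ^ lg) \<le> real (2 * n)" using half by (intro of_nat_mono) simp
    then show ?thesis using n_ge by (subst ln_le_cancel_iff) auto
  qed
  also have "\<dots> = ln 2 + ln (real n)" using n_ge by (simp add: ln_mult)
  finally have "real lg * ln 2 \<le> 2 * ln (real n)" using lnn by simp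
  moreover have "real lg * (1 / 2) \<le> real lg * ln 2" using ln2 by (intro mult_left_mono) auto
  ultimately show "real lg \<le> 4 * ln (real n)" by simp
  have "lg \<le> 2 ^ (lg - 1)" using Suc_leI[OF less_exp[of "lg - 1"]] lg0 by simp
  also have "\<dots> < n" using ell(2)[of "lg - 1"] lg0 by simp
  finally show "lg \<le> n" by simp
qed

text \<open>After \<open>3 * lg / \<tau>\<close> levels the penalty factor is at most
  \<open>exp (- 3 * lg)\<close>, hence at most \<open>1 / n ^ 3\<close>. Multiplied by
  \<open>n\<close> it is at most \<open>1 / (2 * n)\<close>, and thus at most half of
  \<open>n powr - \<epsilon>\<close>.\<close>

lemma pot_start: "z \<in> P \<Longrightarrow> real n powr - \<epsilon> / 2 \<le> pot \<epsilon> \<tau> z levels P"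
proof -
  assume z: "z \<in> P"
  have card: "card P = n" using xs distinct_card by fastforce
  have n: "2 \<le> real n" using n_ge by simp
  have tl: "3 * real lg \<le> \<tau> * real levels"
  proof -
    have "\<tau> * Lev = 3 * real lg"
      using r_pos d_pos Delta_pos by (simp add: \<tau>_def Lev_eq)
    moreover have "Lev \<le> real levels" unfolding levels_def by linarith
    ultimately show ?thesis using tau_bounds by (metis mult_left_mono less_imp_le)
  qed
  have "(1 - \<tau>) ^ levels \<le> exp (- \<tau>) ^ levels"
    using tau_bounds exp_ge_add_one_self[of "- \<tau>"] by (intro power_mono) auto
  also have "\<dots> = exp (- (\<tau> * real levels))" by (simp add: exp_of_nat_mult[symmetric] mult.commute)
  also have "\<dots> \<le> exp (- (3 * real lg))" using tl by simp
  also have "\<dots> = 1 / exp (real lg) ^ 3" by (simp add: exp_minus exp_of_nat_mult[symmetric] divide_inverse)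
  also have "\<dots> \<le> 1 / real n ^ 3"
  proof -
    have "real n \<le> 2 ^ lg" using ell(1) by (metis of_nat_le_iff of_nat_numeral of_nat_power)
    also have "\<dots> \<le> exp 1 ^ lg" using exp_ge_add_one_self[of 1] by (intro power_mono) auto
    also have "\<dots> = exp (real lg)" by (simp add: exp_of_nat_mult[symmetric])
    finally have "real n ^ 3 \<le> exp (real lg) ^ 3" by (intro power_mono) auto
    then show ?thesis using n by (intro divide_left_mono mult_pos_pos) auto
  qed
  finally have "(1 - \<tau>) ^ levels * real n \<le> 1 / real n ^ 3 * real n" by (intro mult_right_mono) auto
  also have "\<dots> = 1 / (real n * real n)" using n by (simp add: power3_eq_cube)
  also have "\<dots> \<le> 1 / (2 * real n)" using n by (intro divide_left_mono) auto
  also have "\<dots> = real n powr - 1 / 2" using n by (simp add: powr_minus_divide)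
  also have "\<dots> \<le> real n powr - \<epsilon> / 2" using n eps by (intro divide_right_mono powr_mono) auto
  finally have "real n powr - \<epsilon> / 2 \<le> real n powr - \<epsilon> - (1 - \<tau>) ^ levels * real n" by simp
  then show ?thesis using z by (simp add: pot_def card le_max_iff_disj)
qed

end

locale nns_query = nns_input E M dM d D \<epsilon> \<Delta> r P \<beta> \<kappa> \<mu> n N Lev xs lg + near_query E M dM d D \<epsilon> \<Delta> r P q z
  for E :: subroutines and M :: "bits set" and dM :: "bits \<Rightarrow> bits \<Rightarrow> real"
    and d :: nat and D \<epsilon> \<Delta> r :: real and P :: "bits set" and \<beta> \<kappa> \<mu> n N :: nat and Lev :: real
    and xs :: "bits list" and lg :: nat and q z :: bits
begin

text \<open>When no pending node is left, the value is no longer an estimate but the indicator of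
  success, so the product over the trees becomes the indicator that all of them fail.\<close>

lemma val_final:
  assumes fin: "final s" and A: "\<And>i. i < nats s 3 \<Longrightarrow> A i = abs s rounds i"
  shows "i < nats s 3 \<Longrightarrow> val k A i = of_bool (hits q k (abs s rounds) i)"
proof (induction k arbitrary: i)
  case (Suc k)
  have i: "i < rounds" using Suc.prems fin by (simp add: final_def)
  have IH: "val k A i' = of_bool (hits q k (abs s rounds) i')" if "i' \<in> children (abs s rounds i)" for i'
    using final_children[OF fin Suc.prems that] Suc.IH by simp
  have "abs s rounds i \<noteq> Pend Q" for Q using i by (simp add: abs_def)
  then show ?case using IH A[OF Suc.prems] by (cases "abs s rounds i") auto
qed simp

text \<open>The final copy into cell 0 is built in, so that the predicate speaks of the forest that
  the query actually searches.\<close>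

definition misses :: "state \<Rightarrow> bool" where
  "misses s \<longleftrightarrow> (\<forall>i<N. \<not> hits q levels (abs (s\<lparr>strs := (strs s)(0 := strs s 1)\<rparr>) rounds) i)"

lemma abs_finite: "abs s j i = Pend Q \<Longrightarrow> finite Q"
  by (auto simp: abs_def cells_def split: if_splits)

lemma abs_children:
  assumes "forest_inv j s" "i < nats s 3" "i' \<in> children (abs s j i)"
  shows "i' < nats s 3 \<and> own s i' = own s i"
proof (cases "i < j")
  case True
  then have "proc_ok s i" using assms(1,2) unfolding forest_inv_def by blast
  then show ?thesis using assms(3) True by (auto simp: abs_def proc_ok_def split: if_splits)
next
  case False
  then show ?thesis using assms(3) by (simp add: abs_def)
qed

text \<open>Rounds with a pending node are instances of \<open>forest_step\<close>; in idle rounds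
  all values below the node counter stay as they are.\<close>

lemma super:
  assumes inv: "forest_inv j s" "bnd \<beta> s" and j: "j < rounds"
  shows "(\<Sum>l | length l = B. \<Prod>i<N. 1 - val levels (abs (step s l) (Suc j)) i)
    \<le> 2 ^ B * (\<Prod>i<N. 1 - val levels (abs s j) i)"
proof -
  have sr: "step_rel j s l (step s l)" if "length l = B" for l
  proof -
    have "nats s 4 = j" using inv(1) by (simp add: forest_inv_def)
    then show ?thesis using step_ok[OF inv j that emb] by (auto simp: step_ok_def)
  qed
  have N: "N \<le> nats s 3" "\<And>i. i < N \<Longrightarrow> own s i = i" using inv(1) unfolding forest_inv_def by blast+
  show ?thesis
  proof (cases "j < nats s 3")
    case True
    have pts: "inj_on (strs s) (cells s j)" "strs s ` cells s j \<subseteq> P" "cell_ok s j"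
      using inv(1) True unfolding forest_inv_def by auto
    have set: "set (node_points s j) = strs s ` cells s j" by (simp add: node_points_def cells_def)
    show ?thesis
    proof (rule forest_step[OF B_resolution, where zs = "node_points s j" and cnt = "nats s 3" and j = j and own = "own s"])
      show "distinct (node_points s j)" using pts(1) by (simp add: node_points_def cells_def distinct_map)
      show "set (node_points s j) \<subseteq> P" using pts(2) set by simp
      show "node_points s j \<noteq> []" using pts(3) by (simp add: node_points_def cell_ok_def)
      show "abs s j j = Pend (set (node_points s j))" by (simp add: abs_def set)
      show "grows B (nats s 3) j (node_points s j) l (abs (step s l) (Suc j))" if "length l = B" for l
        using sr[OF that] True by (simp add: step_rel_def)
      show "abs (step s l) (Suc j) i = abs s j i" if "length l = B" "i < nats s 3" "i \<noteq> j" for l i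
        using sr[OF that(1)] that by (simp add: step_rel_def)
    qed (use N True abs_finite abs_children[OF inv(1)] in auto)
  next
    case False
    have "val levels (abs (step s l) (Suc j)) i = val levels (abs s j) i" if "length l = B" "i < N" for l i
      using sr[OF that(1)] False N(1) that abs_children[OF inv(1)]
      by (intro val_cong[where S = "{..<nats s 3}"]) (auto simp: step_rel_def)
    then show ?thesis by (simp add: card_bool_lists)
  qed
qed

lemma misses_bound:
  "(\<Sum>l | length l = rounds * B. of_bool (misses (forest l)) :: real) \<le> 2 ^ (rounds * B) / 3"
proof -
  let ?Inv = "\<lambda>j s. forest_inv j s \<and> bnd \<beta> s"
  let ?V = "\<lambda>j s. \<Prod>i<N. 1 - val levels (abs s j) i"
  have b: "(\<Sum>l | length l = rounds * B. of_bool (misses (iter step B rounds s_root l))) \<le> 2 ^ (rounds * B) * ?V 0 s_root"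
  proof (rule supermartingale_bound[where Inv = ?Inv and V = ?V and J = rounds])
    fix j s and l :: "bool list" assume j: "j < rounds" and inv: "?Inv j s" and l: "length l = B"
    have "nats s 4 = j" using inv by (simp add: forest_inv_def)
    then show "?Inv (Suc j) (step s l)"
      using step_ok[of j s l] inv j l emb by (auto simp: step_ok_def step_rel_def)
  next
    fix j s assume "j < rounds" "?Inv j s"
    then show "(\<Sum>l | length l = B. ?V (Suc j) (step s l)) \<le> 2 ^ B * ?V j s" using super by blast
  next
    fix s assume inv: "?Inv rounds s"
    let ?s = "s\<lparr>strs := (strs s)(0 := strs s 1)\<rparr>"
    have fin: "final s" using inv final_forest by blast
    have o: "own ?s i = own s i" for i by (simp add: own_def)
    have "proc_ok ?s i = proc_ok s i" for i unfolding proc_ok_def o by simp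
    then have fin': "final ?s" using fin by (simp add: final_def params_def mem_ok_def)
    have eq: "abs s rounds i = abs ?s rounds i" if "i < nats ?s 3" for i
      using that fin by (simp add: abs_def final_def)
    have v: "val levels (abs s rounds) i = of_bool (hits q levels (abs ?s rounds) i)" if "i < N" for i
      using that fin eq by (intro val_final[OF fin']) (auto simp: final_def)
    show "of_bool (misses s) \<le> ?V rounds s"
    proof (cases "misses s")
      case True
      then have "?V rounds s = (\<Prod>i<N. 1)" using v by (intro prod.cong) (auto simp: misses_def)
      then show ?thesis by simp
    next
      case False
      then show ?thesis using val_bounds[OF abs_finite] by (simp add: prod_nonneg)
    qed
  qed (use s_root in auto)
  have "val levels (abs s_root 0) i = pot \<epsilon> \<tau> z levels P" if "i < N" for i
  proof -
    have "abs s_root 0 i = Pend P" using s_root(2) that by (simp add: abs_def whole_def)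
    then show ?thesis using val_Pend[where A = "abs s_root 0" and i = i] P_fin by blast
  qed
  then have "?V 0 s_root = (1 - pot \<epsilon> \<tau> z levels P) ^ N" by simp
  also have "\<dots> \<le> exp (- pot \<epsilon> \<tau> z levels P) ^ N"
    using exp_ge_add_one_self[of "- pot \<epsilon> \<tau> z levels P"] pot_le_1[OF P_fin eps(1), of \<tau> z levels] tau_bounds
    by (intro power_mono) auto
  also have "\<dots> = exp (- (real N * pot \<epsilon> \<tau> z levels P))" by (simp add: exp_of_nat_mult[symmetric])
  \<comment> \<open>At least \<open>4 * n powr \<epsilon>\<close> trees, each with potential at
    least \<open>n powr - \<epsilon> / 2\<close>, give the exponent 2; then
    \<open>exp 2 \<ge> 1 + 2\<close> yields failure probability at most 1/3.\<close>
  also have "\<dots> \<le> exp (- 2)"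
  proof -
    have "4 * real n powr \<epsilon> * (real n powr - \<epsilon> / 2) \<le> real N * pot \<epsilon> \<tau> z levels P"
      using N_bounds(1) pot_start[OF z_P] by (intro mult_mono) auto
    moreover have "real n powr \<epsilon> * real n powr - \<epsilon> = 1" using n_ge by (simp add: powr_add[symmetric])
    ultimately show ?thesis by simp
  qed
  also have "\<dots> \<le> 1 / 3"
    using exp_ge_add_one_self[of 2] by (simp add: exp_minus inverse_eq_divide le_divide_eq divide_le_eq)
  finally have "2 ^ (rounds * B) * ?V 0 s_root \<le> 2 ^ (rounds * B) * (1 / 3)" by (intro mult_left_mono) auto
  with b have "(\<Sum>l | length l = rounds * B. of_bool (misses (iter step B rounds s_root l)) :: real) \<le> 2 ^ (rounds * B) * (1 / 3)"
    by (rule order_trans)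
  then show ?thesis unfolding forest_def by simp
qed

lemma success:
  assumes c: "R + r \<le> c * r"
  shows "2 / 3 \<le> measure coins {\<omega>. \<exists>t s \<omega>' t' s' \<omega>''. exec E pre_prog (s_init, \<omega>) t (s, \<omega>') \<and>
    exec E query_prog (with_query q s, \<omega>') t' (s', \<omega>'') \<and> (answer s' \<in> set xs \<and> dM (answer s') q \<le> c * r)}"
    (is "_ \<le> measure coins ?E")
proof -
  let ?m = "rounds * B"
  define good where "good = {l. length l = ?m \<and> \<not> misses (forest l)}"
  \<comment> \<open>The query flips no coins, so the coins of the construction decide the outcome
    and the good event is a cylinder.\<close>
  have sub: "{\<omega>. stake ?m \<omega> \<in> good} \<subseteq> ?E"
  proof
    fix \<omega> assume "\<omega> \<in> {\<omega>. stake ?m \<omega> \<in> good}"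
    define l where "l = stake ?m \<omega>"
    define w where "w = sdrop ?m \<omega>"
    have \<omega>: "\<omega> = l @- w" by (simp add: l_def w_def stake_sdrop)
    have l: "length l = ?m" "\<not> misses (forest l)" using \<open>\<omega> \<in> _\<close> by (simp_all add: l_def good_def)
    obtain t where t: "exec E pre_prog (s_init, \<omega>) t (stored l, w)" using pre_exec(1)[OF l(1)] \<omega> by blast
    have b: "bnd \<beta> (with_query q (stored l))" using pre_exec(3)[OF l(1)] by (simp add: bnd_def with_query_def)
    have "runs query_prog (with_query q (stored l)) [] (N * (levels * 11 + 5) + 2)
      (\<lambda>s' l'. l' = [] \<and> (found q s' \<or> (\<forall>i<N. \<not> hits q levels (abs (stored l) rounds) i)))"
      using det_query[OF pre_exec(2)[OF l(1)] refl q_M refl] by (simp add: det_def)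
    then obtain t' s' where t': "exec E query_prog (with_query q (stored l), w) t' (s', w)"
      "found q s' \<or> (\<forall>i<N. \<not> hits q levels (abs (stored l) rounds) i)"
      using b unfolding runs_def by fastforce
    have "found q s'" using t'(2) l(2) by (auto simp: misses_def stored_def)
    then have "answer s' \<in> set xs \<and> dM (answer s') q \<le> c * r" using c xs by (simp add: found_def answer_def)
    then show "\<omega> \<in> ?E" using t t'(1) by blast
  qed
  have "real (card {l :: bool list. length l = ?m}) =
      real (card good) + (\<Sum>l | length l = ?m. of_bool (misses (forest l)))"
  proof -
    have "{l. length l = ?m} = good \<union> {l. length l = ?m \<and> misses (forest l)}" by (auto simp: good_def)
    moreover have "good \<inter> {l. length l = ?m \<and> misses (forest l)} = {}" by (auto simp: good_def)
    moreover have "finite good" "finite {l. length l = ?m \<and> misses (forest l)}"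
      using card_bool_lists(2)[of ?m] by (auto simp: good_def intro: finite_subset[rotated])
    ultimately have "card {l :: bool list. length l = ?m} = card good + card {l. length l = ?m \<and> misses (forest l)}"
      by (simp add: card_Un_disjoint)
    moreover have "(\<Sum>l | length l = ?m. of_bool (misses (forest l))) = real (card {l. length l = ?m \<and> misses (forest l)})"
      using card_bool_lists(2)[of ?m] by (simp add: Int_def)
    ultimately show ?thesis by simp
  qed
  then have "2 ^ ?m * (2 / 3) \<le> real (card good)" using misses_bound by (simp add: card_bool_lists)
  then have "2 / 3 \<le> real (card good) / 2 ^ ?m" by (simp add: pos_le_divide_eq mult.commute)
  also have "\<dots> = measure coins {\<omega>. stake ?m \<omega> \<in> good}"
    by (rule measure_coins_stake[symmetric]) (auto simp: good_def)
  also have "\<dots> \<le> measure coins ?E"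
    using sub by (intro coins.finite_measure_mono event_measurable) auto
  finally show ?thesis .
qed

end

section \<open>Time and space bounds\<close>

context nns_input
begin

text \<open>The query program never computes an embedding. The same correctness proof is therefore
  instantiated with a step cost \<open>\<kappa>0\<close> that need not cover
  \<open>embed_time\<close>, and the query time does not depend on \<open>T\<close>.\<close>

lemma query_exec:
  assumes l: "length l = rounds * B" and x: "x \<in> M"
    and \<kappa>0: "2000 * \<beta> + dist_time E + apply_time E + \<mu> \<le> \<kappa>0"
  shows "\<exists>t s. (\<forall>w. exec E query_prog (with_query x (stored l), w) t (s, w)) \<and>
    t \<le> (N * (levels * 11 + 5) + 2) * \<kappa>0"
proof -
  interpret Q: nns E M dM d D \<epsilon> \<Delta> r P \<beta> \<kappa>0 \<mu> n N Lev
    by unfold_locales (use beta_ge \<kappa>0 dist_eq M_len code_len d_le n_ge N_pos size in auto)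
  have "bnd \<beta> (with_query x (stored l))" using pre_exec(3)[OF l] by (simp add: bnd_def with_query_def)
  then show ?thesis
    using Q.det_query[OF pre_exec(2)[OF l] refl x refl] unfolding Q.det_def Q.runs_def by fastforce
qed

lemma Lev_bounds: "0 \<le> Lev" "real levels \<le> Lev + 1"
proof -
  show "0 \<le> Lev" using Delta_pos r_pos by (simp add: Lev_eq)
  then show "real levels \<le> Lev + 1" unfolding levels_def by linarith
qed

lemma ln_n: "1 / 2 \<le> ln (real n)"
proof -
  have "1 / 2 \<le> ln (2 :: real)" using ln_le_minus_one[of "1 / 2 :: real"] by (simp add: ln_div)
  also have "\<dots> \<le> ln (real n)" using n_ge by simp
  finally show ?thesis .
qed

lemma query_time:
  assumes L: "ln (real n) * (\<Delta> / r) \<le> L"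
  shows "real ((N * (levels * 11 + 5) + 2) * \<kappa>0) \<le> real n powr \<epsilon> * L * (5000 * (real d + 1) * real \<kappa>0)"
proof -
  define a where "a = real n powr \<epsilon>"
  have a: "1 \<le> a" using n_ge eps by (simp add: a_def ge_one_powr_ge_zero)
  have \<Lambda>: "1 \<le> \<Delta> / r" using r_le r_pos by simp
  have half: "1 / 2 \<le> L"
  proof -
    have "1 / 2 * 1 \<le> ln (real n) * (\<Delta> / r)" using ln_n \<Lambda> by (intro mult_mono) auto
    then show ?thesis using L by linarith
  qed
  have "Lev = real lg * (6 * real d * (\<Delta> / r))" by (simp add: Lev_eq)
  also have "\<dots> \<le> (4 * ln (real n)) * (6 * real d * (\<Delta> / r))"
    using N_bounds(3) r_pos Delta_pos by (intro mult_right_mono) auto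
  also have "\<dots> = 24 * real d * (ln (real n) * (\<Delta> / r))" by simp
  also have "\<dots> \<le> 24 * real d * L" using L by (intro mult_left_mono) auto
  finally have lev: "real (levels * 11 + 5) \<le> (264 * real d + 32) * L"
    using Lev_bounds half by (simp add: algebra_simps)
  have "real (N * (levels * 11 + 5)) = real N * real (levels * 11 + 5)" by (rule of_nat_mult)
  also have "\<dots> \<le> (16 * a) * ((264 * real d + 32) * L)"
    using N_bounds(2) lev a unfolding a_def by (intro mult_mono) auto
  finally have 1: "real (N * (levels * 11 + 5)) \<le> a * L * (4224 * real d + 512)" by (simp add: algebra_simps)
  have "1 * (1 / 2) \<le> a * L" using a half by (intro mult_mono) auto
  then have 2: "2 \<le> a * L * 4" by linarith
  have "real (N * (levels * 11 + 5) + 2) = real (N * (levels * 11 + 5)) + 2" by simp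
  also have "\<dots> \<le> a * L * (4224 * real d + 512) + a * L * 4" using 1 2 by (rule add_mono)
  also have "\<dots> = a * L * (4224 * real d + 516)" by (simp add: algebra_simps)
  also have "\<dots> \<le> a * L * (5000 * (real d + 1))" using a half by (intro mult_left_mono) auto
  finally have "real (N * (levels * 11 + 5) + 2) * real \<kappa>0 \<le> a * L * (5000 * (real d + 1)) * real \<kappa>0"
    by (rule mult_right_mono) simp
  then show ?thesis by (simp only: a_def of_nat_mult mult.assoc)
qed

lemma space_bound:
  assumes L: "ln (real n) * (\<Delta> / r) \<le> L" and \<beta>: "\<beta> = 2 * \<mu> + 10"
  shows "real ((40 + 8 * (N * n)) * Suc (Suc \<beta>) + (16 + 3 * d + 2 * (N * n)) + Suc (3 * (N * n)) * Suc \<mu>)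
    \<le> real n powr (1 + \<epsilon>) * L * (1200 * real \<mu> + 6000)"
proof -
  define S where "S = real n powr (1 + \<epsilon>)"
  have S: "1 \<le> S" using n_ge eps by (simp add: S_def ge_one_powr_ge_zero)
  have \<Lambda>: "1 \<le> \<Delta> / r" using r_le r_pos by simp
  have half: "1 \<le> 2 * L"
  proof -
    have "1 / 2 * 1 \<le> ln (real n) * (\<Delta> / r)" using ln_n \<Lambda> by (intro mult_mono) auto
    then show ?thesis using L by linarith
  qed
  have "real (N * n) \<le> (16 * real n powr \<epsilon>) * real n"
    unfolding of_nat_mult using N_bounds(2) by (intro mult_right_mono) auto
  then have Nn: "real (N * n) \<le> 16 * S" using n_ge by (simp add: S_def powr_add mult_ac)
  have "real ((40 + 8 * (N * n)) * Suc (Suc \<beta>) + (16 + 3 * d + 2 * (N * n)) + Suc (3 * (N * n)) * Suc \<mu>)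
    = (40 + 8 * real (N * n)) * (2 * real \<mu> + 12) + (16 + 3 * real d + 2 * real (N * n)) + (3 * real (N * n) + 1) * (real \<mu> + 1)"
    by (simp add: \<beta> algebra_simps)
  also have "\<dots> \<le> (168 * S) * (2 * real \<mu> + 12) + (48 + 3 * real \<mu>) * S + (49 * S) * (real \<mu> + 1)"
  proof (intro add_mono mult_right_mono)
    have "16 + 3 * real d + 2 * real (N * n) \<le> (16 + 3 * real \<mu>) * 1 + 32 * S" using Nn d_le by simp
    also have "\<dots> \<le> (16 + 3 * real \<mu>) * S + 32 * S" using S by (intro add_mono mult_left_mono) auto
    finally show "16 + 3 * real d + 2 * real (N * n) \<le> (48 + 3 * real \<mu>) * S" by (simp add: algebra_simps)
  qed (use Nn S in auto)
  also have "\<dots> = S * (388 * real \<mu> + 2113) * 1" by (simp add: algebra_simps)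
  also have "\<dots> \<le> S * (388 * real \<mu> + 2113) * (2 * L)" using half S by (intro mult_left_mono) auto
  also have "\<dots> = S * L * (776 * real \<mu> + 4226)" by (simp add: algebra_simps)
  also have "\<dots> \<le> S * L * (1200 * real \<mu> + 6000)" using S half by (intro mult_left_mono) auto
  finally show ?thesis by (simp add: S_def)
qed

text \<open>All quantities are estimated by \<open>x\<close> and \<open>y\<close>, to be
  instantiated with the argument of the time polynomial and with the value of the given polynomial
  there; the result is \<open>pre_poly\<close> without its factor for the step cost.\<close>

lemma pre_steps_le:
  fixes x y :: real
  assumes n: "real n \<le> 2 * x" and \<Lambda>: "\<Delta> / r \<le> x" and d: "real d \<le> y"
  shows "real pre_steps \<le> 16 * x + 192 * x\<^sup>2 + 128 * x + 12 +
    128 * x\<^sup>2 * (8 * y * y * x + 6 + (2 * x * (10 * x + 8) + y * (18 * x + 16) + 20 * x + 31))"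
proof -
  have x: "1 \<le> x" using n n_ge by simp
  have y: "0 \<le> y" using d by linarith
  have a: "real n powr \<epsilon> \<le> real n powr 1" using n_ge eps by (intro powr_mono) auto
  have N: "real N \<le> 32 * x" using N_bounds(2) a n by simp
  have Nn: "real (N * n) \<le> 64 * x\<^sup>2"
  proof -
    have "real N * real n \<le> (32 * x) * (2 * x)" using N n x by (intro mult_mono) auto
    then show ?thesis by (simp add: power2_eq_square)
  qed
  have lg: "real lg \<le> 2 * x" using N_bounds(4) n by linarith
  have init: "real init_steps \<le> 16 * x + 192 * x\<^sup>2 + 128 * x + 10"
    using lg Nn N by (simp add: init_steps_def)
  have "real B \<le> 2 * real d * real d * (\<Delta> / r)" using B_le by simp
  also have "\<dots> \<le> 2 * y * y * x"
    using d \<Lambda> y r_pos Delta_pos by (intro mult_mono) auto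
  finally have B4: "real B * 4 \<le> 8 * y * y * x" by (simp add: algebra_simps)
  have "real process_steps = real n * (5 * real n + 8) + real d * (9 * real n + 16) + 10 * real n + 31"
    by (simp add: process_steps_def mult.commute)
  also have "\<dots> \<le> (2 * x) * (5 * (2 * x) + 8) + y * (9 * (2 * x) + 16) + 10 * (2 * x) + 31"
    using n d x y by (intro add_mono mult_mono) auto
  finally have proc: "real process_steps \<le> 2 * x * (10 * x + 8) + y * (18 * x + 16) + 20 * x + 31" by simp
  have body: "real (body_steps + 1) \<le> 8 * y * y * x + 6 + (2 * x * (10 * x + 8) + y * (18 * x + 16) + 20 * x + 31)"
  proof -
    have "real (body_steps + 1) = real B * 4 + real process_steps + 6" by (simp add: body_steps_def)
    then show ?thesis using B4 proc by linarith
  qed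
  have "real (rounds * (body_steps + 1)) = real rounds * real (body_steps + 1)" by (rule of_nat_mult)
  also have "\<dots> \<le> (128 * x\<^sup>2) * (8 * y * y * x + 6 + (2 * x * (10 * x + 8) + y * (18 * x + 16) + 20 * x + 31))"
    using Nn body by (intro mult_mono) auto
  finally show ?thesis using init by (simp add: pre_steps_def)
qed

end

section \<open>Polynomial bounds and the base of the logarithm\<close>

lemma poly_map_real: "poly (map_poly real p) (real k) = real (poly p k)"
  by (induction p) (simp_all add: map_poly_pCons)

lemma poly_map_real_mono:
  assumes "0 \<le> a" "a \<le> b"
  shows "0 \<le> poly (map_poly real p) a \<and> poly (map_poly real p) a \<le> poly (map_poly real p) b"
proof (induction p)
  case (pCons c p)
  have "a * poly (map_poly real p) a \<le> b * poly (map_poly real p) b"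
    using pCons assms by (intro mult_mono) auto
  then show ?case using pCons assms by (simp add: map_poly_pCons)
qed simp

text \<open>Points are distinct strings of bounded length, so the logarithm of their number is
  bounded by that length. This keeps the word size \<open>\<beta>\<close> polynomial in the
  dimension, with no extra logarithm of \<open>n\<close> in the query time.\<close>

lemma card_bit_strings:
  assumes "distinct xs" "\<And>x. x \<in> set xs \<Longrightarrow> length (x :: bits) \<le> k"
  shows "length xs \<le> 2 ^ Suc k"
proof -
  have fin: "finite {x :: bits. set x \<subseteq> UNIV \<and> length x \<le> k}" by (rule finite_lists_length_le) simp
  have "length xs = card (set xs)" using assms(1) by (simp add: distinct_card)
  also have "\<dots> \<le> card {x :: bits. set x \<subseteq> UNIV \<and> length x \<le> k}"
    using assms(2) fin by (intro card_mono) auto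
  also have "\<dots> = (\<Sum>i\<le>k. 2 ^ i)" by (subst card_lists_length_le) simp_all
  also have "\<dots> \<le> 2 ^ Suc k" by (induction k) auto
  finally show ?thesis .
qed

text \<open>The factor 2 in \<open>b\<close> keeps \<open>x = r / (2 * \<Delta>)\<close> at most
  1/2, also for \<open>r = \<Delta>\<close>. There
  \<open>- ln (1 - x) \<le> x + 2 * x\<^sup>2 \<le> 2 * x\<close>, so the logarithm to base
  \<open>1 / b\<close> dominates \<open>ln n * (\<Delta> / r)\<close>, the order of the number of
  levels apart from the factor \<open>d\<close>.\<close>

lemma log_shrink_bound:
  fixes r \<Delta> :: real
  assumes "0 < r" "r \<le> \<Delta>" "2 \<le> n"
  defines "b \<equiv> 1 - r / (2 * \<Delta>)"
  shows "0 < b" "b < 1" "ln (real n) * (\<Delta> / r) \<le> log (1 / b) (real n)"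
proof -
  define x where "x = r / (2 * \<Delta>)"
  have x: "0 < x" "x \<le> 1 / 2" using assms by (auto simp: x_def field_simps)
  show b: "0 < b" "b < 1" using x by (auto simp: b_def x_def[symmetric])
  have "- x - 2 * x\<^sup>2 \<le> ln (1 - x)" using x by (intro ln_one_minus_pos_lower_bound) auto
  moreover have "x * x \<le> x * (1 / 2)" using x by (intro mult_left_mono) auto
  ultimately have "- ln b \<le> 2 * x" unfolding b_def x_def[symmetric] by (simp add: power2_eq_square)
  moreover have "0 < - ln b" using b by simp
  moreover have "0 \<le> ln (real n)" using assms by simp
  ultimately have "ln (real n) / (2 * x) \<le> ln (real n) / (- ln b)"
    using x mult_pos_pos[of "2 * x" "- ln b"] by (intro divide_left_mono) simp_all
  moreover have "ln (real n) / (2 * x) = ln (real n) * (\<Delta> / r)" by (simp add: x_def)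
  moreover have "log (1 / b) (real n) = ln (real n) / (- ln b)" using b by (simp add: log_def ln_div)
  ultimately show "ln (real n) * (\<Delta> / r) \<le> log (1 / b) (real n)" by simp
qed

definition pre_poly :: "nat poly \<Rightarrow> real poly" where
  "pre_poly p = (let x = [:0, 1:]; y = map_poly real p in
    (16 * x + 192 * x\<^sup>2 + 128 * x + 12 +
      128 * x\<^sup>2 * (8 * y * y * x + 6 + (2 * x * (10 * x + 8) + y * (18 * x + 16) + 20 * x + 31)))
    * (4003 * y + 20001))"

lemma poly_pre_poly:
  "poly (pre_poly p) x = (let y = poly (map_poly real p) x in
    (16 * x + 192 * x\<^sup>2 + 128 * x + 12 +
      128 * x\<^sup>2 * (8 * y * y * x + 6 + (2 * x * (10 * x + 8) + y * (18 * x + 16) + 20 * x + 31)))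
    * (4003 * y + 20001))"
  by (simp only: pre_poly_def Let_def poly_add poly_mult poly_power poly_numeral poly_pCons poly_0
      mult_zero_right add_0_right add_0_left mult_1_right)

text \<open>The order of quantifiers makes \<open>C0\<close> and \<open>c0\<close> absolute and lets
  the programs and the polynomials depend on \<open>p\<close> only. With \<open>2 \<le> n\<close>
  the logarithm is positive; for a single point it would turn all three bounds into constants at
  argument 0 or into 0.\<close>

theorem theorem1p7:
  shows "\<exists>C0 c0 :: real. 0 < C0 \<and> 0 < c0 \<and>
    (\<forall>p :: nat poly. \<exists>(pre :: com) (qry :: com) (p1 :: real poly) (p2 :: nat poly) (p3 :: nat poly).
      \<forall>(M :: bits set) dM (dm :: nat) (d :: nat) (D :: real) (n :: nat) (T :: nat) (E :: subroutines).
        1 \<le> dm \<and> represented_metric_space p dm M dM E \<and>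
        d \<le> poly p dm \<and> embeds_with_avg_distortion D M dM (ell1 d) ell1_dist \<and>
        2 \<le> n \<and> 1 \<le> T \<and> computes_ell1_embeddings p dm M dM d D n T E \<longrightarrow>
        (\<forall>\<epsilon> \<Delta> r :: real. 0 < \<epsilon> \<and> \<epsilon> \<le> 1 \<and> 0 < r \<and> r \<le> \<Delta> \<longrightarrow>
          (\<exists>c b :: real.
            c \<le> C0 * (D * (1 + ln D) / \<epsilon>) \<and>
            0 < b \<and> b < 1 \<and> 1 - b \<ge> c0 * (r / \<Delta>) \<and>
            solves_NNS E pre qry (initial_state d D \<epsilon> \<Delta> r) M dM n \<Delta> c r
              (poly p1 (real n * log (1 / b) (real n) * real dm) * real T)
              (real n powr (1 + \<epsilon>) * log (1 / b) (real n) * real (poly p2 dm))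
              (real n powr \<epsilon> * log (1 / b) (real n) * real (poly p3 dm)))))"
proof (intro exI conjI allI)
  show "(0::real) < 17" "(0::real) < 1 / 2" by simp_all
  fix p :: "nat poly"
  let ?p2 = "1200 * p + 6000 :: nat poly"
  let ?p3 = "5000 * (p + 1) * (4003 * p + 20000) :: nat poly"
  fix M :: "bits set" and dM :: "bits \<Rightarrow> bits \<Rightarrow> real" and dm d :: nat and D :: real and n T :: nat and E :: subroutines
  show "1 \<le> dm \<and> represented_metric_space p dm M dM E \<and>
        d \<le> poly p dm \<and> embeds_with_avg_distortion D M dM (ell1 d) ell1_dist \<and>
        2 \<le> n \<and> 1 \<le> T \<and> computes_ell1_embeddings p dm M dM d D n T E \<longrightarrow>
        (\<forall>\<epsilon> \<Delta> r :: real. 0 < \<epsilon> \<and> \<epsilon> \<le> 1 \<and> 0 < r \<and> r \<le> \<Delta> \<longrightarrow>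
          (\<exists>c b :: real.
            c \<le> 17 * (D * (1 + ln D) / \<epsilon>) \<and>
            0 < b \<and> b < 1 \<and> 1 - b \<ge> 1 / 2 * (r / \<Delta>) \<and>
            solves_NNS E pre_prog query_prog (initial_state d D \<epsilon> \<Delta> r) M dM n \<Delta> c r
              (poly (pre_poly p) (real n * log (1 / b) (real n) * real dm) * real T)
              (real n powr (1 + \<epsilon>) * log (1 / b) (real n) * real (poly ?p2 dm))
              (real n powr \<epsilon> * log (1 / b) (real n) * real (poly ?p3 dm))))"
  proof (intro impI allI, elim conjE)
    fix \<epsilon> \<Delta> r :: real
    assume dm: "1 \<le> dm" and rep: "represented_metric_space p dm M dM E"
      and d_le: "d \<le> poly p dm" and n: "2 \<le> n" and T: "1 \<le> T"
      and comp: "computes_ell1_embeddings p dm M dM d D n T E"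
      and eps: "0 < \<epsilon>" "\<epsilon> \<le> 1" and r: "0 < r" "r \<le> \<Delta>"
    define b where "b = 1 - r / (2 * \<Delta>)"
    define L where "L = log (1 / b) (real n)"
    \<comment> \<open>The answer lies within \<open>R + r = (16 * D / \<epsilon> + 1) * r\<close>.
      As \<open>\<epsilon> \<le> 1 \<le> D\<close>, the summand 1 is at most
      \<open>D / \<epsilon>\<close>, and \<open>1 + ln D\<close> is at least 1.\<close>
    define c where "c = 17 * (D * (1 + ln D) / \<epsilon>)"
    have b: "0 < b" "b < 1" and L: "ln (real n) * (\<Delta> / r) \<le> L"
      using log_shrink_bound[OF r n] by (simp_all add: b_def L_def)
    define P0 where "P0 = poly p dm"
    \<comment> \<open>Chosen so that \<open>2 ^ \<beta> = 1024 * 4 ^ P0\<close>: with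
      \<open>n \<le> 2 * 2 ^ P0\<close> and \<open>N \<le> 16 * n\<close> the product
      \<open>4 * (n * N)\<close> is at most a quarter of this.\<close>
    define \<beta> where "\<beta> = 2 * P0 + 10"
    \<comment> \<open>This is \<open>2000 * \<beta> + 3 * P0\<close>: the expressions of one step, a
      distance call, an evaluation of an embedding, and a string or vector of length at most
      \<open>P0\<close>.\<close>
    define \<kappa>0 where "\<kappa>0 = 4003 * P0 + 20000"
    define \<kappa> where "\<kappa> = \<kappa>0 + T"
    define lg where "lg = (LEAST k. n \<le> 2 ^ k)"
    define N where "N = 8 * (2::nat) ^ nat \<lfloor>\<epsilon> * real lg\<rfloor>"
    define Lev where "Lev = 6 * real lg * real d * \<Delta> / r"
    have rep': "Metric_space M dM" "\<And>x. x \<in> M \<Longrightarrow> length x \<le> P0" "dist_time E \<le> P0"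
      "\<And>x y. x \<in> M \<Longrightarrow> y \<in> M \<Longrightarrow> dist_fun E x y = dM x y"
      using rep by (auto simp: represented_metric_space_def P0_def)
    have times: "embed_time E \<le> T" "apply_time E \<le> P0"
      using comp by (auto simp: computes_ell1_embeddings_def P0_def)
    have lg: "n \<le> 2 ^ lg" "\<And>i. i < lg \<Longrightarrow> 2 ^ i < n"
    proof -
      have "n \<le> 2 ^ n" by (simp add: less_imp_le)
      then show "n \<le> 2 ^ lg" unfolding lg_def by (rule LeastI)
      show "2 ^ i < n" if "i < lg" for i using not_less_Least[OF that[unfolded lg_def]] by simp
    qed
    have \<kappa>0: "2000 * \<beta> + dist_time E + apply_time E + P0 \<le> \<kappa>0"
      using rep'(3) times(2) by (simp add: \<beta>_def \<kappa>0_def)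
    have inst: "nns_input E M dM d D \<epsilon> \<Delta> r (set xs) \<beta> \<kappa> P0 n N Lev xs lg"
      if xs: "distinct xs" "set xs \<subseteq> M" "length xs = n" "\<forall>x\<in>set xs. \<forall>y\<in>set xs. dM x y \<le> \<Delta>" for xs
    proof -
      have emb: "length (embed_fun E zs) \<le> P0 \<and> has_avg_distortion 1 D M dM (ell1 d) ell1_dist (set zs) (apply_fun E (embed_fun E zs))"
        if "distinct zs" "set zs \<subseteq> set xs" for zs
      proof -
        have "length zs = card (set zs)" using that(1) by (simp add: distinct_card)
        also have "\<dots> \<le> card (set xs)" using that(2) by (intro card_mono) auto
        also have "\<dots> = n" using xs by (simp add: distinct_card)
        finally have "distinct zs \<and> set zs \<subseteq> M \<and> length zs \<le> n" using that xs(2) by blast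
        then show ?thesis using comp unfolding computes_ell1_embeddings_def P0_def by blast
      qed
      \<comment> \<open>Dimension 0 has a single vector, so every map into it has Lipschitz norm 0,
        contrary to the positivity required for two points.\<close>
      have d_pos: "0 < d"
      proof (rule ccontr)
        assume "\<not> 0 < d"
        then have d0: "d = 0" by simp
        have "2 \<le> card (set xs)" using xs n by (simp add: distinct_card)
        then have lip: "0 < lip_norm M dM ell1_dist (apply_fun E (embed_fun E xs))"
          and f: "apply_fun E (embed_fun E xs) \<in> M \<rightarrow> ell1 0"
          using conjunct2[OF emb[OF xs(1) subset_refl]] unfolding has_avg_distortion_def d0 by blast+
        have "apply_fun E (embed_fun E xs) x = []" if "x \<in> M" for x
          using funcset_mem[OF f that] by (simp add: ell1_def)
        then have "insert 0 (dilations M dM ell1_dist (apply_fun E (embed_fun E xs))) = {0}"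
          by (auto simp: dilations_def ell1_dist_def)
        then show False using lip by (simp only: lip_norm_def cSup_singleton)
      qed
      have n_le: "n \<le> 2 ^ Suc P0" using card_bit_strings[OF xs(1), of P0] xs(2,3) rep'(2) by auto
      have N16: "N \<le> 16 * n"
      proof -
        have "nat \<lfloor>\<epsilon> * real lg\<rfloor> \<le> lg"
        proof -
          have "\<epsilon> * real lg \<le> 1 * real lg" using eps by (intro mult_right_mono) auto
          then show ?thesis by linarith
        qed
        then have "(2::nat) ^ nat \<lfloor>\<epsilon> * real lg\<rfloor> \<le> 2 ^ lg" by (intro power_increasing) auto
        moreover have "2 ^ lg \<le> 2 * n"
        proof (cases lg)
          case 0
          then show ?thesis using n by simp
        next
          case (Suc k)
          then show ?thesis using lg(2)[of k] by simp
        qed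
        ultimately show ?thesis unfolding N_def by linarith
      qed
      have size: "4 * (n * N) + d + 2 < 2 ^ \<beta>"
      proof -
        define q :: nat where "q = 2 ^ P0"
        have q: "1 \<le> q" "n \<le> 2 * q" using n_le by (simp_all add: q_def)
        have "d < q" using le_less_trans[OF d_le[folded P0_def] less_exp[of P0]] by (simp only: q_def)
        have "n * N \<le> (2 * q) * (32 * q)" using q(2) N16 by (intro mult_le_mono) linarith+
        also have "\<dots> = 64 * (q * q)" by simp
        finally have "4 * (n * N) \<le> 256 * (q * q)" by linarith
        moreover have "q * 1 \<le> q * q" using q(1) by (intro mult_le_mono) auto
        moreover have "2 ^ \<beta> = 1024 * (q * q)" unfolding \<beta>_def mult_2 power_add q_def by simp
        ultimately show ?thesis using q \<open>d < q\<close> by linarith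
      qed
      have "point_set E M dM d D \<epsilon> \<Delta> r (set xs)"
        by (rule point_set.intro) (use rep'(1) xs emb d_pos eps r in simp_all)
      moreover have "ram E \<beta> \<kappa> P0"
        by (rule ram.intro) (use \<kappa>0 in \<open>simp_all add: \<beta>_def \<kappa>_def\<close>)
      moreover have "nns_axioms E M dM d (set xs) \<beta> P0 n N"
        by (rule nns_axioms.intro) (use rep' emb d_le n size in \<open>simp_all add: P0_def N_def\<close>)
      moreover have "nns_input_axioms E d \<epsilon> \<Delta> r (set xs) \<beta> \<kappa> n N Lev xs lg"
        by (rule nns_input_axioms.intro)
          (use xs lg times(1) in \<open>simp_all add: N_def Lev_def \<kappa>_def \<kappa>0_def \<beta>_def\<close>)
      ultimately show ?thesis by (intro nns_input.intro nns.intro)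
    qed
    show "\<exists>c b. c \<le> 17 * (D * (1 + ln D) / \<epsilon>) \<and> 0 < b \<and> b < 1 \<and> 1 / 2 * (r / \<Delta>) \<le> 1 - b \<and>
            solves_NNS E pre_prog query_prog (initial_state d D \<epsilon> \<Delta> r) M dM n \<Delta> c r
              (poly (pre_poly p) (real n * log (1 / b) (real n) * real dm) * real T)
              (real n powr (1 + \<epsilon>) * log (1 / b) (real n) * real (poly ?p2 dm))
              (real n powr \<epsilon> * log (1 / b) (real n) * real (poly ?p3 dm))"
    proof (intro exI conjI)
      show "c \<le> 17 * (D * (1 + ln D) / \<epsilon>)" by (simp add: c_def)
      show "0 < b" "b < 1" by (rule b)+
      show "1 / 2 * (r / \<Delta>) \<le> 1 - b" by (simp add: b_def)
      show "solves_NNS E pre_prog query_prog (initial_state d D \<epsilon> \<Delta> r) M dM n \<Delta> c r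
              (poly (pre_poly p) (real n * log (1 / b) (real n) * real dm) * real T)
              (real n powr (1 + \<epsilon>) * log (1 / b) (real n) * real (poly ?p2 dm))
              (real n powr \<epsilon> * log (1 / b) (real n) * real (poly ?p3 dm))"
        unfolding solves_NNS_def L_def[symmetric]
      proof (intro allI impI, elim conjE, intro conjI allI ballI impI)
        fix xs
        assume xs: "distinct xs" "set xs \<subseteq> M" "length xs = n" "\<forall>x\<in>set xs. \<forall>y\<in>set xs. dM x y \<le> \<Delta>"
        interpret I: nns_input E M dM d D \<epsilon> \<Delta> r "set xs" \<beta> \<kappa> P0 n N Lev xs lg
          by (rule inst[OF xs])
        {
          fix \<omega> :: "bool stream"
          define l where "l = stake (2 * (N * n) * I.B) \<omega>"
          define w where "w = sdrop (2 * (N * n) * I.B) \<omega>"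
          have \<omega>: "\<omega> = l @- w" by (simp add: l_def w_def stake_sdrop)
          have l: "length l = 2 * (N * n) * I.B" by (simp add: l_def)
          obtain t where t: "exec E pre_prog (initial_state d D \<epsilon> \<Delta> r xs, \<omega>) t (I.stored l, w)"
            "t \<le> I.pre_steps * \<kappa>" using I.pre_exec(1)[OF l] \<omega> by blast
          have time: "real t \<le> poly (pre_poly p) (real n * L * real dm) * real T"
          proof -
            \<comment> \<open>The argument of the time polynomial dominates everything in the step
              count: \<open>L\<close> is at least \<open>\<Delta> / r\<close> halved, so
              \<open>n \<ge> 2\<close> gives \<open>\<Delta> / r \<le> x\<close>, and
              \<open>n \<le> 2 * x\<close> and \<open>dm \<le> x\<close> follow from
              \<open>L \<ge> 1 / 2\<close>.\<close>
            define x where "x = real n * L * real dm"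
            define y where "y = poly (map_poly real p) x"
            have \<Lambda>: "1 \<le> \<Delta> / r" using r by simp
            have half: "1 / 2 * (\<Delta> / r) \<le> L"
              using mult_right_mono[OF I.ln_n, of "\<Delta> / r"] \<Lambda> L by linarith
            have L2: "1 / 2 \<le> L" using half \<Lambda> by linarith
            have nL: "real n * L \<le> x"
              unfolding x_def using mult_left_mono[of 1 "real dm" "real n * L"] dm L2 by simp
            have "real n * (1 / 2) \<le> real n * L" using L2 by (intro mult_left_mono) auto
            then have x1: "real n \<le> 2 * x" using nL by linarith
            have "2 * L \<le> real n * L" using n L2 by (intro mult_right_mono) auto
            then have x2: "\<Delta> / r \<le> x" using half nL by linarith
            have "1 \<le> real n * L" using \<open>2 * L \<le> real n * L\<close> L2 by linarith
            then have dmx: "real dm \<le> x" unfolding x_def using mult_right_mono[of 1 "real n * L" "real dm"] by simp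
            have P0y: "real P0 \<le> y"
              using poly_map_real_mono[of "real dm" x p] dmx by (simp add: y_def P0_def poly_map_real)
            have dy: "real d \<le> y" using d_le P0y unfolding P0_def[symmetric] by linarith
            have "real \<kappa> = real \<kappa>0 + real T" by (simp add: \<kappa>_def)
            \<comment> \<open>The additive embedding time becomes a factor, which is where
              \<open>T \<ge> 1\<close> enters.\<close>
            also have "\<dots> \<le> (real \<kappa>0 + 1) * real T"
              using T mult_left_mono[of 1 "real T" "real \<kappa>0"] by (simp add: algebra_simps)
            also have "\<dots> \<le> (4003 * y + 20001) * real T"
              using P0y by (intro mult_right_mono) (auto simp: \<kappa>0_def)
            finally have \<kappa>y: "real \<kappa> \<le> (4003 * y + 20001) * real T" .
            have ps: "real I.pre_steps \<le> 16 * x + 192 * x\<^sup>2 + 128 * x + 12 +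
              128 * x\<^sup>2 * (8 * y * y * x + 6 + (2 * x * (10 * x + 8) + y * (18 * x + 16) + 20 * x + 31))"
              (is "_ \<le> ?b") by (rule I.pre_steps_le[OF x1 x2 dy])
            have "real t \<le> real I.pre_steps * real \<kappa>" using t(2) by (metis of_nat_le_iff of_nat_mult)
            also have "\<dots> \<le> ?b * ((4003 * y + 20001) * real T)"
              using ps \<kappa>y by (intro mult_mono) (auto intro: order_trans[OF of_nat_0_le_iff])
            also have "\<dots> = poly (pre_poly p) x * real T"
              unfolding poly_pre_poly Let_def y_def[symmetric] by (simp only: mult.assoc)
            finally show ?thesis by (simp only: x_def)
          qed
          have spc: "real (space_usage (I.stored l)) \<le> real n powr (1 + \<epsilon>) * L * real (poly ?p2 dm)"
          proof -
            have "real (space_usage (I.stored l)) \<le> real n powr (1 + \<epsilon>) * L * (1200 * real P0 + 6000)"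
              using I.space_stored[OF l] I.space_bound[OF L] by (meson \<beta>_def of_nat_le_iff order_trans)
            then show ?thesis by (simp add: P0_def)
          qed
          have qry: "\<exists>t' s' \<omega>''. exec E query_prog (with_query x (I.stored l), w) t' (s', \<omega>'') \<and>
              real t' \<le> real n powr \<epsilon> * L * real (poly ?p3 dm)" if x: "x \<in> M" for x
          proof -
            obtain t' s' where t': "exec E query_prog (with_query x (I.stored l), w) t' (s', w)"
              "t' \<le> (N * (I.levels * 11 + 5) + 2) * \<kappa>0" using I.query_exec[OF l x \<kappa>0] by blast
            have "0 \<le> ln (real n) * (\<Delta> / r)" using n r by (intro mult_nonneg_nonneg) auto
            then have L0: "0 \<le> L" using L by linarith
            have "real t' \<le> real ((N * (I.levels * 11 + 5) + 2) * \<kappa>0)" using t'(2) by (intro of_nat_mono)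
            also have "\<dots> \<le> real n powr \<epsilon> * L * (5000 * (real d + 1) * real \<kappa>0)" by (rule I.query_time[OF L])
            also have "\<dots> \<le> real n powr \<epsilon> * L * real (poly ?p3 dm)"
            proof (rule mult_left_mono)
              have "5000 * (real d + 1) * real \<kappa>0 \<le> 5000 * (real P0 + 1) * real \<kappa>0"
                using d_le by (intro mult_right_mono) (auto simp: P0_def)
              then show "5000 * (real d + 1) * real \<kappa>0 \<le> real (poly ?p3 dm)"
                by (simp add: \<kappa>0_def P0_def)
            qed (use L0 in auto)
            finally show ?thesis using t'(1) by blast
          qed
          show "\<exists>t s \<omega>'. exec E pre_prog (initial_state d D \<epsilon> \<Delta> r xs, \<omega>) t (s, \<omega>') \<and>
            real t \<le> poly (pre_poly p) (real n * L * real dm) * real T \<and>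
            real (space_usage s) \<le> real n powr (1 + \<epsilon>) * L * real (poly ?p2 dm) \<and>
            (\<forall>x\<in>M. \<exists>t' s' \<omega>''. exec E query_prog (with_query x s, \<omega>') t' (s', \<omega>'') \<and>
              real t' \<le> real n powr \<epsilon> * L * real (poly ?p3 dm))"
            using t(1) time spc qry by blast
        }
        fix x assume x: "x \<in> M" and "\<exists>y\<in>set xs. dM y x \<le> r"
        then obtain y where y: "y \<in> set xs" "dM y x \<le> r" by blast
        interpret Q: nns_query E M dM d D \<epsilon> \<Delta> r "set xs" \<beta> \<kappa> P0 n N Lev xs lg x y
          by unfold_locales (use x y in auto)
        have D1: "1 \<le> D" using I.D_ge_1 xs n by (simp add: distinct_card)
        have "I.R + r \<le> c * r"
        proof -
          have "\<epsilon> \<le> D" using eps D1 by linarith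
          then have "1 \<le> D / \<epsilon>" using eps by simp
          then have "16 * (D / \<epsilon>) + 1 \<le> 17 * (D / \<epsilon>)" by simp
          also have "\<dots> \<le> 17 * (D / \<epsilon> * (1 + ln D))"
            using D1 eps mult_left_mono[of 1 "1 + ln D" "D / \<epsilon>"] by simp
          also have "\<dots> = c" by (simp add: c_def)
          finally have "(16 * (D / \<epsilon>) + 1) * r \<le> c * r" using r by (intro mult_right_mono) auto
          then show ?thesis by (simp add: I.R_def algebra_simps)
        qed
        from Q.success[OF this]
        show "2 / 3 \<le> measure coins {\<omega>. \<exists>t s \<omega>' t' s' \<omega>''.
             exec E pre_prog (initial_state d D \<epsilon> \<Delta> r xs, \<omega>) t (s, \<omega>') \<and>
             exec E query_prog (with_query x s, \<omega>') t' (s', \<omega>'') \<and>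
             answer s' \<in> set xs \<and> dM (answer s') x \<le> c * r}" .
      qed
    qed
  qed
qed

end
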